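(* Let $\Omega\subset\mathbb{R}^N$ be open, $F\in C(\overline\Omega\times\mathbb{R}\times\mathbb{R}^N\times\mathcal S(N))$ be proper, $f\in C(\partial\Omega\times\mathbb{R})$, and consider the boundary value problem $$\text{(BVP)}\qquad F(x,u,Du,D^2u)=0\ \text{ in }\Omega,\qquad B(x,u,Du)=0\ \text{ on }\partial\Omega,\qquad B(x,r,p)=\langle n(x),p\rangle+f(x,r),$$ where $n(x)$ is the outward unit normal to $\Omega$ at $x\in\partial\Omega$. Assume: (1) $\overline\Omega$ is a compact $C^1$ $N$-submanifold with boundary of $\mathbb{R}^N$; (2) there is $r_0>0$ such that $b(x+r_0n(x),r_0)\cap\Omega=\emptyset$ for all $x\in\partial\Omega$, where $b(z,\rho)$ is the closed ball of radius $\rho$ centered at $z$; (3) there is $\gamma>0$ such that $\gamma(r-s)\le F(x,r,p,X)-F(x,s,p,X)$ for $r\ge s$, $(x,p,X)\in\overline\Omega\times\mathbb{R}^N\times\mathcal S(N)$; (4) there are a neighborhood $V$ of $\partial\Omega$ relative to $\overline\Omega$ and a function $\omega:[0,\infty)\to[0,\infty]$ with $\omega(0+)=0$ such that $|F(x,r,p,X)-F(x,r,q,Y)|\le\omega(|p-q|+\|X-Y\|)$ for $x\in V$, $r\in\mathbb{R}$, $p,q\in\mathbb{R}^N$, $X,Y\in\mathcal S(N)$; (5) (with the same $\omega$) $F(y,r,p,Y)-F(x,r,p,X)\le\omega(\alpha|x-y|^2+|x-y|(|p|+1))$ whenever $\alpha>0$, $x,y\in\overline\Omega$, $r\in\mathbb{R}$,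 $p\in\mathbb{R}^N$ and $X,Y\in\mathcal S(N)$ satisfy $$-3\alpha\begin{pmatrix}I&0\\0&I\end{pmatrix}\le\begin{pmatrix}X&0\\0&-Y\end{pmatrix}\le 3\alpha\begin{pmatrix}I&-I\\-I&I\end{pmatrix};$$ (6) $f(x,r)$ is nondecreasing in $r$ for each $x\in\partial\Omega$. If $u$ is a subsolution of (BVP) and $v$ is a supersolution of (BVP), then $u\le v$ in $\overline\Omega$. Moreover, (BVP) has a unique solution.
   Context: $\mathcal{S}(N)$ is the set of real symmetric $N\times N$ matrices with its usual order; $\|X\|$ is the largest absolute value of an eigenvalue of $X$; $I$ is the identity. $F$ is proper if $F(x,r,p,X)\le F(x,s,p,Y)$ whenever $r\le s$ and $Y\le X$. $\mathrm{USC}$, $\mathrm{LSC}$ denote real-valued upper/lower semicontinuous functions. $a\wedge b=\min\{a,b\}$, $a\vee b=\max\{a,b\}$. For $u:\overline\Omega\to\mathbb{R}$ and $\hat x\in\overline\Omega$, $J^{2,+}_{\overline\Omega}u(\hat x)$ is the set of $(p,X)\in\mathbb{R}^N\times\mathcal S(N)$ such that $u(x)\le u(\hat x)+\langle p,x-\hat x\rangle+\frac12\langle X(x-\hat x),x-\hat x\rangle+o(|x-\hat x|^2)$ as $\overline\Omega\ni x\to\hat x$; $J^{2,-}_{\overline\Omega}u=-J^{2,+}_{\overline\Omega}(-u)$. The closure $\overline J^{2,+}_{\overline\Omega}u(x)$ is the set of $(p,X)$ for which there are $x_n\in\overline\Omega$ and $(p_n,X_n)\in J^{2,+}_{\overline\Omega}u(x_n)$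 with $(x_n,u(x_n),p_n,X_n)\to(x,u(x),p,X)$; $\overline J^{2,-}_{\overline\Omega}u$ is defined similarly from $J^{2,-}_{\overline\Omega}u$. A (viscosity) subsolution of (BVP) is $u\in\mathrm{USC}(\overline\Omega)$ such that for all $(p,X)\in\overline J^{2,+}_{\overline\Omega}u(x)$: $F(x,u(x),p,X)\le0$ if $x\in\Omega$, and $F(x,u(x),p,X)\wedge B(x,u(x),p)\le0$ if $x\in\partial\Omega$. A supersolution is $v\in\mathrm{LSC}(\overline\Omega)$ such that for all $(p,X)\in\overline J^{2,-}_{\overline\Omega}v(x)$: $F(x,v(x),p,X)\ge0$ if $x\in\Omega$, and $F(x,v(x),p,X)\vee B(x,v(x),p)\ge0$ if $x\in\partial\Omega$. A solution is both a subsolution and a supersolution (hence in $C(\overline\Omega)$). *)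

theory Defs
  imports "HOL-Analysis.Analysis" "HOL-Library.Landau_Symbols"
begin

section \<open>Symmetric matrices\<close>

definition sym_mats :: "(real^'n^'n) set" where
  "sym_mats = {X. transpose X = X}"

text \<open>The order on symmetric matrices is that of quadratic forms. It must not be confused with the
  library's order on vectors, which on matrices is the entrywise one.\<close>

definition loewner_le :: "real^'n^'n \<Rightarrow> real^'n^'n \<Rightarrow> bool"  (infix "\<preceq>" 50) where
  "X \<preceq> Y \<longleftrightarrow> (\<forall>\<xi>. \<xi> \<bullet> (X *v \<xi>) \<le> \<xi> \<bullet> (Y *v \<xi>))"

definition eigenvalues :: "real^'n^'n \<Rightarrow> real set" where
  "eigenvalues X = {c. \<exists>v. v \<noteq> 0 \<and> X *v v = c *\<^sub>R v}"

text \<open>Only used on symmetric matrices, whose real eigenvalues form a finite nonempty set.\<close>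

definition spec_norm :: "real^'n^'n \<Rightarrow> real" where
  "spec_norm X = Max (abs ` eigenvalues X)"

definition blockmat ::
  "real^'n^'n \<Rightarrow> real^'n^'n \<Rightarrow> real^'n^'n \<Rightarrow> real^'n^'n \<Rightarrow> real^('n + 'n)^('n + 'n)" where
  "blockmat A B C D = (\<chi> i j. case i of
      Inl a \<Rightarrow> (case j of Inl b \<Rightarrow> A $ a $ b | Inr b \<Rightarrow> B $ a $ b)
    | Inr a \<Rightarrow> (case j of Inl b \<Rightarrow> C $ a $ b | Inr b \<Rightarrow> D $ a $ b))"


section \<open>Domains with smooth boundary\<close>

definition C1_on :: "'a::real_normed_vector set \<Rightarrow> ('a \<Rightarrow> 'b::real_normed_vector) \<Rightarrow> bool" where
  "C1_on U \<phi> \<longleftrightarrow> (\<exists>\<phi>' :: 'a \<Rightarrow> 'a \<Rightarrow>\<^sub>L 'b.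
     (\<forall>x\<in>U. (\<phi> has_derivative blinfun_apply (\<phi>' x)) (at x)) \<and> continuous_on U \<phi>')"

text \<open>Full-dimensional \<open>C\<^sup>1\<close> submanifolds with boundary: every point of \<open>M\<close> has a neighbourhood in
  the ambient space with a \<open>C\<^sup>1\<close> diffeomorphism straightening \<open>M\<close> to a closed coordinate half-space.
  Interior points are covered by images lying inside the half-space.\<close>

definition C1_submanifold_with_boundary :: "(real^'n) set \<Rightarrow> bool" where
  "C1_submanifold_with_boundary M \<longleftrightarrow> (\<forall>x\<in>M.
     \<exists>U W (\<phi> :: real^'n \<Rightarrow> real^'n) (\<psi> :: real^'n \<Rightarrow> real^'n) k.
     open U \<and> x \<in> U \<and> open W \<and> homeomorphism U W \<phi> \<psi> \<and> C1_on U \<phi> \<and> C1_on W \<psi> \<and>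
     \<phi> ` (U \<inter> M) = W \<inter> {y. 0 \<le> y $ k})"

text \<open>Velocities at \<open>x\<close> of curves in \<open>S\<close>.\<close>

definition tangent_vectors :: "'a::real_normed_vector set \<Rightarrow> 'a \<Rightarrow> 'a set" where
  "tangent_vectors S x = {v. \<exists>c :: real \<Rightarrow> 'a.
     c 0 = x \<and> (\<forall>\<^sub>F t in nhds 0. c t \<in> S) \<and> (c has_vector_derivative v) (at 0)}"

text \<open>The second conjunct makes \<open>\<nu>\<close> normal to the boundary, the third one makes it point out
  of \<open>closure \<Omega>\<close>; in particular no such \<open>\<nu>\<close> exists at points of \<open>frontier \<Omega>\<close> that are
  interior to \<open>closure \<Omega>\<close> (slits, punctures).\<close>

definition outward_unit_normal :: "'a::real_inner set \<Rightarrow> 'a \<Rightarrow> 'a \<Rightarrow> bool" where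
  "outward_unit_normal \<Omega> x \<nu> \<longleftrightarrow> norm \<nu> = 1 \<and>
     (\<forall>v\<in>tangent_vectors (frontier \<Omega>) x. \<nu> \<bullet> v = 0) \<and>
     (\<forall>\<^sub>F t in at_right 0. x + t *\<^sub>R \<nu> \<notin> closure \<Omega>)"


section \<open>Semicontinuity and semijets\<close>

definition usc_on :: "'a::topological_space set \<Rightarrow> ('a \<Rightarrow> real) \<Rightarrow> bool" where
  "usc_on S u \<longleftrightarrow> (\<forall>a. openin (top_of_set S) {x \<in> S. u x < a})"

definition lsc_on :: "'a::topological_space set \<Rightarrow> ('a \<Rightarrow> real) \<Rightarrow> bool" where
  "lsc_on S u \<longleftrightarrow> (\<forall>a. openin (top_of_set S) {x \<in> S. a < u x})"

definition J2plus ::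
  "(real^'n) set \<Rightarrow> (real^'n \<Rightarrow> real) \<Rightarrow> real^'n \<Rightarrow> ((real^'n) \<times> (real^'n^'n)) set" where
  "J2plus S u z = {(p, X). X \<in> sym_mats \<and>
     (\<exists>g. g \<in> o[at z within S](\<lambda>x. norm (x - z) ^ 2) \<and>
       (\<forall>\<^sub>F x in at z within S.
          u x \<le> u z + p \<bullet> (x - z) + 1 / 2 * ((X *v (x - z)) \<bullet> (x - z)) + g x))}"

definition J2minus ::
  "(real^'n) set \<Rightarrow> (real^'n \<Rightarrow> real) \<Rightarrow> real^'n \<Rightarrow> ((real^'n) \<times> (real^'n^'n)) set" where
  "J2minus S u z = uminus ` J2plus S (\<lambda>x. - u x) z"

text \<open>The closure operation, applied below with \<open>J = J2plus S u\<close> and \<open>J = J2minus S u\<close>.\<close>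

definition jet_closure ::
  "(real^'n) set \<Rightarrow> (real^'n \<Rightarrow> real) \<Rightarrow> (real^'n \<Rightarrow> ((real^'n) \<times> (real^'n^'n)) set) \<Rightarrow>
     real^'n \<Rightarrow> ((real^'n) \<times> (real^'n^'n)) set" where
  "jet_closure S u J x = {(p, X). \<exists>xs ps Xs.
     (\<forall>k::nat. xs k \<in> S \<and> (ps k, Xs k) \<in> J (xs k)) \<and>
     (\<lambda>k. (xs k, u (xs k), ps k, Xs k)) \<longlonglongrightarrow> (x, u x, p, X)}"

definition J2plus_bar ::
  "(real^'n) set \<Rightarrow> (real^'n \<Rightarrow> real) \<Rightarrow> real^'n \<Rightarrow> ((real^'n) \<times> (real^'n^'n)) set" where
  "J2plus_bar S u = jet_closure S u (J2plus S u)"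

definition J2minus_bar ::
  "(real^'n) set \<Rightarrow> (real^'n \<Rightarrow> real) \<Rightarrow> real^'n \<Rightarrow> ((real^'n) \<times> (real^'n^'n)) set" where
  "J2minus_bar S u = jet_closure S u (J2minus S u)"


section \<open>Viscosity solutions of boundary value problems\<close>

text \<open>\<open>F x r p X\<close> is only meaningful for \<open>x \<in> closure \<Omega>\<close> and \<open>X \<in> sym_mats\<close>, and \<open>B x r p\<close>
  only for \<open>x \<in> frontier \<Omega>\<close>; a function \<open>u\<close> only through its values on \<open>closure \<Omega>\<close>.\<close>

type_synonym 'n pde_op = "real^'n \<Rightarrow> real \<Rightarrow> real^'n \<Rightarrow> real^'n^'n \<Rightarrow> real"
type_synonym 'n bdry_op = "real^'n \<Rightarrow> real \<Rightarrow> real^'n \<Rightarrow> real"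

definition proper_op :: "(real^'n) set \<Rightarrow> 'n pde_op \<Rightarrow> bool" where
  "proper_op \<Omega> F \<longleftrightarrow> (\<forall>x\<in>closure \<Omega>. \<forall>r s p. \<forall>X\<in>sym_mats. \<forall>Y\<in>sym_mats.
     r \<le> s \<longrightarrow> Y \<preceq> X \<longrightarrow> F x r p X \<le> F x s p Y)"

definition subsolution ::
  "(real^'n) set \<Rightarrow> 'n pde_op \<Rightarrow> 'n bdry_op \<Rightarrow> (real^'n \<Rightarrow> real) \<Rightarrow> bool" where
  "subsolution \<Omega> F B u \<longleftrightarrow> usc_on (closure \<Omega>) u \<and>
     (\<forall>x\<in>\<Omega>. \<forall>(p, X)\<in>J2plus_bar (closure \<Omega>) u x. F x (u x) p X \<le> 0) \<and>
     (\<forall>x\<in>frontier \<Omega>. \<forall>(p, X)\<in>J2plus_bar (closure \<Omega>) u x.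
        min (F x (u x) p X) (B x (u x) p) \<le> 0)"

definition supersolution ::
  "(real^'n) set \<Rightarrow> 'n pde_op \<Rightarrow> 'n bdry_op \<Rightarrow> (real^'n \<Rightarrow> real) \<Rightarrow> bool" where
  "supersolution \<Omega> F B v \<longleftrightarrow> lsc_on (closure \<Omega>) v \<and>
     (\<forall>x\<in>\<Omega>. \<forall>(p, X)\<in>J2minus_bar (closure \<Omega>) v x. F x (v x) p X \<ge> 0) \<and>
     (\<forall>x\<in>frontier \<Omega>. \<forall>(p, X)\<in>J2minus_bar (closure \<Omega>) v x.
        max (F x (v x) p X) (B x (v x) p) \<ge> 0)"

definition solution ::
  "(real^'n) set \<Rightarrow> 'n pde_op \<Rightarrow> 'n bdry_op \<Rightarrow> (real^'n \<Rightarrow> real) \<Rightarrow> bool" where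
  "solution \<Omega> F B u \<longleftrightarrow> subsolution \<Omega> F B u \<and> supersolution \<Omega> F B u"

end

theory Submission
  imports Defs
begin

text \<open>
  Comparison is proved by doubling variables. At a boundary maximum of \<open>u - v\<close> small perturbations
  make the Neumann conditions strict, so that only the equation is left; the theorem on sums then
  contradicts (3), (4) and (5). Existence is Perron's method: the barriers come from the exterior ball
  condition, the upper semicontinuous envelope of the supremum of all subsolutions is the largest
  subsolution, its lower semicontinuous envelope is a supersolution, and by comparison they agree.
  The theorem on sums is obtained from sup-convolutions and the lemmas of Jensen and Alexandrov,
  which for strongly convex functions reduce to Rademacher's theorem for the gradient of the
  convex conjugate.
\<close>

section \<open>Rademacher's theorem\<close>

text \<open>Jets are taken relative to the closed set, so at a boundary point they contain far more
  pairs than inside, and a subsolution may violate the boundary inequality there as long as it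
  satisfies the one for \<open>F\<close>. Comparison must exclude the alternative \<open>B\<close>
  at every doubled boundary point. Two sizes compete: the value of \<open>f\<close> to be cancelled
  is of order one, whereas (4) absorbs only small changes of gradient and Hessian. The large
  correction is therefore put into the gradient common to both jets, where (5) tolerates it, and
  only a small tilt and fourth powers, whose Hessians vanish at their centres, are left to (4). The
  exterior ball enters as \<open>n x \<bullet> (y - x) \<le> (norm (y - x))\<^sup>2 / (2 *
  r\<^sub>0)\<close>, which makes the penalty gradient asymptotically harmless; it also determines
  the normal uniquely, and the continuity of \<open>n\<close> follows from that. As \<open>n\<close>
  is only known to be continuous, the barriers are not built from a smooth distance function.
  Statements on supersolutions are read off from those on subsolutions of the problem with
  \<open>- F x (- r) (- p) (- X)\<close> and \<open>- f x (- r)\<close>.\<close>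

lemma emeasure_interval_measure_Ioo:
  fixes G :: "real \<Rightarrow> real"
  assumes "mono G" "continuous_on UNIV G" "a \<le> b"
  shows "emeasure (interval_measure G) {a<..<b} = ennreal (G b - G a)"
proof (cases "a = b")
  case False
  with assms have ab: "a < b" by simp
  have m: "\<And>x y. x \<le> y \<Longrightarrow> G x \<le> G y" using assms(1) by (simp add: monoD)
  have rc: "\<And>x. continuous (at_right x) G"
    using assms(2) by (simp add: continuous_at_imp_continuous_at_within continuous_on_eq_continuous_at)
  have s: "emeasure (interval_measure G) {b} = 0"
    using emeasure_interval_measure_Icc[of b b G] m assms(2) continuous_on_subset by fastforce
  have "{a<..b} = {a<..<b} \<union> {b}" using ab by auto
  then have "emeasure (interval_measure G) {a<..b} = emeasure (interval_measure G) {a<..<b} + emeasure (interval_measure G) {b}"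
    by (subst plus_emeasure) auto
  then show ?thesis using s emeasure_interval_measure_Ioc[of a b G] m rc ab by simp
qed simp

section \<open>Lipschitz functions of one real variable\<close>

lemma real_ball_midpoint: "ball ((c + e) / 2) ((e - c) / 2) = {c<..<(e::real)}"
proof -
  have "(c + e) / 2 - (e - c) / 2 = c" "(c + e) / 2 + (e - c) / 2 = e" by (simp_all add: field_simps)
  then show ?thesis by (simp add: ball_eq_greaterThanLessThan)
qed

text \<open>An open interval is the ball about its midpoint, so the covering theorem for balls
  applies to intervals that merely contain \<open>x\<close>. \<open>P\<close> will be a bound on the
  slope over the interval, and \<open>U\<close> localises the cover.\<close>

lemma Vitali_cover_intervals:
  fixes U :: "real set"
  assumes "open U"
    and A: "\<And>x d. x \<in> A \<Longrightarrow> d > 0 \<Longrightarrow> \<exists>c e. c < x \<and> x < e \<and> e - c < d \<and> P c e"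
  obtains C where "countable C" "\<And>c e. (c, e) \<in> C \<Longrightarrow> c < e \<and> {c<..<e} \<subseteq> U \<and> P c e"
     "disjoint_family_on (\<lambda>(c, e). {c<..<e}) C"
     "negligible (A \<inter> U - (\<Union>(c, e)\<in>C. {c<..<e}))"
proof -
  let ?K = "{(c, e). c < e \<and> {c<..<e} \<subseteq> U \<and> P c e}"
  let ?a = "\<lambda>(c, e). (c + e) / 2 :: real" and ?r = "\<lambda>(c, e). (e - c) / 2 :: real"
  have b: "ball (?a i) (?r i) = (\<lambda>(c, e). {c<..<e}) i" for i
    by (cases i) (simp add: real_ball_midpoint)
  have "\<exists>i. i \<in> ?K \<and> x \<in> ball (?a i) (?r i) \<and> ?r i < d" if xd: "x \<in> A \<inter> U" "0 < d" for x d
  proof -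
    obtain t where t: "t > 0" "ball x t \<subseteq> U"
      using assms(1) xd(1) by (auto simp: open_contains_ball)
    obtain c e where ce: "c < x" "x < e" "e - c < min d t" "P c e"
      using A[of x "min d t"] xd t by auto
    have "{c<..<e} \<subseteq> ball x t"
      using ce by (auto simp: ball_eq_greaterThanLessThan)
    then show ?thesis
      using ce t by (intro exI[of _ "(c, e)"]) (auto simp: real_ball_midpoint)
  qed
  then obtain C where C: "countable C" "C \<subseteq> ?K"
     "pairwise (\<lambda>i j. disjnt (ball (?a i) (?r i)) (ball (?a j) (?r j))) C"
     "negligible (A \<inter> U - (\<Union>i \<in> C. ball (?a i) (?r i)))"
    by (rule Vitali_covering_theorem_balls[of "A \<inter> U" ?K ?a ?r])
  show thesis
    by (rule that[of C]) (use C[unfolded b] in \<open>auto simp: disjoint_family_on_def pairwise_def disjnt_def\<close>)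
qed

text \<open>Lebesgue's argument for the differentiation of monotone functions. Short intervals of
  slope below \<open>a\<close> fill almost all of \<open>A\<close>; inside them, short intervals of
  slope above \<open>b\<close> again fill almost all of \<open>A\<close>. Comparing increments gives
  \<open>b * m \<le> a * m\<close>, where \<open>m\<close> is an outer measure because
  \<open>A\<close> is an arbitrary bounded set.\<close>

lemma slope_gap_negligible_bounded:
  fixes G :: "real \<Rightarrow> real"
  assumes G: "mono G" "continuous_on UNIV G" and ab: "0 \<le> a" "a < b" and bd: "bounded A"
    and A1: "\<And>x d. x \<in> A \<Longrightarrow> d > 0 \<Longrightarrow> \<exists>c e. c < x \<and> x < e \<and> e - c < d \<and> G e - G c < a * (e - c)"
    and A2: "\<And>x d. x \<in> A \<Longrightarrow> d > 0 \<Longrightarrow> \<exists>c e. c < x \<and> x < e \<and> e - c < d \<and> G e - G c > b * (e - c)"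
  shows "negligible A"
proof -
  let ?\<mu> = "measure lebesgue"
  let ?S = "?\<mu> ` {T. A \<subseteq> T \<and> T \<in> lmeasurable}"
  define m where "m = Inf ?S"
  obtain R where R: "A \<subseteq> ball 0 R" using bounded_subset_ballD[OF bd] by blast
  have ne: "?S \<noteq> {}" using R lmeasurable_ball by blast
  have bb: "bdd_below ?S" by (auto intro: bdd_belowI[of _ 0])
  have m0: "0 \<le> m" unfolding m_def using ne by (intro cInf_greatest) auto
  have mle: "m \<le> ?\<mu> T" if "A \<subseteq> T" "T \<in> lmeasurable" for T
    unfolding m_def using that bb by (intro cInf_lower) auto
  have ex: "\<exists>T. A \<subseteq> T \<and> T \<in> lmeasurable \<and> ?\<mu> T < m + e" if "e > 0" for e
    using cInf_lessD[OF ne, of "m + e"] that unfolding m_def[symmetric] by auto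
  let ?\<nu> = "interval_measure G"
  \<comment> \<open>One \<open>\<epsilon>\<close> is lost in passing to a measurable superset of
    \<open>A\<close>, the other in passing from it to an open set.\<close>
  have "b * m \<le> a * (m + 2 * \<epsilon>)" if \<epsilon>: "\<epsilon> > 0" for \<epsilon>
  proof -
    obtain T where T: "A \<subseteq> T" "T \<in> lmeasurable" "?\<mu> T < m + \<epsilon>" using ex \<epsilon> by blast
    obtain U where U: "open U" "T \<subseteq> U" "U \<in> lmeasurable" "?\<mu> U < ?\<mu> T + \<epsilon>"
    proof -
      obtain U where U: "open U" "T \<subseteq> U" "U - T \<in> lmeasurable" "emeasure lebesgue (U - T) < ennreal \<epsilon>"
        using sets_lebesgue_outer_open[OF fmeasurableD[OF T(2)] \<epsilon>] by blast
      have U': "U = T \<union> (U - T)" using U by auto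
      then have lm: "U \<in> lmeasurable" using U(3) T(2) fmeasurable.Un by metis
      have "?\<mu> (U - T) < \<epsilon>" using U(3,4) by (simp add: emeasure_eq_measure2 ennreal_less_iff)
      then have "?\<mu> U < ?\<mu> T + \<epsilon>"
        using measurable_measure_Diff[of U lebesgue T] lm U(2) T(2) by (simp add: fmeasurableD)
      then show thesis using that U lm by blast
    qed
    obtain C where C: "countable C" "\<And>c e. (c, e) \<in> C \<Longrightarrow> c < e \<and> {c<..<e} \<subseteq> U \<and> G e - G c < a * (e - c)"
      "disjoint_family_on (\<lambda>(c, e). {c<..<e}) C"
      "negligible (A \<inter> U - (\<Union>(c, e)\<in>C. {c<..<e}))"
      using Vitali_cover_intervals[OF U(1), of A "\<lambda>c e. G e - G c < a * (e - c)"] A1 by blast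
    define UI where "UI = (\<Union>(c, e)\<in>C. {c<..<e})"
    have oUI: "open UI" unfolding UI_def by auto
    have UIU: "UI \<subseteq> U" using C(2) by (auto simp: UI_def)
    \<comment> \<open>The second cover is taken inside \<open>UI\<close>, so that its increments are
      bounded by those of the first.\<close>
    obtain D where D: "countable D" "\<And>c e. (c, e) \<in> D \<Longrightarrow> c < e \<and> {c<..<e} \<subseteq> UI \<and> G e - G c > b * (e - c)"
      "disjoint_family_on (\<lambda>(c, e). {c<..<e}) D"
      "negligible (A \<inter> UI - (\<Union>(c, e)\<in>D. {c<..<e}))"
      using Vitali_cover_intervals[OF oUI, of A "\<lambda>c e. G e - G c > b * (e - c)"] A2 by blast
    define UJ where "UJ = (\<Union>(c, e)\<in>D. {c<..<e})"
    have oUJ: "open UJ" unfolding UJ_def by auto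
    have UJI: "UJ \<subseteq> UI" using D(2) by (auto simp: UJ_def)
    have lI: "UI \<in> lmeasurable"
      by (rule fmeasurableI2[OF U(3) UIU]) (use oUI in auto)
    have "UJ \<in> lmeasurable"
      by (rule fmeasurableI2[OF lI UJI]) (use oUJ in auto)
    note lm = lI this
    have neg: "negligible (A - UJ)"
      by (rule negligible_subset[OF negligible_Un[OF C(4) D(4)]])
         (use U(2) T(1) in \<open>auto simp: UI_def UJ_def\<close>)
    have "m \<le> ?\<mu> (UJ \<union> (A - UJ))"
      by (rule mle) (use fmeasurable.Un[OF lm(2) negligible_imp_measurable[OF neg]] in auto)
    also have "\<dots> = ?\<mu> UJ"
      by (rule measure_negligible_symdiff[OF lm(2)])
         (rule negligible_subset[OF neg], auto)
    finally have mJ: "m \<le> ?\<mu> UJ" .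
    have eI: "emeasure ?\<nu> {c<..<e} \<le> ennreal a * emeasure lborel {c<..<e}" if "(c, e) \<in> C" for c e
      using C(2)[OF that] emeasure_interval_measure_Ioo[OF G, of c e] ab
      by (simp add: ennreal_mult[symmetric] ennreal_leI)
    have eJ: "ennreal b * emeasure lborel {c<..<e} \<le> emeasure ?\<nu> {c<..<e}" if "(c, e) \<in> D" for c e
      using D(2)[OF that] emeasure_interval_measure_Ioo[OF G, of c e] ab
      by (simp add: ennreal_mult[symmetric] ennreal_leI)
    \<comment> \<open>The increments of \<open>G\<close> are summed as values of
      \<open>interval_measure G\<close>; monotonicity of this measure takes the place of a
      comparison of series.\<close>
    have "ennreal b * emeasure lborel UJ = (\<integral>\<^sup>+i. ennreal b * emeasure lborel ((\<lambda>(c, e). {c<..<e}) i) \<partial>count_space D)"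
      unfolding UJ_def using D(1,3)
      by (subst emeasure_UN_countable) (auto simp: nn_integral_cmult split: prod.splits)
    also have "\<dots> \<le> (\<integral>\<^sup>+i. emeasure ?\<nu> ((\<lambda>(c, e). {c<..<e}) i) \<partial>count_space D)"
      by (rule nn_integral_mono) (use eJ in auto)
    also have "\<dots> = emeasure ?\<nu> UJ"
      unfolding UJ_def using D(1,3) by (subst emeasure_UN_countable) (auto split: prod.splits)
    also have "\<dots> \<le> emeasure ?\<nu> UI"
      using UJI oUI by (intro emeasure_mono) auto
    also have "\<dots> = (\<integral>\<^sup>+i. emeasure ?\<nu> ((\<lambda>(c, e). {c<..<e}) i) \<partial>count_space C)"
      unfolding UI_def using C(1,3) by (subst emeasure_UN_countable) (auto split: prod.splits)
    also have "\<dots> \<le> (\<integral>\<^sup>+i. ennreal a * emeasure lborel ((\<lambda>(c, e). {c<..<e}) i) \<partial>count_space C)"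
      by (rule nn_integral_mono) (use eI in auto)
    also have "\<dots> = ennreal a * emeasure lborel UI"
      unfolding UI_def using C(1,3)
      by (subst emeasure_UN_countable) (auto simp: nn_integral_cmult split: prod.splits)
    finally have le: "ennreal b * emeasure lborel UJ \<le> ennreal a * emeasure lborel UI" .
    have "emeasure lborel UJ = ennreal (?\<mu> UJ)" "emeasure lborel UI = ennreal (?\<mu> UI)"
      using emeasure_eq_measure2[OF lm(1)] emeasure_eq_measure2[OF lm(2)] oUI oUJ
      by (simp_all add: borel_open)
    with le have "b * ?\<mu> UJ \<le> a * ?\<mu> UI"
      using ab by (simp add: ennreal_mult[symmetric])
    moreover have "?\<mu> UI \<le> m + 2 * \<epsilon>"
      using measure_mono_fmeasurable[OF UIU _ U(3)] lm U(4) T(3) by auto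
    ultimately show ?thesis
      using mJ ab by (meson mult_left_mono order_trans less_imp_le)
  qed
  then have "b * m \<le> a * m + e" if "e > 0" for e
  proof -
    have "b * m \<le> a * (m + 2 * (e / (2 * (a + 1))))"
      using \<open>\<And>\<epsilon>. \<epsilon> > 0 \<Longrightarrow> b * m \<le> a * (m + 2 * \<epsilon>)\<close>[of "e / (2 * (a + 1))"] ab that by simp
    also have "\<dots> \<le> a * m + e"
      using ab that by (simp add: field_simps)
    finally show ?thesis .
  qed
  then have "b * m \<le> a * m" by (rule field_le_epsilon)
  then have "m = 0" using ab m0 by (metis mult_le_cancel_right not_less order_antisym)
  then show ?thesis unfolding negligible_outer using ex by auto
qed


text \<open>The interval between \<open>x\<close> and \<open>x + h\<close> has \<open>x\<close> as
  an endpoint, while the Vitali cover wants \<open>x\<close> inside. The inequality is strict and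
  \<open>H\<close> is continuous, so that endpoint can be pushed slightly beyond
  \<open>x\<close>.\<close>

lemma slope_interval_around:
  fixes H :: "real \<Rightarrow> real"
  assumes H: "continuous_on UNIV H" and h: "h \<noteq> 0" "\<bar>h\<bar> < d" "(H (x + h) - H x) / h < 0"
  shows "\<exists>c e. c < x \<and> x < e \<and> e - c < d \<and> H e - H c < 0"
proof -
  define \<delta> where "\<delta> = d - \<bar>h\<bar>"
  have \<delta>: "\<delta> > 0" using h by (simp add: \<delta>_def)
  have iso: "isCont H x" using H by (simp add: continuous_on_eq_continuous_at)
  define \<eta> where "\<eta> = \<bar>H (x + h) - H x\<bar>"
  have \<eta>: "\<eta> > 0" using h by (auto simp: \<eta>_def)
  obtain s where s: "s > 0" "\<And>y. \<bar>y - x\<bar> < s \<Longrightarrow> \<bar>H y - H x\<bar> < \<eta>"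
    using iso \<eta> unfolding continuous_at_eps_delta by (auto simp: dist_real_def)
  define t where "t = min s \<delta> / 2"
  have t: "t > 0" "t < s" "t < \<delta>" using s \<delta> by (auto simp: t_def)
  show ?thesis
  proof (cases "h > 0")
    case True
    then have "H (x + h) - H x < 0" using h(3) by (simp add: divide_less_0_iff)
    moreover have "\<bar>H (x - t) - H x\<bar> < \<eta>" using s(2)[of "x - t"] t by simp
    ultimately have "H (x + h) - H (x - t) < 0" by (simp add: \<eta>_def)
    then show ?thesis using True t h by (intro exI[of _ "x - t"] exI[of _ "x + h"]) (auto simp: \<delta>_def)
  next
    case False
    then have "H (x + h) - H x > 0" using h by (simp add: divide_less_0_iff)
    moreover have "\<bar>H (x + t) - H x\<bar> < \<eta>" using s(2)[of "x + t"] t by simp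
    ultimately have "H (x + t) - H (x + h) < 0" by (simp add: \<eta>_def)
    then show ?thesis using False t h by (intro exI[of _ "x + h"] exI[of _ "x + t"]) (auto simp: \<delta>_def)
  qed
qed

text \<open>After adding \<open>L * x\<close> the function is monotone with quotients in
  \<open>[0, 2 * L]\<close>. Where the quotients do not converge, two rationals separate their lower
  and upper limits, which puts the point into one of the countably many null sets
  \<open>Z p q n\<close>; the index \<open>n\<close> provides boundedness.\<close>

theorem Lipschitz_differentiable_ae_real:
  fixes g :: "real \<Rightarrow> real"
  assumes L: "L-lipschitz_on UNIV g"
  shows "negligible {x. \<not> g differentiable (at x)}"
proof -
  have L0: "L \<ge> 0" using L lipschitz_on_nonneg by blast
  have lip: "\<bar>g x - g y\<bar> \<le> L * \<bar>x - y\<bar>" for x y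
    using lipschitz_onD[OF L, of x y] by (simp add: dist_real_def)
  define G where "G = (\<lambda>x. g x + L * x)"
  have mono: "mono G"
  proof (rule monoI)
    fix x y :: real assume "x \<le> y"
    then show "G x \<le> G y" using lip[of x y] by (simp add: G_def abs_if algebra_simps split: if_splits)
  qed
  have cont: "continuous_on UNIV G"
    unfolding G_def by (intro continuous_intros lipschitz_on_continuous_on[OF L])
  define Z where "Z = (\<lambda>p q n. {x \<in> ball 0 (real n). \<forall>d>0.
      (\<exists>c e. c < x \<and> x < e \<and> e - c < d \<and> G e - G c < p * (e - c)) \<and>
      (\<exists>c e. c < x \<and> x < e \<and> e - c < d \<and> G e - G c > q * (e - c))})"
  have negZ: "negligible (Z p q n)" if "0 \<le> p" "p < q" for p q n
    using that by (intro slope_gap_negligible_bounded[OF mono cont, of p q])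
      (auto simp: Z_def simp del: mem_ball intro!: bounded_subset[OF bounded_ball[of 0 "real n"]])
  let ?I = "{(p, q). 0 \<le> p \<and> p < q} \<inter> \<rat> \<times> \<rat>"
  have cI: "countable ?I" by (intro countable_Int2 countable_SIGMA countable_rat)
  have "x \<in> (\<Union>(p, q)\<in>?I. \<Union>n. Z p q n)" if "\<not> g differentiable (at x)" for x
  proof -
    define Q where "Q = (\<lambda>h. (G (x + h) - G x) / h)"
    have Qb: "0 \<le> Q h" "Q h \<le> 2 * L" if "h \<noteq> 0" for h
      using lip[of "x + h" x] that monoD[OF mono, of x "x + h"] monoD[OF mono, of "x + h" x] L0
      by (auto simp: Q_def G_def divide_simps abs_if algebra_simps split: if_splits)
    have nl: "\<not> (Q \<longlongrightarrow> D) (at 0)" for D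
    proof
      assume "(Q \<longlongrightarrow> D) (at 0)"
      then have "(G has_real_derivative D) (at x)" by (simp add: DERIV_def Q_def)
      then have "((\<lambda>x. G x - L * x) has_real_derivative D - L) (at x)"
        by (auto intro!: derivative_eq_intros)
      then show False using that by (simp add: G_def real_differentiable_def)
    qed
    \<comment> \<open>In \<open>ereal\<close> both limits exist; the bounds on \<open>Q\<close>
      would make a common value real, hence a derivative.\<close>
    let ?E = "\<lambda>h. ereal (Q h)"
    have "Liminf (at 0) ?E < Limsup (at 0) ?E"
    proof (rule ccontr)
      assume "\<not> ?thesis"
      then have eq: "Liminf (at 0) ?E = Limsup (at 0) ?E"
        using Liminf_le_Limsup[of "at (0::real)" ?E] by (simp add: order_antisym)
      have "0 \<le> Liminf (at 0) ?E"
        by (rule Liminf_bounded) (use Qb in \<open>auto simp: eventually_at_filter\<close>)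
      moreover have "Limsup (at 0) ?E \<le> ereal (2 * L)"
        by (rule Limsup_bounded) (use Qb in \<open>auto simp: eventually_at_filter\<close>)
      ultimately obtain D where "Limsup (at 0) ?E = ereal D"
        using eq by (cases "Limsup (at 0) ?E") auto
      then have "(?E \<longlongrightarrow> ereal D) (at 0)"
        using eq by (subst tendsto_iff_Liminf_eq_Limsup) auto
      then show False using nl by simp
    qed
    then obtain p' where p': "Liminf (at 0) ?E < ereal p'" "ereal p' < Limsup (at 0) ?E"
      using ereal_dense2 by blast
    obtain p where p: "p \<in> \<rat>" "p < p'" "Liminf (at 0) ?E < ereal p"
    proof -
      obtain s where s: "Liminf (at 0) ?E < ereal s" "ereal s < ereal p'"
        using ereal_dense2 p'(1) by blast
      then obtain p where p: "p \<in> \<rat>" "s < p" "p < p'" using Rats_dense_in_real by auto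
      have "Liminf (at 0) ?E < ereal p" by (rule less_trans[OF s(1)]) (use p in simp)
      then show thesis using that p by blast
    qed
    obtain q where q: "q \<in> \<rat>" "p' < q" "ereal q < Limsup (at 0) ?E"
    proof -
      obtain s where s: "ereal p' < ereal s" "ereal s < Limsup (at 0) ?E"
        using ereal_dense2 p'(2) by blast
      then obtain q where q: "q \<in> \<rat>" "p' < q" "q < s" using Rats_dense_in_real by auto
      have "ereal q < Limsup (at 0) ?E" by (rule less_trans[OF _ s(2)]) (use q in simp)
      then show thesis using that q by blast
    qed
    have fp: "\<exists>h. h \<noteq> 0 \<and> \<bar>h\<bar> < d \<and> Q h < p" if "d > 0" for d
    proof (rule ccontr)
      assume "\<not> ?thesis"
      then have "\<forall>\<^sub>F h in at 0. ereal p \<le> ?E h"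
        using \<open>d > 0\<close> by (auto simp: eventually_at dist_real_def not_less intro!: exI[of _ d])
      then show False using Liminf_bounded[of "ereal p" ?E "at 0"] p(3) by simp
    qed
    have fq: "\<exists>h. h \<noteq> 0 \<and> \<bar>h\<bar> < d \<and> Q h > q" if "d > 0" for d
    proof (rule ccontr)
      assume "\<not> ?thesis"
      then have "\<forall>\<^sub>F h in at 0. ?E h \<le> ereal q"
        using \<open>d > 0\<close> by (auto simp: eventually_at dist_real_def not_less intro!: exI[of _ d])
      then show False using Limsup_bounded[of ?E "ereal q" "at 0"] q(3) by simp
    qed
    have p0: "0 \<le> p" using fp[of 1] Qb(1) by (meson less_eq_real_def not_less order_trans zero_less_one)
    obtain n where n: "\<bar>x\<bar> < real n" using reals_Archimedean2 by blast
    have "x \<in> Z p q n"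
      unfolding Z_def
    proof (intro CollectI conjI allI impI)
      fix d :: real assume d: "d > 0"
      obtain h where h: "h \<noteq> 0" "\<bar>h\<bar> < d" "Q h < p" using fp d by blast
      have "((G (x + h) - p * (x + h)) - (G x - p * x)) / h = Q h - p"
        using h(1) by (simp add: Q_def field_simps)
      then show "\<exists>c e. c < x \<and> x < e \<and> e - c < d \<and> G e - G c < p * (e - c)"
        using slope_interval_around[of "\<lambda>x. G x - p * x" h d x, OF _ h(1,2)] h(3) cont
        by (fastforce simp: algebra_simps intro!: continuous_intros)
      obtain h where h: "h \<noteq> 0" "\<bar>h\<bar> < d" "Q h > q" using fq d by blast
      have "((q * (x + h) - G (x + h)) - (q * x - G x)) / h = q - Q h"
        using h(1) by (simp add: Q_def field_simps)
      then show "\<exists>c e. c < x \<and> x < e \<and> e - c < d \<and> G e - G c > q * (e - c)"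
        using slope_interval_around[of "\<lambda>x. q * x - G x" h d x, OF _ h(1,2)] h(3) cont
        by (fastforce simp: algebra_simps intro!: continuous_intros)
    qed (use n in auto)
    then show ?thesis using p q p0 by (intro UN_I[of "(p, q)"]) auto
  qed
  moreover have "negligible (\<Union>(p, q)\<in>?I. \<Union>n. Z p q n)"
    using cI negZ by (intro negligible_countable_Union countable_image) (auto intro!: negligible_countable_Union)
  ultimately show ?thesis by (blast intro: negligible_subset)
qed

section \<open>Directional derivatives in several variables\<close>

lemma limit_at_0_iff_rational_Cauchy:
  fixes q :: "real \<Rightarrow> real"
  assumes q: "continuous_on (- {0}) q"
  shows "(\<exists>D. (q \<longlongrightarrow> D) (at 0)) \<longleftrightarrow>
    (\<forall>k::nat. \<exists>m::nat. \<forall>s t::rat. 0 < \<bar>real_of_rat s\<bar> \<and> \<bar>real_of_rat s\<bar> < 1 / (real m + 1)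
      \<and> 0 < \<bar>real_of_rat t\<bar> \<and> \<bar>real_of_rat t\<bar> < 1 / (real m + 1)
       \<longrightarrow> \<bar>q (of_rat s) - q (of_rat t)\<bar> \<le> 1 / (real k + 1))" (is "_ \<longleftrightarrow> ?R")
proof
  assume "\<exists>D. (q \<longlongrightarrow> D) (at 0)"
  then obtain D where D: "(q \<longlongrightarrow> D) (at 0)" by blast
  show ?R
  proof
    fix k :: nat
    have "\<forall>\<^sub>F t in at 0. dist (q t) D < 1 / (2 * (real k + 1))"
      using D by (rule tendstoD) simp
    then obtain d where d: "d > 0" "\<And>t. t \<noteq> 0 \<Longrightarrow> \<bar>t\<bar> < d \<Longrightarrow> \<bar>q t - D\<bar> < 1 / (2 * (real k + 1))"
      by (auto simp: eventually_at dist_real_def)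
    obtain m where m: "1 / (real m + 1) < d" using nat_approx_posE[OF d(1)] by (auto simp: add.commute)
    show "\<exists>m::nat. \<forall>s t::rat. 0 < \<bar>real_of_rat s\<bar> \<and> \<bar>real_of_rat s\<bar> < 1 / (real m + 1) \<and> 0 < \<bar>real_of_rat t\<bar>
      \<and> \<bar>real_of_rat t\<bar> < 1 / (real m + 1)
       \<longrightarrow> \<bar>q (of_rat s) - q (of_rat t)\<bar> \<le> 1 / (real k + 1)"
    proof (intro exI[of _ m] allI impI)
      fix s t :: rat
      assume st: "0 < \<bar>real_of_rat s\<bar> \<and> \<bar>real_of_rat s\<bar> < 1 / (real m + 1) \<and> 0 < \<bar>real_of_rat t\<bar>
        \<and> \<bar>real_of_rat t\<bar> < 1 / (real m + 1)"
      have "\<bar>q (of_rat s) - D\<bar> < 1 / (2 * (real k + 1))" "\<bar>q (of_rat t) - D\<bar> < 1 / (2 * (real k + 1))"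
        using d(2)[of "of_rat s"] d(2)[of "of_rat t"] st m by force+
      then have "\<bar>q (of_rat s) - q (of_rat t)\<bar> \<le> 1 / (2 * (real k + 1)) + 1 / (2 * (real k + 1))"
        by (smt (verit))
      then show "\<bar>q (of_rat s) - q (of_rat t)\<bar> \<le> 1 / (real k + 1)" by (simp add: field_simps)
    qed
  qed
next
  assume R: ?R
  \<comment> \<open>Continuity off \<open>0\<close> lets a rational increment, kept away from
    \<open>0\<close> and below the same bound, replace a real one.\<close>
  have rat: "\<exists>r::rat. 0 < \<bar>real_of_rat r\<bar> \<and> \<bar>real_of_rat r\<bar> < \<delta> \<and> \<bar>q t - q (of_rat r)\<bar> < e"
    if te: "t \<noteq> 0" "\<bar>t\<bar> < \<delta>" "e > 0" for t \<delta> e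
  proof -
    have "isCont q t" using q te by (simp add: continuous_on_eq_continuous_at open_Compl)
    then obtain d where d: "d > 0" "\<And>s. \<bar>s - t\<bar> < d \<Longrightarrow> \<bar>q s - q t\<bar> < e"
      using te(3) unfolding continuous_at_eps_delta by (auto simp: dist_real_def)
    define d' where "d' = min d (min (\<delta> - \<bar>t\<bar>) \<bar>t\<bar>)"
    have d': "d' > 0" "d' \<le> d" "d' \<le> \<delta> - \<bar>t\<bar>" "d' \<le> \<bar>t\<bar>" using te d by (auto simp: d'_def)
    obtain r :: rat where r: "t < of_rat r" "of_rat r < t + d'" using of_rat_dense[of t "t + d'"] d' by auto
    have "0 < \<bar>real_of_rat r\<bar>" "\<bar>real_of_rat r\<bar> < \<delta>" "\<bar>real_of_rat r - t\<bar> < d" using r d' by linarith+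
    then show ?thesis
      using d(2)[of "of_rat r"] by (intro exI[of _ r]) (simp add: abs_minus_commute)
  qed
  have C: "\<exists>\<delta>>0. \<forall>s t. 0 < \<bar>s\<bar> \<and> \<bar>s\<bar> < \<delta> \<and> 0 < \<bar>t\<bar> \<and> \<bar>t\<bar> < \<delta> \<longrightarrow> \<bar>q s - q t\<bar> < e" if "e > 0" for e
  proof -
    obtain k where k: "1 / (real k + 1) < e / 3" using nat_approx_posE[of "e / 3"] \<open>e > 0\<close> by (auto simp: add.commute)
    obtain m where m: "\<And>s t::rat. 0 < \<bar>real_of_rat s\<bar> \<and> \<bar>real_of_rat s\<bar> < 1 / (real m + 1)
      \<and> 0 < \<bar>real_of_rat t\<bar> \<and> \<bar>real_of_rat t\<bar> < 1 / (real m + 1)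
       \<Longrightarrow> \<bar>q (of_rat s) - q (of_rat t)\<bar> \<le> 1 / (real k + 1)" using R by blast
    have "\<bar>q s - q t\<bar> < e" if st: "0 < \<bar>s\<bar>" "\<bar>s\<bar> < 1 / (real m + 1)" "0 < \<bar>t\<bar>" "\<bar>t\<bar> < 1 / (real m + 1)" for s t
    proof -
      obtain a b :: rat where ab: "0 < \<bar>real_of_rat a\<bar>" "\<bar>real_of_rat a\<bar> < 1 / (real m + 1)" "\<bar>q s - q (of_rat a)\<bar> < e / 3"
        "0 < \<bar>real_of_rat b\<bar>" "\<bar>real_of_rat b\<bar> < 1 / (real m + 1)" "\<bar>q t - q (of_rat b)\<bar> < e / 3"
        using rat[of s "1 / (real m + 1)" "e / 3"] rat[of t "1 / (real m + 1)" "e / 3"] st \<open>e > 0\<close> by auto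
      then show ?thesis using m[of a b] k by linarith
    qed
    then show ?thesis by (intro exI[of _ "1 / (real m + 1)"]) auto
  qed
  let ?x = "\<lambda>n::nat. 1 / (real n + 1)"
  have x0: "?x \<longlonglongrightarrow> 0" using LIMSEQ_inverse_real_of_nat by (simp add: inverse_eq_divide add.commute)
  have "Cauchy (\<lambda>n. q (?x n))"
  proof (rule metric_CauchyI)
    fix e :: real assume "e > 0"
    then obtain \<delta> where \<delta>: "\<delta> > 0" "\<And>s t. 0 < \<bar>s\<bar> \<and> \<bar>s\<bar> < \<delta> \<and> 0 < \<bar>t\<bar> \<and> \<bar>t\<bar> < \<delta> \<Longrightarrow> \<bar>q s - q t\<bar> < e" using C by blast
    have "\<forall>\<^sub>F n in sequentially. ?x n < \<delta>" using order_tendstoD(2)[OF x0 \<delta>(1)] .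
    then obtain N where N: "\<And>n. n \<ge> N \<Longrightarrow> ?x n < \<delta>" by (auto simp: eventually_sequentially)
    show "\<exists>M. \<forall>m\<ge>M. \<forall>n\<ge>M. dist (q (?x m)) (q (?x n)) < e"
      by (intro exI[of _ N]) (auto simp: dist_real_def intro!: \<delta>(2) N)
  qed
  then obtain D where D: "(\<lambda>n. q (?x n)) \<longlonglongrightarrow> D" using Cauchy_convergent_iff convergent_def by blast
  have "(q \<longlongrightarrow> D) (at 0)"
  proof (rule tendstoI)
    fix e :: real assume e: "e > 0"
    then obtain \<delta> where \<delta>: "\<delta> > 0" "\<And>s t. 0 < \<bar>s\<bar> \<and> \<bar>s\<bar> < \<delta> \<and> 0 < \<bar>t\<bar> \<and> \<bar>t\<bar> < \<delta> \<Longrightarrow> \<bar>q s - q t\<bar> < e / 2"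
      using C[of "e / 2"] by auto
    have "\<forall>\<^sub>F n in sequentially. ?x n < \<delta> \<and> dist (q (?x n)) D < e / 2"
      using order_tendstoD(2)[OF x0 \<delta>(1)] tendstoD[OF D, of "e / 2"] e by (auto intro: eventually_conj)
    then obtain n where n: "?x n < \<delta>" "dist (q (?x n)) D < e / 2" by (auto simp: eventually_sequentially)
    have "dist (q t) D < e" if "t \<noteq> 0" "\<bar>t\<bar> < \<delta>" for t
      using \<delta>(2)[of t "?x n"] n that by (auto simp: dist_real_def abs_if split: if_splits)
    then show "\<forall>\<^sub>F t in at 0. dist (q t) D < e"
      using \<delta>(1) by (auto simp: eventually_at dist_real_def)
  qed
  then show "\<exists>D. (q \<longlongrightarrow> D) (at 0)" by blast
qed

text \<open>On each line parallel to \<open>e\<close> the one-dimensional theorem applies, so for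
  every \<open>y\<close> almost every translate \<open>y + t *\<^sub>R e\<close> is good. By Fubini
  a single \<open>t\<close> is good for almost every \<open>y\<close>, and translation invariance
  removes it again. Coordinates adapted to \<open>e\<close> are thereby avoided.\<close>

lemma directional_derivative_ae:
  fixes g :: "'a::euclidean_space \<Rightarrow> real"
  assumes L: "L-lipschitz_on UNIV g"
  shows "AE y in lborel. \<exists>D. ((\<lambda>t. (g (y + t *\<^sub>R e) - g y) / t) \<longlongrightarrow> D) (at 0)"
proof -
  define P where "P = (\<lambda>y. \<exists>D. ((\<lambda>t. (g (y + t *\<^sub>R e) - g y) / t) \<longlongrightarrow> D) (at 0))"
  have cg: "continuous_on UNIV g" by (rule lipschitz_on_continuous_on[OF L])
  have [measurable]: "g \<in> borel_measurable borel" using cg by (rule borel_measurable_continuous_onI)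
  \<comment> \<open>Fubini requires \<open>P\<close> to be measurable; quantifying over naturals and
    rationals only makes this visible.\<close>
  have P_eq: "P = (\<lambda>y. \<forall>k::nat. \<exists>m::nat. \<forall>s t::rat. 0 < \<bar>real_of_rat s\<bar> \<and> \<bar>real_of_rat s\<bar> < 1 / (real m + 1)
    \<and> 0 < \<bar>real_of_rat t\<bar> \<and> \<bar>real_of_rat t\<bar> < 1 / (real m + 1)
       \<longrightarrow> \<bar>(g (y + of_rat s *\<^sub>R e) - g y) / of_rat s - (g (y + of_rat t *\<^sub>R e) - g y) / of_rat t\<bar> \<le> 1 / (real k + 1))"
    unfolding P_def
    by (intro ext limit_at_0_iff_rational_Cauchy continuous_intros continuous_on_compose2[OF cg]) auto
  have [measurable]: "Measurable.pred borel P" unfolding P_eq by measurable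
  have m: "Measurable.pred (lborel \<Otimes>\<^sub>M lborel) (\<lambda>x. P (fst x + snd x *\<^sub>R e))"
    by (rule measurable_compose[of "\<lambda>x. fst x + snd x *\<^sub>R e" _ borel P]) measurable
  have 1: "AE t in lborel. P (y + t *\<^sub>R e)" for y
  proof -
    define \<phi> where "\<phi> = (\<lambda>t::real. g (y + t *\<^sub>R e))"
    have "(L * norm e)-lipschitz_on UNIV \<phi>"
    proof (rule lipschitz_onI)
      fix s t :: real
      have "dist (\<phi> s) (\<phi> t) \<le> L * dist (y + s *\<^sub>R e) (y + t *\<^sub>R e)"
        unfolding \<phi>_def by (rule lipschitz_onD[OF L]) auto
      also have "dist (y + s *\<^sub>R e) (y + t *\<^sub>R e) = norm e * dist s t"
        by (simp add: dist_norm scaleR_diff_left[symmetric])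
      finally show "dist (\<phi> s) (\<phi> t) \<le> L * norm e * dist s t" by (simp add: mult.assoc)
    qed (use lipschitz_on_nonneg[OF L] in simp)
    then have n: "negligible {t. \<not> \<phi> differentiable (at t)}" by (rule Lipschitz_differentiable_ae_real)
    have "\<phi> differentiable (at t) \<Longrightarrow> P (y + t *\<^sub>R e)" for t
      unfolding real_differentiable_def DERIV_def P_def \<phi>_def by (simp add: algebra_simps)
    then have "{t. \<not> P (y + t *\<^sub>R e)} \<subseteq> {t. \<not> \<phi> differentiable (at t)}" by blast
    then have "negligible {t. \<not> P (y + t *\<^sub>R e)}" using n negligible_subset by blast
    then have "AE t in lebesgue. P (y + t *\<^sub>R e)"
      by (simp add: negligible_iff_null_sets AE_iff_null_sets completion.AE_iff_null_sets eventually_ae_filter)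
    then show ?thesis by (simp add: AE_completion_iff)
  qed
  have "AE y in lborel. AE t in lborel. P (y + t *\<^sub>R e)" using 1 by simp
  then have "AE t in lborel. AE y in lborel. P (y + t *\<^sub>R e)"
    using lborel_pair.AE_commute[of "\<lambda>y t. P (y + t *\<^sub>R e)", OF predE[OF m]] by blast
  then obtain t :: real where "AE y in lborel. P (y + t *\<^sub>R e)"
    using eventually_happens'[of "ae_filter (lborel :: real measure)"]
    by (auto simp: ae_filter_eq_bot_iff)
  then have "AE y in lborel. P (t *\<^sub>R e + y)" by (simp add: add.commute)
  then have "AE y in distr lborel borel ((+) (t *\<^sub>R e)). P y"
    by (subst AE_distr_iff) auto
  then show ?thesis unfolding lborel_distr_plus P_def .
qed


text \<open>The function \<open>1 + H / K'\<close> is a nonnegative density whose measure agrees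
  with Lebesgue measure on boxes; uniqueness of Lebesgue measure and of densities makes it
  \<open>1\<close> almost everywhere.\<close>

lemma box_integral_zero_imp_AE_zero:
  fixes H :: "'a::euclidean_space \<Rightarrow> real"
  assumes [measurable]: "H \<in> borel_measurable borel"
    and bd: "AE y in lborel. \<bar>H y\<bar> \<le> K"
    and int: "\<And>l u. (\<integral>y. indicator (box l u) y * H y \<partial>lborel) = 0"
  shows "AE y in lborel. H y = 0"
proof -
  define K' where "K' = \<bar>K\<bar> + 1"
  have K': "K' > 0" "AE y in lborel. \<bar>H y\<bar> \<le> K'" using bd by (auto simp: K'_def)
  define \<rho> where "\<rho> = (\<lambda>y. 1 + H y / K')"
  have [measurable]: "\<rho> \<in> borel_measurable borel" unfolding \<rho>_def by measurable
  have \<rho>0: "AE y in lborel. 0 \<le> \<rho> y"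
    using K'(2) by eventually_elim (use K'(1) in \<open>auto simp: \<rho>_def field_simps abs_if split: if_splits\<close>)
  have "lborel = density lborel (\<lambda>y. ennreal (\<rho> y))"
  proof (rule lborel_eqI)
    fix l u :: 'a
    assume lu: "\<And>b. b \<in> Basis \<Longrightarrow> l \<bullet> b \<le> u \<bullet> b"
    have ib: "integrable lborel (indicator (box l u) :: 'a \<Rightarrow> real)"
      by (intro integrable_real_indicator) (auto simp: emeasure_lborel_box_eq)
    have iH: "integrable lborel (\<lambda>y. indicator (box l u) y * H y)"
    proof (rule Bochner_Integration.integrable_bound[of _ "\<lambda>y. K' * indicator (box l u) y"])
      show "AE y in lborel. norm (indicator (box l u) y * H y) \<le> norm (K' * indicator (box l u) y)"
        using K'(2) by eventually_elim (use K'(1) in \<open>auto simp: indicator_def\<close>)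
    qed (use ib in auto)
    have "emeasure (density lborel (\<lambda>y. ennreal (\<rho> y))) (box l u) = (\<integral>\<^sup>+y. ennreal (\<rho> y) * indicator (box l u) y \<partial>lborel)"
      by (simp add: emeasure_density)
    also have "\<dots> = (\<integral>\<^sup>+y. ennreal (indicator (box l u) y + indicator (box l u) y * H y / K') \<partial>lborel)"
      by (intro nn_integral_cong) (auto simp: \<rho>_def indicator_def)
    also have "\<dots> = ennreal (\<integral>y. indicator (box l u) y + indicator (box l u) y * H y / K' \<partial>lborel)"
    proof (rule nn_integral_eq_integral)
      show "integrable lborel (\<lambda>y. indicator (box l u) y + indicator (box l u) y * H y / K')"
        using ib iH by auto
      show "AE y in lborel. 0 \<le> indicator (box l u) y + indicator (box l u) y * H y / K'"
        using \<rho>0 by eventually_elim (auto simp: \<rho>_def indicator_def)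
    qed
    also have "(\<integral>y. indicator (box l u) y + indicator (box l u) y * H y / K' \<partial>lborel) = measure lborel (box l u)"
      using ib iH int[of l u] by (subst Bochner_Integration.integral_add) auto
    also have "\<dots> = (\<Prod>b\<in>Basis. (u - l) \<bullet> b)"
      using lu by (simp add: measure_lborel_box_eq)
    finally show "emeasure (density lborel (\<lambda>y. ennreal (\<rho> y))) (box l u) = ennreal (\<Prod>b\<in>Basis. (u - l) \<bullet> b)" .
  qed simp
  then have "density lborel (\<lambda>y::'a. 1) = density lborel (\<lambda>y. ennreal (\<rho> y))"
    by (simp add: density_1)
  then have "AE y in lborel. 1 = ennreal (\<rho> y)"
    by (subst (asm) sigma_finite_measure.density_unique_iff[OF sigma_finite_lborel]) auto
  then show ?thesis
    by eventually_elim (use K'(1) in \<open>auto simp: \<rho>_def ennreal_eq_1\<close>)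
qed


text \<open>A sequential limit, so that the value is defined for all \<open>y\<close> and Borel
  measurable in \<open>y\<close>; where the two-sided limit exists it is the directional
  derivative.\<close>

definition dir_deriv :: "('a::euclidean_space \<Rightarrow> real) \<Rightarrow> 'a \<Rightarrow> 'a \<Rightarrow> real" where
  "dir_deriv g e y = lim (\<lambda>n. (g (y + (1 / real (Suc n)) *\<^sub>R e) - g y) / (1 / real (Suc n)))"

lemma dir_deriv_eqI:
  fixes g :: "'a::euclidean_space \<Rightarrow> real"
  assumes "((\<lambda>t. (g (y + t *\<^sub>R e) - g y) / t) \<longlongrightarrow> D) (at 0)"
  shows "dir_deriv g e y = D"
    and "(\<lambda>n. (g (y + (1 / real (Suc n)) *\<^sub>R e) - g y) / (1 / real (Suc n))) \<longlonglongrightarrow> D"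
proof -
  have "filterlim (\<lambda>n. 1 / real (Suc n)) (at 0) sequentially"
    using LIMSEQ_inverse_real_of_nat by (intro filterlim_atI) (auto simp: inverse_eq_divide)
  then show *: "(\<lambda>n. (g (y + (1 / real (Suc n)) *\<^sub>R e) - g y) / (1 / real (Suc n))) \<longlonglongrightarrow> D"
    by (rule filterlim_compose[OF assms])
  then show "dir_deriv g e y = D" unfolding dir_deriv_def by (rule limI)
qed

lemma dir_deriv_scale:
  fixes g :: "'a::euclidean_space \<Rightarrow> real"
  assumes "((\<lambda>t. (g (y + t *\<^sub>R e) - g y) / t) \<longlongrightarrow> D) (at 0)"
  shows "((\<lambda>t. (g (y + t *\<^sub>R (c *\<^sub>R e)) - g y) / t) \<longlongrightarrow> c * D) (at 0)"
proof (cases "c = 0")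
  case False
  have "filterlim (\<lambda>t. c * t) (at 0) (at 0)"
    using False by (intro filterlim_atI) (auto intro!: tendsto_eq_intros simp: eventually_at_filter)
  then have "((\<lambda>t. (g (y + (c * t) *\<^sub>R e) - g y) / (c * t)) \<longlongrightarrow> D) (at 0)"
    by (rule filterlim_compose[OF assms])
  then have "((\<lambda>t. c * ((g (y + (c * t) *\<^sub>R e) - g y) / (c * t))) \<longlongrightarrow> c * D) (at 0)"
    by (intro tendsto_intros)
  then show ?thesis using False by (simp add: mult.commute)
qed simp

text \<open>The quotient in direction \<open>v + w\<close> is the quotient in \<open>v\<close> plus
  the quotient in \<open>w\<close> at the shifted point. Integrated over a box, the shift moves to
  the indicator of the box, which converges off the null boundary. Hence both sides have equal
  integrals over every box; this replaces integration by parts against smooth test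
  functions.\<close>

lemma dir_deriv_add_ae:
  fixes g :: "'a::euclidean_space \<Rightarrow> real"
  assumes L: "L-lipschitz_on UNIV g"
  shows "AE y in lborel. dir_deriv g (v + w) y = dir_deriv g v y + dir_deriv g w y"
proof -
  have cg: "continuous_on UNIV g" by (rule lipschitz_on_continuous_on[OF L])
  have [measurable]: "g \<in> borel_measurable borel" using cg by (rule borel_measurable_continuous_onI)
  define q where "q = (\<lambda>e n y. (g (y + (1 / real (Suc n)) *\<^sub>R e) - g y) / (1 / real (Suc n)))"
  have [measurable]: "q e n \<in> borel_measurable borel" for e n unfolding q_def by measurable
  have [measurable]: "dir_deriv g e \<in> borel_measurable borel" for e
    unfolding dir_deriv_def by measurable
  have lim: "AE y in lborel. (\<lambda>n. q e n y) \<longlonglongrightarrow> dir_deriv g e y" for e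
    using directional_derivative_ae[OF L, of e] 
    by eventually_elim (use dir_deriv_eqI in \<open>fastforce simp: q_def\<close>)
  have qb: "\<bar>q e n y\<bar> \<le> L * norm e" for e n y
  proof -
    have "\<bar>g (y + (1 / real (Suc n)) *\<^sub>R e) - g y\<bar> \<le> L * (norm e * (1 / real (Suc n)))"
      using lipschitz_onD[OF L, of "y + (1 / real (Suc n)) *\<^sub>R e" y] by (simp add: dist_norm)
    then have "\<bar>g (y + (1 / real (Suc n)) *\<^sub>R e) - g y\<bar> * real (Suc n) \<le> L * norm e"
      by (simp add: pos_le_divide_eq del: of_nat_Suc)
    then show ?thesis by (simp add: q_def abs_mult del: of_nat_Suc)
  qed
  have db: "AE y in lborel. \<bar>dir_deriv g e y\<bar> \<le> L * norm e" for e
    using lim[of e]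
    by eventually_elim (rule tendsto_upperbound[OF tendsto_rabs], auto simp: qb)
  define H where "H = (\<lambda>y. dir_deriv g (v + w) y - dir_deriv g v y - dir_deriv g w y)"
  have "AE y in lborel. H y = 0"
  proof (rule box_integral_zero_imp_AE_zero)
    show "H \<in> borel_measurable borel" unfolding H_def by measurable
    show "AE y in lborel. \<bar>H y\<bar> \<le> L * norm (v + w) + L * norm v + L * norm w"
      using db[of "v + w"] db[of v] db[of w] by eventually_elim (auto simp: H_def)
    fix l u :: 'a
    obtain R where R: "R > 0" "box l u \<subseteq> ball 0 R" using bounded_subset_ballD[of "box l u" 0] bounded_box by blast
    define \<psi> where "\<psi> = (indicator (box l u) :: 'a \<Rightarrow> real)"
    have [measurable]: "\<psi> \<in> borel_measurable borel" unfolding \<psi>_def by measurable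
    \<comment> \<open>\<open>W\<close> dominates the indicator of the box and all its shifts by
      fractions of \<open>v\<close>.\<close>
    define W where "W = (indicator (ball (0::'a) (R + norm v)) :: 'a \<Rightarrow> real)"
    have iW: "integrable lborel (\<lambda>y. c * W y)" for c
      unfolding W_def by (intro integrable_mult_right integrable_real_indicator) (use
        emeasure_lborel_ball_finite[of "0::'a" "R + norm v"] in auto)
    have W1: "\<bar>\<psi> y\<bar> \<le> W y" for y
    proof (cases "y \<in> box l u")
      case True
      then have "y \<in> ball 0 R" using R by blast
      then have "y \<in> ball 0 (R + norm v)" using norm_ge_zero[of v] by (simp del: norm_ge_zero)
      then show ?thesis by (simp add: \<psi>_def W_def del: mem_ball)
    qed (simp add: \<psi>_def W_def)
    have W2: "\<bar>\<psi> (y - (1 / real (Suc n)) *\<^sub>R v)\<bar> \<le> W y" for y n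
    proof (cases "y - (1 / real (Suc n)) *\<^sub>R v \<in> box l u")
      case True
      then have "norm (y - (1 / real (Suc n)) *\<^sub>R v) < R" using R by auto
      moreover have "norm ((1 / real (Suc n)) *\<^sub>R v) \<le> norm v"
        by (simp add: divide_le_eq mult_le_cancel_left1 mult_left_le)
      moreover have "norm y \<le> norm (y - (1 / real (Suc n)) *\<^sub>R v) + norm ((1 / real (Suc n)) *\<^sub>R v)"
        using norm_triangle_sub[of y "(1 / real (Suc n)) *\<^sub>R v"] by (simp only: add.commute)
      ultimately have "norm y < R + norm v" by linarith
      then show ?thesis by (auto simp: \<psi>_def W_def indicator_def)
    qed (auto simp: \<psi>_def W_def indicator_def)
    have prod_le: "\<bar>a * b\<bar> \<le> c * d" if "\<bar>a\<bar> \<le> d" "\<bar>b\<bar> \<le> c" for a b c d :: real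
      using mult_mono[OF that(2,1)] order_trans[OF abs_ge_zero that(2)] by (simp add: abs_mult mult.commute)
    have I: "(\<lambda>n. \<integral>y. \<psi> y * q e n y \<partial>lborel) \<longlonglongrightarrow> (\<integral>y. \<psi> y * dir_deriv g e y \<partial>lborel)"
      and iq: "integrable lborel (\<lambda>y. \<psi> y * q e n y)" and id: "integrable lborel (\<lambda>y. \<psi> y * dir_deriv g e y)" for e n
    proof -
      have 1: "AE y in lborel. (\<lambda>n. \<psi> y * q e n y) \<longlonglongrightarrow> \<psi> y * dir_deriv g e y"
        using lim[of e] by eventually_elim (intro tendsto_intros)
      have 2: "AE y in lborel. norm (\<psi> y * q e n y) \<le> L * norm e * W y" for n
        using prod_le[OF W1 qb] by simp
      show "(\<lambda>n. \<integral>y. \<psi> y * q e n y \<partial>lborel) \<longlonglongrightarrow> (\<integral>y. \<psi> y * dir_deriv g e y \<partial>lborel)"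
        by (rule integral_dominated_convergence[OF _ _ iW 1 2]) auto
      show "integrable lborel (\<lambda>y. \<psi> y * q e n y)"
        by (rule Bochner_Integration.integrable_bound[OF iW[of "L * norm e"]])
           (use prod_le[OF W1 qb] in \<open>auto intro!: AE_I2 order_trans[OF _ abs_ge_self]\<close>)
      have "AE y in lborel. norm (\<psi> y * dir_deriv g e y) \<le> norm (L * norm e * W y)"
        using db[of e] by eventually_elim (use prod_le[OF W1] in \<open>auto intro: order_trans[OF _ abs_ge_self]\<close>)
      then show "integrable lborel (\<lambda>y. \<psi> y * dir_deriv g e y)"
        by (intro Bochner_Integration.integrable_bound[OF iW[of "L * norm e"]]) measurable
    qed
    have shift: "(\<integral>y. \<psi> y * q w n (y + (1 / real (Suc n)) *\<^sub>R v) \<partial>lborel) = (\<integral>y. \<psi> (y - (1 / real (Suc n)) *\<^sub>R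
      v) * q w n y \<partial>lborel)"
      and ishift: "integrable lborel (\<lambda>y. \<psi> y * q w n (y + (1 / real (Suc n)) *\<^sub>R v))" for n
    proof -
      let ?c = "(1 / real (Suc n)) *\<^sub>R v"
      have "(\<integral>y. \<psi> (y - ?c) * q w n y \<partial>lborel) = (\<integral>y. \<psi> (y - ?c) * q w n y \<partial>(distr lborel borel ((+) ?c)))"
        by (simp add: lborel_distr_plus)
      also have "\<dots> = (\<integral>y. \<psi> (?c + y - ?c) * q w n (?c + y) \<partial>lborel)"
        by (rule integral_distr) measurable
      finally show "(\<integral>y. \<psi> y * q w n (y + ?c) \<partial>lborel) = (\<integral>y. \<psi> (y - ?c) * q w n y \<partial>lborel)"
        unfolding add.commute[of ?c] add_diff_cancel_right' by (rule sym)
      show "integrable lborel (\<lambda>y. \<psi> y * q w n (y + ?c))"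
        by (rule Bochner_Integration.integrable_bound[OF iW[of "L * norm w"]])
           (use prod_le[OF W1 qb] in \<open>auto intro!: AE_I2 order_trans[OF _ abs_ge_self]\<close>)
    qed
    have J: "(\<lambda>n. \<integral>y. \<psi> (y - (1 / real (Suc n)) *\<^sub>R v) * q w n y \<partial>lborel) \<longlonglongrightarrow> (\<integral>y. \<psi> y * dir_deriv g w y \<partial>lborel)"
    proof (rule integral_dominated_convergence[OF _ _ iW[of "L * norm w"]])
      have "AE y in lebesgue. y \<notin> frontier (box l u)"
        using negligible_convex_frontier[OF convex_box(2)[of l u]]
        unfolding negligible_iff_null_sets by (rule AE_not_in)
      then have fr: "AE y in lborel. y \<notin> frontier (box l u)"
        by (simp only: AE_completion_iff)
      show "AE y in lborel. (\<lambda>n. \<psi> (y - (1 / real (Suc n)) *\<^sub>R v) * q w n y) \<longlonglongrightarrow> \<psi> y * dir_deriv g w y"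
        using fr lim[of w]
      proof eventually_elim
        case (elim y)
        have "isCont \<psi> y" using elim(1) unfolding \<psi>_def by (simp add: isCont_indicator)
        moreover have "(\<lambda>n. y - (1 / real (Suc n)) *\<^sub>R v) \<longlonglongrightarrow> y"
          using tendsto_diff[OF tendsto_const tendsto_scaleR[OF LIMSEQ_inverse_real_of_nat tendsto_const], of y v]
          by (simp add: inverse_eq_divide)
        ultimately have "(\<lambda>n. \<psi> (y - (1 / real (Suc n)) *\<^sub>R v)) \<longlonglongrightarrow> \<psi> y"
          by (rule isCont_tendsto_compose)
        then show ?case by (rule tendsto_mult[OF _ elim(2)])
      qed
      show "AE y in lborel. norm (\<psi> (y - (1 / real (Suc n)) *\<^sub>R v) * q w n y) \<le> L * norm w * W y" for n
        using prod_le[OF W2 qb] by simp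
    qed measurable
    have split: "q (v + w) n y = q w n (y + (1 / real (Suc n)) *\<^sub>R v) + q v n y" for n y
      unfolding q_def by (simp only: scaleR_add_right add.assoc[symmetric] add_divide_distrib[symmetric]) simp
    have "(\<integral>y. \<psi> y * q (v + w) n y \<partial>lborel) = (\<integral>y. \<psi> (y - (1 / real (Suc n)) *\<^sub>R v) * q w n y \<partial>lborel)
      + (\<integral>y. \<psi> y * q v n y \<partial>lborel)" for n
      unfolding split shift[symmetric] distrib_left by (rule Bochner_Integration.integral_add[OF ishift iq])
    with tendsto_add[OF J I[of v]] have "(\<lambda>n. \<integral>y. \<psi> y * q (v + w) n y \<partial>lborel) \<longlonglongrightarrow>
        (\<integral>y. \<psi> y * dir_deriv g w y \<partial>lborel) + (\<integral>y. \<psi> y * dir_deriv g v y \<partial>lborel)" by simp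
    then have "(\<integral>y. \<psi> y * dir_deriv g (v + w) y \<partial>lborel) = (\<integral>y. \<psi> y * dir_deriv g w y \<partial>lborel) + (\<integral>y. \<psi> y *
      dir_deriv g v y \<partial>lborel)"
      using I[of "v + w"] LIMSEQ_unique by blast
    moreover have "(\<integral>y. \<psi> y * H y \<partial>lborel) = (\<integral>y. \<psi> y * dir_deriv g (v + w) y \<partial>lborel) - (\<integral>y. \<psi> y * dir_deriv
      g v y \<partial>lborel) - (\<integral>y. \<psi> y * dir_deriv g w y \<partial>lborel)"
      unfolding H_def right_diff_distrib using id by simp
    ultimately show "(\<integral>y. indicator (box l u) y * H y \<partial>lborel) = 0" by (simp add: \<psi>_def)
  qed
  then show ?thesis by eventually_elim (simp add: H_def)
qed

text \<open>Almost everywhere the directional derivative is linear on a countable dense set of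
  directions. Finitely many of these directions are dense enough near the unit sphere, and the
  Lipschitz bound transfers the estimate to all others, so the convergence is uniform and the
  derivative total.\<close>

theorem Rademacher:
  fixes g :: "'a::euclidean_space \<Rightarrow> real"
  assumes L: "L-lipschitz_on UNIV g"
  shows "AE y in lborel. g differentiable (at y)"
proof -
  define lim where "lim = (\<lambda>e y. \<exists>D. ((\<lambda>t. (g (y + t *\<^sub>R e) - g y) / t) \<longlongrightarrow> D) (at 0))"
  have lip: "\<bar>g x - g y\<bar> \<le> L * norm (x - y)" for x y
    using lipschitz_onD[OF L, of x y] by (simp add: dist_norm)
  have L0: "0 \<le> L" using L lipschitz_on_nonneg by blast
  have lim_ae: "AE y in lborel. lim e y" for e
    unfolding lim_def by (rule directional_derivative_ae[OF L])
  have dl: "((\<lambda>t. (g (y + t *\<^sub>R e) - g y) / t) \<longlongrightarrow> dir_deriv g e y) (at 0)" if "lim e y" for e y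
    using that dir_deriv_eqI(1) unfolding lim_def by metis
  have sum_ae: "AE y in lborel. dir_deriv g (\<Sum>b\<in>A. (e \<bullet> b) *\<^sub>R b) y = (\<Sum>b\<in>A. (e \<bullet> b) * dir_deriv g b y)"
    if "finite A" for A :: "'a set" and e
    using that
  proof (induction A rule: finite_induct)
    case empty
    show ?case by (simp add: dir_deriv_def)
  next
    case (insert b A)
    have "AE y in lborel. dir_deriv g ((e \<bullet> b) *\<^sub>R b + (\<Sum>b\<in>A. (e \<bullet> b) *\<^sub>R b)) y = dir_deriv g ((e \<bullet> b) *\<^sub>R b)
      y + dir_deriv g (\<Sum>b\<in>A. (e \<bullet> b) *\<^sub>R b) y"
      by (rule dir_deriv_add_ae[OF L])
    with insert.IH lim_ae[of b] show ?case
    proof eventually_elim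
      case (elim y)
      have "dir_deriv g ((e \<bullet> b) *\<^sub>R b) y = (e \<bullet> b) * dir_deriv g b y"
        by (rule dir_deriv_eqI(1)[OF dir_deriv_scale[OF dl[OF elim(2)]]])
      then show ?case using elim insert.hyps by simp
    qed
  qed
  obtain D :: "'a set" where D: "countable D" "\<And>X. open X \<Longrightarrow> X \<noteq> {} \<Longrightarrow> \<exists>d\<in>D. d \<in> X"
    by (erule countable_dense_setE)
  have "AE y in lborel. \<forall>e\<in>D. lim e y \<and> dir_deriv g e y = (\<Sum>b\<in>Basis. (e \<bullet> b) * dir_deriv g b y)"
    unfolding AE_ball_countable[OF D(1)]
  proof
    fix e
    show "AE y in lborel. lim e y \<and> dir_deriv g e y = (\<Sum>b\<in>Basis. (e \<bullet> b) * dir_deriv g b y)"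
      using lim_ae[of e] sum_ae[OF finite_Basis, of e] by eventually_elim (simp add: euclidean_representation)
  qed
  then show ?thesis
  proof eventually_elim
    case (elim y)
    define G where "G = (\<Sum>b\<in>Basis. dir_deriv g b y *\<^sub>R b)"
    have conv: "((\<lambda>t. (g (y + t *\<^sub>R e) - g y) / t) \<longlongrightarrow> e \<bullet> G) (at 0)" if "e \<in> D" for e
      using elim that dl[of e y] by (simp add: G_def inner_sum_right mult.commute)
    have "(g has_derivative (\<lambda>k. k \<bullet> G)) (at y)"
      unfolding has_derivative_at_alt
    proof (intro conjI allI impI)
      show "bounded_linear (\<lambda>k. k \<bullet> G)" by (rule bounded_linear_inner_left)
      fix \<epsilon> :: real assume \<epsilon>: "\<epsilon> > 0"
      \<comment> \<open>Three errors will be added: the convergence along \<open>d\<close>, and the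
        replacement of the true direction by \<open>d\<close> in \<open>g\<close> and in the linear
        form. Relative to \<open>norm k\<close> they amount to
        \<open>(1 + L + norm G) * \<eta>\<close>.\<close>
      define \<eta> where "\<eta> = \<epsilon> / (1 + L + norm G)"
      have pos: "1 + L + norm G > 0" using L0 norm_ge_zero[of G] by linarith
      have \<eta>: "\<eta> > 0" using \<epsilon> pos by (simp add: \<eta>_def)
      have "sphere 0 1 \<subseteq> (\<Union>d\<in>D. ball d \<eta>)"
        using D(2)[OF open_ball] \<eta> by (force simp: dist_commute)
      then obtain D' where D': "D' \<subseteq> D" "finite D'" "sphere 0 1 \<subseteq> (\<Union>d\<in>D'. ball d \<eta>)"
        using compactE_image[of "sphere (0::'a) 1" D "\<lambda>d. ball d \<eta>"] by (metis compact_sphere open_ball)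
      have "\<forall>\<^sub>F t in at 0. \<forall>d\<in>D'. dist ((g (y + t *\<^sub>R d) - g y) / t) (d \<bullet> G) < \<eta>"
        using D'(1,2) tendstoD[OF conv \<eta>] by (intro eventually_ball_finite) auto
      then obtain \<delta> where \<delta>: "\<delta> > 0" "\<And>t d. t \<noteq> 0 \<Longrightarrow> \<bar>t\<bar> < \<delta> \<Longrightarrow> d \<in> D' \<Longrightarrow> \<bar>(g (y + t *\<^sub>R d) - g y) / t - d \<bullet> G\<bar> < \<eta>"
        by (auto simp: eventually_at dist_real_def)
      have "norm (g (y + k) - g y - k \<bullet> G) \<le> \<epsilon> * norm k" if k: "norm k < \<delta>" for k
      proof (cases "k = 0")
        case False
        define t where "t = norm k"
        define u where "u = k /\<^sub>R t"
        have t: "t > 0" "t < \<delta>" using False k by (auto simp: t_def)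
        have ku: "k = t *\<^sub>R u" using t by (simp add: u_def)
        have "u \<in> sphere 0 1" using t by (simp add: u_def t_def)
        then obtain d where d: "d \<in> D'" "dist d u < \<eta>" using D'(3) by auto
        have 1: "\<bar>g (y + t *\<^sub>R d) - g y - t * (d \<bullet> G)\<bar> \<le> t * \<eta>"
        proof -
          have "g (y + t *\<^sub>R d) - g y - t * (d \<bullet> G) = t * ((g (y + t *\<^sub>R d) - g y) / t - d \<bullet> G)"
            using t by (simp add: field_simps)
          then show ?thesis using \<delta>(2)[of t d] t d by (simp add: abs_mult)
        qed
        have 2: "\<bar>g (y + k) - g (y + t *\<^sub>R d)\<bar> \<le> t * (L * \<eta>)"
        proof -
          have "norm ((y + k) - (y + t *\<^sub>R d)) = t * dist d u"
            using t unfolding ku by (simp add: dist_norm scaleR_diff_right[symmetric] norm_minus_commute)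
          then have "\<bar>g (y + k) - g (y + t *\<^sub>R d)\<bar> \<le> L * (t * dist d u)" using lip[of "y + k" "y + t *\<^sub>R d"] by simp
          also have "\<dots> \<le> L * (t * \<eta>)" using d(2) t L0 by (intro mult_left_mono) auto
          finally show ?thesis by (simp add: mult.left_commute)
        qed
        have 3: "\<bar>t * (d \<bullet> G) - k \<bullet> G\<bar> \<le> t * (norm G * \<eta>)"
        proof -
          have "t * (d \<bullet> G) - k \<bullet> G = t * ((d - u) \<bullet> G)" unfolding ku by (simp add: algebra_simps)
          then have "\<bar>t * (d \<bullet> G) - k \<bullet> G\<bar> \<le> t * (norm (d - u) * norm G)"
            using t Cauchy_Schwarz_ineq2[of "d - u" G] by (simp add: abs_mult)
          also have "\<dots> \<le> t * (\<eta> * norm G)"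
            using d(2) t by (intro mult_left_mono mult_right_mono) (auto simp: dist_norm)
          finally show ?thesis by (simp add: mult.commute)
        qed
        have "\<bar>g (y + k) - g y - k \<bullet> G\<bar> \<le> t * \<eta> + t * (L * \<eta>) + t * (norm G * \<eta>)"
          using 1 2 3 by linarith
        also have "\<dots> = t * ((1 + L + norm G) * \<eta>)" by (simp add: algebra_simps)
        also have "\<dots> = \<epsilon> * norm k" using pos by (simp add: \<eta>_def t_def)
        finally show ?thesis by simp
      qed simp
      then show "\<exists>d>0. \<forall>z. norm (z - y) < d \<longrightarrow> norm (g z - g y - (z - y) \<bullet> G) \<le> \<epsilon> * norm (z - y)"
        using \<delta>(1) by (intro exI[of _ \<delta>]) (metis add.commute diff_add_cancel)
    qed
    then show ?case by (auto simp: differentiable_def)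
  qed
qed

corollary Rademacher_vector:
  fixes J :: "'a::euclidean_space \<Rightarrow> 'b::euclidean_space"
  assumes L: "L-lipschitz_on UNIV J"
  shows "negligible {y. \<not> J differentiable (at y)}"
proof -
  have "L-lipschitz_on UNIV (\<lambda>y. J y \<bullet> b)" if "b \<in> Basis" for b
  proof (rule lipschitz_onI)
    fix x y
    have "\<bar>(J x - J y) \<bullet> b\<bar> \<le> norm (J x - J y)" using that by (simp add: Basis_le_norm)
    also have "\<dots> \<le> L * dist x y" using lipschitz_onD[OF L, of x y] by (simp add: dist_norm)
    finally show "dist (J x \<bullet> b) (J y \<bullet> b) \<le> L * dist x y" by (simp add: dist_real_def inner_diff_left)
  qed (use L lipschitz_on_nonneg in blast)
  then have "AE y in lborel. \<forall>b\<in>Basis. (\<lambda>y. J y \<bullet> b) differentiable (at y)"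
    by (subst AE_ball_countable) (auto intro: Rademacher countable_finite)
  then have "AE y in lborel. J differentiable (at y)"
    by eventually_elim (simp add: differentiable_componentwise_within[of J])
  then have "AE y in lebesgue. J differentiable (at y)" by (simp add: AE_completion_iff)
  then show ?thesis by (simp add: eventually_ae_filter_negligible) (meson negligible_subset)
qed

section \<open>Second-order expansions of strongly convex functions\<close>

text \<open>A subgradient with quadratic gain. Every subgradient has this gain when
  \<open>\<lambda>x. g x - (norm x)\<^sup>2 / 2\<close> is convex; building it in makes
  \<open>y\<close> determine \<open>x\<close>.\<close>

definition strong_subgradient :: "('a::euclidean_space \<Rightarrow> real) \<Rightarrow> 'a \<Rightarrow> 'a \<Rightarrow> bool" where
  "strong_subgradient g x y \<longleftrightarrow> (\<forall>k. g x + y \<bullet> k + (norm k)\<^sup>2 / 2 \<le> g (x + k))"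

text \<open>Compares the second-order parts of two expansions along a ray: after division by
  \<open>t\<^sup>2\<close> the remainder is \<open>\<eta> * c\<close>, so a single admissible
  \<open>t\<close> for each \<open>\<eta>\<close> suffices.\<close>

lemma le_scaled_squares_imp_le:
  fixes a b c \<eta> :: real
  assumes "\<And>\<eta>. \<eta> > 0 \<Longrightarrow> \<exists>t>0. t\<^sup>2 * a \<le> t\<^sup>2 * b + \<eta> * (t\<^sup>2 * c)" "c \<ge> 0"
  shows "a \<le> b"
proof (rule field_le_epsilon)
  fix e :: real assume e: "e > 0"
  obtain t where t: "t > 0" "t\<^sup>2 * a \<le> t\<^sup>2 * b + e / (c + 1) * (t\<^sup>2 * c)"
    using assms(1)[of "e / (c + 1)"] e assms(2) by auto
  have "t\<^sup>2 * a \<le> t\<^sup>2 * (b + e / (c + 1) * c)" using t(2) by (simp add: algebra_simps)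
  then have "a \<le> b + e / (c + 1) * c" using t(1) by simp
  also have "e / (c + 1) * c \<le> e" using e assms(2) by (simp add: divide_simps)
  finally show "a \<le> b + e" by simp
qed

section \<open>Subgradients of strongly convex functions\<close>

lemma convex_on_strict_gap:
  fixes g :: "'a::euclidean_space \<Rightarrow> real"
  assumes "convex_on UNIV (\<lambda>x. g x - (norm x)\<^sup>2 / 2)" "0 \<le> t" "t \<le> 1"
  shows "g (x + t *\<^sub>R k) \<le> (1 - t) * g x + t * g (x + k) - t * (1 - t) * (norm k)\<^sup>2 / 2"
proof -
  have eq: "x + t *\<^sub>R k = (1 - t) *\<^sub>R x + t *\<^sub>R (x + k)" by (simp add: algebra_simps)
  have "g (x + t *\<^sub>R k) - (norm (x + t *\<^sub>R k))\<^sup>2 / 2 \<le> (1 - t) * (g x - (norm x)\<^sup>2 / 2) + t * (g (x + k) - (norm (x + k))\<^sup>2 / 2)"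
    unfolding eq using convex_onD[OF assms(1), of t x "x + k"] assms(2,3) by simp
  moreover have "(norm (x + t *\<^sub>R k))\<^sup>2 = (1 - t) * (norm x)\<^sup>2 + t * (norm (x + k))\<^sup>2 - t * (1 - t) * (norm k)\<^sup>2"
    unfolding power2_norm_eq_inner inner_add_left inner_add_right inner_scaleR_left inner_scaleR_right inner_commute[of k x]
    by (simp add: algebra_simps)
  ultimately show ?thesis by (simp add: algebra_simps add_divide_distrib diff_divide_distrib)
qed

text \<open>Strong convexity along the segment gains
  \<open>t * (1 - t) * (norm k)\<^sup>2 / 2\<close>; dividing by \<open>t\<close> and letting
  \<open>t\<close> tend to \<open>0\<close> keeps all of it, so an ordinary subgradient is a strong
  one.\<close>

lemma strong_subgradientI_min:
  fixes g :: "'a::euclidean_space \<Rightarrow> real"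
  assumes conv: "convex_on UNIV (\<lambda>x. g x - (norm x)\<^sup>2 / 2)"
    and min: "\<And>k. g x + y \<bullet> k \<le> g (x + k)"
  shows "strong_subgradient g x y"
  unfolding strong_subgradient_def
proof
  fix k
  have "(y \<bullet> k + g x + (norm k)\<^sup>2 / 2) \<le> g (x + k) + t * ((norm k)\<^sup>2 / 2)" if t: "0 < t" "t \<le> 1" for t
  proof -
    have "g x + t * (y \<bullet> k) \<le> (1 - t) * g x + t * g (x + k) - t * (1 - t) * (norm k)\<^sup>2 / 2"
      using convex_on_strict_gap[OF conv, of t x k] min[of "t *\<^sub>R k"] t by simp
    then have "t * (y \<bullet> k + g x + (norm k)\<^sup>2 / 2) \<le> t * (g (x + k) + t * ((norm k)\<^sup>2 / 2))"
      by (simp add: algebra_simps add_divide_distrib diff_divide_distrib)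
    then show ?thesis using t by simp
  qed
  then have "\<forall>\<^sub>F t in at_right 0. (y \<bullet> k + g x + (norm k)\<^sup>2 / 2) \<le> g (x + k) + t * ((norm k)\<^sup>2 / 2)"
    by (auto simp: eventually_at_right_field intro!: exI[of _ 1])
  moreover have "((\<lambda>t. g (x + k) + t * ((norm k)\<^sup>2 / 2)) \<longlongrightarrow> g (x + k) + 0 * ((norm k)\<^sup>2 / 2)) (at_right 0)"
    by (intro tendsto_intros)
  ultimately have "(y \<bullet> k + g x + (norm k)\<^sup>2 / 2) \<le> g (x + k) + 0 * ((norm k)\<^sup>2 / 2)"
    by (intro tendsto_lowerbound) auto
  then show "g x + y \<bullet> k + (norm k)\<^sup>2 / 2 \<le> g (x + k)" by simp
qed

text \<open>The point \<open>x\<close> lies between \<open>x + k\<close> and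
  \<open>x - t *\<^sub>R k\<close>. The paraboloid is used only at the second point, where its
  quadratic part is of order \<open>t\<^sup>2\<close>; convexity then gives the subgradient
  inequality at the first point as \<open>t\<close> tends to \<open>0\<close>.\<close>

lemma strong_subgradientI_touch:
  fixes g :: "'a::euclidean_space \<Rightarrow> real"
  assumes conv: "convex_on UNIV (\<lambda>x. g x - (norm x)\<^sup>2 / 2)"
    and touch: "\<And>k. g (x + k) \<le> g x + y \<bullet> k + C * (norm k)\<^sup>2"
  shows "strong_subgradient g x y"
proof (rule strong_subgradientI_min[OF conv])
  fix k
  have "g x + y \<bullet> k \<le> g (x + k) + t * (C * (norm k)\<^sup>2)" if t: "0 < t" for t
  proof -
    \<comment> \<open>The weight for which \<open>x\<close> is the convex combination of
      \<open>x + k\<close> and \<open>x - t *\<^sub>R k\<close>.\<close>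
    define s where "s = 1 / (1 + t)"
    have s: "0 < s" "s < 1" "t = (1 - s) / s" using t by (auto simp: s_def field_simps)
    have "g ((x + k) + s *\<^sub>R (- (1 + t) *\<^sub>R k)) \<le> (1 - s) * g (x + k) + s * g ((x + k) + (- (1 + t) *\<^sub>R k))
      - s * (1 - s) * (norm (- (1 + t) *\<^sub>R k))\<^sup>2 / 2"
      using convex_on_strict_gap[OF conv, of s "x + k" "- (1 + t) *\<^sub>R k"] s by simp
    also have "s *\<^sub>R (- (1 + t) *\<^sub>R k) = - k"
    proof -
      have "s * (- (1 + t)) = - 1" using t by (simp add: s_def field_simps)
      then show ?thesis by (simp only: scaleR_scaleR) simp
    qed
    also have "(x + k) + (- (1 + t) *\<^sub>R k) = x + (- t *\<^sub>R k)" by (simp add: algebra_simps)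
    finally have "g x \<le> (1 - s) * g (x + k) + s * g (x + (- t *\<^sub>R k))"
      using s by (smt (verit, best) add_diff_cancel_right' diff_conv_add_uminus divide_nonneg_nonneg
        mult_nonneg_nonneg zero_le_power2)
    also have "\<dots> \<le> (1 - s) * g (x + k) + s * (g x + y \<bullet> (- t *\<^sub>R k) + C * (norm (- t *\<^sub>R k))\<^sup>2)"
      using touch[of "- t *\<^sub>R k"] s by (intro add_left_mono mult_left_mono) auto
    finally have "(1 + t) * g x \<le> (1 + t) * ((1 - s) * g (x + k) + s * (g x + y \<bullet> (- t *\<^sub>R k) + C * (norm (- t *\<^sub>R k))\<^sup>2))"
      using t by simp
    also have "\<dots> = ((1 + t) * (1 - s)) * g (x + k) + ((1 + t) * s) * (g x + y \<bullet> (- t *\<^sub>R k) + C * (norm (- t *\<^sub>R k))\<^sup>2)"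
      by (simp only: distrib_left mult.assoc)
    also have "(1 + t) * s = 1" using t by (simp add: s_def)
    also have "(1 + t) * (1 - s) = t" using t by (simp add: s_def field_simps)
    finally have "t * (g x + y \<bullet> k) \<le> t * (g (x + k) + t * (C * (norm k)\<^sup>2))"
      by (simp add: algebra_simps power2_eq_square)
    then show ?thesis using t by simp
  qed
  then have "\<forall>\<^sub>F t in at_right 0. g x + y \<bullet> k \<le> g (x + k) + t * (C * (norm k)\<^sup>2)"
    by (auto simp: eventually_at_right_field intro!: exI[of _ 1])
  moreover have "((\<lambda>t. g (x + k) + t * (C * (norm k)\<^sup>2)) \<longlongrightarrow> g (x + k) + 0 * (C * (norm k)\<^sup>2)) (at_right 0)"
    by (intro tendsto_intros)
  ultimately have "g x + y \<bullet> k \<le> g (x + k) + 0 * (C * (norm k)\<^sup>2)"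
    by (intro tendsto_lowerbound) auto
  then show "g x + y \<bullet> k \<le> g (x + k)" by simp
qed

lemma strong_subgradient_monotone:
  assumes "strong_subgradient g x y" "strong_subgradient g x' y'"
  shows "(norm (x' - x))\<^sup>2 \<le> (y' - y) \<bullet> (x' - x)" and "norm (x' - x) \<le> norm (y' - y)"
proof -
  have "g x + y \<bullet> (x' - x) + (norm (x' - x))\<^sup>2 / 2 \<le> g x'"
    using assms(1)[unfolded strong_subgradient_def, rule_format, of "x' - x"] by simp
  moreover have "g x' + y' \<bullet> (x - x') + (norm (x - x'))\<^sup>2 / 2 \<le> g x"
    using assms(2)[unfolded strong_subgradient_def, rule_format, of "x - x'"] by simp
  ultimately show *: "(norm (x' - x))\<^sup>2 \<le> (y' - y) \<bullet> (x' - x)"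
    by (simp add: inner_diff_left inner_diff_right norm_minus_commute)
  also have "\<dots> \<le> norm (y' - y) * norm (x' - x)" by (rule norm_cauchy_schwarz)
  finally show "norm (x' - x) \<le> norm (y' - y)"
    by (cases "x' = x") (auto simp: power2_eq_square)
qed

lemma continuous_attains_sup_coercive:
  fixes f :: "'a::euclidean_space \<Rightarrow> real"
  assumes "continuous_on UNIV f" and "\<And>z. norm z > R \<Longrightarrow> f z \<le> f 0" and "R \<ge> 0"
  obtains x where "norm x \<le> R" "\<And>z. f z \<le> f x"
proof -
  have "continuous_on (cball 0 R) f" using assms(1) continuous_on_subset by blast
  then obtain x where x: "x \<in> cball 0 R" "\<And>z. z \<in> cball 0 R \<Longrightarrow> f z \<le> f x"
    using continuous_attains_sup[of "cball 0 R" f] assms(3) by auto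
  have "f z \<le> f x" for z
    using x(2)[of z] x(2)[of 0] assms(2)[of z] assms(3) by (cases "norm z \<le> R") (auto intro: order_trans)
  then show thesis using that x(1) by auto
qed

section \<open>The Legendre conjugate of a strongly convex function and its gradient\<close>

context
  fixes g :: "'a::euclidean_space \<Rightarrow> real"
  assumes conv: "convex_on UNIV (\<lambda>x. g x - (norm x)\<^sup>2 / 2)"
    and base: "strong_subgradient g 0 0"
begin

lemma strongly_convex_continuous: "continuous_on UNIV g"
proof -
  have "continuous_on UNIV (\<lambda>x. (g x - (norm x)\<^sup>2 / 2) + (norm x)\<^sup>2 / 2)"
    by (intro continuous_on_add[OF convex_on_continuous[OF open_UNIV conv]] continuous_intros) auto
  then show ?thesis by simp
qed

lemma base_le: "g 0 + (norm k)\<^sup>2 / 2 \<le> g k"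
  using base[unfolded strong_subgradient_def, rule_format, of k] by simp

text \<open>By \<open>base_le\<close> the quadratic growth of \<open>g\<close> beats the linear
  term, so \<open>y \<bullet> z - g z\<close> has a maximizer, and there \<open>y\<close> is a
  subgradient.\<close>

lemma ex_strong_subgradient: "\<exists>x. strong_subgradient g x y"
proof -
  have "y \<bullet> z - g z \<le> y \<bullet> 0 - g 0" if "norm z > 2 * norm y" for z
  proof -
    have "y \<bullet> z \<le> norm y * norm z" by (rule norm_cauchy_schwarz)
    also have "\<dots> \<le> (norm z / 2) * norm z" using that by (intro mult_right_mono) auto
    finally show ?thesis using base_le[of z] by (simp add: power2_eq_square)
  qed
  moreover have "continuous_on UNIV (\<lambda>z. y \<bullet> z - g z)"
    by (intro continuous_intros strongly_convex_continuous)
  ultimately obtain x where x: "\<And>z. y \<bullet> z - g z \<le> y \<bullet> x - g x"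
    using continuous_attains_sup_coercive[of "\<lambda>z. y \<bullet> z - g z" "2 * norm y"]
      by (meson mult_nonneg_nonneg norm_ge_zero zero_le_numeral)
  have "g x + y \<bullet> k \<le> g (x + k)" for k
    using x[of "x + k"] by (simp add: inner_add_right)
  then show ?thesis using strong_subgradientI_min[OF conv] by blast
qed

text \<open>The gradient of the conjugate \<open>conj_fun\<close>, that is the maximizer of
  \<open>\<lambda>z. y \<bullet> z - g z\<close>. Strong monotonicity makes the chosen point
  unique.\<close>

definition conj_grad :: "'a \<Rightarrow> 'a" where
  "conj_grad y = (SOME x. strong_subgradient g x y)"

definition conj_fun :: "'a \<Rightarrow> real" where
  "conj_fun y = y \<bullet> conj_grad y - g (conj_grad y)"

lemma conj_grad: "strong_subgradient g (conj_grad y) y"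
  unfolding conj_grad_def using ex_strong_subgradient by (rule someI_ex)

lemma conj_grad_eq: "strong_subgradient g x y \<Longrightarrow> conj_grad y = x"
  using strong_subgradient_monotone(2)[OF conj_grad[of y], of x y] by simp

lemma conj_grad_lipschitz: "1-lipschitz_on UNIV conj_grad"
  by (rule lipschitz_onI) (auto simp: dist_norm intro: strong_subgradient_monotone(2) conj_grad)

lemma conj_fun_ge: "y \<bullet> z - g z \<le> conj_fun y"
proof -
  have "g (conj_grad y) + y \<bullet> (z - conj_grad y) + (norm (z - conj_grad y))\<^sup>2 / 2 \<le> g z"
    using conj_grad[of y, unfolded strong_subgradient_def, rule_format, of "z - conj_grad y"] by simp
  moreover have "0 \<le> (norm (z - conj_grad y))\<^sup>2 / 2" by simp
  ultimately show ?thesis unfolding conj_fun_def inner_diff_right by linarith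
qed

lemma conj_fun_lower: "conj_fun y + k \<bullet> conj_grad y \<le> conj_fun (y + k)"
  using conj_fun_ge[of "y + k" "conj_grad y"] by (simp add: conj_fun_def inner_add_left)

text \<open>The bound \<open>conj_fun_lower\<close> read from \<open>y + k\<close> back to
  \<open>y\<close>, combined with the Lipschitz bound for \<open>conj_grad\<close>. The conjugate is
  thus trapped between a plane and a paraboloid.\<close>

lemma conj_fun_upper: "conj_fun (y + k) \<le> conj_fun y + k \<bullet> conj_grad y + (norm k)\<^sup>2"
proof -
  have "conj_fun (y + k) \<le> conj_fun y + k \<bullet> conj_grad (y + k)"
    using conj_fun_lower[of "y + k" "- k"] by simp
  also have "k \<bullet> conj_grad (y + k) = k \<bullet> conj_grad y + k \<bullet> (conj_grad (y + k) - conj_grad y)"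
    by (simp add: inner_diff_right)
  also have "k \<bullet> (conj_grad (y + k) - conj_grad y) \<le> norm k * norm (conj_grad (y + k) - conj_grad y)"
    by (rule norm_cauchy_schwarz)
  also have "\<dots> \<le> norm k * norm k"
    using strong_subgradient_monotone(2)[OF conj_grad[of y] conj_grad[of "y + k"]]
    by (intro mult_left_mono) auto
  finally show ?thesis by (simp add: power2_eq_square)
qed

lemma conj_fun_derivative: "(conj_fun has_derivative (\<lambda>k. k \<bullet> conj_grad y)) (at y)"
  unfolding has_derivative_at_alt
proof (intro conjI allI impI)
  show "bounded_linear (\<lambda>k. k \<bullet> conj_grad y)" by (rule bounded_linear_inner_left)
  fix e :: real assume e: "e > 0"
  have "norm (conj_fun z - conj_fun y - (z - y) \<bullet> conj_grad y) \<le> e * norm (z - y)" if "norm (z - y) < e" for z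
  proof -
    have "\<bar>conj_fun z - conj_fun y - (z - y) \<bullet> conj_grad y\<bar> \<le> norm (z - y) * norm (z - y)"
      using conj_fun_lower[of y "z - y"] conj_fun_upper[of y "z - y"] by (simp add: power2_eq_square)
    also have "\<dots> \<le> e * norm (z - y)" using that by (intro mult_right_mono) auto
    finally show ?thesis by simp
  qed
  then show "\<exists>d>0. \<forall>z. norm (z - y) < d \<longrightarrow> norm (conj_fun z - conj_fun y - (z - y) \<bullet> conj_grad y) \<le> e * norm (z - y)"
    using e by blast
qed

text \<open>Biconjugation: at a maximizer \<open>y\<close> of
  \<open>a \<bullet> y - conj_fun y\<close> the paraboloid bound \<open>conj_fun_upper\<close>
  leaves no room for \<open>conj_grad y\<close> to differ from \<open>a\<close>.\<close>

lemma conj_grad_surj: "\<exists>y. strong_subgradient g a y"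
proof -
  define f where "f = (\<lambda>y. a \<bullet> y - conj_fun y)"
  have cont: "continuous_on UNIV conj_fun"
    using conj_fun_derivative by (meson continuous_at_imp_continuous_on has_derivative_continuous)
  obtain C where C: "\<And>z. z \<in> cball 0 (norm a + 1) \<Longrightarrow> g z \<le> C"
    using continuous_attains_sup[of "cball 0 (norm a + 1)" g]
      continuous_on_subset[OF strongly_convex_continuous subset_UNIV] by fastforce
  have far: "f y \<le> f 0" if "norm y > \<bar>C\<bar> + \<bar>conj_fun 0\<bar>" for y
  proof -
    have y0: "norm y > 0" using that by linarith
    \<comment> \<open>Testing at radius \<open>norm a + 1\<close> makes \<open>conj_fun\<close> grow
      faster than \<open>a \<bullet> y\<close> possibly can.\<close>
    define z where "z = ((norm a + 1) / norm y) *\<^sub>R y"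
    have "norm z = norm a + 1" using y0 by (simp add: z_def)
    then have "g z \<le> C" using C[of z] by simp
    moreover have "y \<bullet> z = (norm a + 1) * norm y"
      using y0 by (simp add: z_def dot_square_norm power2_eq_square)
    ultimately have "conj_fun y \<ge> (norm a + 1) * norm y - C" using conj_fun_ge[of y z] by simp
    moreover have "a \<bullet> y \<le> norm a * norm y" by (rule norm_cauchy_schwarz)
    ultimately show ?thesis using that by (simp add: f_def algebra_simps)
  qed
  have "continuous_on UNIV f" unfolding f_def by (intro continuous_intros cont)
  then obtain y where y: "\<And>z. f z \<le> f y"
    using far by (rule continuous_attains_sup_coercive[where R = "\<bar>C\<bar> + \<bar>conj_fun 0\<bar>"]) auto
  \<comment> \<open>Half the difference maximizes
    \<open>k \<bullet> (a - conj_grad y) - (norm k)\<^sup>2\<close>.\<close>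
  define k where "k = (1 / 2) *\<^sub>R (a - conj_grad y)"
  have "a \<bullet> k \<le> k \<bullet> conj_grad y + (norm k)\<^sup>2"
    using y[of "y + k"] conj_fun_upper[of y k] by (simp add: f_def inner_add_right)
  then have "2 * (norm k)\<^sup>2 \<le> (norm k)\<^sup>2"
    by (simp add: k_def power2_norm_eq_inner inner_commute algebra_simps)
  then have "k = 0" by simp
  then have "a = conj_grad y" by (simp add: k_def)
  then show ?thesis using conj_grad by blast
qed

text \<open>\<open>conj_grad\<close> is the gradient at every point, so its first-order expansion at
  \<open>y\<close> integrates along the segment from \<open>y\<close> to \<open>y + k\<close>; the
  mean value theorem for \<open>\<phi>\<close> does the integration. Only the quadratic form of
  \<open>S\<close> enters.\<close>

lemma conj_fun_second_order:
  assumes S: "(conj_grad has_derivative S) (at y)" and \<eta>: "\<eta> > 0"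
  shows "\<exists>\<rho>>0. \<forall>k. norm k < \<rho> \<longrightarrow> \<bar>conj_fun (y + k) - conj_fun y - k \<bullet> conj_grad y - (k \<bullet> S k) / 2\<bar> \<le> \<eta> * (norm k)\<^sup>2"
proof -
  have lin: "linear S" using S has_derivative_linear by blast
  obtain \<rho> where \<rho>: "\<rho> > 0" "\<And>z. norm (z - y) < \<rho> \<Longrightarrow> norm (conj_grad z - conj_grad y - S (z - y)) \<le> \<eta> * norm (z - y)"
    using S \<eta> unfolding has_derivative_at_alt by blast
  have "\<bar>conj_fun (y + k) - conj_fun y - k \<bullet> conj_grad y - (k \<bullet> S k) / 2\<bar> \<le> \<eta> * (norm k)\<^sup>2" if k: "norm k < \<rho>" for k
  proof -
    define \<phi> where "\<phi> = (\<lambda>t. conj_fun (y + t *\<^sub>R k) - t * (k \<bullet> conj_grad y) - t\<^sup>2 * ((k \<bullet> S k) / 2))"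
    define d where "d = (\<lambda>t. k \<bullet> (conj_grad (y + t *\<^sub>R k) - conj_grad y - S (t *\<^sub>R k)))"
    have der: "(\<phi> has_real_derivative d t) (at t)" for t
    proof -
      have "((\<lambda>t. y + t *\<^sub>R k) has_derivative (\<lambda>s. s *\<^sub>R k)) (at t)" by (auto intro!: derivative_eq_intros)
      from has_derivative_compose[OF this conj_fun_derivative]
      have "((\<lambda>t. conj_fun (y + t *\<^sub>R k)) has_real_derivative k \<bullet> conj_grad (y + t *\<^sub>R k)) (at t)"
        by (simp add: has_field_derivative_def mult_commute_abs)
      then show ?thesis unfolding \<phi>_def d_def
        by (auto intro!: derivative_eq_intros simp: linear_scale[OF lin] inner_diff_right)
    qed
    obtain t where t: "0 < t" "t < 1" "\<phi> 1 - \<phi> 0 = (1 - 0) * d t"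
      using MVT2[of 0 1 \<phi> d] der by auto
    have "\<bar>d t\<bar> \<le> norm k * norm (conj_grad (y + t *\<^sub>R k) - conj_grad y - S (t *\<^sub>R k))"
      unfolding d_def by (rule Cauchy_Schwarz_ineq2)
    also have "norm (conj_grad (y + t *\<^sub>R k) - conj_grad y - S (t *\<^sub>R k)) \<le> \<eta> * norm (t *\<^sub>R k)"
      using \<rho>(2)[of "y + t *\<^sub>R k"] t k mult_left_le_one_le[of "norm k" t] by auto
    also have "\<eta> * norm (t *\<^sub>R k) \<le> \<eta> * norm k"
      using t \<eta> mult_left_le_one_le[of "norm k" t] by (intro mult_left_mono) auto
    finally have "\<bar>\<phi> 1 - \<phi> 0\<bar> \<le> norm k * (\<eta> * norm k)" using t(3) by (simp add: mult_left_mono)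
    then show ?thesis by (simp add: \<phi>_def power2_eq_square algebra_simps)
  qed
  then show ?thesis using \<rho>(1) by blast
qed

end

text \<open>By strong convexity the gradient of the conjugate of \<open>g\<close> is single-valued and 1-Lipschitz, so
  Rademacher's theorem applies to it. Since \<open>T\<close> below is Lipschitz and maps the points \<open>Y p\<close> to \<open>p\<close>,
  some small \<open>p\<close> has \<open>Y p\<close> outside the exceptional null set, and the second-order expansion of the
  conjugate at \<open>Y p\<close> dualizes to one of \<open>g\<close> at \<open>X p\<close>.\<close>

theorem Jensen_Alexandrov:
  fixes g :: "'a::euclidean_space \<Rightarrow> real"
  assumes conv: "convex_on UNIV (\<lambda>x. g x - (norm x)\<^sup>2 / 2)"
    and linM: "linear M" and symM: "\<And>x y. M x \<bullet> y = x \<bullet> M y"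
    and touch: "\<And>z. g z \<le> g 0 + (M z \<bullet> z) / 2" and \<epsilon>: "\<epsilon> > 0"
  obtains x P Q where "norm x < \<epsilon>" "norm P < \<epsilon>" "linear Q" "\<And>a b. Q a \<bullet> b = a \<bullet> Q b"
    "\<And>k. (norm k)\<^sup>2 \<le> Q k \<bullet> k" "\<And>k. Q k \<bullet> k \<le> M k \<bullet> k + \<epsilon> * (norm k)\<^sup>2"
    "\<And>\<eta>. \<eta> > 0 \<Longrightarrow> \<exists>\<rho>>0. \<forall>k. norm k < \<rho> \<longrightarrow> \<bar>g (x + k) - g x - P \<bullet> k - (Q k \<bullet> k) / 2\<bar> \<le> \<eta> * (norm k)\<^sup>2"
proof -
  obtain B where B: "B > 0" "\<And>z. norm (M z) \<le> B * norm z"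
    using linear_bounded_pos[OF linM] by blast
  define c where "c = B + \<epsilon>"
  have c: "c > 0" using B \<epsilon> by (simp add: c_def)
  \<comment> \<open>The added \<open>\<epsilon>\<close> makes \<open>0\<close> a strict maximum of
    \<open>g z - (M' z \<bullet> z) / 2\<close> with quadratic decay; a tilt by \<open>p\<close>
    then has a maximizer within \<open>2 * norm p / \<epsilon>\<close> of \<open>0\<close>.\<close>
  define M' where "M' = (\<lambda>k. M k + \<epsilon> *\<^sub>R k)"
  have linM': "linear M'" unfolding M'_def
    by (intro linear_compose_add linM linear_compose_scale_right linear_id[unfolded id_def])
  have symM': "M' x \<bullet> y = x \<bullet> M' y" for x y
    by (simp add: M'_def symM inner_add_left inner_add_right)
  have M'_kk: "M' k \<bullet> k = M k \<bullet> k + \<epsilon> * (norm k)\<^sup>2" for k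
    by (simp add: M'_def inner_add_left dot_square_norm)
  have M'_le: "norm (M' k) \<le> c * norm k" for k
    using B(2)[of k] norm_triangle_ineq[of "M k" "\<epsilon> *\<^sub>R k"] \<epsilon> by (simp add: M'_def c_def algebra_simps)
  have M'_q: "M' k \<bullet> k \<le> c * (norm k)\<^sup>2" for k
  proof -
    have "M' k \<bullet> k \<le> norm (M' k) * norm k" by (rule norm_cauchy_schwarz)
    also have "\<dots> \<le> c * norm k * norm k" using M'_le by (intro mult_right_mono) auto
    finally show ?thesis by (simp add: power2_eq_square)
  qed
  have base: "strong_subgradient g 0 0"
  proof (rule strong_subgradientI_touch[OF conv, where C = "c / 2"])
    fix k :: 'a
    show "g (0 + k) \<le> g 0 + 0 \<bullet> k + c / 2 * (norm k)\<^sup>2"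
    proof -
      have "0 \<le> \<epsilon> * (norm k)\<^sup>2" using \<epsilon> by simp
      then show ?thesis using touch[of k] M'_q[of k] M'_kk[of k] by simp
    qed
  qed
  note cont = strongly_convex_continuous[OF conv base]
  let ?J = "conj_grad g" and ?h = "conj_fun g"
  note J = conj_grad[OF conv base] and J_eq = conj_grad_eq[OF conv base]
  have ex_x: "\<exists>x. norm x \<le> 2 * norm p / \<epsilon> \<and> (\<forall>k. g (x + k) \<le> g x + (p + M' x) \<bullet> k + (M' k \<bullet> k) / 2)" for p
  proof -
    let ?f = "\<lambda>z. g z - (M' z \<bullet> z) / 2 - p \<bullet> z"
    have far: "?f z \<le> ?f 0" if "norm z > 2 * norm p / \<epsilon>" for z
    proof -
      have "- (p \<bullet> z) \<le> norm p * norm z" using norm_cauchy_schwarz[of "- p" z] by simp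
      also have "\<dots> \<le> (\<epsilon> / 2 * norm z) * norm z"
        using that \<epsilon> by (intro mult_right_mono) (auto simp: field_simps)
      also have "\<dots> = \<epsilon> * (norm z)\<^sup>2 / 2" by (simp add: power2_eq_square)
      finally have "- (p \<bullet> z) \<le> \<epsilon> * (norm z)\<^sup>2 / 2" .
      moreover have "(M' z \<bullet> z) / 2 = (M z \<bullet> z) / 2 + \<epsilon> * (norm z)\<^sup>2 / 2" by (simp add: M'_kk add_divide_distrib)
      ultimately have "g z - (M' z \<bullet> z) / 2 - p \<bullet> z \<le> g 0" using touch[of z] by linarith
      then show ?thesis by (simp add: linear_0[OF linM'])
    qed
    have contf: "continuous_on UNIV ?f"
      by (intro continuous_intros cont linear_continuous_on linM'[unfolded linear_conv_bounded_linear]) auto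
    obtain x where x: "norm x \<le> 2 * norm p / \<epsilon>" "\<And>z. ?f z \<le> ?f x"
      by (rule continuous_attains_sup_coercive[of ?f "2 * norm p / \<epsilon>", OF contf far]) (use \<epsilon> in auto)
    have "g (x + k) \<le> g x + (p + M' x) \<bullet> k + (M' k \<bullet> k) / 2" for k
    proof -
      have "M' (x + k) \<bullet> (x + k) = M' x \<bullet> x + 2 * (M' x \<bullet> k) + M' k \<bullet> k"
        using symM'[of k x] by (simp add: linear_add[OF linM'] inner_add_left inner_add_right inner_commute)
      then show ?thesis using x(2)[of "x + k"] by (simp add: inner_add_left inner_add_right add_divide_distrib)
    qed
    then show ?thesis using x(1) by blast
  qed
  then obtain X where X: "\<And>p. norm (X p) \<le> 2 * norm p / \<epsilon>"
    "\<And>p k. g (X p + k) \<le> g (X p) + (p + M' (X p)) \<bullet> k + (M' k \<bullet> k) / 2" by metis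
  define Y where "Y = (\<lambda>p. p + M' (X p))"
  have SGX: "strong_subgradient g (X p) (Y p)" for p
  proof (rule strong_subgradientI_touch[OF conv, where C = "c / 2"])
    fix k
    show "g (X p + k) \<le> g (X p) + Y p \<bullet> k + c / 2 * (norm k)\<^sup>2"
      using X(2)[of p k] M'_q[of k] by (simp add: Y_def)
  qed
  \<comment> \<open>The bounds \<open>norm x \<le> 2 * \<delta> / \<epsilon>\<close> and
    \<open>norm y \<le> \<delta> + c * norm x\<close> are both to stay below
    \<open>\<epsilon>\<close>; all terms together, with a spare \<open>\<delta>\<close>, are made to
    add up to \<open>\<epsilon>\<close>.\<close>
  define \<delta> where "\<delta> = \<epsilon> / (2 + 2 / \<epsilon> + 2 * c / \<epsilon>)"
  have den: "2 + 2 / \<epsilon> + 2 * c / \<epsilon> > 0" using \<epsilon> c by (simp add: add_pos_pos)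
  have \<delta>: "\<delta> > 0" using \<epsilon> den by (simp add: \<delta>_def)
  have \<delta>_eq: "2 * \<delta> + 2 * \<delta> / \<epsilon> + c * (2 * \<delta> / \<epsilon>) = \<epsilon>"
  proof -
    have "\<delta> * (2 + 2 / \<epsilon> + 2 * c / \<epsilon>) = \<epsilon>" using den by (simp add: \<delta>_def)
    then show ?thesis by (simp add: algebra_simps)
  qed
  define N where "N = {y. \<not> ?J differentiable (at y)}"
  have "negligible N" unfolding N_def by (rule Rademacher_vector[OF conj_grad_lipschitz[OF conv base]])
  define T where "T = (\<lambda>y. y - M' (?J y))"
  have TY: "T (Y p) = p" for p using J_eq[OF SGX[of p]] by (simp add: T_def Y_def)
  have "negligible (T ` N)"
  proof (rule negligible_locally_Lipschitz_image[OF order_refl \<open>negligible N\<close>])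
    fix x
    have "norm (T y - T x) \<le> (1 + c) * norm (y - x)" for y
    proof -
      have "T y - T x = (y - x) - M' (?J y - ?J x)" by (simp add: T_def linear_diff[OF linM'])
      then have "norm (T y - T x) \<le> norm (y - x) + norm (M' (?J y - ?J x))" using norm_triangle_ineq4 by metis
      also have "norm (M' (?J y - ?J x)) \<le> c * norm (?J y - ?J x)" by (rule M'_le)
      also have "\<dots> \<le> c * norm (y - x)"
        using strong_subgradient_monotone(2)[OF J J] c by (intro mult_left_mono) auto
      finally show ?thesis by (simp add: algebra_simps)
    qed
    then show "\<exists>T' B. open T' \<and> x \<in> T' \<and> (\<forall>y\<in>N \<inter> T'. norm (T y - T x) \<le> B * norm (y - x))" by blast
  qed
  then have "\<not> ball 0 \<delta> \<subseteq> T ` N"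
    using open_not_negligible[of "ball (0::'a) \<delta>"] \<delta> negligible_subset by (metis ball_eq_empty not_less open_ball)
  then obtain p where "p \<in> ball 0 \<delta>" and p2: "p \<notin> T ` N" by blast
  then have p1: "norm p < \<delta>" by simp
  note p = p1 p2
  define x where "x = X p"
  define y where "y = Y p"
  have "y \<notin> N" using p(2) TY unfolding y_def by (metis imageI)
  then obtain S where S: "(?J has_derivative S) (at y)" unfolding N_def differentiable_def by blast
  have linS: "linear S" using S has_derivative_linear by blast
  have SG: "strong_subgradient g x y" unfolding x_def y_def by (rule SGX)
  have Jy: "?J y = x" using J_eq[OF SG] .
  have hy: "?h y = y \<bullet> x - g x" by (simp add: conj_fun_def[OF conv base] Jy)
  have gx: "g (x + k) \<le> g x + y \<bullet> k + (M' k \<bullet> k) / 2" for k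
    unfolding x_def y_def Y_def using X(2) by blast
  have nx: "norm x \<le> 2 * \<delta> / \<epsilon>"
  proof -
    have "2 * norm p / \<epsilon> \<le> 2 * \<delta> / \<epsilon>" using p(1) \<epsilon> by (intro divide_right_mono) auto
    then show ?thesis using X(1)[of p] unfolding x_def by linarith
  qed
  have cx: "c * norm x \<le> c * (2 * \<delta> / \<epsilon>)" using nx c by (intro mult_left_mono) auto
  have pos: "0 < 2 * \<delta> / \<epsilon>" "0 < c * (2 * \<delta> / \<epsilon>)" using \<delta> \<epsilon> c by auto
  have x_small: "norm x < \<epsilon>" using nx \<delta>_eq \<delta> pos by linarith
  have "norm y \<le> norm p + norm (M' x)" unfolding x_def y_def Y_def by (rule norm_triangle_ineq)
  then have y_small: "norm y < \<epsilon>" using M'_le[of x] cx p(1) \<delta>_eq \<delta> pos by linarith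
  note hS = conj_fun_second_order[OF conv base S, unfolded Jy]
  \<comment> \<open>Fenchel's inequality at \<open>x + t *\<^sub>R v\<close> and
    \<open>y + t *\<^sub>R k\<close>: the terms of order zero and one cancel, and those of order
    \<open>t\<^sup>2\<close> give the same inequality for the quadratic parts.\<close>
  have dual: "k \<bullet> v \<le> (M' v \<bullet> v) / 2 + (k \<bullet> S k) / 2" for k v
  proof (rule le_scaled_squares_imp_le[where c = "(norm k)\<^sup>2"])
    fix \<eta> :: real assume "\<eta> > 0"
    then obtain \<rho> where \<rho>: "\<rho> > 0" "\<And>k. norm k < \<rho> \<Longrightarrow> \<bar>?h (y + k) - ?h y - k \<bullet> x - (k \<bullet> S k) / 2\<bar> \<le> \<eta> * (norm k)\<^sup>2"
      using hS by blast
    define t where "t = \<rho> / (1 + norm k)"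
    have nk: "1 + norm k > 0" using norm_ge_zero[of k] by linarith
    have t: "t > 0" using \<rho>(1) nk by (simp add: t_def)
    have "norm (t *\<^sub>R k) < \<rho>" using nk \<rho>(1) by (simp add: t_def field_simps)
    then have "?h (y + t *\<^sub>R k) \<le> ?h y + (t *\<^sub>R k) \<bullet> x + (t *\<^sub>R k \<bullet> S (t *\<^sub>R k)) / 2 + \<eta> * (norm (t *\<^sub>R k))\<^sup>2"
      using \<rho>(2)[of "t *\<^sub>R k"] by linarith
    moreover have "(y + t *\<^sub>R k) \<bullet> (x + t *\<^sub>R v) - g (x + t *\<^sub>R v) \<le> ?h (y + t *\<^sub>R k)"
      by (rule conj_fun_ge[OF conv base])
    moreover have "g (x + t *\<^sub>R v) \<le> g x + y \<bullet> (t *\<^sub>R v) + (M' (t *\<^sub>R v) \<bullet> (t *\<^sub>R v)) / 2" by (rule gx)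
    ultimately have "t\<^sup>2 * (k \<bullet> v) \<le> t\<^sup>2 * ((M' v \<bullet> v) / 2 + (k \<bullet> S k) / 2) + \<eta> * (t\<^sup>2 * (norm k)\<^sup>2)"
      unfolding hy linear_scale[OF linS] linear_scale[OF linM'] using t
      by (simp add: inner_add_left inner_add_right power_mult_distrib power2_eq_square[of t] algebra_simps)
    then show "\<exists>t>0. t\<^sup>2 * (k \<bullet> v) \<le> t\<^sup>2 * ((M' v \<bullet> v) / 2 + (k \<bullet> S k) / 2) + \<eta> * (t\<^sup>2 * (norm k)\<^sup>2)"
      using t by blast
  qed simp
  \<comment> \<open>Only the quadratic form of \<open>S\<close> is under control, so
    \<open>S\<close> is replaced by its symmetric part. By \<open>dual\<close> it is positive
    definite, and its inverse \<open>Q\<close> will be the Hessian of \<open>g\<close> at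
    \<open>x\<close>.\<close>
  define R where "R = (\<lambda>k. (1 / 2) *\<^sub>R (S k + adjoint S k))"
  have linR: "linear R" unfolding R_def
    by (intro linear_compose_scale_right linear_compose_add linS adjoint_linear)
  have symR: "R a \<bullet> b = a \<bullet> R b" for a b
    using adjoint_works[OF linS, of a b] adjoint_works[OF linS, of b a]
    by (simp add: R_def inner_add_left inner_add_right inner_commute)
  have R_q: "R k \<bullet> k = k \<bullet> S k" for k
    using adjoint_works[OF linS, of k k] by (simp add: R_def inner_add_right inner_commute)
  have R_pos: "(norm k)\<^sup>2 / c \<le> R k \<bullet> k" for k
  proof -
    have "k \<bullet> ((1 / c) *\<^sub>R k) \<le> (M' ((1 / c) *\<^sub>R k) \<bullet> ((1 / c) *\<^sub>R k)) / 2 + (R k \<bullet> k) / 2"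
      unfolding R_q by (rule dual)
    moreover have "M' ((1 / c) *\<^sub>R k) \<bullet> ((1 / c) *\<^sub>R k) \<le> c * (norm ((1 / c) *\<^sub>R k))\<^sup>2" by (rule M'_q)
    moreover have "c * (norm ((1 / c) *\<^sub>R k))\<^sup>2 = (norm k)\<^sup>2 / c" using c by (simp add: power2_eq_square)
    moreover have "k \<bullet> ((1 / c) *\<^sub>R k) = (norm k)\<^sup>2 / c" by (simp add: dot_square_norm)
    ultimately show ?thesis by linarith
  qed
  have R_nonneg: "0 \<le> R k \<bullet> k" for k using R_pos[of k] c zero_le_power2[of "norm k"] by (meson divide_nonneg_pos order_trans)
  have "inj R"
  proof (subst linear_injective_0[OF linR], intro allI impI)
    fix k assume "R k = 0"
    then have "(norm k)\<^sup>2 / c \<le> 0" using R_pos[of k] by simp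
    then show "k = 0" using c by (simp add: divide_le_0_iff)
  qed
  then obtain Q where Q: "linear Q" "\<And>a. Q (R a) = a" "\<And>a. R (Q a) = a"
    using linear_injective_isomorphism[OF linR] by blast
  have symQ: "Q a \<bullet> b = a \<bullet> Q b" for a b
    using symR[of "Q a" "Q b"] by (simp add: Q(3))
  have Q_le: "Q v \<bullet> v \<le> M' v \<bullet> v" for v
    using dual[of "Q v" v] R_q[of "Q v"] by (simp add: Q(3) inner_commute)
  obtain b where b: "b > 0" "\<And>z. norm (Q z) \<le> b * norm z" using linear_bounded_pos[OF Q(1)] by blast
  have expansion: "\<exists>\<rho>>0. \<forall>k. norm k < \<rho> \<longrightarrow> \<bar>g (x + k) - g x - y \<bullet> k - (Q k \<bullet> k) / 2\<bar> \<le> \<eta> * (norm k)\<^sup>2" if \<eta>: "\<eta> > 0" for \<eta>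
  proof -
    \<comment> \<open>\<open>C\<close> bounds both \<open>norm (Q z)\<close> and the change of
      subgradient \<open>norm (y' - y)\<close> by multiples of \<open>norm z\<close>, so that the
      expansion of the conjugate is available for both increments.\<close>
    define C where "C = max b (2 * c)"
    have C: "C > 0" "b \<le> C" "2 * c \<le> C" using b by (auto simp: C_def)
    obtain \<rho> where \<rho>: "\<rho> > 0" "\<And>k. norm k < \<rho> \<Longrightarrow> \<bar>?h (y + k) - ?h y - k \<bullet> x - (k \<bullet> S k) / 2\<bar> \<le> \<eta> / C\<^sup>2 * (norm k)\<^sup>2"
      using hS[of "\<eta> / C\<^sup>2"] \<eta> C by auto
    have small: "norm k < \<rho>" "\<eta> / C\<^sup>2 * (norm k)\<^sup>2 \<le> \<eta> * (norm z)\<^sup>2" if "norm z < \<rho> / C" "norm k \<le> C * norm z" for k z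
    proof -
      have "C * norm z < \<rho>" using that(1) C by (simp add: field_simps)
      then show "norm k < \<rho>" using that(2) by linarith
      have "(norm k)\<^sup>2 \<le> (C * norm z)\<^sup>2" using that(2) by (intro power_mono) auto
      then have "\<eta> / C\<^sup>2 * (norm k)\<^sup>2 \<le> \<eta> / C\<^sup>2 * (C * norm z)\<^sup>2" using \<eta> by (intro mult_left_mono) auto
      then show "\<eta> / C\<^sup>2 * (norm k)\<^sup>2 \<le> \<eta> * (norm z)\<^sup>2" using C by (simp add: power_mult_distrib)
    qed
    have "\<bar>g (x + z) - g x - y \<bullet> z - (Q z \<bullet> z) / 2\<bar> \<le> \<eta> * (norm z)\<^sup>2" if z: "norm z < \<rho> / C" for z
    proof -
      have "norm (Q z) \<le> C * norm z" using b(2)[of z] C(2) by (meson mult_right_mono norm_ge_zero order_trans)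
      note s = small[OF z this]
      have "?h (y + Q z) \<le> ?h y + Q z \<bullet> x + (Q z \<bullet> S (Q z)) / 2 + \<eta> * (norm z)\<^sup>2"
        using \<rho>(2)[OF s(1)] s(2) by linarith
      moreover have "Q z \<bullet> S (Q z) = Q z \<bullet> z" using R_q[of "Q z"] by (simp add: Q(3) inner_commute)
      moreover have "(y + Q z) \<bullet> (x + z) - g (x + z) \<le> ?h (y + Q z)" by (rule conj_fun_ge[OF conv base])
      ultimately have lower: "g x + y \<bullet> z + (Q z \<bullet> z) / 2 - \<eta> * (norm z)\<^sup>2 \<le> g (x + z)"
        unfolding hy by (simp add: inner_add_left inner_add_right)
      \<comment> \<open>The lower bound needed only Fenchel's inequality; the upper one needs
        equality, which holds at a subgradient \<open>y'\<close> of \<open>g\<close> at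
        \<open>x + z\<close>. Positivity of \<open>R\<close> at \<open>k - Q z\<close> bounds the
        outcome whatever \<open>k\<close> is.\<close>
      obtain y' where y': "strong_subgradient g (x + z) y'" using conj_grad_surj[OF conv base] by blast
      define k where "k = y' - y"
      have "norm k \<le> C * norm z" if "z \<noteq> 0" "k \<noteq> 0"
      proof -
        \<comment> \<open>Following \<open>y'\<close> from \<open>x + z\<close> over the length
          \<open>norm z\<close> in the direction of \<open>k\<close>, and comparing with the
          paraboloid above \<open>g\<close>, bounds \<open>norm k\<close>.\<close>
        define v where "v = (norm z / norm k) *\<^sub>R k"
        have nv: "norm v = norm z" using that by (simp add: v_def)
        have kv: "k \<bullet> v = norm z * norm k" using that by (simp add: v_def dot_square_norm power2_eq_square)
        have "g (x + z) + y' \<bullet> v + (norm v)\<^sup>2 / 2 \<le> g (x + (z + v))"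
          using y'[unfolded strong_subgradient_def, rule_format, of v] by (simp add: add.assoc)
        moreover have "g x + y \<bullet> z + (norm z)\<^sup>2 / 2 \<le> g (x + z)"
          using SG[unfolded strong_subgradient_def, rule_format, of z] .
        moreover have "g (x + (z + v)) \<le> g x + y \<bullet> (z + v) + c * (norm (z + v))\<^sup>2 / 2"
          using gx[of "z + v"] M'_q[of "z + v"] by simp
        moreover have "y' \<bullet> v = y \<bullet> v + k \<bullet> v" by (simp add: k_def inner_diff_left)
        moreover have "0 \<le> (norm v)\<^sup>2 / 2" "0 \<le> (norm z)\<^sup>2 / 2" by auto
        ultimately have "k \<bullet> v \<le> c * (norm (z + v))\<^sup>2 / 2" unfolding inner_add_right by linarith
        also have "\<dots> \<le> c * (2 * norm z)\<^sup>2 / 2"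
          using norm_triangle_ineq[of z v] nv c by (intro divide_right_mono mult_left_mono power_mono) auto
        finally have "norm z * norm k \<le> norm z * (2 * c * norm z)" unfolding kv by (simp add: power2_eq_square mult_ac)
        then have "norm k \<le> 2 * c * norm z" using that by simp
        also have "\<dots> \<le> C * norm z" using C by (intro mult_right_mono) auto
        finally show ?thesis .
      qed
      moreover have "g (x + z) = g x \<and> Q z = 0" if "z = 0" using that linear_0[OF Q(1)] by simp
      moreover have "g (x + z) - g x - y \<bullet> z - (Q z \<bullet> z) / 2 \<le> \<eta> * (norm z)\<^sup>2" if "norm k \<le> C * norm z"
      proof -
        note s = small[OF z that]
        have "?h (y + k) \<ge> ?h y + k \<bullet> x + (k \<bullet> S k) / 2 - \<eta> * (norm z)\<^sup>2"
          using \<rho>(2)[OF s(1)] s(2) by linarith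
        moreover have "?h (y + k) = (y + k) \<bullet> (x + z) - g (x + z)"
          using J_eq[OF y'] by (simp add: k_def conj_fun_def[OF conv base])
        moreover have "k \<bullet> z - (k \<bullet> S k) / 2 \<le> (Q z \<bullet> z) / 2"
          using R_nonneg[of "k - Q z"] symR[of k "Q z"] unfolding R_q[symmetric]
          by (simp add: linear_diff[OF linR] Q(3) inner_diff_left inner_diff_right inner_commute)
        ultimately show ?thesis unfolding hy by (simp add: inner_add_left inner_add_right)
      qed
      moreover have "norm k \<le> C * norm z" if "k = 0" using that C by simp
      ultimately show ?thesis using lower by (cases "z = 0"; cases "k = 0") (auto simp: abs_le_iff)
    qed
    then show ?thesis using \<rho>(1) C by (intro exI[of _ "\<rho> / C"]) auto
  qed
  have Q_ge: "(norm k)\<^sup>2 \<le> Q k \<bullet> k" for k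
  proof -
    have "(norm k)\<^sup>2 / 2 \<le> (Q k \<bullet> k) / 2"
    proof (rule le_scaled_squares_imp_le[where c = "(norm k)\<^sup>2"])
      fix \<eta> :: real assume "\<eta> > 0"
      then obtain \<rho> where \<rho>: "\<rho> > 0" "\<And>k. norm k < \<rho> \<Longrightarrow> \<bar>g (x + k) - g x - y \<bullet> k - (Q k \<bullet> k) / 2\<bar> \<le> \<eta> * (norm k)\<^sup>2"
        using expansion by blast
      define t where "t = \<rho> / (1 + norm k)"
      have nk: "1 + norm k > 0" using norm_ge_zero[of k] by linarith
      have t: "t > 0" using \<rho>(1) nk by (simp add: t_def)
      have "norm (t *\<^sub>R k) < \<rho>" using nk \<rho>(1) by (simp add: t_def field_simps)
      then have "g (x + t *\<^sub>R k) \<le> g x + y \<bullet> (t *\<^sub>R k) + (Q (t *\<^sub>R k) \<bullet> (t *\<^sub>R k)) / 2 + \<eta> * (norm (t *\<^sub>R k))\<^sup>2"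
        using \<rho>(2)[of "t *\<^sub>R k"] by linarith
      then have "(norm (t *\<^sub>R k))\<^sup>2 / 2 \<le> (Q (t *\<^sub>R k) \<bullet> (t *\<^sub>R k)) / 2 + \<eta> * (norm (t *\<^sub>R k))\<^sup>2"
        using SG[unfolded strong_subgradient_def, rule_format, of "t *\<^sub>R k"] by linarith
      then have "t\<^sup>2 * ((norm k)\<^sup>2 / 2) \<le> t\<^sup>2 * ((Q k \<bullet> k) / 2) + \<eta> * (t\<^sup>2 * (norm k)\<^sup>2)"
        unfolding linear_scale[OF Q(1)] by (simp add: power_mult_distrib power2_eq_square[of t] mult.assoc)
      then show "\<exists>t>0. t\<^sup>2 * ((norm k)\<^sup>2 / 2) \<le> t\<^sup>2 * ((Q k \<bullet> k) / 2) + \<eta> * (t\<^sup>2 * (norm k)\<^sup>2)"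
        using t by blast
    qed simp
    then show ?thesis by simp
  qed
  show thesis
    by (rule that[of x y Q]) (use x_small y_small Q(1) symQ Q_ge Q_le M'_kk expansion in auto)
qed

section \<open>Semicontinuity and semijets\<close>

lemma usc_on_iff:
  fixes u :: "'a::metric_space \<Rightarrow> real"
  shows "usc_on S u \<longleftrightarrow> (\<forall>x\<in>S. \<forall>e>0. \<exists>d>0. \<forall>y\<in>S. dist y x < d \<longrightarrow> u y < u x + e)"
proof
  assume u: "usc_on S u"
  show "\<forall>x\<in>S. \<forall>e>0. \<exists>d>0. \<forall>y\<in>S. dist y x < d \<longrightarrow> u y < u x + e"
  proof (intro ballI allI impI)
    fix x and e :: real assume "x \<in> S" "e > 0"
    then have "x \<in> {y \<in> S. u y < u x + e}" by simp
    moreover have "openin (top_of_set S) {y \<in> S. u y < u x + e}" using u by (simp add: usc_on_def)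
    ultimately show "\<exists>d>0. \<forall>y\<in>S. dist y x < d \<longrightarrow> u y < u x + e"
      unfolding openin_euclidean_subtopology_iff by blast
  qed
next
  assume R: "\<forall>x\<in>S. \<forall>e>0. \<exists>d>0. \<forall>y\<in>S. dist y x < d \<longrightarrow> u y < u x + e"
  show "usc_on S u"
    unfolding usc_on_def openin_euclidean_subtopology_iff
  proof (intro allI conjI ballI)
    fix a x assume "x \<in> {x \<in> S. u x < a}"
    then obtain d where "d > 0" "\<forall>y\<in>S. dist y x < d \<longrightarrow> u y < u x + (a - u x)"
      using R by (metis (no_types, lifting) diff_gt_0_iff_gt mem_Collect_eq)
    then show "\<exists>e>0. \<forall>x'\<in>S. dist x' x < e \<longrightarrow> x' \<in> {x \<in> S. u x < a}" by auto
  qed auto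
qed

lemma lsc_on_iff_usc_on_minus: "lsc_on S v \<longleftrightarrow> usc_on S (\<lambda>x. - v x)"
proof -
  have "usc_on S (\<lambda>x. - v x) \<longleftrightarrow> (\<forall>a. openin (top_of_set S) {x \<in> S. - v x < - a})"
    unfolding usc_on_def by (metis minus_minus)
  then show ?thesis by (simp add: lsc_on_def)
qed

lemma usc_on_add_continuous:
  fixes u :: "'a::metric_space \<Rightarrow> real"
  assumes "usc_on S u" "continuous_on S h"
  shows "usc_on S (\<lambda>x. u x + h x)"
  unfolding usc_on_iff
proof (intro ballI allI impI)
  fix x and e :: real assume x: "x \<in> S" "e > 0"
  obtain d1 where d1: "d1 > 0" "\<forall>y\<in>S. dist y x < d1 \<longrightarrow> u y < u x + e / 2"
    using assms(1) x unfolding usc_on_iff by (meson half_gt_zero)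
  obtain d2 where d2: "d2 > 0" "\<forall>y\<in>S. dist y x < d2 \<longrightarrow> dist (h y) (h x) < e / 2"
    using assms(2) x unfolding continuous_on_iff by (meson half_gt_zero)
  show "\<exists>d>0. \<forall>y\<in>S. dist y x < d \<longrightarrow> u y + h y < u x + h x + e"
  proof (intro exI[of _ "min d1 d2"] conjI ballI impI)
    fix y assume y: "y \<in> S" "dist y x < min d1 d2"
    then have "u y < u x + e / 2" "dist (h y) (h x) < e / 2" using d1(2) d2(2) by auto
    then show "u y + h y < u x + h x + e" by (simp add: dist_real_def abs_if split: if_splits)
  qed (use d1 d2 in auto)
qed

lemma usc_on_subset: "usc_on S u \<Longrightarrow> T \<subseteq> S \<Longrightarrow> usc_on T (u :: 'a::metric_space \<Rightarrow> real)"
  unfolding usc_on_iff by (meson subset_iff)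

lemma continuous_imp_usc_on: "continuous_on S h \<Longrightarrow> usc_on S (h :: 'a::metric_space \<Rightarrow> real)"
  using usc_on_add_continuous[of S "\<lambda>x. 0" h] by (force simp: usc_on_iff)

lemma usc_on_limsup:
  fixes u :: "'a::metric_space \<Rightarrow> real"
  assumes "usc_on S u" "x \<in> S" "\<And>n. xs n \<in> S" "xs \<longlonglongrightarrow> x" "e > 0"
  shows "\<forall>\<^sub>F n in sequentially. u (xs n) < u x + e"
proof -
  obtain d where d: "d > 0" "\<forall>y\<in>S. dist y x < d \<longrightarrow> u y < u x + e"
    using assms(1,2,5) unfolding usc_on_iff by blast
  have "\<forall>\<^sub>F n in sequentially. dist (xs n) x < d" using assms(4) d(1) by (rule tendstoD)
  then show ?thesis by eventually_elim (use d assms(3) in auto)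
qed

text \<open>If no value were largest, the sets where \<open>u\<close> lies below \<open>u y\<close>
  would cover \<open>K\<close>; in a finite subcover the index with the largest value stays
  uncovered.\<close>

lemma usc_on_attains_sup:
  fixes u :: "'a::metric_space \<Rightarrow> real"
  assumes K: "compact K" "K \<noteq> {}" and u: "usc_on K u"
  shows "\<exists>x\<in>K. \<forall>y\<in>K. u y \<le> u x"
proof (rule ccontr)
  assume "\<not> ?thesis"
  then have nex: "\<exists>y\<in>K. u x < u y" if "x \<in> K" for x using that by (meson not_le)
  have "\<exists>T. open T \<and> {x \<in> K. u x < u y} = K \<inter> T" for y
    using u unfolding usc_on_def openin_open by blast
  then obtain T where T: "\<And>y. open (T y)" "\<And>y. {x \<in> K. u x < u y} = K \<inter> T y" by metis
  have "K \<subseteq> (\<Union>y\<in>K. T y)" using nex T(2) by blast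
  then obtain D where D: "D \<subseteq> K" "finite D" "K \<subseteq> (\<Union>y\<in>D. T y)"
    using compactE_image[OF K(1), of K T] T(1) by metis
  have "D \<noteq> {}" using D(3) K(2) by auto
  then have "Max (u ` D) \<in> u ` D" using D(2) by (intro Max_in) auto
  then obtain y where y: "y \<in> D" "u y = Max (u ` D)" by force
  then obtain z where z: "z \<in> D" "y \<in> T z" using D by blast
  then have "u y < u z" using T(2)[of z] y(1) D(1) by blast
  moreover have "u z \<le> u y" unfolding y(2) using z D(2) by simp
  ultimately show False by simp
qed

text \<open>The form used from here on: the Landau remainder becomes an \<open>\<epsilon>\<close> in
  front of the square. Conversely, the positive part of the error is an admissible
  remainder.\<close>

lemma J2plus_iff:
  "(p, X) \<in> J2plus S u z \<longleftrightarrow> X \<in> sym_mats \<and>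
     (\<forall>\<epsilon>>0. \<exists>\<rho>>0. \<forall>x\<in>S. norm (x - z) < \<rho> \<longrightarrow>
        u x \<le> u z + p \<bullet> (x - z) + ((X *v (x - z)) \<bullet> (x - z)) / 2 + \<epsilon> * (norm (x - z))\<^sup>2)"
    (is "_ \<longleftrightarrow> _ \<and> ?R")
proof -
  let ?q = "\<lambda>x. u z + p \<bullet> (x - z) + 1 / 2 * ((X *v (x - z)) \<bullet> (x - z))"
  have "(\<exists>g. g \<in> o[at z within S](\<lambda>x. norm (x - z) ^ 2) \<and> (\<forall>\<^sub>F x in at z within S. u x \<le> ?q x + g x)) \<longleftrightarrow> ?R"
  proof
    assume "\<exists>g. g \<in> o[at z within S](\<lambda>x. norm (x - z) ^ 2) \<and> (\<forall>\<^sub>F x in at z within S. u x \<le> ?q x + g x)"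
    then obtain g where g: "g \<in> o[at z within S](\<lambda>x. norm (x - z) ^ 2)" "\<forall>\<^sub>F x in at z within S. u x \<le> ?q x + g x"
      by blast
    show ?R
    proof (intro allI impI)
      fix \<epsilon> :: real assume "\<epsilon> > 0"
      then have "\<forall>\<^sub>F x in at z within S. norm (g x) \<le> \<epsilon> * norm (norm (x - z) ^ 2)"
        by (rule landau_o.smallD[OF g(1)])
      with g(2) have "\<forall>\<^sub>F x in at z within S. u x \<le> ?q x + \<epsilon> * (norm (x - z))\<^sup>2"
        by eventually_elim auto
      then obtain \<rho> where \<rho>: "\<rho> > 0" "\<And>x. x \<in> S \<Longrightarrow> x \<noteq> z \<Longrightarrow> dist x z < \<rho> \<Longrightarrow> u x \<le> ?q x + \<epsilon> * (norm (x - z))\<^sup>2"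
        unfolding eventually_at by blast
      have "u x \<le> ?q x + \<epsilon> * (norm (x - z))\<^sup>2" if "x \<in> S" "norm (x - z) < \<rho>" for x
        using \<rho>(2)[of x] that by (cases "x = z") (auto simp: dist_norm)
      then show "\<exists>\<rho>>0. \<forall>x\<in>S. norm (x - z) < \<rho> \<longrightarrow> u x \<le> u z + p \<bullet> (x - z) + ((X *v (x - z)) \<bullet> (x - z)) / 2 + \<epsilon> * (norm (x - z))\<^sup>2"
        using \<rho>(1) by auto
    qed
  next
    assume R: ?R
    let ?g = "\<lambda>x. max 0 (u x - ?q x)"
    have "?g \<in> o[at z within S](\<lambda>x. norm (x - z) ^ 2)"
    proof (rule landau_o.smallI)
      fix c :: real assume "c > 0"
      then obtain \<rho> where "\<rho> > 0" "\<forall>x\<in>S. norm (x - z) < \<rho> \<longrightarrow> u x \<le> ?q x + c * (norm (x - z))\<^sup>2"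
        using R by auto
      then show "\<forall>\<^sub>F x in at z within S. norm (?g x) \<le> c * norm (norm (x - z) ^ 2)"
        unfolding eventually_at using \<open>c > 0\<close> by (intro exI[of _ \<rho>]) (auto simp: dist_norm max_def)
    qed
    moreover have "\<forall>\<^sub>F x in at z within S. u x \<le> ?q x + ?g x" by (simp add: max_def)
    ultimately show "\<exists>g. g \<in> o[at z within S](\<lambda>x. norm (x - z) ^ 2) \<and> (\<forall>\<^sub>F x in at z within S. u x \<le> ?q x + g x)"
      by blast
  qed
  then show ?thesis by (simp add: J2plus_def)
qed

lemma J2minus_iff_J2plus: "(p, X) \<in> J2minus S v z \<longleftrightarrow> (- p, - X) \<in> J2plus S (\<lambda>x. - v x) z"
proof -
  have "(p, X) \<in> uminus ` A \<longleftrightarrow> (- p, - X) \<in> A" for A :: "((real^'a) \<times> (real^'a^'a)) set"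
    by (metis (no_types, opaque_lifting) add.inverse_inverse image_iff uminus_Pair)
  then show ?thesis unfolding J2minus_def .
qed

lemma J2plus_barI:
  assumes "\<And>k::nat. xs k \<in> S" "\<And>k. (ps k, Xs k) \<in> J2plus S u (xs k)"
    "xs \<longlonglongrightarrow> x" "(\<lambda>k. u (xs k)) \<longlonglongrightarrow> u x" "ps \<longlonglongrightarrow> p" "Xs \<longlonglongrightarrow> X"
  shows "(p, X) \<in> J2plus_bar S u x"
  unfolding J2plus_bar_def jet_closure_def using assms by (auto intro!: exI tendsto_Pair)

lemma J2plus_barE:
  assumes "(p, X) \<in> J2plus_bar S u x"
  obtains xs ps Xs where "\<And>k::nat. xs k \<in> S" "\<And>k. (ps k, Xs k) \<in> J2plus S u (xs k)"
    "xs \<longlonglongrightarrow> x" "(\<lambda>k. u (xs k)) \<longlonglongrightarrow> u x" "ps \<longlonglongrightarrow> p" "Xs \<longlonglongrightarrow> X"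
proof -
  obtain xs ps Xs where a: "\<And>k::nat. xs k \<in> S \<and> (ps k, Xs k) \<in> J2plus S u (xs k)"
    "(\<lambda>k. (xs k, u (xs k), ps k, Xs k)) \<longlonglongrightarrow> (x, u x, p, X)"
    using assms unfolding J2plus_bar_def jet_closure_def by blast
  show thesis
    by (rule that[of xs ps Xs])
      (use a(1) tendsto_fst[OF a(2)] tendsto_fst[OF tendsto_snd[OF a(2)]] tendsto_fst[OF tendsto_snd[OF tendsto_snd[OF a(2)]]]
      tendsto_snd[OF tendsto_snd[OF tendsto_snd[OF a(2)]]] in simp_all)
qed

lemma J2minus_bar_iff_J2plus_bar: "(p, X) \<in> J2minus_bar S v z \<longleftrightarrow> (- p, - X) \<in> J2plus_bar S (\<lambda>x. - v x) z"
proof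
  assume "(p, X) \<in> J2minus_bar S v z"
  then obtain xs ps Xs where a: "\<And>k::nat. xs k \<in> S \<and> (ps k, Xs k) \<in> J2minus S v (xs k)"
    "(\<lambda>k. (xs k, v (xs k), ps k, Xs k)) \<longlonglongrightarrow> (z, v z, p, X)"
    unfolding J2minus_bar_def jet_closure_def by blast
  have l: "xs \<longlonglongrightarrow> z" "(\<lambda>k. v (xs k)) \<longlonglongrightarrow> v z" "ps \<longlonglongrightarrow> p" "Xs \<longlonglongrightarrow> X"
    using tendsto_fst[OF a(2)] tendsto_fst[OF tendsto_snd[OF a(2)]] tendsto_fst[OF tendsto_snd[OF tendsto_snd[OF a(2)]]]
      tendsto_snd[OF tendsto_snd[OF tendsto_snd[OF a(2)]]] by simp_all
  show "(- p, - X) \<in> J2plus_bar S (\<lambda>x. - v x) z"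
    using a(1) l by (intro J2plus_barI[of xs _ "\<lambda>k. - ps k" "\<lambda>k. - Xs k"] tendsto_minus) (auto simp: J2minus_iff_J2plus)
next
  assume "(- p, - X) \<in> J2plus_bar S (\<lambda>x. - v x) z"
  then obtain xs ps Xs where a: "\<And>k::nat. xs k \<in> S \<and> (ps k, Xs k) \<in> J2plus S (\<lambda>x. - v x) (xs k)"
    "(\<lambda>k. (xs k, - v (xs k), ps k, Xs k)) \<longlonglongrightarrow> (z, - v z, - p, - X)"
    unfolding J2plus_bar_def jet_closure_def by blast
  have l: "xs \<longlonglongrightarrow> z" "(\<lambda>k. - v (xs k)) \<longlonglongrightarrow> - v z" "ps \<longlonglongrightarrow> - p" "Xs \<longlonglongrightarrow> - X"
    using tendsto_fst[OF a(2)] tendsto_fst[OF tendsto_snd[OF a(2)]] tendsto_fst[OF tendsto_snd[OF tendsto_snd[OF a(2)]]]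
      tendsto_snd[OF tendsto_snd[OF tendsto_snd[OF a(2)]]] by simp_all
  have "(\<lambda>k. (xs k, v (xs k), - ps k, - Xs k)) \<longlonglongrightarrow> (z, v z, p, X)"
    using l tendsto_minus[OF l(2)] tendsto_minus[OF l(3)] tendsto_minus[OF l(4)] by (intro tendsto_Pair) auto
  then show "(p, X) \<in> J2minus_bar S v z"
    unfolding J2minus_bar_def jet_closure_def mem_Collect_eq prod.case using a(1)
    by (intro exI[of _ xs] exI[of _ "\<lambda>k. - ps k"] exI[of _ "\<lambda>k. - Xs k"]) (simp add: J2minus_iff_J2plus)
qed

lemma sum_UNIV_sum_type: "(\<Sum>i\<in>UNIV. f i) = (\<Sum>a\<in>UNIV. f (Inl a)) + (\<Sum>b\<in>UNIV. f (Inr b))"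
  for f :: "'n::finite + 'n \<Rightarrow> real"
  unfolding UNIV_Plus_UNIV[symmetric] by (subst sum.Plus) auto

lemma blockmat_quadratic:
  fixes \<xi> :: "real^('n::finite + 'n)"
  defines "a \<equiv> \<chi> i. \<xi> $ Inl i" and "b \<equiv> \<chi> i. \<xi> $ Inr i"
  shows "\<xi> \<bullet> (blockmat A B C D *v \<xi>) = a \<bullet> (A *v a) + a \<bullet> (B *v b) + b \<bullet> (C *v a) + b \<bullet> (D *v b)"
  by (simp add: inner_vec_def matrix_vector_mult_def blockmat_def sum_UNIV_sum_type a_def b_def
      distrib_left sum.distrib)

lemma sym_mats_selfadjoint: "X \<in> sym_mats \<Longrightarrow> (X *v a) \<bullet> b = a \<bullet> (X *v b)"
  by (simp add: sym_mats_def) (metis dot_lmul_matrix inner_commute transpose_matrix_vector)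

lemma selfadjoint_sym_mats:
  assumes "linear Q" "\<And>a b. Q a \<bullet> b = a \<bullet> Q b"
  shows "matrix Q \<in> sym_mats"
proof -
  have "matrix Q $ i $ j = matrix Q $ j $ i" for i j
    using assms(2)[of "axis i 1" "axis j 1"]
    by (simp add: matrix_def inner_axis inner_axis')
  then show ?thesis by (simp add: sym_mats_def transpose_def vec_eq_iff)
qed

section \<open>The theorem on sums\<close>

lemma matrix_mult_linear:
  fixes A :: "real^'n \<Rightarrow> real^'m"
  shows "linear A \<Longrightarrow> matrix A *v x = A x"
  using matrix_works[of A x] by (simp add: linear_def scalar_mult_eq_scaleR)

lemma convex_on_sup_affine:
  fixes f :: "'a::real_inner \<Rightarrow> real"
  assumes "\<And>\<xi>. \<exists>x\<in>K. f \<xi> = c x + l x \<bullet> \<xi>" and "\<And>x \<xi>. x \<in> K \<Longrightarrow> c x + l x \<bullet> \<xi> \<le> f \<xi>"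
  shows "convex_on UNIV f"
proof (rule convex_onI)
  fix t :: real and x y :: 'a assume t: "0 < t" "t < 1"
  obtain z where z: "z \<in> K" "f ((1 - t) *\<^sub>R x + t *\<^sub>R y) = c z + l z \<bullet> ((1 - t) *\<^sub>R x + t *\<^sub>R y)"
    using assms(1) by blast
  have "c z + l z \<bullet> ((1 - t) *\<^sub>R x + t *\<^sub>R y) = (1 - t) * (c z + l z \<bullet> x) + t * (c z + l z \<bullet> y)"
    by (simp add: inner_add_right algebra_simps)
  also have "\<dots> \<le> (1 - t) * f x + t * f y"
    using t assms(2)[OF z(1)] by (intro add_mono mult_left_mono) auto
  finally show "f ((1 - t) *\<^sub>R x + t *\<^sub>R y) \<le> (1 - t) * f x + t * f y" using z(2) by simp
qed simp

text \<open>The sup-convolution recentred at \<open>z\<close>. Expanding the square shows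
  \<open>s \<xi> + c / 2 * (norm \<xi>)\<^sup>2\<close> to be a supremum of affine functions of
  \<open>\<xi>\<close>. The supremum runs over the compact \<open>K\<close> and is attained at
  \<open>m \<xi>\<close>; these points will carry jets of \<open>w\<close> relative to
  \<open>K\<close>.\<close>

lemma sup_convolution:
  fixes w :: "'a::euclidean_space \<Rightarrow> real"
  assumes K: "compact K" "K \<noteq> {}" and w: "usc_on K w"
  obtains m s where "\<And>\<xi>. m \<xi> \<in> K" "\<And>\<xi>. s \<xi> = w (m \<xi>) - c / 2 * (norm (m \<xi> - z - \<xi>))\<^sup>2"
    "\<And>\<xi> x. x \<in> K \<Longrightarrow> w x - c / 2 * (norm (x - z - \<xi>))\<^sup>2 \<le> s \<xi>"
    "convex_on UNIV (\<lambda>\<xi>. s \<xi> + c / 2 * (norm \<xi>)\<^sup>2)"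
proof -
  let ?f = "\<lambda>\<xi> x. w x - c / 2 * (norm (x - z - \<xi>))\<^sup>2"
  have "usc_on K (?f \<xi>)" for \<xi>
    unfolding diff_conv_add_uminus[of "w _"] by (intro usc_on_add_continuous[OF w] continuous_intros)
  then have "\<exists>x\<in>K. \<forall>y\<in>K. ?f \<xi> y \<le> ?f \<xi> x" for \<xi>
    by (rule usc_on_attains_sup[OF K])
  then obtain m where m: "\<And>\<xi>. m \<xi> \<in> K" "\<And>\<xi> y. y \<in> K \<Longrightarrow> ?f \<xi> y \<le> ?f \<xi> (m \<xi>)"
    by metis
  define s where "s = (\<lambda>\<xi>. ?f \<xi> (m \<xi>))"
  have e: "?f \<xi> x + c / 2 * (norm \<xi>)\<^sup>2 = (w x - c / 2 * (norm (x - z))\<^sup>2) + (c *\<^sub>R (x - z)) \<bullet> \<xi>" for x \<xi>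
  proof -
    have E: "(norm ((x - z) - \<xi>))\<^sup>2 = (norm (x - z))\<^sup>2 - 2 * ((x - z) \<bullet> \<xi>) + (norm \<xi>)\<^sup>2"
      unfolding power2_norm_eq_inner inner_diff_left inner_diff_right by (simp add: inner_commute algebra_simps)
    show ?thesis unfolding E inner_scaleR_left by (simp add: field_simps)
  qed
  show thesis
  proof (rule that[of m s])
    show "convex_on UNIV (\<lambda>\<xi>. s \<xi> + c / 2 * (norm \<xi>)\<^sup>2)"
    proof (rule convex_on_sup_affine[of K _ "\<lambda>x. w x - c / 2 * (norm (x - z))\<^sup>2" "\<lambda>x. c *\<^sub>R (x - z)"])
      show "\<exists>x\<in>K. s \<xi> + c / 2 * (norm \<xi>)\<^sup>2 = w x - c / 2 * (norm (x - z))\<^sup>2 + (c *\<^sub>R (x - z)) \<bullet> \<xi>" for \<xi>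
        unfolding e[symmetric] s_def using m(1) by blast
      show "w x - c / 2 * (norm (x - z))\<^sup>2 + (c *\<^sub>R (x - z)) \<bullet> \<xi> \<le> s \<xi> + c / 2 * (norm \<xi>)\<^sup>2" if "x \<in> K" for x \<xi>
        unfolding e[symmetric] s_def using m(2)[OF that] by simp
    qed
  qed (use m in \<open>auto simp: s_def\<close>)
qed

text \<open>The parabola through the maximizer shows that second-order information on the
  sup-convolution at \<open>\<xi>\<close> is second-order information on \<open>w\<close> at the maximizer.\<close>

lemma sup_convolution_jet:
  fixes w :: "real^'n \<Rightarrow> real"
  assumes m: "\<And>\<xi>. m \<xi> \<in> K" and s: "\<And>\<xi>. s \<xi> = w (m \<xi>) - c / 2 * (norm (m \<xi> - z - \<xi>))\<^sup>2"
    and ge: "\<And>\<xi> x. x \<in> K \<Longrightarrow> w x - c / 2 * (norm (x - z - \<xi>))\<^sup>2 \<le> s \<xi>"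
    and A: "linear A" "\<And>a b. A a \<bullet> b = a \<bullet> A b"
    and ex: "\<And>\<eta>. \<eta> > 0 \<Longrightarrow> \<exists>\<rho>>0. \<forall>k. norm k < \<rho> \<longrightarrow> \<bar>s (\<xi> + k) - s \<xi> - p \<bullet> k - (A k \<bullet> k) / 2\<bar> \<le> \<eta> * (norm k)\<^sup>2"
  shows "(p, matrix A) \<in> J2plus K w (m \<xi>)" and "p = c *\<^sub>R (m \<xi> - z - \<xi>)"
proof -
  show "(p, matrix A) \<in> J2plus K w (m \<xi>)"
    unfolding J2plus_iff
  proof (intro conjI allI impI selfadjoint_sym_mats A)
    fix \<epsilon> :: real assume "\<epsilon> > 0"
    then obtain \<rho> where \<rho>: "\<rho> > 0" "\<And>k. norm k < \<rho> \<Longrightarrow> \<bar>s (\<xi> + k) - s \<xi> - p \<bullet> k - (A k \<bullet> k) / 2\<bar> \<le> \<epsilon> * (norm k)\<^sup>2"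
      using ex by blast
    show "\<exists>\<rho>>0. \<forall>x\<in>K. norm (x - m \<xi>) < \<rho> \<longrightarrow> w x \<le> w (m \<xi>) + p \<bullet> (x - m \<xi>) + ((matrix A *v (x - m \<xi>)) \<bullet> (x
      - m \<xi>)) / 2 + \<epsilon> * (norm (x - m \<xi>))\<^sup>2"
    proof (intro exI[of _ \<rho>] conjI ballI impI \<rho>(1))
      fix x assume x: "x \<in> K" "norm (x - m \<xi>) < \<rho>"
      let ?k = "x - m \<xi>"
      \<comment> \<open>Moving \<open>\<xi>\<close> along with \<open>x\<close> leaves the penalty
        unchanged, so \<open>s (\<xi> + ?k)\<close> bounds \<open>w x\<close> up to a
        constant.\<close>
      have E: "x - z - (\<xi> + ?k) = m \<xi> - z - \<xi>" by simp
      have "w x - c / 2 * (norm (m \<xi> - z - \<xi>))\<^sup>2 \<le> s (\<xi> + ?k)"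
        using ge[OF x(1), of "\<xi> + ?k"] unfolding E .
      then show "w x \<le> w (m \<xi>) + p \<bullet> ?k + ((matrix A *v ?k) \<bullet> ?k) / 2 + \<epsilon> * (norm ?k)\<^sup>2"
        using \<rho>(2)[OF x(2)] s[of \<xi>] by (simp add: matrix_mult_linear[OF A(1)])
    qed
  qed
  obtain B where B: "B > 0" "\<And>k. norm (A k) \<le> B * norm k" using linear_bounded_pos[OF A(1)] by blast
  \<comment> \<open>The parabola based at \<open>m \<xi>\<close> lies below \<open>s\<close> and
    touches it at \<open>\<xi>\<close>, so its gradient there can only be \<open>p\<close>;
    \<open>d\<close> is the supposed discrepancy.\<close>
  define d where "d = c *\<^sub>R (m \<xi> - z - \<xi>) - p"
  define C where "C = \<bar>c\<bar> / 2 + B / 2 + 1"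
  obtain \<rho> where \<rho>: "\<rho> > 0" "\<And>k. norm k < \<rho> \<Longrightarrow> \<bar>s (\<xi> + k) - s \<xi> - p \<bullet> k - (A k \<bullet> k) / 2\<bar> \<le> 1 * (norm k)\<^sup>2"
    using ex[of 1] by auto
  have key: "d \<bullet> k \<le> C * (norm k)\<^sup>2" if "norm k < \<rho>" for k
  proof -
    have "A k \<bullet> k \<le> norm (A k) * norm k" by (rule norm_cauchy_schwarz)
    also have "\<dots> \<le> B * norm k * norm k" using B(2) by (intro mult_right_mono) auto
    finally have Ak: "A k \<bullet> k \<le> B * (norm k)\<^sup>2" by (simp add: power2_eq_square)
    have "m \<xi> - z - (\<xi> + k) = (m \<xi> - z - \<xi>) - k" by simp
    then have E: "(norm (m \<xi> - z - (\<xi> + k)))\<^sup>2 = (norm (m \<xi> - z - \<xi>))\<^sup>2 - 2 * ((m \<xi> - z - \<xi>) \<bullet> k) + (norm k)\<^sup>2"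
      unfolding power2_norm_eq_inner inner_diff_left inner_diff_right by (simp add: inner_commute algebra_simps)
    have "s \<xi> + c * ((m \<xi> - z - \<xi>) \<bullet> k) - c / 2 * (norm k)\<^sup>2 \<le> s (\<xi> + k)"
      using ge[OF m[of \<xi>], of "\<xi> + k"] unfolding E s[of \<xi>] by (simp add: field_simps)
    moreover have "c / 2 * (norm k)\<^sup>2 \<le> \<bar>c\<bar> / 2 * (norm k)\<^sup>2" by (intro mult_right_mono) auto
    ultimately show ?thesis using \<rho>(2)[OF that] Ak by (simp add: d_def C_def inner_diff_left algebra_simps)
  qed
  have C: "C > 0" using B(1) by (simp add: C_def)
  have "d = 0"
  proof (rule ccontr)
    assume "d \<noteq> 0"
    \<comment> \<open>Small enough for \<open>key\<close>, and with \<open>C * t \<le> 1 / 2\<close>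
      the quadratic term cannot pay for the linear one.\<close>
    define t where "t = min (\<rho> / (2 * norm d)) (1 / (2 * C))"
    have t: "t > 0" "t \<le> \<rho> / (2 * norm d)" "t \<le> 1 / (2 * C)" using \<rho>(1) C \<open>d \<noteq> 0\<close> by (auto simp: t_def)
    have "norm (t *\<^sub>R d) < \<rho>" using t \<rho>(1) \<open>d \<noteq> 0\<close> by (simp add: field_simps)
    then have "t * (norm d)\<^sup>2 \<le> t * (C * t * (norm d)\<^sup>2)"
      using key[of "t *\<^sub>R d"] by (simp add: dot_square_norm power_mult_distrib power2_eq_square[of t] algebra_simps)
    then have "1 \<le> C * t" using t(1) \<open>d \<noteq> 0\<close> by simp
    moreover have "C * t \<le> 1 / 2" using t(3) C by (simp add: field_simps)
    ultimately show False by simp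
  qed
  then show "p = c *\<^sub>R (m \<xi> - z - \<xi>)" by (simp add: d_def)
qed

lemma J2plus_add_linear:
  assumes "(p, X) \<in> J2plus K w x" and "\<And>y. u y = w y + q \<bullet> y"
  shows "(p + q, X) \<in> J2plus K u x"
  using assms by (simp add: J2plus_iff inner_add_left inner_diff_right algebra_simps)

text \<open>Polarization turns the bound on the quadratic form into a bound on each entry. The crude
  constant serves only to extract convergent subsequences.\<close>

lemma norm_matrix_le_quadratic:
  fixes X :: "real^'n^'n"
  assumes X: "X \<in> sym_mats" and q: "\<And>a. \<bar>a \<bullet> (X *v a)\<bar> \<le> C * (norm a)\<^sup>2"
  shows "norm X \<le> real CARD('n) * (real CARD('n) * C)"
proof -
  have e: "\<bar>X $ i $ j\<bar> \<le> C" for i j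
  proof -
    let ?a = "axis i 1 :: real^'n" and ?b = "axis j 1 :: real^'n"
    have "X $ i $ j = ?a \<bullet> (X *v ?b)" by (simp add: inner_axis' matrix_vector_mult_basis column_def)
    moreover have "4 * (?a \<bullet> (X *v ?b)) = (?a + ?b) \<bullet> (X *v (?a + ?b)) - (?a - ?b) \<bullet> (X *v (?a - ?b))"
      using sym_mats_selfadjoint[OF X, of ?b ?a]
      by (simp add: matrix_vector_right_distrib matrix_vector_mult_diff_distrib inner_add_left inner_add_right
        inner_diff_left inner_diff_right inner_commute)
    moreover have "\<bar>(?a + ?b) \<bullet> (X *v (?a + ?b))\<bar> + \<bar>(?a - ?b) \<bullet> (X *v (?a - ?b))\<bar> \<le> C * (norm (?a + ?b))\<^sup>2
      + C * (norm (?a - ?b))\<^sup>2"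
      using q[of "?a + ?b"] q[of "?a - ?b"] by linarith
    moreover have "(norm (?a + ?b))\<^sup>2 + (norm (?a - ?b))\<^sup>2 = 2 * (norm ?a)\<^sup>2 + 2 * (norm ?b)\<^sup>2"
      unfolding power2_norm_eq_inner by (simp add: inner_add_left inner_add_right inner_diff_left inner_diff_right)
    then have "C * (norm (?a + ?b))\<^sup>2 + C * (norm (?a - ?b))\<^sup>2 = C * 4"
      unfolding distrib_left[symmetric] by simp
    ultimately show ?thesis by linarith
  qed
  have "norm X \<le> (\<Sum>i\<in>UNIV. norm (X $ i))" unfolding norm_vec_def[of X] by (rule L2_set_le_sum) simp
  also have "\<dots> \<le> (\<Sum>i\<in>(UNIV :: 'n set). real CARD('n) * C)"
  proof (rule sum_mono)
    fix i
    have "norm (X $ i) \<le> (\<Sum>j\<in>UNIV. \<bar>X $ i $ j\<bar>)" by (rule norm_le_l1_cart)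
    also have "\<dots> \<le> (\<Sum>j\<in>(UNIV :: 'n set). C)" using e by (intro sum_mono) auto
    finally show "norm (X $ i) \<le> real CARD('n) * C" by simp
  qed
  finally show ?thesis by simp
qed

lemma closed_sym_mats: "closed (sym_mats :: (real^'n^'n) set)"
proof -
  have "sym_mats = (\<Inter>i. \<Inter>j. {X :: real^'n^'n. X $ i $ j = X $ j $ i})"
    by (auto simp: sym_mats_def transpose_def vec_eq_iff)
  also have "closed \<dots>" by (intro closed_INT ballI closed_Collect_eq continuous_intros)
  finally show ?thesis .
qed

lemma tendsto_matrix_quadratic:
  fixes X :: "nat \<Rightarrow> real^'n^'n"
  assumes "X \<longlonglongrightarrow> L"
  shows "(\<lambda>k. a \<bullet> (X k *v b)) \<longlonglongrightarrow> a \<bullet> (L *v b)"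
  unfolding inner_vec_def matrix_vector_mult_def using assms by (auto intro!: tendsto_intros)

text \<open>The quadratic penalty is absorbed by two sup-convolutions; the function to which
  the Jensen-Alexandrov theorem is applied is separable, hence so is its Hessian.\<close>

lemma maximum_principle_approx:
  fixes u v :: "real^'n \<Rightarrow> real"
  assumes K: "compact K" and usc: "usc_on K u" and lsc: "lsc_on K v"
    and hat: "xh \<in> K" "yh \<in> K" and \<alpha>: "\<alpha> > 0"
    and max: "\<And>x y. x \<in> K \<Longrightarrow> y \<in> K \<Longrightarrow> u x - v y - \<alpha> / 2 * (norm (x - y))\<^sup>2 \<le> u xh - v yh - \<alpha> / 2 * (norm (xh - yh))\<^sup>2"
  obtains xs ys ps qs Xs Ys where "\<And>k::nat. xs k \<in> K" "\<And>k. ys k \<in> K"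
    "\<And>k. (ps k, Xs k) \<in> J2plus K u (xs k)" "\<And>k. (qs k, Ys k) \<in> J2plus K (\<lambda>y. - v y) (ys k)"
    "xs \<longlonglongrightarrow> xh" "ys \<longlonglongrightarrow> yh" "(\<lambda>k. u (xs k)) \<longlonglongrightarrow> u xh" "(\<lambda>k. - v (ys k)) \<longlonglongrightarrow> - v yh"
    "ps \<longlonglongrightarrow> \<alpha> *\<^sub>R (xh - yh)" "qs \<longlonglongrightarrow> - (\<alpha> *\<^sub>R (xh - yh))"
    "\<And>k a b. - (3 * \<alpha>) * ((norm a)\<^sup>2 + (norm b)\<^sup>2) \<le> a \<bullet> (Xs k *v a) + b \<bullet> (Ys k *v b)"
    "\<And>k a b. a \<bullet> (Xs k *v a) + b \<bullet> (Ys k *v b) \<le> 3 * \<alpha> * (norm (a - b))\<^sup>2 + 1 / real (Suc k) * ((norm a)\<^sup>2 + (norm b)\<^sup>2)"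
proof -
  \<comment> \<open>In \<open>sum_le\<close> the square of \<open>norm ((a - b) + (x - y))\<close>
    is at most \<open>3 * (norm (a - b))\<^sup>2 + 3 * ((norm x)\<^sup>2 + (norm
    y)\<^sup>2)\<close>. With \<open>c = 3 * \<alpha>\<close> the second part is exactly the penalty
    of the sup-convolutions, and the first becomes the bound \<open>3 * \<alpha>\<close> on the
    matrices.\<close>
  define c where "c = 3 * \<alpha>"
  have c: "c > 0" using \<alpha> by (simp add: c_def)
  define ph where "ph = \<alpha> *\<^sub>R (xh - yh)"
  \<comment> \<open>Removing the linear part of the penalty at the maximum point turns the penalty
    into a square centred there, as \<open>wmax\<close> records.\<close>
  define w1 where "w1 = (\<lambda>x. u x + - (ph \<bullet> x))"
  define w2 where "w2 = (\<lambda>y. - v y + ph \<bullet> y)"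
  have usc1: "usc_on K w1" unfolding w1_def by (intro usc_on_add_continuous usc continuous_intros)
  have usc2: "usc_on K w2" unfolding w2_def
    using lsc by (intro usc_on_add_continuous continuous_intros) (simp add: lsc_on_iff_usc_on_minus)
  have K0: "K \<noteq> {}" using hat by auto
  obtain m1 s1 where m1: "\<And>\<xi>. m1 \<xi> \<in> K" and s1: "\<And>\<xi>. s1 \<xi> = w1 (m1 \<xi>) - c / 2 * (norm (m1 \<xi> - xh - \<xi>))\<^sup>2"
    and ge1: "\<And>\<xi> x. x \<in> K \<Longrightarrow> w1 x - c / 2 * (norm (x - xh - \<xi>))\<^sup>2 \<le> s1 \<xi>"
    and cv1: "convex_on UNIV (\<lambda>\<xi>. s1 \<xi> + c / 2 * (norm \<xi>)\<^sup>2)"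
    by (rule sup_convolution[OF K K0 usc1, of c xh]) blast
  obtain m2 s2 where m2: "\<And>\<xi>. m2 \<xi> \<in> K" and s2: "\<And>\<xi>. s2 \<xi> = w2 (m2 \<xi>) - c / 2 * (norm (m2 \<xi> - yh - \<xi>))\<^sup>2"
    and ge2: "\<And>\<xi> x. x \<in> K \<Longrightarrow> w2 x - c / 2 * (norm (x - yh - \<xi>))\<^sup>2 \<le> s2 \<xi>"
    and cv2: "convex_on UNIV (\<lambda>\<xi>. s2 \<xi> + c / 2 * (norm \<xi>)\<^sup>2)"
    by (rule sup_convolution[OF K K0 usc2, of c yh]) blast
  have wmax: "w1 x + w2 y \<le> w1 xh + w2 yh + \<alpha> / 2 * (norm ((x - xh) - (y - yh)))\<^sup>2" if "x \<in> K" "y \<in> K" for x y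
  proof -
    have "(x - xh) - (y - yh) = (x - y) - (xh - yh)" by simp
    then have E: "(norm ((x - xh) - (y - yh)))\<^sup>2 = (norm (x - y))\<^sup>2 - 2 * ((xh - yh) \<bullet> (x - y)) + (norm (xh - yh))\<^sup>2"
      by (simp only: power2_norm_eq_inner inner_diff_left[of "x - y"] inner_diff_right[of _ "x
        - y"] inner_commute[of "x - y" "xh - yh"])
    have W: "w1 x + w2 y = u x - v y - \<alpha> * ((xh - yh) \<bullet> (x - y))" for x y
      by (simp add: w1_def w2_def ph_def inner_diff_right algebra_simps)
    show ?thesis using max[OF that] unfolding E W dot_square_norm by (simp add: field_simps)
  qed
  have sum_le: "s1 a + s2 b \<le> w1 xh + w2 yh + c / 2 * (norm (a - b))\<^sup>2" for a b
  proof -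
    define x where "x = m1 a - xh - a"
    define y where "y = m2 b - yh - b"
    have d: "(m1 a - xh) - (m2 b - yh) = (a - b) + (x - y)" by (simp add: x_def y_def)
    have i1: "(norm ((a - b) + (x - y)))\<^sup>2 \<le> 3 * (norm (a - b))\<^sup>2 + 3 / 2 * (norm (x - y))\<^sup>2"
    proof -
      have "0 \<le> (norm (2 *\<^sub>R (a - b) - (x - y)))\<^sup>2" by simp
      then show ?thesis
        by (simp add: power2_norm_eq_inner inner_add_left inner_add_right inner_diff_left inner_diff_right
          inner_commute field_simps)
    qed
    have i2: "(norm (x - y))\<^sup>2 \<le> 2 * (norm x)\<^sup>2 + 2 * (norm y)\<^sup>2"
    proof -
      have "0 \<le> (norm (x + y))\<^sup>2" by simp
      then show ?thesis
        by (simp add: power2_norm_eq_inner inner_add_left inner_add_right inner_diff_left inner_diff_right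
          inner_commute field_simps)
    qed
    have "(norm ((a - b) + (x - y)))\<^sup>2 \<le> 3 * (norm (a - b))\<^sup>2 + 3 * ((norm x)\<^sup>2 + (norm y)\<^sup>2)"
      using i1 i2 by simp
    then have "\<alpha> / 2 * (norm ((a - b) + (x - y)))\<^sup>2 \<le> \<alpha> / 2 * (3 * (norm (a - b))\<^sup>2 + 3 * ((norm x)\<^sup>2 + (norm y)\<^sup>2))"
      using \<alpha> by (intro mult_left_mono) auto
    moreover have "s1 a + s2 b = w1 (m1 a) + w2 (m2 b) - c / 2 * ((norm x)\<^sup>2 + (norm y)\<^sup>2)"
      by (simp add: s1 s2 x_def y_def algebra_simps)
    ultimately show ?thesis using wmax[OF m1[of a] m2[of b]] unfolding d by (simp add: c_def algebra_simps)
  qed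
  have s10: "s1 0 = w1 xh" and s20: "s2 0 = w2 yh"
    using sum_le[of 0 0] ge1[OF hat(1), of 0] ge2[OF hat(2), of 0] by auto
  \<comment> \<open>\<open>c / 2\<close> makes the sum convex; the extra \<open>1 / 2\<close>
    supplies the strong convexity assumed in \<open>Jensen_Alexandrov\<close>.\<close>
  define g where "g = (\<lambda>\<zeta>. s1 (fst \<zeta>) + s2 (snd \<zeta>) + (c + 1) / 2 * (norm \<zeta>)\<^sup>2)"
  have nz: "(norm \<zeta>)\<^sup>2 = (norm (fst \<zeta>))\<^sup>2 + (norm (snd \<zeta>))\<^sup>2" for \<zeta> :: "(real^'n) \<times> (real^'n)"
    by (simp add: norm_prod_def)
  have cvg: "convex_on UNIV (\<lambda>\<zeta>. g \<zeta> - (norm \<zeta>)\<^sup>2 / 2)"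
  proof -
    have "convex_on UNIV (\<lambda>\<zeta>::(real^'n) \<times> (real^'n). (s1 (fst \<zeta>) + c / 2 * (norm (fst \<zeta>))\<^sup>2) + (s2 (snd \<zeta>)
      + c / 2 * (norm (snd \<zeta>))\<^sup>2))"
    proof (rule convex_on_add)
      show "convex_on UNIV (\<lambda>\<zeta>::(real^'n) \<times> (real^'n). s1 (fst \<zeta>) + c / 2 * (norm (fst \<zeta>))\<^sup>2)"
        by (rule convex_onI) (use convex_onD[OF cv1] in auto)
      show "convex_on UNIV (\<lambda>\<zeta>::(real^'n) \<times> (real^'n). s2 (snd \<zeta>) + c / 2 * (norm (snd \<zeta>))\<^sup>2)"
        by (rule convex_onI) (use convex_onD[OF cv2] in auto)
    qed
    moreover have "(s1 (fst \<zeta>) + c / 2 * (norm (fst \<zeta>))\<^sup>2) + (s2 (snd \<zeta>) + c / 2 * (norm (snd \<zeta>))\<^sup>2) = g \<zeta> - (norm \<zeta>)\<^sup>2 / 2" for \<zeta>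
      unfolding g_def nz by (simp add: field_simps)
    ultimately show ?thesis by simp
  qed
  \<comment> \<open>Hessian of the quadratic majorant of \<open>g\<close>: the coupling
    \<open>c / 2 * (norm (a - b))\<^sup>2\<close> from \<open>sum_le\<close> plus the added
    \<open>(c + 1) / 2 * (norm \<zeta>)\<^sup>2\<close>.\<close>
  define M :: "(real^'n) \<times> (real^'n) \<Rightarrow> (real^'n) \<times> (real^'n)" where
    "M = (\<lambda>\<zeta>. (c *\<^sub>R (fst \<zeta> - snd \<zeta>) + (c + 1) *\<^sub>R fst \<zeta>, c *\<^sub>R (snd \<zeta> - fst \<zeta>) + (c + 1) *\<^sub>R snd \<zeta>))"
  have linM: "linear M" by (rule linearI) (auto simp: M_def algebra_simps)
  have symM: "M x \<bullet> y = x \<bullet> M y" for x y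
    by (simp add: M_def inner_prod_def inner_diff_left inner_diff_right inner_add_left inner_add_right) (simp add: algebra_simps)
  have M_q: "M \<zeta> \<bullet> \<zeta> = c * (norm (fst \<zeta> - snd \<zeta>))\<^sup>2 + (c + 1) * (norm \<zeta>)\<^sup>2" for \<zeta>
    unfolding nz power2_norm_eq_inner M_def inner_prod_def fst_conv snd_conv inner_diff_left inner_diff_right
      inner_add_left inner_scaleR_left
    by (simp add: inner_commute[of "snd \<zeta>" "fst \<zeta>"]) (simp add: algebra_simps)
  have touch: "g \<zeta> \<le> g 0 + (M \<zeta> \<bullet> \<zeta>) / 2" for \<zeta>
    using sum_le[of "fst \<zeta>" "snd \<zeta>"] unfolding M_q by (simp add: g_def s10 s20 field_simps)
  have "\<exists>\<zeta> P Q. norm \<zeta> < 1 / real (Suc n) \<and> norm P < 1 / real (Suc n) \<and> linear Q \<and> (\<forall>a b. Q a \<bullet> b = a \<bullet> Q b) \<and>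
      (\<forall>k. (norm k)\<^sup>2 \<le> Q k \<bullet> k) \<and> (\<forall>k. Q k \<bullet> k \<le> M k \<bullet> k + 1 / real (Suc n) * (norm k)\<^sup>2) \<and>
      (\<forall>\<eta>>0. \<exists>\<rho>>0. \<forall>k. norm k < \<rho> \<longrightarrow> \<bar>g (\<zeta> + k) - g \<zeta> - P \<bullet> k - (Q k \<bullet> k) / 2\<bar> \<le> \<eta> * (norm k)\<^sup>2)" for n
    by (rule Jensen_Alexandrov[OF cvg linM symM touch, of "1 / real (Suc n)"]) (simp, blast)
  then obtain \<zeta> P Q where \<zeta>: "\<And>n. norm (\<zeta> n) < 1 / real (Suc n)" and P: "\<And>n. norm (P n) < 1 / real (Suc n)"
    and linQ: "\<And>n. linear (Q n)" and symQ: "\<And>n a b. Q n a \<bullet> b = a \<bullet> Q n b"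
    and Q_ge: "\<And>n k. (norm k)\<^sup>2 \<le> Q n k \<bullet> k" and Q_le: "\<And>n k. Q n k \<bullet> k \<le> M k \<bullet> k + 1 / real (Suc n) * (norm k)\<^sup>2"
    and ex: "\<And>n \<eta>. \<eta> > 0 \<Longrightarrow> \<exists>\<rho>>0. \<forall>k. norm k < \<rho> \<longrightarrow> \<bar>g (\<zeta> n + k) - g (\<zeta> n) - P n \<bullet> k - (Q n k \<bullet> k) / 2\<bar> \<le> \<eta> * (norm k)\<^sup>2"
    by metis
  have inv0: "(\<lambda>n. 1 / real (Suc n)) \<longlonglongrightarrow> 0" using LIMSEQ_inverse_real_of_nat by (simp add: inverse_eq_divide)
  have \<zeta>0: "\<zeta> \<longlonglongrightarrow> 0" by (rule Lim_null_comparison[OF _ inv0]) (rule always_eventually, use \<zeta> less_imp_le in blast)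
  have P0: "P \<longlonglongrightarrow> 0" by (rule Lim_null_comparison[OF _ inv0]) (rule always_eventually, use P less_imp_le in blast)
  \<comment> \<open>The diagonal blocks of the Hessian, with the auxiliary square removed
    again.\<close>
  define A1 where "A1 = (\<lambda>n k. fst (Q n (k, 0)) - (c + 1) *\<^sub>R k)"
  define A2 where "A2 = (\<lambda>n k. snd (Q n (0, k)) - (c + 1) *\<^sub>R k)"
  have A1: "linear (A1 n)" "\<And>a b. A1 n a \<bullet> b = a \<bullet> A1 n b" for n
  proof -
    have "linear (\<lambda>k. fst (Q n (k, 0)))"
      by (rule linearI) (use linear_add[OF linQ[of n], of "(_, 0)" "(_, 0)"] linear_scale[OF linQ[of n], of _
        "(_, 0)"] in simp_all)
    then show "linear (A1 n)" unfolding A1_def by (intro linear_compose_sub linear_compose_scale_right linear_id[unfolded id_def])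
    show "A1 n a \<bullet> b = a \<bullet> A1 n b" for a b
      using symQ[of n "(a, 0)" "(b, 0)"] by (simp add: A1_def inner_prod_def inner_diff_left inner_diff_right)
  qed
  have A2: "linear (A2 n)" "\<And>a b. A2 n a \<bullet> b = a \<bullet> A2 n b" for n
  proof -
    have "linear (\<lambda>k. snd (Q n (0, k)))"
      by (rule linearI) (use linear_add[OF linQ[of n], of "(0, _)" "(0, _)"] linear_scale[OF linQ[of n], of _
        "(0, _)"] in simp_all)
    then show "linear (A2 n)" unfolding A2_def by (intro linear_compose_sub linear_compose_scale_right linear_id[unfolded id_def])
    show "A2 n a \<bullet> b = a \<bullet> A2 n b" for a b
      using symQ[of n "(0, a)" "(0, b)"] by (simp add: A2_def inner_prod_def inner_diff_left inner_diff_right)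
  qed
  define p1 where "p1 = (\<lambda>n. fst (P n) - (c + 1) *\<^sub>R fst (\<zeta> n))"
  define p2 where "p2 = (\<lambda>n. snd (P n) - (c + 1) *\<^sub>R snd (\<zeta> n))"
  have nsq: "(norm (a + k))\<^sup>2 = (norm a)\<^sup>2 + 2 * (a \<bullet> k) + (norm k)\<^sup>2" for a k :: "real^'n"
    unfolding power2_norm_eq_inner by (simp add: inner_add_left inner_add_right inner_commute)
  have ex1: "\<exists>\<rho>>0. \<forall>k. norm k < \<rho> \<longrightarrow> \<bar>s1 (fst (\<zeta> n) + k) - s1 (fst (\<zeta> n)) - p1 n \<bullet> k - (A1 n k \<bullet> k) / 2\<bar>
    \<le> \<eta> * (norm k)\<^sup>2" if \<eta>: "\<eta> > 0" for n \<eta>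
  proof -
    obtain \<rho> where \<rho>: "\<rho> > 0" "\<And>k. norm k < \<rho> \<Longrightarrow> \<bar>g (\<zeta> n + k) - g (\<zeta> n) - P n \<bullet> k - (Q n k \<bullet> k) / 2\<bar> \<le> \<eta> * (norm k)\<^sup>2"
      using ex[OF \<eta>] by blast
    have E: "s1 (fst (\<zeta> n) + k) - s1 (fst (\<zeta> n)) - p1 n \<bullet> k - (A1 n k \<bullet> k) / 2 = g (\<zeta> n + (k, 0)) - g (\<zeta> n)
      - P n \<bullet> (k, 0) - (Q n (k, 0) \<bullet> (k, 0)) / 2" for k
      by (simp add: g_def nz nsq p1_def A1_def inner_prod_def inner_diff_left inner_diff_right inner_add_left
        inner_add_right inner_commute dot_square_norm field_simps)
    show ?thesis
    proof (intro exI[of _ \<rho>] conjI allI impI \<rho>(1))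
      fix k :: "real^'n" assume "norm k < \<rho>"
      then show "\<bar>s1 (fst (\<zeta> n) + k) - s1 (fst (\<zeta> n)) - p1 n \<bullet> k - (A1 n k \<bullet> k) / 2\<bar> \<le> \<eta> * (norm k)\<^sup>2"
        unfolding E using \<rho>(2)[of "(k, 0)"] by (simp add: norm_Pair)
    qed
  qed
  have ex2: "\<exists>\<rho>>0. \<forall>k. norm k < \<rho> \<longrightarrow> \<bar>s2 (snd (\<zeta> n) + k) - s2 (snd (\<zeta> n)) - p2 n \<bullet> k - (A2 n k \<bullet> k) / 2\<bar>
    \<le> \<eta> * (norm k)\<^sup>2" if \<eta>: "\<eta> > 0" for n \<eta>
  proof -
    obtain \<rho> where \<rho>: "\<rho> > 0" "\<And>k. norm k < \<rho> \<Longrightarrow> \<bar>g (\<zeta> n + k) - g (\<zeta> n) - P n \<bullet> k - (Q n k \<bullet> k) / 2\<bar> \<le> \<eta> * (norm k)\<^sup>2"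
      using ex[OF \<eta>] by blast
    have E: "s2 (snd (\<zeta> n) + k) - s2 (snd (\<zeta> n)) - p2 n \<bullet> k - (A2 n k \<bullet> k) / 2 = g (\<zeta> n + (0, k)) - g (\<zeta> n)
      - P n \<bullet> (0, k) - (Q n (0, k) \<bullet> (0, k)) / 2" for k
      by (simp add: g_def nz nsq p2_def A2_def inner_prod_def inner_diff_left inner_diff_right inner_add_left
        inner_add_right inner_commute dot_square_norm field_simps)
    show ?thesis
    proof (intro exI[of _ \<rho>] conjI allI impI \<rho>(1))
      fix k :: "real^'n" assume "norm k < \<rho>"
      then show "\<bar>s2 (snd (\<zeta> n) + k) - s2 (snd (\<zeta> n)) - p2 n \<bullet> k - (A2 n k \<bullet> k) / 2\<bar> \<le> \<eta> * (norm k)\<^sup>2"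
        unfolding E using \<rho>(2)[of "(0, k)"] by (simp add: norm_Pair)
    qed
  qed
  have j1: "(p1 n, matrix (A1 n)) \<in> J2plus K w1 (m1 (fst (\<zeta> n)))" "p1 n = c *\<^sub>R (m1 (fst (\<zeta> n)) - xh - fst (\<zeta> n))" for n
    using sup_convolution_jet[OF m1 s1 ge1 A1 ex1] by blast+
  have j2: "(p2 n, matrix (A2 n)) \<in> J2plus K w2 (m2 (snd (\<zeta> n)))" "p2 n = c *\<^sub>R (m2 (snd (\<zeta> n)) - yh - snd (\<zeta> n))" for n
    using sup_convolution_jet[OF m2 s2 ge2 A2 ex2] by blast+
  \<comment> \<open>\<open>g\<close> is a sum of functions of the two variables, so the expansion
    along \<open>(a, b)\<close> is the sum of those along \<open>(a, 0)\<close> and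
    \<open>(0, b)\<close>; to second order this leaves nothing for the off-diagonal blocks.\<close>
  have Q_split: "Q n (a, b) \<bullet> (a, b) = A1 n a \<bullet> a + A2 n b \<bullet> b + (c + 1) * ((norm a)\<^sup>2 + (norm b)\<^sup>2)" for n a b
  proof -
    define D where "D = Q n (a, b) \<bullet> (a, b) - A1 n a \<bullet> a - A2 n b \<bullet> b - (c + 1) * ((norm a)\<^sup>2 + (norm b)\<^sup>2)"
    define N where "N = (norm (a, b))\<^sup>2 + (norm a)\<^sup>2 + (norm b)\<^sup>2"
    have D: "\<exists>t>0. \<bar>t\<^sup>2 * (D / 2)\<bar> \<le> \<eta> * (t\<^sup>2 * N)" if \<eta>: "\<eta> > 0" for \<eta>
    proof -
      obtain r where r: "r > 0" "\<And>k. norm k < r \<Longrightarrow> \<bar>g (\<zeta> n + k) - g (\<zeta> n) - P n \<bullet> k - (Q n k \<bullet> k) / 2\<bar> \<le> \<eta> * (norm k)\<^sup>2"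
        using ex[OF \<eta>] by blast
      obtain r1 where r1: "r1 > 0" "\<And>k. norm k < r1 \<Longrightarrow> \<bar>s1 (fst (\<zeta> n) + k) - s1 (fst (\<zeta> n)) - p1 n \<bullet> k
        - (A1 n k \<bullet> k) / 2\<bar> \<le> \<eta> * (norm k)\<^sup>2"
        using ex1[OF \<eta>] by blast
      obtain r2 where r2: "r2 > 0" "\<And>k. norm k < r2 \<Longrightarrow> \<bar>s2 (snd (\<zeta> n) + k) - s2 (snd (\<zeta> n)) - p2 n \<bullet> k
        - (A2 n k \<bullet> k) / 2\<bar> \<le> \<eta> * (norm k)\<^sup>2"
        using ex2[OF \<eta>] by blast
      define L where "L = norm (a, b) + norm a + norm b + 1"
      define t where "t = min r (min r1 r2) / L"
      have L: "L > 0" unfolding L_def using norm_ge_zero[of "(a, b)"] norm_ge_zero[of a] norm_ge_zero[of b] by linarith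
      have t: "t > 0" "t * L \<le> r" "t * L \<le> r1" "t * L \<le> r2" using r(1) r1(1) r2(1) L by (auto simp: t_def)
      have "t * norm (a, b) < t * L" "t * norm a < t * L" "t * norm b < t * L"
        using t(1) norm_ge_zero[of "(a, b)"] norm_ge_zero[of a] norm_ge_zero[of b] unfolding L_def
          by (auto simp del: norm_ge_zero)
      moreover have "norm (t *\<^sub>R (a, b)) = t * norm (a, b)" "norm (t *\<^sub>R a) = t * norm a" "norm (t *\<^sub>R b) = t * norm b"
        using t(1) by (simp_all del: scaleR_Pair)
      ultimately have "norm (t *\<^sub>R (a, b)) < r" "norm (t *\<^sub>R a) < r1" "norm (t *\<^sub>R b) < r2" using t by linarith+
      note i = r(2)[OF this(1)] r1(2)[OF this(2)] r2(2)[OF this(3)]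
      have "g (\<zeta> n + t *\<^sub>R (a, b)) - g (\<zeta> n) - P n \<bullet> (t *\<^sub>R (a, b)) - (Q n (t *\<^sub>R (a, b)) \<bullet> (t *\<^sub>R (a, b))) / 2
        = (s1 (fst (\<zeta> n) + t *\<^sub>R a) - s1 (fst (\<zeta> n)) - p1 n \<bullet> (t *\<^sub>R a) - (A1 n (t *\<^sub>R a) \<bullet> (t *\<^sub>R a)) / 2)
        + (s2 (snd (\<zeta> n) + t *\<^sub>R b) - s2 (snd (\<zeta> n)) - p2 n \<bullet> (t *\<^sub>R b) - (A2 n (t *\<^sub>R b) \<bullet> (t *\<^sub>R b)) / 2) - t\<^sup>2 * (D / 2)"
        unfolding D_def linear_scale[OF linQ] linear_scale[OF A1(1)] linear_scale[OF A2(1)]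
        by (simp add: g_def nz nsq p1_def p2_def inner_prod_def inner_diff_left inner_diff_right
          inner_add_left inner_add_right inner_commute power_mult_distrib power2_eq_square[of t] field_simps)
      then have "\<bar>t\<^sup>2 * (D / 2)\<bar> \<le> \<eta> * (norm (t *\<^sub>R (a, b)))\<^sup>2 + \<eta> * (norm (t *\<^sub>R a))\<^sup>2 + \<eta> * (norm (t *\<^sub>R b))\<^sup>2"
        using i by linarith
      also have "\<dots> = \<eta> * (t\<^sup>2 * N)" by (simp add: N_def power_mult_distrib algebra_simps del: scaleR_Pair)
      finally show ?thesis using t(1) by blast
    qed
    have "N \<ge> 0" by (simp add: N_def)
    have "D / 2 \<le> 0" by (rule le_scaled_squares_imp_le[OF _ \<open>N \<ge> 0\<close>]) (use D in \<open>fastforce simp: abs_le_iff\<close>)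
    moreover have "- (D / 2) \<le> 0" by (rule le_scaled_squares_imp_le[OF _ \<open>N \<ge> 0\<close>]) (use D in \<open>fastforce simp: abs_le_iff\<close>)
    ultimately show ?thesis by (simp add: D_def)
  qed
  define xs where "xs = (\<lambda>n. m1 (fst (\<zeta> n)))"
  define ys where "ys = (\<lambda>n. m2 (snd (\<zeta> n)))"
  have f0: "(\<lambda>n. fst (\<zeta> n)) \<longlonglongrightarrow> 0" "(\<lambda>n. snd (\<zeta> n)) \<longlonglongrightarrow> 0" "(\<lambda>n. fst (P n)) \<longlonglongrightarrow> 0" "(\<lambda>n. snd (P n)) \<longlonglongrightarrow> 0"
    using tendsto_fst[OF \<zeta>0] tendsto_snd[OF \<zeta>0] tendsto_fst[OF P0] tendsto_snd[OF P0] by simp_all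
  have p10: "p1 \<longlonglongrightarrow> 0" "p2 \<longlonglongrightarrow> 0"
    using tendsto_diff[OF f0(3) tendsto_scaleR[OF tendsto_const f0(1)]] tendsto_diff[OF f0(4)
      tendsto_scaleR[OF tendsto_const f0(2)]]
    by (simp_all add: p1_def p2_def)
  have xs_eq: "xs n = xh + fst (\<zeta> n) + (1 / c) *\<^sub>R p1 n" "ys n = yh + snd (\<zeta> n) + (1 / c) *\<^sub>R p2 n" for n
    using c by (simp_all add: xs_def ys_def j1(2) j2(2))
  have xs_lim: "xs \<longlonglongrightarrow> xh" "ys \<longlonglongrightarrow> yh"
    unfolding xs_eq[abs_def]
    using tendsto_add[OF tendsto_add[OF tendsto_const f0(1)] tendsto_scaleR[OF tendsto_const p10(1)]]
      tendsto_add[OF tendsto_add[OF tendsto_const f0(2)] tendsto_scaleR[OF tendsto_const p10(2)]] by fastforce+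
  \<comment> \<open>\<open>u\<close> and \<open>v\<close> are only semicontinuous; the convergence
    of their values along the sequences comes from the continuity of the sup-convolutions.\<close>
  have cont: "isCont s1 0" "isCont s2 0"
  proof -
    have "continuous_on UNIV (\<lambda>\<xi>. (s1 \<xi> + c / 2 * (norm \<xi>)\<^sup>2) - c / 2 * (norm \<xi>)\<^sup>2)"
      by (intro continuous_on_diff[OF convex_on_continuous[OF open_UNIV cv1]] continuous_intros)
    then show "isCont s1 0" by (simp add: continuous_on_eq_continuous_at)
    have "continuous_on UNIV (\<lambda>\<xi>. (s2 \<xi> + c / 2 * (norm \<xi>)\<^sup>2) - c / 2 * (norm \<xi>)\<^sup>2)"
      by (intro continuous_on_diff[OF convex_on_continuous[OF open_UNIV cv2]] continuous_intros)
    then show "isCont s2 0" by (simp add: continuous_on_eq_continuous_at)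
  qed
  have "u (xs n) = s1 (fst (\<zeta> n)) + c / 2 * (norm ((1 / c) *\<^sub>R p1 n))\<^sup>2 + ph \<bullet> xs n"
    "- v (ys n) = s2 (snd (\<zeta> n)) + c / 2 * (norm ((1 / c) *\<^sub>R p2 n))\<^sup>2 - ph \<bullet> ys n" for n
    using c by (simp_all add: s1 s2 xs_def ys_def j1(2) j2(2) w1_def w2_def)
  moreover have "(\<lambda>n. s1 (fst (\<zeta> n)) + c / 2 * (norm ((1 / c) *\<^sub>R p1 n))\<^sup>2 + ph \<bullet> xs n) \<longlonglongrightarrow> s1 0 + c / 2 * (norm
    ((1 / c) *\<^sub>R (0::real^'n)))\<^sup>2 + ph \<bullet> xh"
    by (intro tendsto_intros isCont_tendsto_compose[OF cont(1)] f0 p10 xs_lim)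
  moreover have "(\<lambda>n. s2 (snd (\<zeta> n)) + c / 2 * (norm ((1 / c) *\<^sub>R p2 n))\<^sup>2 - ph \<bullet> ys n) \<longlonglongrightarrow> s2 0 + c / 2 * (norm
    ((1 / c) *\<^sub>R (0::real^'n)))\<^sup>2 - ph \<bullet> yh"
    by (intro tendsto_intros isCont_tendsto_compose[OF cont(2)] f0 p10 xs_lim)
  ultimately have u_lim: "(\<lambda>n. u (xs n)) \<longlonglongrightarrow> u xh" "(\<lambda>n. - v (ys n)) \<longlonglongrightarrow> - v yh"
    by (simp_all add: s10 s20 w1_def w2_def)
  show thesis
  proof (rule that[of xs ys "\<lambda>n. p1 n + ph" "\<lambda>n. matrix (A1 n)" "\<lambda>n. p2 n + - ph" "\<lambda>n. matrix (A2 n)"])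
    show "(p1 n + ph, matrix (A1 n)) \<in> J2plus K u (xs n)" for n
      unfolding xs_def by (rule J2plus_add_linear[OF j1(1)]) (simp add: w1_def)
    show "(p2 n + - ph, matrix (A2 n)) \<in> J2plus K (\<lambda>y. - v y) (ys n)" for n
      unfolding ys_def by (rule J2plus_add_linear[OF j2(1)]) (simp add: w2_def)
    show "(\<lambda>n. p1 n + ph) \<longlonglongrightarrow> \<alpha> *\<^sub>R (xh - yh)" "(\<lambda>n. p2 n + - ph) \<longlonglongrightarrow> - (\<alpha> *\<^sub>R (xh - yh))"
      using tendsto_add[OF p10(1) tendsto_const[of ph]] tendsto_add[OF p10(2) tendsto_const[of "- ph"]]
      by (simp_all add: ph_def)
    fix n a b
    have e: "a \<bullet> (matrix (A1 n) *v a) + b \<bullet> (matrix (A2 n) *v b) = Q n (a, b) \<bullet> (a, b) - (c + 1) * ((norm a)\<^sup>2 + (norm b)\<^sup>2)"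
      unfolding Q_split by (simp add: matrix_mult_linear[OF A1(1)] matrix_mult_linear[OF A2(1)] inner_commute)
    show "- (3 * \<alpha>) * ((norm a)\<^sup>2 + (norm b)\<^sup>2) \<le> a \<bullet> (matrix (A1 n) *v a) + b \<bullet> (matrix (A2 n) *v b)"
      using Q_ge[of "(a, b)" n] unfolding e nz by (simp add: c_def algebra_simps)
    show "a \<bullet> (matrix (A1 n) *v a) + b \<bullet> (matrix (A2 n) *v b) \<le> 3 * \<alpha> * (norm (a - b))\<^sup>2 + 1 / real (Suc n) *
      ((norm a)\<^sup>2 + (norm b)\<^sup>2)"
      using Q_le[of n "(a, b)"] unfolding e M_q nz by (simp add: c_def algebra_simps)
  qed (use m1 m2 xs_lim u_lim in \<open>auto simp: xs_def ys_def\<close>)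
qed

text \<open>The two-sided bounds on the quadratic forms confine the approximating matrices to a
  compact set; along a subsequence the jets pass to their closures and the error
  \<open>1 / real (Suc k)\<close> disappears. The jet of \<open>v\<close> arises as the negative of
  one of \<open>- v\<close>, which accounts for the sign of \<open>Y\<close>.\<close>

theorem maximum_principle:
  fixes u v :: "real^'n \<Rightarrow> real"
  assumes K: "compact K" and usc: "usc_on K u" and lsc: "lsc_on K v"
    and hat: "xh \<in> K" "yh \<in> K" and \<alpha>: "\<alpha> > 0"
    and max: "\<And>x y. x \<in> K \<Longrightarrow> y \<in> K \<Longrightarrow> u x - v y - \<alpha> / 2 * (norm (x - y))\<^sup>2 \<le> u xh - v yh - \<alpha> / 2 * (norm (xh - yh))\<^sup>2"
  shows "\<exists>X Y. (\<alpha> *\<^sub>R (xh - yh), X) \<in> J2plus_bar K u xh \<and> (\<alpha> *\<^sub>R (xh - yh), Y) \<in> J2minus_bar K v yh \<and>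
    X \<in> sym_mats \<and> Y \<in> sym_mats \<and>
    (- 3 * \<alpha>) *\<^sub>R blockmat (mat 1) 0 0 (mat 1) \<preceq> blockmat X 0 0 (- Y) \<and>
    blockmat X 0 0 (- Y) \<preceq> (3 * \<alpha>) *\<^sub>R blockmat (mat 1) (- mat 1) (- mat 1) (mat 1)"
proof -
  obtain xs ys ps qs Xs Ys where seq: "\<And>k::nat. xs k \<in> K" "\<And>k. ys k \<in> K"
    "\<And>k. (ps k, Xs k) \<in> J2plus K u (xs k)" "\<And>k. (qs k, Ys k) \<in> J2plus K (\<lambda>y. - v y) (ys k)"
    "xs \<longlonglongrightarrow> xh" "ys \<longlonglongrightarrow> yh" "(\<lambda>k. u (xs k)) \<longlonglongrightarrow> u xh" "(\<lambda>k. - v (ys k)) \<longlonglongrightarrow> - v yh"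
    "ps \<longlonglongrightarrow> \<alpha> *\<^sub>R (xh - yh)" "qs \<longlonglongrightarrow> - (\<alpha> *\<^sub>R (xh - yh))"
    and lo: "\<And>k a b. - (3 * \<alpha>) * ((norm a)\<^sup>2 + (norm b)\<^sup>2) \<le> a \<bullet> (Xs k *v a) + b \<bullet> (Ys k *v b)"
    and up: "\<And>k a b. a \<bullet> (Xs k *v a) + b \<bullet> (Ys k *v b) \<le> 3 * \<alpha> * (norm (a - b))\<^sup>2 + 1 / real (Suc k) * ((norm a)\<^sup>2 + (norm b)\<^sup>2)"
    by (rule maximum_principle_approx[OF K usc lsc hat \<alpha> max]) blast+
  have sym: "Xs k \<in> sym_mats" "Ys k \<in> sym_mats" for k
    using seq(3,4)[of k] by (simp_all add: J2plus_iff)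
  define C where "C = 3 * \<alpha> + 1"
  have s1: "1 / real (Suc k) \<le> 1" for k by simp
  have bX: "\<bar>a \<bullet> (Xs k *v a)\<bar> \<le> C * (norm a)\<^sup>2" for k a
  proof -
    have "1 / real (Suc k) * (norm a)\<^sup>2 \<le> 1 * (norm a)\<^sup>2" by (intro mult_right_mono s1) auto
    moreover have "- (3 * \<alpha> * (norm a)\<^sup>2) \<le> a \<bullet> (Xs k *v a)" using lo[of a 0 k] by simp
    moreover have "a \<bullet> (Xs k *v a) \<le> 3 * \<alpha> * (norm a)\<^sup>2 + 1 / real (Suc k) * (norm a)\<^sup>2" using up[of a k 0] by simp
    moreover have "0 \<le> (norm a)\<^sup>2" by simp
    ultimately show ?thesis unfolding C_def distrib_right abs_le_iff by linarith
  qed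
  have bY: "\<bar>b \<bullet> (Ys k *v b)\<bar> \<le> C * (norm b)\<^sup>2" for k b
  proof -
    have "1 / real (Suc k) * (norm b)\<^sup>2 \<le> 1 * (norm b)\<^sup>2" by (intro mult_right_mono s1) auto
    moreover have "- (3 * \<alpha> * (norm b)\<^sup>2) \<le> b \<bullet> (Ys k *v b)" using lo[of 0 b k] by simp
    moreover have "b \<bullet> (Ys k *v b) \<le> 3 * \<alpha> * (norm b)\<^sup>2 + 1 / real (Suc k) * (norm b)\<^sup>2" using up[of 0 k b] by simp
    moreover have "0 \<le> (norm b)\<^sup>2" by simp
    ultimately show ?thesis unfolding C_def distrib_right abs_le_iff by linarith
  qed
  let ?R = "real CARD('n) * (real CARD('n) * C)"
  have "norm (Xs k, Ys k) \<le> ?R + ?R" for k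
    using norm_Pair_le[of "Xs k" "Ys k"] norm_matrix_le_quadratic[OF sym(1) bX, of k]
      norm_matrix_le_quadratic[OF sym(2) bY, of k] by linarith
  then have "bounded (range (\<lambda>k. (Xs k, Ys k)))" by (auto simp: bounded_iff simp del: norm_Pair)
  then obtain L and r :: "nat \<Rightarrow> nat" where r: "strict_mono r" "((\<lambda>k. (Xs k, Ys k)) \<circ> r) \<longlonglongrightarrow> L"
    using bounded_imp_convergent_subsequence by blast
  define X where "X = fst L"
  define Y where "Y = snd L"
  have XL: "(Xs \<circ> r) \<longlonglongrightarrow> X" and YL: "(Ys \<circ> r) \<longlonglongrightarrow> Y"
    using tendsto_fst[OF r(2)] tendsto_snd[OF r(2)] by (simp_all add: o_def X_def Y_def)
  have sub: "(f \<circ> r) \<longlonglongrightarrow> l" if "f \<longlonglongrightarrow> l" for f :: "nat \<Rightarrow> 'z::topological_space" and l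
    using LIMSEQ_subseq_LIMSEQ[OF that r(1)] .
  have "(\<alpha> *\<^sub>R (xh - yh), X) \<in> J2plus_bar K u xh"
    by (rule J2plus_barI[of "xs \<circ> r" K "ps \<circ> r" "Xs \<circ> r"])
      (use seq(1,3) sub[OF seq(5)] sub[OF seq(7)] sub[OF seq(9)] XL in \<open>simp_all add: o_def\<close>)
  moreover have "(- (\<alpha> *\<^sub>R (xh - yh)), Y) \<in> J2plus_bar K (\<lambda>y. - v y) yh"
    by (rule J2plus_barI[of "ys \<circ> r" K "qs \<circ> r" "Ys \<circ> r"])
      (use seq(2,4) sub[OF seq(6)] sub[OF seq(8)] sub[OF seq(10)] YL in \<open>simp_all add: o_def\<close>)
  then have "(\<alpha> *\<^sub>R (xh - yh), - Y) \<in> J2minus_bar K v yh"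
    by (simp add: J2minus_bar_iff_J2plus_bar)
  moreover have "X \<in> sym_mats" by (rule closed_sequentially[OF closed_sym_mats _ XL]) (simp add: sym)
  moreover have "Y \<in> sym_mats" by (rule closed_sequentially[OF closed_sym_mats _ YL]) (simp add: sym)
  then have "- Y \<in> sym_mats" by (simp add: sym_mats_def transpose_def vec_eq_iff)
  moreover have lim: "(\<lambda>k. a \<bullet> (Xs (r k) *v a) + b \<bullet> (Ys (r k) *v b)) \<longlonglongrightarrow> a \<bullet> (X *v a) + b \<bullet> (Y *v b)" for a b
    using tendsto_add[OF tendsto_matrix_quadratic[OF XL] tendsto_matrix_quadratic[OF YL]] by (simp add: o_def)
  have lo': "- (3 * \<alpha>) * ((norm a)\<^sup>2 + (norm b)\<^sup>2) \<le> a \<bullet> (X *v a) + b \<bullet> (Y *v b)" for a b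
    by (rule tendsto_lowerbound[OF lim]) (use lo in auto)
  have up': "a \<bullet> (X *v a) + b \<bullet> (Y *v b) \<le> 3 * \<alpha> * (norm (a - b))\<^sup>2" for a b
  proof -
    have "(\<lambda>k. 1 / real (Suc k)) \<longlonglongrightarrow> 0" using LIMSEQ_inverse_real_of_nat by (simp add: inverse_eq_divide)
    from tendsto_add[OF tendsto_const tendsto_mult[OF sub[OF this] tendsto_const]]
    have "(\<lambda>k. 3 * \<alpha> * (norm (a - b))\<^sup>2 + 1 / real (Suc (r k)) * ((norm a)\<^sup>2 + (norm b)\<^sup>2)) \<longlonglongrightarrow> 3 * \<alpha> * (norm (a
      - b))\<^sup>2 + 0 * ((norm a)\<^sup>2 + (norm b)\<^sup>2)"
      unfolding o_def .
    from LIMSEQ_le[OF lim this] show ?thesis using up by auto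
  qed
  moreover have "(- 3 * \<alpha>) *\<^sub>R blockmat (mat 1) 0 0 (mat 1) \<preceq> blockmat X 0 0 (- (- Y))"
    unfolding loewner_le_def scaleR_matrix_vector_assoc[symmetric] inner_scaleR_right blockmat_quadratic
  proof
    fix \<xi> :: "real^('n + 'n)"
    show "- 3 * \<alpha> * ((\<chi> i. \<xi> $ Inl i) \<bullet> (mat 1 *v (\<chi> i. \<xi> $ Inl i)) + (\<chi> i. \<xi> $ Inl i) \<bullet> (0 *v (\<chi> i. \<xi> $ Inr
      i)) + (\<chi> i. \<xi> $ Inr i) \<bullet> (0 *v (\<chi> i. \<xi> $ Inl i)) + (\<chi> i. \<xi> $ Inr i) \<bullet> (mat 1 *v (\<chi> i. \<xi> $ Inr i)))
      \<le> (\<chi> i. \<xi> $ Inl i) \<bullet> (X *v (\<chi> i. \<xi> $ Inl i)) + (\<chi> i. \<xi> $ Inl i) \<bullet> (0 *v (\<chi> i. \<xi> $ Inr i))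
        + (\<chi> i. \<xi> $ Inr i) \<bullet> (0 *v (\<chi> i. \<xi> $ Inl i)) + (\<chi> i. \<xi> $ Inr i) \<bullet> (- (- Y) *v (\<chi> i. \<xi> $ Inr i))"
      using lo'[of "\<chi> i. \<xi> $ Inl i" "\<chi> i. \<xi> $ Inr i"] by (simp add: dot_square_norm)
  qed
  moreover have "blockmat X 0 0 (- (- Y)) \<preceq> (3 * \<alpha>) *\<^sub>R blockmat (mat 1) (- mat 1) (- mat 1) (mat 1)"
    unfolding loewner_le_def scaleR_matrix_vector_assoc[symmetric] inner_scaleR_right blockmat_quadratic
  proof
    fix \<xi> :: "real^('n + 'n)"
    define a where "a = (\<chi> i. \<xi> $ Inl i)"
    define b where "b = (\<chi> i. \<xi> $ Inr i)"
    have mm: "(- mat 1) *v c = - c" for c :: "real^'n"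
      using matrix_vector_mult_diff_rdistrib[of 0 "mat 1" c] by simp
    have "(norm (a - b))\<^sup>2 = a \<bullet> a - a \<bullet> b - b \<bullet> a + b \<bullet> b"
      unfolding power2_norm_eq_inner by (simp add: inner_diff_left inner_diff_right)
    then show "a \<bullet> (X *v a) + a \<bullet> (0 *v b) + b \<bullet> (0 *v a) + b \<bullet> (- (- Y) *v b)
      \<le> 3 * \<alpha> * (a \<bullet> (mat 1 *v a) + a \<bullet> ((- mat 1) *v b) + b \<bullet> ((- mat 1) *v a) + b \<bullet> (mat 1 *v b))"
      using up'[of a b] by (simp add: mm)
  qed
  ultimately show ?thesis by blast
qed

section \<open>Domains with the exterior ball property\<close>

lemma norm_diff_square:
  fixes a b :: "'a::real_inner"
  shows "(norm (a - b))\<^sup>2 = (norm a)\<^sup>2 - 2 * (a \<bullet> b) + (norm b)\<^sup>2"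
  unfolding power2_norm_eq_inner inner_diff_left inner_diff_right inner_commute[of b a] by simp

text \<open>The geometric data alone. \<open>n\<close> is prescribed pointwise as an outward normal;
  its continuity is derived in \<open>continuous_on_n\<close>.\<close>

locale exterior_ball_domain =
  fixes \<Omega> :: "(real^'n) set" and n :: "real^'n \<Rightarrow> real^'n" and r\<^sub>0 :: real
  assumes open_\<Omega>: "open \<Omega>"
    and normal: "\<And>x. x \<in> frontier \<Omega> \<Longrightarrow> outward_unit_normal \<Omega> x (n x)"
    and compact_closure: "compact (closure \<Omega>)"
    and manifold: "C1_submanifold_with_boundary (closure \<Omega>)"
    and r\<^sub>0: "r\<^sub>0 > 0"
    and exterior_ball: "\<And>x. x \<in> frontier \<Omega> \<Longrightarrow> cball (x + r\<^sub>0 *\<^sub>R n x) r\<^sub>0 \<inter> \<Omega> = {}"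
begin

lemma norm_n: "x \<in> frontier \<Omega> \<Longrightarrow> norm (n x) = 1"
  using normal by (simp add: outward_unit_normal_def)

lemma closure_eq: "closure \<Omega> = \<Omega> \<union> frontier \<Omega>"
  by (rule closure_Un_frontier)

lemma not_frontier: "x \<in> \<Omega> \<Longrightarrow> x \<notin> frontier \<Omega>"
  using open_\<Omega> by (simp add: frontier_def interior_open)

text \<open>Disjointness from an open set passes from \<open>\<Omega>\<close> to its closure. The
  closed exterior ball, in contrast, does meet the closure, namely at the boundary point it belongs
  to.\<close>

lemma closure_outside_ball:
  assumes "ball c \<rho> \<inter> \<Omega> = {}" "y \<in> closure \<Omega>"
  shows "\<rho> \<le> norm (y - c)"
proof (rule ccontr)
  assume "\<not> ?thesis"
  then have "y \<in> ball c \<rho>" by (simp add: dist_norm norm_minus_commute)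
  then show False using assms open_Int_closure_eq_empty[OF open_ball, of c \<rho> \<Omega>] by blast
qed

lemma exterior_ball_inner:
  assumes "ball (x + \<rho> *\<^sub>R \<nu>) \<rho> \<inter> \<Omega> = {}" "y \<in> closure \<Omega>" "norm \<nu> = 1" "\<rho> > 0"
  shows "\<nu> \<bullet> (y - x) \<le> (norm (y - x))\<^sup>2 / (2 * \<rho>)"
proof -
  have "\<rho> \<le> norm ((y - x) - \<rho> *\<^sub>R \<nu>)"
    using closure_outside_ball[OF assms(1,2)] by (simp add: algebra_simps)
  then have "\<rho>\<^sup>2 \<le> (norm ((y - x) - \<rho> *\<^sub>R \<nu>))\<^sup>2" using assms(4) by (intro power_mono) auto
  also have "\<dots> = (norm (y - x))\<^sup>2 - 2 * \<rho> * (\<nu> \<bullet> (y - x)) + \<rho>\<^sup>2 * (norm \<nu>)\<^sup>2"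
    unfolding norm_diff_square[of "y - x"] by (simp add: inner_commute[of "y - x" \<nu>] power_mult_distrib)
  finally show ?thesis using assms(3,4) by (simp add: field_simps)
qed

lemma n_inner_le: "x \<in> frontier \<Omega> \<Longrightarrow> y \<in> closure \<Omega> \<Longrightarrow> n x \<bullet> (y - x) \<le> (norm (y - x))\<^sup>2 / (2 * r\<^sub>0)"
  by (rule exterior_ball_inner) (use exterior_ball r\<^sub>0 norm_n ball_subset_cball in blast)+

text \<open>The paraboloid bound \<open>exterior_ball_inner\<close> along
  \<open>t *\<^sub>R w\<close>, divided by \<open>t\<close>: a direction entering the closure cannot
  point into the exterior ball.\<close>

lemma direction_nonpos_of_exterior_ball:
  assumes "ball (x + \<rho> *\<^sub>R \<nu>) \<rho> \<inter> \<Omega> = {}" "norm \<nu> = 1" "\<rho> > 0"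
    and "\<forall>\<^sub>F t in at_right 0. x + t *\<^sub>R w \<in> closure \<Omega>"
  shows "\<nu> \<bullet> w \<le> 0"
proof -
  have "\<forall>\<^sub>F t in at_right 0. \<nu> \<bullet> w \<le> t * ((norm w)\<^sup>2 / (2 * \<rho>))"
    using assms(4) eventually_at_right_less[of 0]
  proof eventually_elim
    case (elim t)
    have "t * (\<nu> \<bullet> w) \<le> t * (t * ((norm w)\<^sup>2 / (2 * \<rho>)))"
      using exterior_ball_inner[OF assms(1) elim(1) assms(2,3)] elim(2) by (simp add: power_mult_distrib power2_eq_square[of t])
    then show ?case by (simp only: mult_le_cancel_left_pos[OF elim(2)])
  qed
  moreover have "((\<lambda>t. t * ((norm w)\<^sup>2 / (2 * \<rho>))) \<longlongrightarrow> 0 * ((norm w)\<^sup>2 / (2 * \<rho>))) (at_right 0)"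
    by (intro tendsto_intros)
  ultimately have "\<nu> \<bullet> w \<le> 0 * ((norm w)\<^sup>2 / (2 * \<rho>))" by (intro tendsto_lowerbound) auto
  then show ?thesis by simp
qed

text \<open>A chart shows that the directions into the closure of \<open>\<Omega>\<close> contain an open half-space
  \<open>{w. 0 < a \<bullet> w}\<close>; the exterior ball forces \<open>a\<close> to be a negative multiple of \<open>n x\<close>.\<close>

lemma inward_direction:
  assumes x: "x \<in> frontier \<Omega>" and w: "n x \<bullet> w < 0"
  shows "\<forall>\<^sub>F t in at_right 0. x + t *\<^sub>R w \<in> closure \<Omega>"
proof -
  let ?M = "closure \<Omega>"
  have xM: "x \<in> ?M" using x by (simp add: closure_eq)
  obtain U W and \<phi> \<psi> :: "real^'n \<Rightarrow> real^'n" and k where ch: "open U" "x \<in> U" "open W" "homeomorphism U W \<phi> \<psi>"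
    "C1_on U \<phi>" "C1_on W \<psi>"
    "\<phi> ` (U \<inter> ?M) = W \<inter> {y. 0 \<le> y $ k}"
    using manifold xM unfolding C1_submanifold_with_boundary_def by metis
  have inM: "y \<in> ?M" if "y \<in> U" "0 \<le> \<phi> y $ k" for y
  proof -
    have "\<phi> y \<in> \<phi> ` (U \<inter> ?M)" unfolding ch(7) using that homeomorphism_image1[OF ch(4)] by blast
    then obtain y' where y': "y' \<in> U \<inter> ?M" "\<phi> y = \<phi> y'" by blast
    have "y = y'"
      using homeomorphism_apply1[OF ch(4) that(1)] homeomorphism_apply1[OF ch(4) IntD1[OF y'(1)]] y'(2) by (metis (no_types))
    then show ?thesis using y'(1) by blast
  qed
  obtain D where D: "(\<phi> has_derivative D) (at x)" using ch(2,5) unfolding C1_on_def by blast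
  have cont: "isCont \<phi> x" using D has_derivative_continuous by blast
  have line: "((\<lambda>t. x + t *\<^sub>R v) \<longlongrightarrow> x) (at_right 0)" for v
  proof -
    have "((\<lambda>t. x + t *\<^sub>R v) \<longlongrightarrow> x + 0 *\<^sub>R v) (at_right 0)" by (intro tendsto_intros)
    then show ?thesis by simp
  qed
  have evU: "\<forall>\<^sub>F t in at_right 0. x + t *\<^sub>R v \<in> U" for v
    using topological_tendstoD[OF line ch(1,2)] .
  have "\<phi> x \<in> \<phi> ` (U \<inter> ?M)" using ch(2) xM by (intro imageI IntI)
  then have "0 \<le> \<phi> x $ k" unfolding ch(7) by simp
  \<comment> \<open>A positive value would keep \<open>x + t *\<^sub>R n x\<close> in the closure
    for small \<open>t\<close>, against the choice of \<open>n x\<close>.\<close>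
  moreover have "\<not> 0 < \<phi> x $ k"
  proof
    assume pos: "0 < \<phi> x $ k"
    have "((\<lambda>t. \<phi> (x + t *\<^sub>R n x) $ k) \<longlongrightarrow> \<phi> x $ k) (at_right 0)"
      by (intro tendsto_vec_nth isCont_tendsto_compose[OF cont] line)
    then have "\<forall>\<^sub>F t in at_right 0. 0 < \<phi> (x + t *\<^sub>R n x) $ k" using pos by (rule order_tendstoD(1))
    moreover have "\<forall>\<^sub>F t in at_right 0. x + t *\<^sub>R n x \<notin> ?M"
      using normal[OF x] by (simp add: outward_unit_normal_def)
    ultimately have "\<forall>\<^sub>F t in at_right (0::real). False"
      using evU[of "n x"] by eventually_elim (use inM less_imp_le in blast)
    then show False by simp
  qed
  ultimately have zero: "\<phi> x $ k = 0" by simp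
  \<comment> \<open>The gradient at \<open>x\<close> of the coordinate that straightens the
    boundary.\<close>
  define a where "a = adjoint D (axis k 1)"
  have lin: "linear D" using D has_derivative_linear by blast
  have Da: "D v $ k = a \<bullet> v" for v
    using adjoint_works[OF lin, of v "axis k 1"] by (simp add: a_def inner_axis inner_commute)
  have into: "\<forall>\<^sub>F t in at_right 0. x + t *\<^sub>R v \<in> ?M" if "a \<bullet> v > 0" for v
  proof -
    have "((\<lambda>t. x + t *\<^sub>R v) has_derivative (\<lambda>s. s *\<^sub>R v)) (at 0)" by (auto intro!: derivative_eq_intros)
    moreover have "(\<phi> has_derivative D) (at (x + 0 *\<^sub>R v))" using D by simp
    ultimately have "((\<lambda>t. \<phi> (x + t *\<^sub>R v)) has_derivative (\<lambda>s. D (s *\<^sub>R v))) (at 0)"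
      by (rule has_derivative_compose)
    from bounded_linear.has_derivative[OF bounded_linear_vec_nth this, of k]
    have "((\<lambda>t. \<phi> (x + t *\<^sub>R v) $ k) has_real_derivative a \<bullet> v) (at 0)"
      by (simp add: has_field_derivative_def linear_scale[OF lin] Da mult_commute_abs)
    then have "((\<lambda>h. \<phi> (x + h *\<^sub>R v) $ k / h) \<longlongrightarrow> a \<bullet> v) (at 0)" by (simp add: DERIV_def zero)
    then have "((\<lambda>h. \<phi> (x + h *\<^sub>R v) $ k / h) \<longlongrightarrow> a \<bullet> v) (at_right 0)"
      by (rule filterlim_mono) (auto simp: at_le)
    then have "\<forall>\<^sub>F h in at_right 0. 0 < \<phi> (x + h *\<^sub>R v) $ k / h" using that by (rule order_tendstoD(1))
    then show ?thesis using evU[of v] eventually_at_right_less[of 0]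
      by eventually_elim (auto intro!: inM simp: zero_less_divide_iff)
  qed
  \<comment> \<open>The inverse chart is differentiable too, so \<open>D\<close> is invertible and
    its \<open>k\<close>-th row cannot vanish.\<close>
  have "a \<noteq> 0"
  proof
    assume "a = 0"
    have "\<phi> x \<in> W" using ch(2) homeomorphism_image1[OF ch(4)] by blast
    then obtain E where E: "(\<psi> has_derivative E) (at (\<phi> x))" using ch(6) unfolding C1_on_def by blast
    have "((\<lambda>y. \<psi> (\<phi> y)) has_derivative (\<lambda>h. E (D h))) (at x)" by (rule has_derivative_compose[OF D E])
    moreover have "((\<lambda>y. \<psi> (\<phi> y)) has_derivative (\<lambda>h. h)) (at x)"
    proof (rule has_derivative_transform_within_open[OF has_derivative_ident ch(1,2)])
      show "y = \<psi> (\<phi> y)" if "y \<in> U" for y using homeomorphism_apply1[OF ch(4) that] by simp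
    qed
    ultimately have "(\<lambda>h. E (D h)) = (\<lambda>h. h)" by (rule has_derivative_unique)
    then have "inj D" by (metis injI)
    then have "surj D" using lin by (simp add: linear_injective_imp_surjective)
    then obtain v where "D v = axis k 1" by (metis surjD)
    then have "D v $ k = 1" by simp
    then show False using Da[of v] \<open>a = 0\<close> by simp
  qed
  have ext: "ball (x + r\<^sub>0 *\<^sub>R n x) r\<^sub>0 \<inter> \<Omega> = {}" using exterior_ball[OF x] ball_subset_cball by blast
  have np: "n x \<bullet> v \<le> 0" if "a \<bullet> v > 0" for v
    by (rule direction_nonpos_of_exterior_ball[OF ext norm_n[OF x] r\<^sub>0 into[OF that]])
  have "a \<bullet> w > 0"
  proof (rule ccontr)
    assume neg: "\<not> a \<bullet> w > 0"
    \<comment> \<open>Adding \<open>e *\<^sub>R a\<close> to \<open>- w\<close> makes the product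
      with \<open>a\<close> positive, and \<open>e\<close> is small enough to change the product
      with \<open>n x\<close> by at most half of its value.\<close>
    define e where "e = - (n x \<bullet> w) / (2 * (\<bar>n x \<bullet> a\<bar> + 1))"
    have e: "e > 0" unfolding e_def by (rule divide_pos_pos) (use w in auto)
    have "0 < e * (a \<bullet> a)" using e \<open>a \<noteq> 0\<close> by simp
    then have "a \<bullet> (e *\<^sub>R a - w) > 0" using neg by (simp add: inner_diff_right)
    then have "n x \<bullet> (e *\<^sub>R a - w) \<le> 0" by (rule np)
    moreover have "\<bar>e * (n x \<bullet> a)\<bar> \<le> - (n x \<bullet> w) / 2"
    proof -
      have "\<bar>e * (n x \<bullet> a)\<bar> \<le> e * (\<bar>n x \<bullet> a\<bar> + 1)" using e by (simp add: abs_mult)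
      also have "\<dots> = - (n x \<bullet> w) / 2"
      proof -
        have "\<bar>n x \<bullet> a\<bar> + 1 \<noteq> 0" by linarith
        then show ?thesis unfolding e_def times_divide_eq_left by (rule mult_divide_mult_cancel_right)
      qed
      finally show ?thesis .
    qed
    ultimately show False using w by (simp add: inner_diff_right abs_le_iff)
  qed
  then show ?thesis by (rule into)
qed

text \<open>If \<open>\<nu>\<close> differed from \<open>n x\<close>, the direction
  \<open>\<nu> - n x\<close> would enter the closure by \<open>inward_direction\<close> and at the
  same time point into the ball belonging to \<open>\<nu>\<close>.\<close>

lemma exterior_direction_unique:
  assumes x: "x \<in> frontier \<Omega>" and "norm \<nu> = 1" "\<rho> > 0" "ball (x + \<rho> *\<^sub>R \<nu>) \<rho> \<inter> \<Omega> = {}"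
  shows "\<nu> = n x"
proof (rule ccontr)
  assume ne: "\<nu> \<noteq> n x"
  have "(norm (\<nu> - n x))\<^sup>2 = 2 - 2 * (n x \<bullet> \<nu>)"
    using assms(2) norm_n[OF x] unfolding power2_norm_eq_inner inner_diff_left inner_diff_right
    by (simp add: dot_square_norm inner_commute)
  moreover have "(norm (\<nu> - n x))\<^sup>2 > 0" using ne by simp
  ultimately have lt: "n x \<bullet> \<nu> < 1" by linarith
  have "n x \<bullet> (\<nu> - n x) < 0" using lt norm_n[OF x] by (simp add: inner_diff_right dot_square_norm)
  then have "\<nu> \<bullet> (\<nu> - n x) \<le> 0"
    using direction_nonpos_of_exterior_ball[OF assms(4,2,3)] inward_direction[OF x] by blast
  then show False using lt assms(2) by (simp add: inner_diff_right dot_square_norm inner_commute)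
qed

text \<open>A limit of exterior ball directions is again one, because the radius is uniform, and
  \<open>exterior_direction_unique\<close> identifies it. Hence the graph is closed, which for
  values in the compact unit sphere is continuity.\<close>

lemma continuous_on_n: "continuous_on (frontier \<Omega>) n"
proof -
  let ?S = "frontier \<Omega>" and ?T = "sphere (0 :: real^'n) 1"
  have "closed ((\<lambda>x. (x, n x)) ` ?S)"
    unfolding closed_sequential_limits
  proof (intro allI impI, elim conjE)
    fix z l assume z: "\<forall>k. z k \<in> (\<lambda>x. (x, n x)) ` ?S" and l: "z \<longlonglongrightarrow> l"
    have zk: "fst (z k) \<in> ?S" "snd (z k) = n (fst (z k))" for k using z by (metis (no_types, lifting) fst_conv imageE snd_conv)+
    have l1: "(\<lambda>k. fst (z k)) \<longlonglongrightarrow> fst l" and l2: "(\<lambda>k. snd (z k)) \<longlonglongrightarrow> snd l"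
      using tendsto_fst[OF l] tendsto_snd[OF l] .
    have f: "fst l \<in> ?S" using closed_sequentially[OF frontier_closed _ l1] zk(1) by blast
    have n1: "norm (snd l) = 1"
    proof -
      have "(\<lambda>k. norm (snd (z k))) \<longlonglongrightarrow> norm (snd l)" by (rule tendsto_norm[OF l2])
      moreover have "norm (snd (z k)) = 1" for k using zk norm_n by simp
      ultimately show ?thesis by (simp add: LIMSEQ_const_iff)
    qed
    have "ball (fst l + r\<^sub>0 *\<^sub>R snd l) r\<^sub>0 \<inter> \<Omega> = {}"
    proof (rule ccontr)
      assume "\<not> ?thesis"
      then obtain y where y: "norm (y - (fst l + r\<^sub>0 *\<^sub>R snd l)) < r\<^sub>0" "y \<in> \<Omega>"
        by (auto simp: dist_norm norm_minus_commute)
      have "(\<lambda>k. norm (y - (fst (z k) + r\<^sub>0 *\<^sub>R snd (z k)))) \<longlonglongrightarrow> norm (y - (fst l + r\<^sub>0 *\<^sub>R snd l))"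
        by (intro tendsto_intros l1 l2)
      then have "\<forall>\<^sub>F k in sequentially. norm (y - (fst (z k) + r\<^sub>0 *\<^sub>R snd (z k))) < r\<^sub>0"
        using y(1) by (rule order_tendstoD(2))
      then obtain k where "norm (y - (fst (z k) + r\<^sub>0 *\<^sub>R snd (z k))) < r\<^sub>0" by (auto simp: eventually_sequentially)
      then have "y \<in> cball (fst (z k) + r\<^sub>0 *\<^sub>R n (fst (z k))) r\<^sub>0" using zk(2)[of k]
        by (simp add: dist_norm norm_minus_commute)
      then show False using exterior_ball[OF zk(1)[of k]] y(2) by blast
    qed
    then have "snd l = n (fst l)" using exterior_direction_unique[OF f n1 r\<^sub>0] by blast
    then show "l \<in> (\<lambda>x. (x, n x)) ` ?S" by (intro image_eqI[OF _ f] prod_eqI) simp_all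
  qed
  then have "closedin (top_of_set (?S \<times> ?T)) ((\<lambda>x. (x, n x)) ` ?S)"
    by (intro closed_subset) (use norm_n in \<open>auto simp: mem_sphere\<close>)
  moreover have "n \<in> ?S \<rightarrow> ?T" using norm_n by simp
  ultimately show ?thesis
    using continuous_closed_graph_eq[OF compact_sphere] by blast
qed

text \<open>The polar of an open half-space is a ray. The tangential part \<open>e'\<close> of
  \<open>e\<close> is tested against itself, pushed into the half-space by a small multiple of
  \<open>- \<nu>\<close>.\<close>

lemma normal_cone:
  fixes e \<nu> :: "real^'n"
  assumes "norm \<nu> = 1" "\<And>w. \<nu> \<bullet> w < 0 \<Longrightarrow> e \<bullet> w \<le> 0"
  shows "\<exists>c\<ge>0. e = c *\<^sub>R \<nu>"
proof (intro exI[of _ "e \<bullet> \<nu>"] conjI)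
  define l where "l = e \<bullet> \<nu>"
  define e' where "e' = e - l *\<^sub>R \<nu>"
  have nn: "\<nu> \<bullet> \<nu> = 1" using assms(1) by (simp add: dot_square_norm)
  show "0 \<le> e \<bullet> \<nu>" using assms(2)[of "- \<nu>"] nn by simp
  have "(norm e')\<^sup>2 \<le> 0 + s" if "s > 0" for s
  proof -
    define t where "t = s / (\<bar>l\<bar> + 1)"
    have t: "t > 0" using that by (simp add: t_def)
    have o: "\<nu> \<bullet> e' = 0" using nn by (simp add: e'_def l_def inner_diff_right inner_commute)
    have e: "e = e' + l *\<^sub>R \<nu>" by (simp add: e'_def)
    have "e \<bullet> (e' - t *\<^sub>R \<nu>) \<le> 0" using o nn t by (intro assms(2)) (simp add: inner_diff_right)
    moreover have "e \<bullet> (e' - t *\<^sub>R \<nu>) = (norm e')\<^sup>2 - t * l"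
      unfolding e inner_add_left inner_diff_right inner_scaleR_left inner_scaleR_right inner_commute[of e' \<nu>] o nn
      by (simp add: dot_square_norm)
    moreover have "t * l \<le> t * (\<bar>l\<bar> + 1)" using t by (intro mult_left_mono) auto
    moreover have "t * (\<bar>l\<bar> + 1) = s" by (simp add: t_def)
    ultimately show ?thesis by simp
  qed
  then have "(norm e')\<^sup>2 \<le> 0" by (rule field_le_epsilon)
  then show "e = (e \<bullet> \<nu>) *\<^sub>R \<nu>" by (simp add: e'_def l_def)
qed

end

section \<open>Perturbation of semijets\<close>

lemma J2plus_mono:
  assumes "(p, X) \<in> J2plus S u z" "w z = u z" "\<rho> > 0" "\<And>x. x \<in> S \<Longrightarrow> norm (x - z) < \<rho> \<Longrightarrow> w x \<le> u x"
  shows "(p, X) \<in> J2plus S w z"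
  unfolding J2plus_iff
proof (intro conjI allI impI)
  show "X \<in> sym_mats" using assms(1) by (simp add: J2plus_iff)
  fix e :: real assume "e > 0"
  then obtain r where r: "r > 0" "\<And>x. x \<in> S \<Longrightarrow> norm (x - z) < r \<Longrightarrow> u x \<le> u z + p \<bullet> (x - z) + ((X *v (x
    - z)) \<bullet> (x - z)) / 2 + e * (norm (x - z))\<^sup>2"
    using assms(1) unfolding J2plus_iff by blast
  show "\<exists>r>0. \<forall>x\<in>S. norm (x - z) < r \<longrightarrow> w x \<le> w z + p \<bullet> (x - z) + ((X *v (x - z)) \<bullet> (x - z)) / 2 + e * (norm (x - z))\<^sup>2"
    using r assms(2-4) by (intro exI[of _ "min r \<rho>"]) (auto intro: order_trans)
qed

lemma scaled_identity_quadratic: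
  fixes X :: "real^'n^'n"
  shows "((X + s *\<^sub>R mat 1) *v k) \<bullet> k = (X *v k) \<bullet> k + s * (norm k)\<^sup>2"
  by (simp add: matrix_vector_mult_add_rdistrib scaleR_matrix_vector_assoc[symmetric] inner_add_left dot_square_norm)

lemma sym_mats_add_scaled_identity: "X \<in> sym_mats \<Longrightarrow> X + s *\<^sub>R mat 1 \<in> sym_mats"
  by (auto simp: sym_mats_def transpose_def vec_eq_iff mat_def)

lemma sym_mats_uminus: "- X \<in> sym_mats \<longleftrightarrow> X \<in> sym_mats"
  by (auto simp: sym_mats_def transpose_def vec_eq_iff)

text \<open>The Hessian changes to which (4) is applied are multiples of the identity, so this is
  the spectral norm to be evaluated.\<close>

lemma spec_norm_scaled_identity: "spec_norm (s *\<^sub>R mat 1 :: real^'n^'n) = \<bar>s\<bar>"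
proof -
  have "eigenvalues (s *\<^sub>R mat 1 :: real^'n^'n) = {s}"
  proof (rule set_eqI, rule iffI)
    fix c assume "c \<in> eigenvalues (s *\<^sub>R mat 1 :: real^'n^'n)"
    then obtain v :: "real^'n" where v: "v \<noteq> 0" "s *\<^sub>R v = c *\<^sub>R v"
      by (auto simp: eigenvalues_def scaleR_matrix_vector_assoc[symmetric])
    then show "c \<in> {s}" by simp
  next
    fix c assume "c \<in> {s}"
    moreover have "axis undefined 1 \<noteq> (0 :: real^'n)" by (simp add: axis_eq_0_iff)
    ultimately show "c \<in> eigenvalues (s *\<^sub>R mat 1 :: real^'n^'n)"
      by (auto simp: eigenvalues_def scaleR_matrix_vector_assoc[symmetric])
  qed
  then show ?thesis by (simp add: spec_norm_def)
qed

text \<open>Upper jets ask only for upper expansions, so a multiple of the identity above the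
  Hessian of \<open>\<psi>\<close> may stand for that Hessian; its \<open>spec_norm\<close> is
  explicit.\<close>

lemma J2plus_perturb:
  fixes z :: "real^'n"
  assumes a: "(p, X) \<in> J2plus S a z"
    and \<psi>: "\<And>e. e > 0 \<Longrightarrow> \<exists>\<rho>>0. \<forall>x. norm (x - z) < \<rho> \<longrightarrow> \<psi> x \<le> \<psi> z + q \<bullet> (x - z) + (s / 2 + e) * (norm (x - z))\<^sup>2"
  shows "(p + q, X + s *\<^sub>R mat 1) \<in> J2plus S (\<lambda>x. a x + \<psi> x) z"
  unfolding J2plus_iff scaled_identity_quadratic
proof (intro conjI allI impI)
  show "X + s *\<^sub>R mat 1 \<in> sym_mats" using a by (simp add: J2plus_iff sym_mats_add_scaled_identity)
  fix e :: real assume e: "e > 0"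
  then obtain r where r: "r > 0" "\<And>x. x \<in> S \<Longrightarrow> norm (x - z) < r \<Longrightarrow> a x \<le> a z + p \<bullet> (x - z) + ((X *v (x
    - z)) \<bullet> (x - z)) / 2 + (e / 2) * (norm (x - z))\<^sup>2"
    using a unfolding J2plus_iff by (meson half_gt_zero)
  obtain \<rho> where \<rho>: "\<rho> > 0" "\<And>x. norm (x - z) < \<rho> \<Longrightarrow> \<psi> x \<le> \<psi> z + q \<bullet> (x - z) + (s / 2 + e / 2) * (norm (x - z))\<^sup>2"
    using \<psi>[of "e / 2"] e by auto
  show "\<exists>r>0. \<forall>x\<in>S. norm (x - z) < r \<longrightarrow> a x + \<psi> x \<le> a z + \<psi> z + (p + q) \<bullet> (x - z) + ((X *v (x - z)) \<bullet> (x - z)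
    + s * (norm (x - z))\<^sup>2) / 2 + e * (norm (x - z))\<^sup>2"
  proof (intro exI[of _ "min r \<rho>"] conjI ballI impI)
    fix x assume x: "x \<in> S" "norm (x - z) < min r \<rho>"
    have "a x + \<psi> x \<le> (a z + p \<bullet> (x - z) + ((X *v (x - z)) \<bullet> (x - z)) / 2 + (e / 2) * (norm (x - z))\<^sup>2) + (\<psi> z
      + q \<bullet> (x - z) + (s / 2 + e / 2) * (norm (x - z))\<^sup>2)"
      using r(2)[of x] \<rho>(2)[of x] x by (intro add_mono) auto
    also have "\<dots> = a z + \<psi> z + (p + q) \<bullet> (x - z) + ((X *v (x - z)) \<bullet> (x - z) + s * (norm (x - z))\<^sup>2) / 2 + e * (norm (x - z))\<^sup>2"
      unfolding inner_add_left by (simp add: field_simps)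
    finally show "a x + \<psi> x \<le> a z + \<psi> z + (p + q) \<bullet> (x - z) + ((X *v (x - z)) \<bullet> (x - z) + s * (norm (x
      - z))\<^sup>2) / 2 + e * (norm (x - z))\<^sup>2" .
  qed (use r \<rho> in auto)
qed

text \<open>In a closure of jets the base point varies, so the upper expansion of
  \<open>\<psi>\<close> is assumed at every point, with coefficients that are continuous at the
  limit.\<close>

lemma J2plus_bar_perturb:
  fixes z :: "real^'n" and q :: "real^'n \<Rightarrow> real^'n"
  assumes a: "(p, X) \<in> J2plus_bar S a z"
    and \<psi>: "\<And>z e. e > 0 \<Longrightarrow> \<exists>\<rho>>0. \<forall>x. norm (x - z) < \<rho> \<longrightarrow> \<psi> x \<le> \<psi> z + q z \<bullet> (x - z) + (s z / 2 + e) * (norm (x - z))\<^sup>2"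
    and cont: "isCont \<psi> z" "isCont q z" "isCont s z"
  shows "(p + q z, X + s z *\<^sub>R mat 1) \<in> J2plus_bar S (\<lambda>x. a x + \<psi> x) z"
proof -
  obtain xs ps Xs where seq: "\<And>k::nat. xs k \<in> S" "\<And>k. (ps k, Xs k) \<in> J2plus S a (xs k)"
    "xs \<longlonglongrightarrow> z" "(\<lambda>k. a (xs k)) \<longlonglongrightarrow> a z" "ps \<longlonglongrightarrow> p" "Xs \<longlonglongrightarrow> X"
    using J2plus_barE[OF a] by blast
  show ?thesis
  proof (rule J2plus_barI[of xs S "\<lambda>k. ps k + q (xs k)" "\<lambda>k. Xs k + s (xs k) *\<^sub>R mat 1"])
    show "(ps k + q (xs k), Xs k + s (xs k) *\<^sub>R mat 1) \<in> J2plus S (\<lambda>x. a x + \<psi> x) (xs k)" for k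
      by (rule J2plus_perturb[OF seq(2) \<psi>])
  qed (intro seq(1,3) tendsto_intros seq(4-6) isCont_tendsto_compose[OF _ seq(3)] cont)+
qed

text \<open>The Hessian of the fourth power has largest eigenvalue
  \<open>12 * (norm (z - c))\<^sup>2\<close>, belonging to the radial direction. It vanishes at the
  centre, which is why the comparison proof localises with fourth powers and not with squares: their
  contribution to (4) can be made small.\<close>

lemma quartic_expansion:
  fixes c z :: "'a::real_inner"
  assumes "e > 0"
  shows "\<exists>\<rho>>0. \<forall>x. norm (x - z) < \<rho> \<longrightarrow>
    norm (x - c) ^ 4 \<le> norm (z - c) ^ 4 + (4 * (norm (z - c))\<^sup>2) *\<^sub>R (z - c) \<bullet> (x - z) + (12 * (norm (z
      - c))\<^sup>2 / 2 + e) * (norm (x - z))\<^sup>2"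
proof -
  define Y where "Y = norm (z - c)"
  define \<rho> where "\<rho> = min 1 (e / (4 * Y + 1))"
  have Y: "Y \<ge> 0" by (simp add: Y_def)
  have \<rho>: "\<rho> > 0" "\<rho> \<le> 1" "\<rho> \<le> e / (4 * Y + 1)" using assms Y by (auto simp: \<rho>_def)
  have "norm (x - c) ^ 4 \<le> Y ^ 4 + (4 * Y\<^sup>2) *\<^sub>R (z - c) \<bullet> (x - z) + (12 * Y\<^sup>2 / 2 + e) * (norm (x - z))\<^sup>2"
    if x: "norm (x - z) < \<rho>" for x
  proof -
    define K where "K = norm (x - z)"
    define d where "d = (z - c) \<bullet> (x - z)"
    have K: "K \<ge> 0" "K \<le> \<rho>" using x by (auto simp: K_def)
    have d: "\<bar>d\<bar> \<le> Y * K" unfolding d_def Y_def K_def by (rule Cauchy_Schwarz_ineq2)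
    have "x - c = (z - c) + (x - z)" by simp
    then have "(norm (x - c))\<^sup>2 = Y\<^sup>2 + 2 * d + K\<^sup>2"
      unfolding Y_def K_def d_def power2_norm_eq_inner
        by (simp only: inner_add_left inner_add_right inner_commute[of "x - z" "z - c"])
    then have "norm (x - c) ^ 4 = (Y\<^sup>2 + 2 * d + K\<^sup>2)\<^sup>2" by (metis power_mult numeral_Bit0 mult_2_right power_even_eq)
    also have "\<dots> = Y ^ 4 + 4 * Y\<^sup>2 * d + 2 * Y\<^sup>2 * K\<^sup>2 + 4 * d\<^sup>2 + 4 * d * K\<^sup>2 + (K\<^sup>2)\<^sup>2"
      by (simp add: power2_eq_square power4_eq_xxxx algebra_simps)
    also have "4 * d\<^sup>2 \<le> 4 * (Y\<^sup>2 * K\<^sup>2)"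
    proof -
      have "d\<^sup>2 \<le> (Y * K)\<^sup>2" using d by (rule abs_le_square_iff[THEN iffD1, OF order_trans]) (use Y K in simp)
      then show ?thesis by (simp add: power_mult_distrib)
    qed
    also have "4 * d * K\<^sup>2 \<le> 4 * Y * K * K\<^sup>2"
      using d K by (intro mult_right_mono) auto
    finally have "norm (x - c) ^ 4 \<le> Y ^ 4 + 4 * Y\<^sup>2 * d + 6 * Y\<^sup>2 * K\<^sup>2 + (4 * Y * K + K\<^sup>2) * K\<^sup>2"
      by (simp add: algebra_simps power2_eq_square)
    also have "(4 * Y * K + K\<^sup>2) * K\<^sup>2 \<le> e * K\<^sup>2"
    proof (rule mult_right_mono)
      have "K\<^sup>2 \<le> K" using K \<rho>(2) by (simp add: power2_eq_square mult_left_le)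
      then have "4 * Y * K + K\<^sup>2 \<le> (4 * Y + 1) * K" by (simp add: algebra_simps)
      also have "\<dots> \<le> (4 * Y + 1) * (e / (4 * Y + 1))" using K \<rho>(3) Y by (intro mult_left_mono) auto
      also have "\<dots> = e" using Y by simp
      finally show "4 * Y * K + K\<^sup>2 \<le> e" .
    qed simp
    finally show ?thesis by (simp add: d_def K_def algebra_simps)
  qed
  then show ?thesis using \<rho>(1) unfolding Y_def by blast
qed

context exterior_ball_domain
begin

text \<open>Jets of functions with a quadratic lower support: at boundary points the gradient
  of the support may only be corrected in the direction \<open>- n x\<close>, which is what makes
  \<open>n x \<bullet> p\<close> monotone under touching from above.\<close>

lemma J2plus_lower_support:
  assumes J: "(q, Y) \<in> J2plus (closure \<Omega>) g x"
    and low: "\<rho> > 0" "\<And>y. y \<in> closure \<Omega> \<Longrightarrow> norm (y - x) < \<rho> \<Longrightarrow> g x + d \<bullet> (y - x) + ((Z *v (y - x)) \<bullet> (y - x)) / 2 \<le> g y"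
  shows "x \<in> frontier \<Omega> \<Longrightarrow> \<exists>c\<ge>0. q = d - c *\<^sub>R n x" and "x \<in> \<Omega> \<Longrightarrow> q = d \<and> Z \<preceq> Y"
proof -
  have comp: "0 \<le> (q - d) \<bullet> w + t * (((Y *v w) \<bullet> w - (Z *v w) \<bullet> w) / 2 + e * (norm w)\<^sup>2)"
    if "t > 0" "x + t *\<^sub>R w \<in> closure \<Omega>" "t * norm w < \<rho>"
      and up: "g (x + t *\<^sub>R w) \<le> g x + q \<bullet> (t *\<^sub>R w) + ((Y *v (t *\<^sub>R w)) \<bullet> (t *\<^sub>R w)) / 2 + e * (norm (t *\<^sub>R w))\<^sup>2" for t w e
  proof -
    have "g x + d \<bullet> (t *\<^sub>R w) + ((Z *v (t *\<^sub>R w)) \<bullet> (t *\<^sub>R w)) / 2 \<le> g (x + t *\<^sub>R w)"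
      using low(2)[of "x + t *\<^sub>R w"] that by simp
    then have "0 \<le> t * ((q - d) \<bullet> w + t * (((Y *v w) \<bullet> w - (Z *v w) \<bullet> w) / 2 + e * (norm w)\<^sup>2))"
      using up by (simp add: matrix_vector_mult_scaleR inner_diff_left power_mult_distrib power2_eq_square[of t] field_simps)
    then show ?thesis using \<open>t > 0\<close> by (simp add: zero_le_mult_iff)
  qed
  have ev: "\<forall>\<^sub>F t in at_right 0. 0 \<le> (q - d) \<bullet> w + t * (((Y *v w) \<bullet> w - (Z *v w) \<bullet> w) / 2 + e * (norm w)\<^sup>2)"
    if w: "\<forall>\<^sub>F t in at_right 0. x + t *\<^sub>R w \<in> closure \<Omega>" and e: "e > 0" for w e
  proof -
    obtain r where r: "r > 0" "\<And>y. y \<in> closure \<Omega> \<Longrightarrow> norm (y - x) < r \<Longrightarrow> g y \<le> g x + q \<bullet> (y - x) + ((Y *v (y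
      - x)) \<bullet> (y - x)) / 2 + e * (norm (y - x))\<^sup>2"
      using J e unfolding J2plus_iff by blast
    have "((\<lambda>t. t * norm w) \<longlongrightarrow> 0 * norm w) (at_right 0)" by (intro tendsto_intros)
    then have "\<forall>\<^sub>F t in at_right 0. t * norm w < min r \<rho>"
      using r(1) low(1) by (intro order_tendstoD(2)[where a = "min r \<rho>"]) auto
    then show ?thesis using w eventually_at_right_less[of 0]
    proof eventually_elim
      case (elim t)
      have "g (x + t *\<^sub>R w) \<le> g x + q \<bullet> (t *\<^sub>R w) + ((Y *v (t *\<^sub>R w)) \<bullet> (t *\<^sub>R w)) / 2 + e * (norm (t *\<^sub>R w))\<^sup>2"
        using r(2)[OF elim(2)] elim by simp
      then show ?case using comp[of t w e] elim by simp
    qed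
  qed
  have first: "(d - q) \<bullet> w \<le> 0" if w: "\<forall>\<^sub>F t in at_right 0. x + t *\<^sub>R w \<in> closure \<Omega>" for w
  proof -
    have "((\<lambda>t. (q - d) \<bullet> w + t * (((Y *v w) \<bullet> w - (Z *v w) \<bullet> w) / 2 + 1 * (norm w)\<^sup>2)) \<longlongrightarrow> (q - d) \<bullet> w
      + 0 * (((Y *v w) \<bullet> w - (Z *v w) \<bullet> w) / 2 + 1 * (norm w)\<^sup>2)) (at_right 0)"
      by (intro tendsto_intros)
    then have "0 \<le> (q - d) \<bullet> w + 0 * (((Y *v w) \<bullet> w - (Z *v w) \<bullet> w) / 2 + 1 * (norm w)\<^sup>2)"
      by (rule tendsto_lowerbound) (use ev[OF w, of 1] in auto)
    then show ?thesis by (simp add: inner_diff_left)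
  qed
  show "\<exists>c\<ge>0. q = d - c *\<^sub>R n x" if x: "x \<in> frontier \<Omega>"
  proof -
    obtain c where "c \<ge> 0" "d - q = c *\<^sub>R n x"
      using normal_cone[OF norm_n[OF x], of "d - q"] first inward_direction[OF x] by blast
    then show ?thesis by (intro exI[of _ c]) (simp add: algebra_simps)
  qed
  show "q = d \<and> Z \<preceq> Y" if x: "x \<in> \<Omega>"
  proof -
    have into: "\<forall>\<^sub>F t in at_right 0. x + t *\<^sub>R w \<in> closure \<Omega>" for w
    proof -
      have "((\<lambda>t. x + t *\<^sub>R w) \<longlongrightarrow> x + 0 *\<^sub>R w) (at_right 0)" by (intro tendsto_intros)
      then have "\<forall>\<^sub>F t in at_right 0. x + t *\<^sub>R w \<in> \<Omega>"
        by (rule topological_tendstoD[OF _ open_\<Omega>]) (use x in simp)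
      then show ?thesis by eventually_elim (use closure_subset in blast)
    qed
    \<comment> \<open>At an interior point every direction is admissible, in particular
      \<open>d - q\<close>.\<close>
    have "(d - q) \<bullet> (d - q) = 0" using first[OF into] by (intro order_antisym inner_ge_zero)
    then have q: "q = d" by simp
    have "w \<bullet> (Z *v w) \<le> w \<bullet> (Y *v w)" for w
    proof -
      have "(Z *v w) \<bullet> w / 2 \<le> (Y *v w) \<bullet> w / 2 + e" if e: "e > 0" for e
      proof -
        define e' where "e' = e / ((norm w)\<^sup>2 + 1)"
        have e': "e' > 0" using e by (simp add: e'_def add_nonneg_pos)
        have "\<forall>\<^sub>F t in at_right (0::real). 0 \<le> ((Y *v w) \<bullet> w - (Z *v w) \<bullet> w) / 2 + e' * (norm w)\<^sup>2"
          using ev[OF into e', of w] eventually_at_right_less[of 0]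
          by eventually_elim (simp add: q zero_le_mult_iff)
        then have "0 \<le> ((Y *v w) \<bullet> w - (Z *v w) \<bullet> w) / 2 + e' * (norm w)\<^sup>2" by simp
        moreover have "e' * (norm w)\<^sup>2 \<le> e" using e by (simp add: e'_def divide_simps add_nonneg_pos)
        ultimately show ?thesis by (simp add: diff_divide_distrib)
      qed
      then have "(Z *v w) \<bullet> w / 2 \<le> (Y *v w) \<bullet> w / 2" by (rule field_le_epsilon)
      then show ?thesis by (simp add: inner_commute)
    qed
    then show ?thesis using q by (simp add: loewner_le_def)
  qed
qed

end

section \<open>Perron's method for the Neumann problem\<close>

lemma quadratic_recenter:
  assumes "X \<in> sym_mats"
  shows "p \<bullet> (y - z) + ((X *v (y - z)) \<bullet> (y - z)) / 2 =
    (p \<bullet> (a - z) + ((X *v (a - z)) \<bullet> (a - z)) / 2) + (p + X *v (a - z)) \<bullet> (y - a) + ((X *v (y - a)) \<bullet> (y - a)) / 2"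
proof -
  have e: "y - z = (a - z) + (y - a)" by simp
  have "(X *v (y - a)) \<bullet> (a - z) = (X *v (a - z)) \<bullet> (y - a)"
    using sym_mats_selfadjoint[OF assms, of "a - z" "y - a"] by (simp add: inner_commute)
  then show ?thesis
    unfolding e matrix_vector_right_distrib inner_add_left inner_add_right by (simp add: field_simps)
qed

text \<open>The limit of suprema over shrinking balls. The last clause, that values of
  \<open>E\<close> are nearly attained by \<open>W\<close> close by, is what the stability argument
  for subsolutions consumes; applied to the negative function the lemma yields the lower
  envelope.\<close>

lemma usc_envelope_exists:
  fixes W :: "'a::metric_space \<Rightarrow> real"
  assumes bd: "\<And>x. x \<in> S \<Longrightarrow> W x \<le> C"
  shows "\<exists>E. usc_on S E \<and> (\<forall>x\<in>S. W x \<le> E x) \<and> (\<forall>z\<in>S. \<forall>e>0. \<exists>x\<in>S. dist x z < e \<and> W x > E z - e)"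
proof -
  define M where "M = (\<lambda>z r. Sup (W ` (S \<inter> ball z r)))"
  define E where "E = (\<lambda>z. Inf (M z ` {0<..}))"
  have bda: "bdd_above (W ` (S \<inter> ball z r))" for z r using bd by (auto intro!: bdd_aboveI[of _ C])
  have WM: "W x \<le> M z r" if "x \<in> S" "dist x z < r" for x z r
    unfolding M_def using that by (intro cSup_upper bda) (auto simp: dist_commute)
  have bdb: "bdd_below (M z ` {0<..})" if "z \<in> S" for z
    using WM[OF that, of z] by (auto intro!: bdd_belowI[of _ "W z"])
  have EM: "E z \<le> M z r" if "z \<in> S" "r > 0" for z r
    unfolding E_def using that by (intro cInf_lower bdb) auto
  have WE: "W x \<le> E x" if "x \<in> S" for x
    unfolding E_def using WM[OF that, of x] by (intro cInf_greatest) auto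
  have near: "\<exists>x\<in>S. dist x z < e \<and> W x > E z - e" if "z \<in> S" "e > 0" for z e
  proof -
    have "E z - e < M z e" using EM[OF that] that(2) by linarith
    moreover have "W ` (S \<inter> ball z e) \<noteq> {}" using that by auto
    ultimately obtain x where "x \<in> S \<inter> ball z e" "E z - e < W x"
      unfolding M_def using less_cSup_iff[OF _ bda] by blast
    then show ?thesis by (auto simp: dist_commute)
  qed
  have "usc_on S E"
    unfolding usc_on_iff
  proof (intro ballI allI impI)
    fix z and e :: real assume z: "z \<in> S" "e > 0"
    have "E z < E z + e" using z by simp
    then obtain r where r: "r > 0" "M z r < E z + e"
      using cInf_lessD[of "M z ` {0<..}" "E z + e"] by (auto simp: E_def)
    have "E y < E z + e" if y: "y \<in> S" "dist y z < r / 2" for y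
    proof -
      have "S \<inter> ball y (r / 2) \<subseteq> S \<inter> ball z r"
      proof
        fix x assume "x \<in> S \<inter> ball y (r / 2)"
        then show "x \<in> S \<inter> ball z r"
          using dist_triangle[of z x y] y(2) by (auto simp: dist_commute)
      qed
      moreover have "W ` (S \<inter> ball y (r / 2)) \<noteq> {}" using y r by auto
      ultimately have "M y (r / 2) \<le> M z r" unfolding M_def by (intro cSup_subset_mono bda) auto
      then show ?thesis using EM[OF y(1), of "r / 2"] r by linarith
    qed
    then show "\<exists>d>0. \<forall>y\<in>S. dist y z < d \<longrightarrow> E y < E z + e" using r(1) by (intro exI[of _ "r / 2"]) auto
  qed
  then show ?thesis using WE near by blast
qed

text \<open>The operator governing \<open>- u\<close> when \<open>F\<close> governs
  \<open>u\<close>; see \<open>supersolution_iff_dual\<close>.\<close>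

definition dual_op :: "'n pde_op \<Rightarrow> 'n::finite pde_op" where
  "dual_op F = (\<lambda>x r p X. - F x (- r) (- p) (- X))"

definition dual_bdry :: "(real^'n \<Rightarrow> real \<Rightarrow> real) \<Rightarrow> real^'n \<Rightarrow> real \<Rightarrow> real" where
  "dual_bdry f = (\<lambda>x r. - f x (- r))"

text \<open>A set of hypotheses stable under duality, as \<open>dual_bvp\<close> shows, so that
  barriers and Perron's constructions are available for both kinds of one-sided solutions.\<close>

locale neumann_bvp = exterior_ball_domain \<Omega> n r\<^sub>0
  for \<Omega> :: "(real^'n) set" and n :: "real^'n \<Rightarrow> real^'n" and r\<^sub>0 :: real +
  fixes F :: "'n pde_op" and f :: "real^'n \<Rightarrow> real \<Rightarrow> real" and \<gamma> :: real
  assumes F_cont: "continuous_on (closure \<Omega> \<times> UNIV \<times> UNIV \<times> sym_mats) (\<lambda>(x, r, p, X). F x r p X)"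
    and F_proper: "proper_op \<Omega> F"
    and f_cont: "continuous_on (frontier \<Omega> \<times> UNIV) (\<lambda>(x, r). f x r)"
    and \<gamma>: "\<gamma> > 0"
    and F_strict: "\<And>x r s p X. x \<in> closure \<Omega> \<Longrightarrow> X \<in> sym_mats \<Longrightarrow> r \<ge> s \<Longrightarrow> \<gamma> * (r - s) \<le> F x r p X - F x s p X"
    and f_mono: "\<And>x r s. x \<in> frontier \<Omega> \<Longrightarrow> r \<le> s \<Longrightarrow> f x r \<le> f x s"
begin

definition bc :: "'n bdry_op" where
  "bc = (\<lambda>x r p. n x \<bullet> p + f x r)"

text \<open>Interior and boundary condition in one disjunction; in this form the condition is closed
  under limits even when interior points tend to the boundary.\<close>

definition sub_cond :: "real^'n \<Rightarrow> real \<Rightarrow> real^'n \<Rightarrow> real^'n^'n \<Rightarrow> bool" where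
  "sub_cond x r p X \<longleftrightarrow> F x r p X \<le> 0 \<or> (x \<in> frontier \<Omega> \<and> bc x r p \<le> 0)"

abbreviation "Sub \<equiv> subsolution \<Omega> F bc"

lemma F_proper': "x \<in> closure \<Omega> \<Longrightarrow> X \<in> sym_mats \<Longrightarrow> Y \<in> sym_mats \<Longrightarrow> Y \<preceq> X \<Longrightarrow> F x r p X \<le> F x r p Y"
  using F_proper unfolding proper_op_def by blast

lemma F_tendsto:
  assumes "xs \<longlonglongrightarrow> x" "rs \<longlonglongrightarrow> r" "ps \<longlonglongrightarrow> p" "Xs \<longlonglongrightarrow> X"
    and mem: "\<And>k. xs k \<in> closure \<Omega>" "\<And>k::nat. Xs k \<in> sym_mats"
  shows "(\<lambda>k. F (xs k) (rs k) (ps k) (Xs k)) \<longlonglongrightarrow> F x r p X"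
proof -
  have "x \<in> closure \<Omega>" "X \<in> sym_mats"
    using closed_sequentially[OF closed_closure mem(1) assms(1)] closed_sequentially[OF closed_sym_mats mem(2) assms(4)] .
  then have "(\<lambda>k. case (xs k, rs k, ps k, Xs k) of (x, r, p, X) \<Rightarrow> F x r p X) \<longlonglongrightarrow> (case (x, r, p, X) of (x, r, p, X) \<Rightarrow> F x r p X)"
    by (intro continuous_on_tendsto_compose[OF F_cont] tendsto_Pair assms(1-4)) (use mem in auto)
  then show ?thesis by simp
qed

lemma bc_tendsto:
  assumes "xs \<longlonglongrightarrow> x" "rs \<longlonglongrightarrow> r" "ps \<longlonglongrightarrow> p" and mem: "\<forall>\<^sub>F k::nat in sequentially. xs k \<in> frontier \<Omega>" "x \<in> frontier \<Omega>"
  shows "(\<lambda>k. bc (xs k) (rs k) (ps k)) \<longlonglongrightarrow> bc x r p"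
proof -
  have "(\<lambda>k. n (xs k)) \<longlonglongrightarrow> n x"
    by (rule continuous_on_tendsto_compose[OF continuous_on_n assms(1) mem(2,1)])
  moreover have "(\<lambda>k. case (xs k, rs k) of (x, r) \<Rightarrow> f x r) \<longlonglongrightarrow> (case (x, r) of (x, r) \<Rightarrow> f x r)"
    by (intro continuous_on_tendsto_compose[OF f_cont] tendsto_Pair assms(1,2)) (use mem in \<open>auto elim: eventually_mono\<close>)
  ultimately show ?thesis unfolding bc_def using assms(3) by (auto intro!: tendsto_intros)
qed

text \<open>If \<open>F\<close> is positive in the limit, it is positive eventually, so the boundary
  alternative holds eventually. Since the frontier is closed and \<open>n\<close> and
  \<open>f\<close> are continuous, it survives the limit.\<close>

lemma sub_cond_closed:
  assumes lim: "xs \<longlonglongrightarrow> x" "rs \<longlonglongrightarrow> r" "ps \<longlonglongrightarrow> p" "Xs \<longlonglongrightarrow> X"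
    and mem: "\<And>k. xs k \<in> closure \<Omega>" "\<And>k::nat. Xs k \<in> sym_mats"
    and sub: "\<forall>\<^sub>F k in sequentially. sub_cond (xs k) (rs k) (ps k) (Xs k)"
  shows "sub_cond x r p X"
proof (cases "F x r p X \<le> 0")
  case False
  then have "\<forall>\<^sub>F k in sequentially. 0 < F (xs k) (rs k) (ps k) (Xs k)"
    by (intro order_tendstoD(1)[OF F_tendsto[OF lim mem]]) auto
  with sub have ev: "\<forall>\<^sub>F k in sequentially. xs k \<in> frontier \<Omega> \<and> bc (xs k) (rs k) (ps k) \<le> 0"
    by eventually_elim (auto simp: sub_cond_def)
  then have ev1: "\<forall>\<^sub>F k in sequentially. xs k \<in> frontier \<Omega>" and ev2: "\<forall>\<^sub>F k in sequentially. bc (xs k) (rs k) (ps k) \<le> 0"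
    by (auto elim: eventually_mono)
  have x: "x \<in> frontier \<Omega>"
    by (rule Lim_in_closed_set[OF frontier_closed ev1 _ lim(1)]) simp
  have "bc x r p \<le> 0" by (rule tendsto_upperbound[OF bc_tendsto[OF lim(1-3) ev1 x] ev2]) simp
  then show ?thesis using x by (simp add: sub_cond_def)
qed (simp add: sub_cond_def)

text \<open>Closedness of \<open>sub_cond\<close> makes it equivalent to test jets or their
  closures, so that functions can be verified to be subsolutions on plain jets.\<close>

lemma subsolution_iff:
  "Sub u \<longleftrightarrow> usc_on (closure \<Omega>) u \<and> (\<forall>x\<in>closure \<Omega>. \<forall>p X. (p, X) \<in> J2plus (closure \<Omega>) u x \<longrightarrow> sub_cond x (u x) p X)"
    (is "_ \<longleftrightarrow> _ \<and> ?R")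
proof -
  let ?S = "\<forall>x\<in>closure \<Omega>. \<forall>p X. (p, X) \<in> J2plus_bar (closure \<Omega>) u x \<longrightarrow> sub_cond x (u x) p X"
  have "Sub u \<longleftrightarrow> usc_on (closure \<Omega>) u \<and> ?S"
    unfolding subsolution_def sub_cond_def closure_eq using not_frontier by (auto simp: min_le_iff_disj)
  moreover have "?S \<longleftrightarrow> ?R"
  proof
    assume S: ?S
    show ?R
    proof (intro ballI allI impI)
      fix x p X assume "x \<in> closure \<Omega>" "(p, X) \<in> J2plus (closure \<Omega>) u x"
      moreover from this have "(p, X) \<in> J2plus_bar (closure \<Omega>) u x"
        by (intro J2plus_barI[of "\<lambda>_. x" _ "\<lambda>_. p" "\<lambda>_. X"]) auto
      ultimately show "sub_cond x (u x) p X" using S by blast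
    qed
  next
    assume R: ?R
    show ?S
    proof (intro ballI allI impI)
      fix x p X assume x: "x \<in> closure \<Omega>" "(p, X) \<in> J2plus_bar (closure \<Omega>) u x"
      obtain xs ps Xs where seq: "\<And>k::nat. xs k \<in> closure \<Omega>" "\<And>k. (ps k, Xs k) \<in> J2plus (closure \<Omega>) u (xs k)"
        "xs \<longlonglongrightarrow> x" "(\<lambda>k. u (xs k)) \<longlonglongrightarrow> u x" "ps \<longlonglongrightarrow> p" "Xs \<longlonglongrightarrow> X"
        using J2plus_barE[OF x(2)] by blast
      show "sub_cond x (u x) p X"
        by (rule sub_cond_closed[OF seq(3-6,1)]) (use seq(1,2) R in \<open>auto simp: J2plus_iff\<close>)
    qed
  qed
  ultimately show ?thesis by blast
qed

lemma sub_bar: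
  assumes "Sub u" "x \<in> closure \<Omega>" "(p, X) \<in> J2plus_bar (closure \<Omega>) u x"
  shows "sub_cond x (u x) p X"
  using assms unfolding subsolution_def sub_cond_def closure_eq using not_frontier by (auto simp: min_le_iff_disj)

lemma dual_bvp: "neumann_bvp \<Omega> n r\<^sub>0 (dual_op F) (dual_bdry f) \<gamma>"
proof unfold_locales
  show "continuous_on (closure \<Omega> \<times> UNIV \<times> UNIV \<times> sym_mats) (\<lambda>(x, r, p, X). dual_op F x r p X)"
  proof -
    have "continuous_on (closure \<Omega> \<times> UNIV \<times> UNIV \<times> sym_mats)
       (\<lambda>y. - (case (fst y, - fst (snd y), - fst (snd (snd y)), - snd (snd (snd y))) of (x, r, p, X) \<Rightarrow> F x r p X))"
      by (intro continuous_on_minus continuous_on_compose2[OF F_cont] continuous_intros) (auto simp: sym_mats_uminus)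
    then show ?thesis by (simp add: dual_op_def split_beta)
  qed
  show "continuous_on (frontier \<Omega> \<times> UNIV) (\<lambda>(x, r). dual_bdry f x r)"
  proof -
    have "continuous_on (frontier \<Omega> \<times> UNIV) (\<lambda>y. - (case (fst y, - snd y) of (x, r) \<Rightarrow> f x r))"
      by (intro continuous_on_minus continuous_on_compose2[OF f_cont] continuous_intros) auto
    then show ?thesis by (simp add: dual_bdry_def split_beta)
  qed
  have mv: "(- X) *v \<xi> = - (X *v \<xi>)" for X :: "real^'n^'n" and \<xi>
    using matrix_vector_mult_diff_rdistrib[of 0 X \<xi>] by simp
  show "proper_op \<Omega> (dual_op F)"
    using F_proper unfolding proper_op_def dual_op_def loewner_le_def
    by (simp add: sym_mats_uminus mv)
  show "\<gamma> * (r - s) \<le> dual_op F x r p X - dual_op F x s p X" if "x \<in> closure \<Omega>" "X \<in> sym_mats" "s \<le> r" for x r s p X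
    using F_strict[of x "- X" "- r" "- s" "- p"] that by (simp add: dual_op_def sym_mats_uminus algebra_simps)
  show "dual_bdry f x r \<le> dual_bdry f x s" if "x \<in> frontier \<Omega>" "r \<le> s" for x r s
    using f_mono[of x "- s" "- r"] that by (simp add: dual_bdry_def)
qed (rule \<gamma>)

lemma supersolution_iff_dual:
  "supersolution \<Omega> F bc v \<longleftrightarrow> subsolution \<Omega> (dual_op F) (neumann_bvp.bc n (dual_bdry f)) (\<lambda>x. - v x)"
proof -
  interpret d: neumann_bvp \<Omega> n r\<^sub>0 "dual_op F" "dual_bdry f" \<gamma> by (rule dual_bvp)
  have all: "(\<forall>y\<in>J2minus_bar (closure \<Omega>) v x. Q y) \<longleftrightarrow> (\<forall>y\<in>J2plus_bar (closure \<Omega>) (\<lambda>x. - v x) x. Q (- y))" for x Q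
  proof -
    have "(\<forall>y\<in>J2minus_bar (closure \<Omega>) v x. Q y) \<longleftrightarrow> (\<forall>p X. (p, X) \<in> J2minus_bar (closure \<Omega>) v x \<longrightarrow> Q (p, X))" by auto
    also have "\<dots> \<longleftrightarrow> (\<forall>p X. (p, X) \<in> J2plus_bar (closure \<Omega>) (\<lambda>x. - v x) x \<longrightarrow> Q (- (p, X)))"
    proof (intro iffI allI impI)
      fix p X assume H: "\<forall>p X. (p, X) \<in> J2minus_bar (closure \<Omega>) v x \<longrightarrow> Q (p, X)" "(p, X) \<in> J2plus_bar (closure \<Omega>) (\<lambda>x. - v x) x"
      then show "Q (- (p, X))" using H(1)[rule_format, of "- p" "- X"] by (simp add: J2minus_bar_iff_J2plus_bar)
    next
      fix p X assume H: "\<forall>p X. (p, X) \<in> J2plus_bar (closure \<Omega>) (\<lambda>x. - v x) x \<longrightarrow> Q (- (p, X))"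
        "(p, X) \<in> J2minus_bar (closure \<Omega>) v x"
      then show "Q (p, X)" using H(1)[rule_format, of "- p" "- X"] by (simp add: J2minus_bar_iff_J2plus_bar)
    qed
    finally show ?thesis by auto
  qed
  show ?thesis
    unfolding supersolution_def subsolution_def all lsc_on_iff_usc_on_minus d.bc_def
    by (simp add: bc_def dual_op_def dual_bdry_def split_beta min_le_iff_disj le_max_iff_disj)
qed

text \<open>A paraboloid touching \<open>E\<close> strictly from above at \<open>z\<close> is
  touched, up to constants, by members of the family at points \<open>y k\<close>. These points
  converge to \<open>z\<close> and the values there to \<open>E z\<close>, so
  \<open>sub_cond_closed\<close> yields the condition in the limit.\<close>

lemma sup_subsolution:
  assumes usc: "usc_on (closure \<Omega>) E" and le: "\<And>w x. w \<in> \<W> \<Longrightarrow> x \<in> closure \<Omega> \<Longrightarrow> w x \<le> E x"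
    and sub: "\<And>w. w \<in> \<W> \<Longrightarrow> Sub w"
    and near: "\<And>z e. z \<in> closure \<Omega> \<Longrightarrow> e > 0 \<Longrightarrow> \<exists>w\<in>\<W>. \<exists>x\<in>closure \<Omega>. dist x z < e \<and> w x > E z - e"
  shows "Sub E"
  unfolding subsolution_iff
proof (intro conjI usc ballI allI impI)
  let ?K = "closure \<Omega>"
  fix z p X assume z: "z \<in> ?K" and J: "(p, X) \<in> J2plus ?K E z"
  have X: "X \<in> sym_mats" using J by (simp add: J2plus_iff)
  have step: "sub_cond z (E z) p (X + (2 * \<epsilon>) *\<^sub>R mat 1)" if \<epsilon>: "\<epsilon> > 0" for \<epsilon>
  proof -
    \<comment> \<open>This raises the paraboloid by \<open>\<epsilon>\<close> times the square; half
      of it pays for the remainder of the jet, half makes the contact strict.\<close>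
    define X' where "X' = X + (2 * \<epsilon>) *\<^sub>R mat 1"
    have X': "X' \<in> sym_mats" unfolding X'_def by (rule sym_mats_add_scaled_identity[OF X])
    define \<psi> where "\<psi> = (\<lambda>x. p \<bullet> (x - z) + ((X' *v (x - z)) \<bullet> (x - z)) / 2)"
    obtain \<rho> where \<rho>: "\<rho> > 0" "\<And>x. x \<in> ?K \<Longrightarrow> norm (x - z) < \<rho> \<Longrightarrow> E x \<le> E z + p \<bullet> (x - z) + ((X *v (x - z)) \<bullet> (x
      - z)) / 2 + \<epsilon> / 2 * (norm (x - z))\<^sup>2"
      using J \<epsilon> unfolding J2plus_iff by (meson half_gt_zero)
    have E\<psi>: "E x - \<psi> x \<le> E z - \<epsilon> / 2 * (norm (x - z))\<^sup>2" if "x \<in> ?K" "norm (x - z) < \<rho>" for x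
      using \<rho>(2)[OF that] unfolding \<psi>_def X'_def scaled_identity_quadratic by (simp add: field_simps)
    have cont\<psi>: "continuous_on UNIV \<psi>" unfolding \<psi>_def
      by (intro continuous_intros linear_continuous_on_compose[OF _ matrix_vector_mul_linear]) auto
    \<comment> \<open>\<open>N\<close> lies strictly inside the region where the expansion of
      \<open>E\<close> holds; a maximizer over \<open>N\<close> with
      \<open>norm (y k - z) < \<rho> / 2\<close> is a local maximizer relative to
      \<open>?K\<close>.\<close>
    define N where "N = ?K \<inter> cball z (\<rho> / 2)"
    have N: "compact N" "z \<in> N" unfolding N_def using compact_closure z \<rho>(1) by (auto intro: compact_Int_closed)
    have "\<exists>w x. w \<in> \<W> \<and> x \<in> ?K \<and> dist x z < 1 / real (Suc k) \<and> w x > E z - 1 / real (Suc k)" for k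
      using near[OF z, of "1 / real (Suc k)"] by auto
    then obtain w x where w: "\<And>k. w k \<in> \<W>" and x: "\<And>k. x k \<in> ?K" "\<And>k. dist (x k) z < 1 / real (Suc k)"
      and wx: "\<And>k. w k (x k) > E z - 1 / real (Suc k)" by metis
    have "\<exists>y\<in>N. \<forall>y'\<in>N. w k y' + - \<psi> y' \<le> w k y + - \<psi> y" for k
    proof (rule usc_on_attains_sup[OF N(1)])
      have "usc_on ?K (w k)" using sub[OF w[of k]] by (simp add: subsolution_def)
      then show "usc_on N (\<lambda>y. w k y + - \<psi> y)"
        by (intro usc_on_add_continuous usc_on_subset[of ?K _ N] continuous_on_minus continuous_on_subset[OF cont\<psi>])
          (simp_all add: N_def)
    qed (use N in auto)
    then obtain y where y: "\<And>k. y k \<in> N" and y_max: "\<And>k. \<forall>y'\<in>N. w k y' + - \<psi> y' \<le> w k (y k) + - \<psi> (y k)" by metis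
    have y2: "w k y' - \<psi> y' \<le> w k (y k) - \<psi> (y k)" if "y' \<in> N" for k y' using y_max[of k] that by simp
    note y = y y2
    have yK: "y k \<in> ?K" "norm (y k - z) \<le> \<rho> / 2" for k
      using y(1)[of k] by (auto simp: N_def dist_norm norm_minus_commute)
    have inv0: "(\<lambda>k. 1 / real (Suc k)) \<longlonglongrightarrow> 0" using LIMSEQ_inverse_real_of_nat by (simp add: inverse_eq_divide)
    have xz: "x \<longlonglongrightarrow> z"
      by (rule metric_tendsto_imp_tendsto[OF inv0]) (rule always_eventually, use x(2) less_imp_le in
        \<open>fastforce simp: dist_real_def\<close>)
    have \<psi>0: "\<psi> z = 0" by (simp add: \<psi>_def)
    have \<psi>lim: "(\<lambda>k. \<psi> (s k)) \<longlonglongrightarrow> 0" if "s \<longlonglongrightarrow> z" for s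
      using continuous_on_tendsto_compose[OF cont\<psi> that] \<psi>0 by simp
    have xN: "\<forall>\<^sub>F k in sequentially. x k \<in> N"
    proof -
      have "\<forall>\<^sub>F k in sequentially. dist (x k) z < \<rho> / 2" using tendstoD[OF xz, of "\<rho> / 2"] \<rho>(1) by simp
      then show ?thesis by eventually_elim (use x(1) in \<open>auto simp: N_def dist_commute\<close>)
    qed
    \<comment> \<open>Together with \<open>wE\<close> this squeezes
      \<open>w k (y k) - \<psi> (y k)\<close> towards \<open>E z\<close> and leaves no room for
      \<open>norm (y k - z)\<close>.\<close>
    have chain: "\<forall>\<^sub>F k in sequentially. E z - 1 / real (Suc k) - \<psi> (x k) \<le> w k (y k) - \<psi> (y k)"
      using xN
    proof eventually_elim
      case (elim k)
      show ?case using y(2)[OF elim, of k] wx[of k] by linarith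
    qed
    have wE: "w k (y k) - \<psi> (y k) \<le> E z - \<epsilon> / 2 * (norm (y k - z))\<^sup>2" for k
    proof -
      have "norm (y k - z) < \<rho>" using yK(2)[of k] \<rho>(1) by linarith
      then show ?thesis using le[OF w yK(1), of k k] E\<psi>[OF yK(1), of k] by linarith
    qed
    have small0: "(\<lambda>k. 1 / real (Suc k) + \<psi> (x k)) \<longlonglongrightarrow> 0" using tendsto_add[OF inv0 \<psi>lim[OF xz]] by simp
    have "(\<lambda>k. \<epsilon> / 2 * (norm (y k - z))\<^sup>2) \<longlonglongrightarrow> 0"
    proof (rule tendsto_sandwich[OF _ _ tendsto_const small0])
      show "\<forall>\<^sub>F k in sequentially. \<epsilon> / 2 * (norm (y k - z))\<^sup>2 \<le> 1 / real (Suc k) + \<psi> (x k)"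
        using chain
      proof eventually_elim
        case (elim k)
        then show ?case using wE[of k] by linarith
      qed
    qed (use \<epsilon> in auto)
    from tendsto_mult[OF tendsto_const[of "2 / \<epsilon>"] this] have "(\<lambda>k. (norm (y k - z))\<^sup>2) \<longlonglongrightarrow> 0" using \<epsilon> by simp
    from tendsto_real_sqrt[OF this] have "(\<lambda>k. norm (y k - z)) \<longlonglongrightarrow> 0" by simp
    then have yz: "y \<longlonglongrightarrow> z" by (rule LIM_zero_cancel[OF tendsto_norm_zero_cancel])
    have "(\<lambda>k. w k (y k) - \<psi> (y k)) \<longlonglongrightarrow> E z"
    proof (rule tendsto_sandwich[OF chain])
      show "\<forall>\<^sub>F k in sequentially. w k (y k) - \<psi> (y k) \<le> E z"
      proof (intro always_eventually allI)
        fix k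
        have "0 \<le> \<epsilon> / 2 * (norm (y k - z))\<^sup>2" using \<epsilon> by simp
        then show "w k (y k) - \<psi> (y k) \<le> E z" using wE[of k] by linarith
      qed
      show "(\<lambda>k. E z - 1 / real (Suc k) - \<psi> (x k)) \<longlonglongrightarrow> E z"
        using tendsto_diff[OF tendsto_const small0, of "E z"] by (simp add: algebra_simps)
    qed simp
    from tendsto_add[OF this \<psi>lim[OF yz]] have wlim: "(\<lambda>k. w k (y k)) \<longlonglongrightarrow> E z" by simp
    define q where "q = (\<lambda>k. p + X' *v (y k - z))"
    have jet: "(q k, X') \<in> J2plus ?K (w k) (y k)" if k: "norm (y k - z) < \<rho> / 2" for k
      unfolding J2plus_iff
    proof (intro conjI X' allI impI)
      fix e :: real assume "e > 0"
      show "\<exists>r>0. \<forall>t\<in>?K. norm (t - y k) < r \<longrightarrow> w k t \<le> w k (y k) + q k \<bullet> (t - y k) + ((X' *v (t - y k)) \<bullet> (t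
        - y k)) / 2 + e * (norm (t - y k))\<^sup>2"
      proof (intro exI[of _ "\<rho> / 2 - norm (y k - z)"] conjI ballI impI)
        fix t assume t: "t \<in> ?K" "norm (t - y k) < \<rho> / 2 - norm (y k - z)"
        have "norm (t - z) \<le> norm (t - y k) + norm (y k - z)" using norm_triangle_ineq[of "t - y k" "y k - z"] by simp
        then have "t \<in> N" using t by (simp add: N_def dist_norm norm_minus_commute)
        then have "w k t - \<psi> t \<le> w k (y k) - \<psi> (y k)" by (rule y(2))
        moreover have "\<psi> t = \<psi> (y k) + q k \<bullet> (t - y k) + ((X' *v (t - y k)) \<bullet> (t - y k)) / 2"
          unfolding \<psi>_def q_def by (rule quadratic_recenter[OF X'])
        moreover have "0 \<le> e * (norm (t - y k))\<^sup>2" using \<open>e > 0\<close> by simp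
        ultimately show "w k t \<le> w k (y k) + q k \<bullet> (t - y k) + ((X' *v (t - y k)) \<bullet> (t - y k)) / 2
          + e * (norm (t - y k))\<^sup>2" by linarith
      qed (use k in simp)
    qed
    have "\<forall>\<^sub>F k in sequentially. norm (y k - z) < \<rho> / 2"
      using tendstoD[OF yz, of "\<rho> / 2"] \<rho>(1) by (simp add: dist_norm)
    then have ev: "\<forall>\<^sub>F k in sequentially. sub_cond (y k) (w k (y k)) (q k) X'"
      by eventually_elim (use sub[OF w] jet yK(1) in \<open>auto simp: subsolution_iff\<close>)
    have "q \<longlonglongrightarrow> p + X' *v (z - z)"
      unfolding q_def by (intro tendsto_add tendsto_const bounded_linear.tendsto[OF
        matrix_vector_mul_bounded_linear tendsto_diff[OF yz tendsto_const]])
    then have "q \<longlonglongrightarrow> p" by simp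
    from sub_cond_closed[OF yz wlim this tendsto_const yK(1) X' ev] show ?thesis unfolding X'_def .
  qed
  have inv0: "(\<lambda>k. 1 / real (Suc k)) \<longlonglongrightarrow> 0" using LIMSEQ_inverse_real_of_nat by (simp add: inverse_eq_divide)
  have "(\<lambda>k. X + (2 * (1 / real (Suc k))) *\<^sub>R mat 1) \<longlonglongrightarrow> X + (2 * 0) *\<^sub>R mat 1"
    by (intro tendsto_intros inv0)
  then have "(\<lambda>k. X + (2 * (1 / real (Suc k))) *\<^sub>R mat 1) \<longlonglongrightarrow> X" by simp
  then show "sub_cond z (E z) p X"
    by (rule sub_cond_closed[OF tendsto_const tendsto_const tendsto_const _ z sym_mats_add_scaled_identity[OF
      X] always_eventually])
      (intro allI step, simp)
qed

text \<open>If \<open>L\<close> violated the supersolution condition at \<open>z\<close>, a quadratic test function touching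
  \<open>L\<close> strictly from below at \<open>z\<close>, raised slightly, would be a subsolution near \<open>z\<close>; its maximum
  with \<open>W\<close> would be a subsolution exceeding \<open>W\<close> somewhere.\<close>

lemma maximal_subsolution_super:
  assumes W: "Sub W" and maxW: "\<And>w x. Sub w \<Longrightarrow> x \<in> closure \<Omega> \<Longrightarrow> w x \<le> W x"
    and lsc: "usc_on (closure \<Omega>) (\<lambda>x. - L x)" and LW: "\<And>x. x \<in> closure \<Omega> \<Longrightarrow> L x \<le> W x"
    and near: "\<And>z e. z \<in> closure \<Omega> \<Longrightarrow> e > 0 \<Longrightarrow> \<exists>x\<in>closure \<Omega>. dist x z < e \<and> W x < L z + e"
  shows "supersolution \<Omega> F bc L"
proof -
  let ?K = "closure \<Omega>"
  interpret d: neumann_bvp \<Omega> n r\<^sub>0 "dual_op F" "dual_bdry f" \<gamma> by (rule dual_bvp)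
  have dual_cond: "d.sub_cond x (- r) (- q) (- Y) \<longleftrightarrow> 0 \<le> F x r q Y \<or> (x \<in> frontier \<Omega> \<and> 0 \<le> bc x r q)" for x r q Y
    unfolding d.sub_cond_def d.bc_def bc_def by (auto simp: dual_op_def dual_bdry_def)
  show ?thesis
    unfolding supersolution_iff_dual d.subsolution_iff
  proof (intro conjI lsc ballI allI impI)
    fix z p X assume z: "z \<in> ?K" and J: "(p, X) \<in> J2plus ?K (\<lambda>x. - L x) z"
    define P where "P = - p"
    define Z where "Z = - X"
    have Z: "Z \<in> sym_mats" using J by (simp add: Z_def J2plus_iff sym_mats_uminus)
    show "d.sub_cond z (- L z) p X"
    proof (rule ccontr)
      assume bad: "\<not> d.sub_cond z (- L z) p X"
      \<comment> \<open>This lowers the paraboloid by \<open>2 * \<epsilon>\<close> times the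
        square: once \<open>\<epsilon>\<close> for the remainder of the jet, once to stay strictly
        below \<open>L\<close> away from \<open>z\<close>.\<close>
      define ZZ where "ZZ = (\<lambda>\<epsilon>. Z + (- 4 * \<epsilon>) *\<^sub>R mat 1)"
      have ZZ: "ZZ \<epsilon> \<in> sym_mats" for \<epsilon> unfolding ZZ_def by (rule sym_mats_add_scaled_identity[OF Z])
      define \<psi> where "\<psi> = (\<lambda>\<epsilon> x. P \<bullet> (x - z) + ((ZZ \<epsilon> *v (x - z)) \<bullet> (x - z)) / 2)"
      define D\<psi> where "D\<psi> = (\<lambda>\<epsilon> x. P + ZZ \<epsilon> *v (x - z))"
      define good where "good = (\<lambda>\<epsilon> \<delta> x. F x (L z + \<psi> \<epsilon> x + \<delta>) (D\<psi> \<epsilon> x) (ZZ \<epsilon>) < 0 \<and>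
        (x \<in> frontier \<Omega> \<longrightarrow> bc x (L z + \<psi> \<epsilon> x + \<delta>) (D\<psi> \<epsilon> x) < 0))"
      \<comment> \<open>The failure of a closed condition is open: it persists at nearby points, for
        slightly changed Hessians and slightly raised values, all measured by one
        \<open>m\<close>.\<close>
      have "\<exists>m>0. \<forall>x\<in>?K. \<forall>\<epsilon> \<delta>. norm (x - z) \<le> m \<and> 0 \<le> \<epsilon> \<and> \<epsilon> \<le> m \<and> 0 \<le> \<delta> \<and> \<delta> \<le> m \<longrightarrow> good \<epsilon> \<delta> x"
      proof (rule ccontr)
        assume nex: "\<not> ?thesis"
        have "\<exists>x \<epsilon> \<delta>. x \<in> ?K \<and> norm (x - z) \<le> 1 / real (Suc k) \<and> 0 \<le> \<epsilon> \<and> \<epsilon> \<le> 1 / real (Suc k) \<and> 0 \<le> \<delta>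
          \<and> \<delta> \<le> 1 / real (Suc k) \<and> \<not> good \<epsilon> \<delta> x" for k
        proof -
          have "(0::real) < 1 / real (Suc k)" by simp
          then show ?thesis using nex by blast
        qed
        then obtain x \<epsilon> \<delta> where x: "\<And>k. x k \<in> ?K" "\<And>k. norm (x k - z) \<le> 1 / real (Suc k)"
          and \<epsilon>: "\<And>k. 0 \<le> \<epsilon> k" "\<And>k. \<epsilon> k \<le> 1 / real (Suc k)" and \<delta>: "\<And>k. 0 \<le> \<delta> k" "\<And>k. \<delta> k \<le> 1 / real (Suc k)"
          and ng: "\<And>k. \<not> good (\<epsilon> k) (\<delta> k) (x k)" by metis
        have inv0: "(\<lambda>k. 1 / real (Suc k)) \<longlonglongrightarrow> 0" using LIMSEQ_inverse_real_of_nat by (simp add: inverse_eq_divide)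
        have \<epsilon>0: "\<epsilon> \<longlonglongrightarrow> 0" by (rule tendsto_sandwich[OF _ _ tendsto_const inv0]) (use \<epsilon> in auto)
        have \<delta>0: "\<delta> \<longlonglongrightarrow> 0" by (rule tendsto_sandwich[OF _ _ tendsto_const inv0]) (use \<delta> in auto)
        have nx0: "(\<lambda>k. x k - z) \<longlonglongrightarrow> 0" by (rule Lim_null_comparison[OF always_eventually inv0]) (use x(2) in blast)
        then have xz: "x \<longlonglongrightarrow> z" by (rule LIM_zero_cancel)
        have ZZ0: "(\<lambda>k. ZZ (\<epsilon> k)) \<longlonglongrightarrow> Z + (- 4 * 0) *\<^sub>R mat 1" unfolding ZZ_def by (intro tendsto_intros \<epsilon>0)
        then have ZZ0: "(\<lambda>k. ZZ (\<epsilon> k)) \<longlonglongrightarrow> Z" by simp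
        have "(\<lambda>k. Z *v (x k - z) + (- 4 * \<epsilon> k) *\<^sub>R (x k - z)) \<longlonglongrightarrow> Z *v 0 + (- 4 * 0) *\<^sub>R 0"
          by (intro tendsto_intros \<epsilon>0 nx0 bounded_linear.tendsto[OF matrix_vector_mul_bounded_linear])
        then have ZZx: "(\<lambda>k. ZZ (\<epsilon> k) *v (x k - z)) \<longlonglongrightarrow> 0"
          unfolding ZZ_def matrix_vector_mult_add_rdistrib scaleR_matrix_vector_assoc[symmetric] matrix_vector_mul_lid by simp
        have D0: "(\<lambda>k. D\<psi> (\<epsilon> k) (x k)) \<longlonglongrightarrow> P" unfolding D\<psi>_def using tendsto_add[OF tendsto_const ZZx] by simp
        have "(\<lambda>k. P \<bullet> (x k - z) + ((ZZ (\<epsilon> k) *v (x k - z)) \<bullet> (x k - z)) / 2) \<longlonglongrightarrow> P \<bullet> 0 + (0 \<bullet> (0::real^'n)) / 2"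
          by (intro tendsto_intros nx0 ZZx) simp
        then have \<psi>0: "(\<lambda>k. \<psi> (\<epsilon> k) (x k)) \<longlonglongrightarrow> 0" by (simp add: \<psi>_def)
        have "(\<lambda>k. - (L z + \<psi> (\<epsilon> k) (x k) + \<delta> k)) \<longlonglongrightarrow> - (L z + 0 + 0)" by (intro tendsto_intros \<psi>0 \<delta>0)
        then have r0: "(\<lambda>k. - (L z + \<psi> (\<epsilon> k) (x k) + \<delta> k)) \<longlonglongrightarrow> - L z" by simp
        have p0: "(\<lambda>k. - D\<psi> (\<epsilon> k) (x k)) \<longlonglongrightarrow> p" using tendsto_minus[OF D0] by (simp add: P_def)
        have X0: "(\<lambda>k. - ZZ (\<epsilon> k)) \<longlonglongrightarrow> X" using tendsto_minus[OF ZZ0] by (simp add: Z_def)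
        have "d.sub_cond (x k) (- (L z + \<psi> (\<epsilon> k) (x k) + \<delta> k)) (- D\<psi> (\<epsilon> k) (x k)) (- ZZ (\<epsilon> k))" for k
          using ng[of k] unfolding good_def dual_cond by (auto simp: not_less)
        then have "d.sub_cond z (- L z) p X"
          by (intro d.sub_cond_closed[OF xz r0 p0 X0 x(1)] always_eventually allI) (simp_all add: ZZ sym_mats_uminus)
        then show False using bad by simp
      qed
      then obtain m where m: "m > 0" and good: "\<And>x \<epsilon> \<delta>. x \<in> ?K \<Longrightarrow> norm (x - z) \<le> m \<Longrightarrow> 0 \<le> \<epsilon> \<Longrightarrow> \<epsilon> \<le> m \<Longrightarrow> 0 \<le> \<delta> \<Longrightarrow> \<delta> \<le> m \<Longrightarrow> good \<epsilon> \<delta> x"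
        by blast
      obtain \<rho>' where \<rho>': "\<rho>' > 0" "\<And>x. x \<in> ?K \<Longrightarrow> norm (x - z) < \<rho>' \<Longrightarrow> - L x \<le> - L z + p \<bullet> (x - z) + ((X *v (x
        - z)) \<bullet> (x - z)) / 2 + m * (norm (x - z))\<^sup>2"
        using J m unfolding J2plus_iff by blast
      have Lge: "L z + \<psi> m x + m * (norm (x - z))\<^sup>2 \<le> L x" if "x \<in> ?K" "norm (x - z) < \<rho>'" for x
      proof -
        have "(X *v (x - z)) = - (Z *v (x - z))"
          using matrix_vector_mult_diff_rdistrib[of 0 Z "x - z"] by (simp add: Z_def)
        then show ?thesis using \<rho>'(2)[OF that] unfolding \<psi>_def ZZ_def scaled_identity_quadratic
          by (simp add: P_def field_simps)
      qed
      define \<rho> where "\<rho> = min m \<rho>'"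
      \<comment> \<open>Raised by no more than this, the paraboloid is still below \<open>W\<close>
        from radius \<open>\<rho> / 2\<close> on, so \<open>U\<close> equals \<open>W\<close> well
        before the gluing radius \<open>\<rho>\<close>.\<close>
      define \<delta> where "\<delta> = min m (m * (\<rho> / 2)\<^sup>2)"
      have \<rho>: "\<rho> > 0" "\<rho> \<le> m" "\<rho> \<le> \<rho>'" using m \<rho>'(1) by (auto simp: \<rho>_def)
      have \<delta>: "\<delta> > 0" "\<delta> \<le> m" "\<delta> \<le> m * (\<rho> / 2)\<^sup>2" using m \<rho> by (auto simp: \<delta>_def)
      define B where "B = (\<lambda>x. L z + \<psi> m x + \<delta>)"
      define U where "U = (\<lambda>x. if norm (x - z) < \<rho> then max (W x) (B x) else W x)"
      have cont\<psi>: "continuous_on UNIV (\<psi> m)" unfolding \<psi>_def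
        by (intro continuous_intros linear_continuous_on_compose[OF _ matrix_vector_mul_linear]) auto
      have contB: "continuous_on UNIV B" unfolding B_def by (intro continuous_intros cont\<psi>)
      have BW: "U x = W x" if "x \<in> ?K" "norm (x - z) \<ge> \<rho> / 2" for x
      proof (cases "norm (x - z) < \<rho>")
        case True
        have "m * (\<rho> / 2)\<^sup>2 \<le> m * (norm (x - z))\<^sup>2" using that(2) m \<rho>(1) by (intro mult_left_mono power_mono) auto
        then have "B x \<le> W x" using Lge[OF that(1)] LW[OF that(1)] True \<rho>(3) \<delta>(3) unfolding B_def by linarith
        then show ?thesis by (simp add: U_def)
      qed (simp add: U_def)
      have WU: "W x \<le> U x" for x by (simp add: U_def)
      have uscW: "usc_on ?K W" using W by (simp add: subsolution_def)
      have uscU: "usc_on ?K U"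
        unfolding usc_on_iff
      proof (intro ballI allI impI)
        fix x and e :: real assume x: "x \<in> ?K" "e > 0"
        obtain d1 where d1: "d1 > 0" "\<And>y. y \<in> ?K \<Longrightarrow> dist y x < d1 \<Longrightarrow> W y < W x + e"
          using uscW x unfolding usc_on_iff by blast
        show "\<exists>d>0. \<forall>y\<in>?K. dist y x < d \<longrightarrow> U y < U x + e"
        proof (cases "norm (x - z) < \<rho>")
          case True
          obtain d2 where d2: "d2 > 0" "\<And>y. dist y x < d2 \<Longrightarrow> dist (B y) (B x) < e"
            using contB x(2) unfolding continuous_on_iff by blast
          show ?thesis
          proof (intro exI[of _ "min d1 d2"] conjI ballI impI)
            fix y assume y: "y \<in> ?K" "dist y x < min d1 d2"
            then have "W y < W x + e" "B y < B x + e" using d1(2) d2(2)[of y] by (auto simp: dist_real_def)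
            then show "U y < U x + e" using True by (auto simp: U_def)
          qed (use d1 d2 in auto)
        next
          case False
          show ?thesis
          proof (intro exI[of _ "min d1 (\<rho> / 2)"] conjI ballI impI)
            fix y assume y: "y \<in> ?K" "dist y x < min d1 (\<rho> / 2)"
            have "norm (x - z) \<le> norm (x - y) + norm (y - z)" using norm_triangle_ineq[of "x - y" "y - z"] by simp
            then have "norm (y - z) \<ge> \<rho> / 2" using y(2) False by (simp add: dist_norm norm_minus_commute)
            then show "U y < U x + e" using BW[OF y(1)] d1(2)[OF y(1)] y(2) False by (simp add: U_def)
          qed (use d1 \<rho> in auto)
        qed
      qed
      have "Sub U"
        unfolding subsolution_iff
      proof (intro conjI uscU ballI allI impI)
        fix x q Y assume x: "x \<in> ?K" and JU: "(q, Y) \<in> J2plus ?K U x"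
        have Y: "Y \<in> sym_mats" using JU by (simp add: J2plus_iff)
        show "sub_cond x (U x) q Y"
        proof (cases "U x = W x")
          case True
          have "(q, Y) \<in> J2plus ?K W x" by (rule J2plus_mono[OF JU _ zero_less_one]) (use True WU in auto)
          then show ?thesis using W x True by (auto simp: subsolution_iff)
        next
          case False
          then have xr: "norm (x - z) < \<rho>" and Ux: "U x = B x" by (auto simp: U_def max_def split: if_splits)
          have JB: "(q, Y) \<in> J2plus ?K B x"
          proof (rule J2plus_mono[where w = B, OF JU])
            show "B x = U x" by (rule Ux[symmetric])
            show "0 < \<rho> - norm (x - z)" using xr by simp
            fix y assume "y \<in> ?K" "norm (y - x) < \<rho> - norm (x - z)"
            moreover have "norm (y - z) \<le> norm (y - x) + norm (x - z)" using norm_triangle_ineq[of "y - x" "x - z"] by simp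
            ultimately show "B y \<le> U y" by (simp add: U_def)
          qed
          have low: "B x + D\<psi> m x \<bullet> (y - x) + ((ZZ m *v (y - x)) \<bullet> (y - x)) / 2 \<le> B y" for y
            unfolding B_def \<psi>_def D\<psi>_def using quadratic_recenter[OF ZZ, of P y z m x] by simp
          have g: "good m \<delta> x" by (rule good) (use x xr \<rho> \<delta> m in auto)
          note ls = J2plus_lower_support[OF JB zero_less_one low]
          show ?thesis
          proof (cases "x \<in> frontier \<Omega>")
            case True
            obtain c where c: "c \<ge> 0" "q = D\<psi> m x - c *\<^sub>R n x" using ls(1)[OF True] by blast
            have "n x \<bullet> q = n x \<bullet> D\<psi> m x - c" using norm_n[OF True] by (simp add: c(2) inner_diff_right dot_square_norm)
            then have "bc x (U x) q < 0" using g True c(1) unfolding good_def bc_def Ux B_def by simp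
            then show ?thesis using True by (simp add: sub_cond_def)
          next
            case False
            then have "x \<in> \<Omega>" using x by (simp add: closure_eq)
            then have q: "q = D\<psi> m x" "ZZ m \<preceq> Y" using ls(2) by auto
            have "F x (U x) q Y \<le> F x (U x) q (ZZ m)" by (rule F_proper'[OF x Y ZZ q(2)])
            then show ?thesis using g unfolding good_def sub_cond_def q(1) Ux B_def by simp
          qed
        qed
      qed
      then have UW: "U x \<le> W x" if "x \<in> ?K" for x using maxW that by blast
      have "\<psi> m z = 0" by (simp add: \<psi>_def)
      then obtain e where e: "e > 0" "\<And>x. dist x z < e \<Longrightarrow> \<bar>\<psi> m x\<bar> < \<delta> / 2"
        using cont\<psi> \<delta>(1) unfolding continuous_on_iff by (metis UNIV_I dist_real_def diff_zero half_gt_zero)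
      \<comment> \<open>Arbitrarily close to \<open>z\<close> there are points where
        \<open>W\<close> is hardly above \<open>L z\<close>, while \<open>B\<close> stays above
        \<open>L z + \<delta> / 2\<close>; there \<open>U\<close> exceeds the largest
        subsolution.\<close>
      obtain x where x: "x \<in> ?K" "dist x z < min e (min \<rho> (\<delta> / 2))" "W x < L z + min e (min \<rho> (\<delta> / 2))"
        using near[OF z, of "min e (min \<rho> (\<delta> / 2))"] e(1) \<rho>(1) \<delta>(1) by auto
      have "B x \<le> U x" using x(2) by (simp add: U_def dist_norm)
      moreover have "\<bar>\<psi> m x\<bar> < \<delta> / 2" using e(2) x(2) by simp
      ultimately have "W x < U x" using x(3) unfolding B_def by (simp add: abs_less_iff)
      then show False using UW[OF x(1)] by simp
    qed
  qed
qed

text \<open>The barrier is a supremum of paraboloids \<open>A * (- (n z \<bullet> (x - z)) - \<kappa> * (norm (x - z))\<^sup>2) - C\<close>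
  over boundary points \<open>z\<close>: for large \<open>\<kappa>\<close> the maximizing \<open>z\<close> is close to a given boundary point
  \<open>x\<close>, and the exterior ball condition keeps the derivative in direction \<open>n x\<close> below \<open>- A / 2\<close>.\<close>

lemma barrier_subsolution:
  assumes ne: "\<Omega> \<noteq> {}"
  shows "\<exists>g. Sub g \<and> continuous_on (closure \<Omega>) g"
proof -
  let ?K = "closure \<Omega>" and ?G = "frontier \<Omega>"
  have G: "compact ?G" "?G \<noteq> {}"
  proof -
    show "compact ?G" using compact_closure by (metis bounded_closure compact_closure compact_frontier_bounded
      compact_imp_bounded bounded_subset closure_subset)
    have "\<Omega> \<noteq> UNIV" using compact_closure not_compact_UNIV by auto
    then show "?G \<noteq> {}" using ne frontier_eq_empty by blast
  qed
  obtain \<eta> where \<eta>: "\<eta> > 0" "\<And>x y. x \<in> ?G \<Longrightarrow> y \<in> ?G \<Longrightarrow> dist y x < \<eta> \<Longrightarrow> dist (n y) (n x) < 1 / 2"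
    using compact_uniformly_continuous[OF continuous_on_n G(1)] unfolding uniformly_continuous_on_def
    by (metis half_gt_zero zero_less_one)
  \<comment> \<open>\<open>2 / \<eta>\<close> forces the maximizing boundary point into the range
    where normals differ by less than \<open>1 / 2\<close>; \<open>4 / r\<^sub>0\<close> limits the
    loss from the quadratic term to \<open>1 / 4\<close>.\<close>
  define \<kappa> where "\<kappa> = max (2 / \<eta>) (4 / r\<^sub>0)"
  have \<kappa>: "\<kappa> > 0" "1 / \<kappa> < \<eta>" "1 / (\<kappa> * r\<^sub>0) \<le> 1 / 4"
  proof -
    have "2 / \<eta> > 0" using \<eta>(1) by simp
    then show k: "\<kappa> > 0" unfolding \<kappa>_def by linarith
    have "2 / \<eta> \<le> \<kappa>" "4 / r\<^sub>0 \<le> \<kappa>" by (simp_all add: \<kappa>_def)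
    then show "1 / \<kappa> < \<eta>" "1 / (\<kappa> * r\<^sub>0) \<le> 1 / 4" using k \<eta>(1) r\<^sub>0 by (auto simp: field_simps)
  qed
  define h where "h = (\<lambda>x z. - (n z \<bullet> (x - z)) - \<kappa> * (norm (x - z))\<^sup>2)"
  have "\<exists>z\<in>?G. \<forall>z'\<in>?G. h x z' \<le> h x z" for x
    unfolding h_def by (intro continuous_attains_sup G continuous_intros continuous_on_n)
  then obtain m where m: "\<And>x. m x \<in> ?G" "\<And>x z. z \<in> ?G \<Longrightarrow> h x z \<le> h x (m x)" by metis
  define \<theta> where "\<theta> = (\<lambda>x. h x (m x))"
  have expand: "h y z = h x z + (- n z - (2 * \<kappa>) *\<^sub>R (x - z)) \<bullet> (y - x) - \<kappa> * (norm (y - x))\<^sup>2" for x y z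
  proof -
    have "y - z = (x - z) + (y - x)" by simp
    then have E: "(norm (y - z))\<^sup>2 = (norm (x - z))\<^sup>2 + 2 * ((x - z) \<bullet> (y - x)) + (norm (y - x))\<^sup>2"
      unfolding power2_norm_eq_inner by (simp only: inner_add_left inner_add_right inner_commute[of "y - x" "x - z"])
    have E2: "n z \<bullet> (y - z) = n z \<bullet> (x - z) + n z \<bullet> (y - x)" by (simp add: inner_diff_right)
    show ?thesis
      unfolding h_def E E2 inner_diff_left[of "- n z" "(2 * \<kappa>) *\<^sub>R (x - z)"] inner_minus_left inner_scaleR_left
      by (simp add: distrib_left)
  qed
  have \<theta>_low: "\<theta> y \<ge> \<theta> x + (- n (m x) - (2 * \<kappa>) *\<^sub>R (x - m x)) \<bullet> (y - x) - \<kappa> * (norm (y - x))\<^sup>2" for x y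
    using m(2)[OF m(1)[of x], of y] expand[of y "m x" x] by (simp add: \<theta>_def)
  have cont\<theta>: "continuous_on UNIV \<theta>"
  proof -
    have E: "h x z + \<kappa> * (norm x)\<^sup>2 = h 0 z + (- n z - (2 * \<kappa>) *\<^sub>R (0 - z)) \<bullet> x" for x z
      using expand[of x z 0] by simp
    \<comment> \<open>Adding the square turns the paraboloids into affine functions, and convexity
      gives the continuity of \<open>\<theta>\<close>.\<close>
    have "convex_on UNIV (\<lambda>x. \<theta> x + \<kappa> * (norm x)\<^sup>2)"
    proof (rule convex_on_sup_affine[of ?G _ "\<lambda>z. h 0 z" "\<lambda>z. - n z - (2 * \<kappa>) *\<^sub>R (0 - z)"])
      show "\<exists>z\<in>?G. \<theta> x + \<kappa> * (norm x)\<^sup>2 = h 0 z + (- n z - (2 * \<kappa>) *\<^sub>R (0 - z)) \<bullet> x" for x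
        unfolding E[symmetric] \<theta>_def using m(1) by blast
      show "h 0 z + (- n z - (2 * \<kappa>) *\<^sub>R (0 - z)) \<bullet> x \<le> \<theta> x + \<kappa> * (norm x)\<^sup>2" if "z \<in> ?G" for z x
        unfolding E[symmetric] \<theta>_def using m(2)[OF that] by simp
    qed
    then have "continuous_on UNIV (\<lambda>x. (\<theta> x + \<kappa> * (norm x)\<^sup>2) - \<kappa> * (norm x)\<^sup>2)"
      by (intro continuous_on_diff convex_on_continuous continuous_intros) auto
    then show ?thesis by simp
  qed
  define d where "d = (\<lambda>x. - n (m x) - (2 * \<kappa>) *\<^sub>R (x - m x))"
  have bdry: "n x \<bullet> d x \<le> - 1 / 2" if x: "x \<in> ?G" for x
  proof -
    \<comment> \<open>For a boundary point \<open>x\<close> the competitor \<open>z = x\<close> has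
      value \<open>0\<close>, which confines \<open>m x\<close> to distance
      \<open>1 / \<kappa>\<close> from \<open>x\<close>.\<close>
    have "h x x = 0" by (simp add: h_def)
    then have "0 \<le> h x (m x)" using m(2)[OF x, of x] by simp
    moreover have "- (n (m x) \<bullet> (x - m x)) \<le> norm (x - m x)"
      using norm_cauchy_schwarz[of "- n (m x)" "x - m x"] norm_n[OF m(1)] by simp
    ultimately have "\<kappa> * (norm (x - m x))\<^sup>2 \<le> norm (x - m x)" by (simp add: h_def)
    then have "norm (x - m x) * (\<kappa> * norm (x - m x)) \<le> norm (x - m x) * 1" by (simp add: power2_eq_square mult_ac)
    then have "\<kappa> * norm (x - m x) \<le> 1" by (cases "x = m x") auto
    then have dist: "norm (x - m x) \<le> 1 / \<kappa>" using \<kappa>(1) by (simp add: field_simps)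
    have "dist (n (m x)) (n x) < 1 / 2" using dist \<kappa>(2) by (intro \<eta>(2)[OF x m(1)]) (simp add: dist_norm norm_minus_commute)
    then have "(norm (n (m x) - n x))\<^sup>2 \<le> (1 / 2)\<^sup>2" by (intro power_mono) (auto simp: dist_norm)
    then have nn: "n x \<bullet> n (m x) \<ge> 3 / 4"
      using norm_n[OF x] norm_n[OF m(1)[of x]] unfolding norm_diff_square by (simp add: inner_commute power2_eq_square)
    have "n x \<bullet> (m x - x) \<le> (norm (m x - x))\<^sup>2 / (2 * r\<^sub>0)"
      by (rule n_inner_le[OF x]) (use m(1) in \<open>simp add: closure_eq\<close>)
    also have "\<dots> \<le> (1 / \<kappa>)\<^sup>2 / (2 * r\<^sub>0)"
      using dist r\<^sub>0 by (intro divide_right_mono power_mono) (auto simp: norm_minus_commute)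
    finally have "2 * \<kappa> * (n x \<bullet> (m x - x)) \<le> 2 * \<kappa> * ((1 / \<kappa>)\<^sup>2 / (2 * r\<^sub>0))" using \<kappa>(1) by (intro mult_left_mono) auto
    also have "\<dots> = 1 / (\<kappa> * r\<^sub>0)" using \<kappa>(1) r\<^sub>0 by (simp add: power2_eq_square field_simps)
    finally have "2 * \<kappa> * (n x \<bullet> (m x - x)) \<le> 1 / 4" using \<kappa>(3) by linarith
    moreover have "n x \<bullet> d x = - (n x \<bullet> n (m x)) + 2 * \<kappa> * (n x \<bullet> (m x - x))"
      unfolding d_def inner_diff_right inner_scaleR_right inner_minus_right by (simp add: algebra_simps)
    ultimately show ?thesis using nn by linarith
  qed
  obtain Mf where Mf: "Mf \<ge> 0" "\<And>x. x \<in> ?G \<Longrightarrow> f x 0 \<le> Mf"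
  proof -
    have "continuous_on ?G (\<lambda>x. case (x, 0) of (x, r) \<Rightarrow> f x r)"
      by (rule continuous_on_compose2[OF f_cont]) (auto intro!: continuous_intros)
    then obtain x where "\<forall>y\<in>?G. f y 0 \<le> f x 0" using continuous_attains_sup[OF G] by auto
    then show thesis by (intro that[of "max 0 (f x 0)"]) (auto simp: max_def)
  qed
  \<comment> \<open>\<open>A / 2\<close>, the guaranteed inward slope at the boundary, has to exceed
    \<open>Mf\<close>.\<close>
  define A where "A = 2 * Mf + 1"
  have A: "A > 0" using Mf(1) by (simp add: A_def)
  obtain R where R: "\<And>x. x \<in> ?K \<Longrightarrow> norm x \<le> R"
    using compact_imp_bounded[OF compact_closure] unfolding bounded_iff by blast
  have dR: "norm (A *\<^sub>R d x) \<le> A * (1 + 2 * \<kappa> * (R + R))" if "x \<in> ?K" for x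
  proof -
    have "norm (d x) \<le> norm (- n (m x)) + norm ((2 * \<kappa>) *\<^sub>R (x - m x))" unfolding d_def by (rule norm_triangle_ineq4)
    also have "\<dots> \<le> 1 + 2 * \<kappa> * (R + R)"
    proof -
      have "norm (x - m x) \<le> R + R"
        using norm_triangle_ineq4[of x "m x"] R[OF that] R[of "m x"] m(1)[of x] by (simp add: closure_eq)
      then show ?thesis using \<kappa>(1) norm_n[OF m(1)[of x]] by simp
    qed
    finally show ?thesis using A by simp
  qed
  define Z where "Z = (0 + (- 2 * A * \<kappa>) *\<^sub>R mat 1 :: real^'n^'n)"
  have Z: "Z \<in> sym_mats" unfolding Z_def by (intro sym_mats_add_scaled_identity) (simp add: sym_mats_def transpose_def vec_eq_iff)
  let ?T = "?K \<times> cball (0 :: real^'n) (A * (1 + 2 * \<kappa> * (R + R)))"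
  obtain MF where MF: "MF \<ge> 0" "\<And>x p. (x, p) \<in> ?T \<Longrightarrow> F x 0 p Z \<le> MF"
  proof -
    have c: "continuous_on ?T (\<lambda>y. case (fst y, 0, snd y, Z) of (x, r, p, X) \<Rightarrow> F x r p X)"
      by (rule continuous_on_compose2[OF F_cont]) (auto intro!: continuous_intros Z)
    have "compact ?T" by (rule compact_Times[OF compact_closure compact_cball])
    from compact_imp_bounded[OF compact_continuous_image[OF c this]]
    obtain M where M: "\<forall>v\<in>(\<lambda>y. case (fst y, 0, snd y, Z) of (x, r, p, X) \<Rightarrow> F x r p X) ` ?T. norm v \<le> M"
      unfolding bounded_iff by blast
    have "F x 0 p Z \<le> M" if xp: "(x, p) \<in> ?T" for x p
      using bspec[OF M imageI[OF xp]] by (simp add: abs_le_iff)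
    then show thesis by (intro that[of "max 0 M"]) (force simp: max_def)+
  qed
  obtain D where D: "\<And>x. x \<in> ?K \<Longrightarrow> \<theta> x \<le> D" "D \<ge> 0"
  proof -
    obtain y where "\<forall>x\<in>?K. \<theta> x \<le> \<theta> y"
      using continuous_attains_sup[OF compact_closure _ continuous_on_subset[OF cont\<theta> subset_UNIV]] ne by auto
    then show thesis by (intro that[of "max 0 (\<theta> y)"]) (auto simp: max_def)
  qed
  \<comment> \<open>So low that (3) gains \<open>MF\<close> between the values \<open>g x\<close>
    and \<open>0\<close>, which outweighs the bound on \<open>F x 0 q Z\<close>.\<close>
  define C where "C = A * D + MF / \<gamma>"
  define g where "g = (\<lambda>x. A * \<theta> x - C)"
  have gle: "g x \<le> - (MF / \<gamma>)" if "x \<in> ?K" for x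
    using mult_left_mono[OF D(1)[OF that], of A] A by (simp add: g_def C_def)
  have g0: "g x \<le> 0" if "x \<in> ?K" for x
  proof -
    have "0 \<le> MF / \<gamma>" using MF(1) \<gamma> by simp
    then show ?thesis using gle[OF that] by linarith
  qed
  have contg: "continuous_on UNIV g" unfolding g_def by (intro continuous_intros cont\<theta>)
  have low: "g x + (A *\<^sub>R d x) \<bullet> (y - x) + ((Z *v (y - x)) \<bullet> (y - x)) / 2 \<le> g y" for x y
    using mult_left_mono[OF \<theta>_low[of x y], of A] A unfolding Z_def scaled_identity_quadratic g_def d_def
    by (simp add: algebra_simps)
  have "Sub g"
    unfolding subsolution_iff
  proof (intro conjI ballI allI impI)
    show "usc_on ?K g" by (rule continuous_imp_usc_on) (rule continuous_on_subset[OF contg], simp)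
    fix x q Y assume x: "x \<in> ?K" and J: "(q, Y) \<in> J2plus ?K g x"
    have Y: "Y \<in> sym_mats" using J by (simp add: J2plus_iff)
    note ls = J2plus_lower_support[OF J zero_less_one low]
    show "sub_cond x (g x) q Y"
    proof (cases "x \<in> ?G")
      case True
      obtain c where c: "c \<ge> 0" "q = A *\<^sub>R d x - c *\<^sub>R n x" using ls(1)[OF True] by blast
      have "n x \<bullet> q = A * (n x \<bullet> d x) - c" using norm_n[OF True] by (simp add: c(2) inner_diff_right dot_square_norm)
      moreover have "A * (n x \<bullet> d x) \<le> A * (- 1 / 2)" using bdry[OF True] A by (intro mult_left_mono) auto
      moreover have "f x (g x) \<le> Mf" using f_mono[OF True g0[OF x]] Mf(2)[OF True] by linarith
      ultimately have "bc x (g x) q \<le> 0" unfolding bc_def using c(1) A_def by linarith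
      then show ?thesis using True by (simp add: sub_cond_def)
    next
      case False
      then have "x \<in> \<Omega>" using x by (simp add: closure_eq)
      then have q: "q = A *\<^sub>R d x" "Z \<preceq> Y" using ls(2) by auto
      have "F x (g x) q Y \<le> F x (g x) q Z" by (rule F_proper'[OF x Y Z q(2)])
      moreover have "\<gamma> * (0 - g x) \<le> F x 0 q Z - F x (g x) q Z" by (rule F_strict[OF x Z g0[OF x]])
      moreover have "F x 0 q Z \<le> MF" by (rule MF(2)) (use x dR[OF x] q(1) in auto)
      moreover have "\<gamma> * g x \<le> \<gamma> * - (MF / \<gamma>)" using gle[OF x] \<gamma> by (intro mult_left_mono) auto
      then have "\<gamma> * g x \<le> - MF" using \<gamma> by simp
      ultimately show ?thesis by (simp add: sub_cond_def)
    qed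
  qed
  then show ?thesis using continuous_on_subset[OF contg subset_UNIV] by blast
qed

lemma subsolution_cong:
  assumes "Sub u" and eq: "\<And>x. x \<in> closure \<Omega> \<Longrightarrow> w x = u x"
  shows "Sub w"
proof -
  have "usc_on (closure \<Omega>) w \<longleftrightarrow> usc_on (closure \<Omega>) u" unfolding usc_on_iff using eq by simp
  moreover have "(p, X) \<in> J2plus (closure \<Omega>) w x \<longleftrightarrow> (p, X) \<in> J2plus (closure \<Omega>) u x" if "x \<in> closure \<Omega>" for p X x
    unfolding J2plus_iff using eq that by simp
  ultimately show ?thesis using assms(1) eq unfolding subsolution_iff by simp
qed

lemma supersolution_cong:
  assumes "supersolution \<Omega> F bc u" and "\<And>x. x \<in> closure \<Omega> \<Longrightarrow> w x = u x"
  shows "supersolution \<Omega> F bc w"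
proof -
  interpret d: neumann_bvp \<Omega> n r\<^sub>0 "dual_op F" "dual_bdry f" \<gamma> by (rule dual_bvp)
  show ?thesis using d.subsolution_cong assms by (simp add: supersolution_iff_dual)
qed

lemma barrier_supersolution:
  assumes "\<Omega> \<noteq> {}"
  shows "\<exists>h. supersolution \<Omega> F bc h \<and> continuous_on (closure \<Omega>) h"
proof -
  interpret d: neumann_bvp \<Omega> n r\<^sub>0 "dual_op F" "dual_bdry f" \<gamma> by (rule dual_bvp)
  obtain g where "d.Sub g" "continuous_on (closure \<Omega>) g" using d.barrier_subsolution[OF assms] by blast
  then show ?thesis
    by (intro exI[of _ "\<lambda>x. - g x"]) (simp add: supersolution_iff_dual continuous_on_minus)
qed

end

section \<open>Comparison and existence\<close>

lemma usc_on_Times: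
  fixes a :: "'a::metric_space \<Rightarrow> real" and c :: "'b::metric_space \<Rightarrow> real"
  assumes "usc_on S a" "usc_on T c"
  shows "usc_on (S \<times> T) (\<lambda>z. a (fst z) + c (snd z))"
  unfolding usc_on_iff
proof (intro ballI allI impI)
  fix z and e :: real assume z: "z \<in> S \<times> T" "e > 0"
  obtain d1 where d1: "d1 > 0" "\<And>y. y \<in> S \<Longrightarrow> dist y (fst z) < d1 \<Longrightarrow> a y < a (fst z) + e / 2"
    using assms(1) z unfolding usc_on_iff by (metis half_gt_zero mem_Times_iff)
  obtain d2 where d2: "d2 > 0" "\<And>y. y \<in> T \<Longrightarrow> dist y (snd z) < d2 \<Longrightarrow> c y < c (snd z) + e / 2"
    using assms(2) z unfolding usc_on_iff by (metis half_gt_zero mem_Times_iff)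
  show "\<exists>d>0. \<forall>y\<in>S \<times> T. dist y z < d \<longrightarrow> a (fst y) + c (snd y) < a (fst z) + c (snd z) + e"
  proof (intro exI[of _ "min d1 d2"] conjI ballI impI)
    fix y assume y: "y \<in> S \<times> T" "dist y z < min d1 d2"
    have "a (fst y) < a (fst z) + e / 2" "c (snd y) < c (snd z) + e / 2"
      using y dist_fst_le[of y z] dist_snd_le[of y z] by (intro d1(2) d2(2); auto)+
    then show "a (fst y) + c (snd y) < a (fst z) + c (snd z) + e" by linarith
  qed (use d1 d2 in auto)
qed

text \<open>\<open>a\<close> cannot drop in the limit: the sum with \<open>c\<close> stays above its
  value at \<open>z\<close>, and upper semicontinuity keeps \<open>c\<close> from making up for a
  drop.\<close>

lemma usc_pair_limit:
  fixes a c :: "'a::metric_space \<Rightarrow> real"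
  assumes "usc_on K a" "usc_on K c" "z \<in> K" "\<And>k. xs k \<in> K" "\<And>k. ys k \<in> K" "xs \<longlonglongrightarrow> z" "ys \<longlonglongrightarrow> z"
    and ge: "\<And>k::nat. a z + c z \<le> a (xs k) + c (ys k)"
  shows "(\<lambda>k. a (xs k)) \<longlonglongrightarrow> a z"
proof (rule order_tendstoI)
  fix e assume "e < a z"
  then have "\<forall>\<^sub>F k in sequentially. c (ys k) < c z + (a z - e)"
    by (intro usc_on_limsup[OF assms(2,3,5,7)]) simp
  then show "\<forall>\<^sub>F k in sequentially. e < a (xs k)"
  proof eventually_elim
    case (elim k)
    then show ?case using ge[of k] by linarith
  qed
next
  fix e assume "a z < e"
  then have "\<forall>\<^sub>F k in sequentially. a (xs k) < a z + (e - a z)"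
    by (intro usc_on_limsup[OF assms(1,3,4,6)]) simp
  then show "\<forall>\<^sub>F k in sequentially. a (xs k) < e" by simp
qed

text \<open>With penalties \<open>2 ^ k\<close> the maxima decrease in \<open>k\<close>, hence
  converge, and their consecutive differences dominate the penalty terms, which must therefore
  vanish. The theorem on sums supplies the jets, and \<open>usc_pair_limit\<close> the convergence
  of the values.\<close>

lemma doubling:
  fixes a b :: "real^'n \<Rightarrow> real"
  assumes K: "compact K" "K \<noteq> {}" and a: "usc_on K a" and b: "lsc_on K b"
  shows "\<exists>z \<alpha> xs ys X Y. z \<in> K \<and> (\<forall>x\<in>K. a x - b x \<le> a z - b z) \<and>
    (\<forall>k::nat. \<alpha> k > 0 \<and> xs k \<in> K \<and> ys k \<in> K \<and>
      (\<alpha> k *\<^sub>R (xs k - ys k), X k) \<in> J2plus_bar K a (xs k) \<and> (\<alpha> k *\<^sub>R (xs k - ys k), Y k) \<in> J2minus_bar K b (ys k) \<and>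
      X k \<in> sym_mats \<and> Y k \<in> sym_mats \<and>
      (- 3 * \<alpha> k) *\<^sub>R blockmat (mat 1) 0 0 (mat 1) \<preceq> blockmat (X k) 0 0 (- Y k) \<and>
      blockmat (X k) 0 0 (- Y k) \<preceq> (3 * \<alpha> k) *\<^sub>R blockmat (mat 1) (- mat 1) (- mat 1) (mat 1)) \<and>
    xs \<longlonglongrightarrow> z \<and> ys \<longlonglongrightarrow> z \<and> (\<lambda>k. a (xs k)) \<longlonglongrightarrow> a z \<and> (\<lambda>k. b (ys k)) \<longlonglongrightarrow> b z \<and>
    (\<lambda>k. \<alpha> k * (norm (xs k - ys k))\<^sup>2) \<longlonglongrightarrow> 0"
proof -
  have nb: "usc_on K (\<lambda>y. - b y)" using b by (simp add: lsc_on_iff_usc_on_minus)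
  let ?\<Phi> = "\<lambda>k x y. a x - b y - 2 ^ k / 2 * (norm (x - y))\<^sup>2"
  have "\<exists>p\<in>K \<times> K. \<forall>q\<in>K \<times> K. ?\<Phi> k (fst q) (snd q) \<le> ?\<Phi> k (fst p) (snd p)" for k :: nat
  proof -
    have U: "usc_on (K \<times> K) (\<lambda>z. (a (fst z) + - b (snd z)) + - (2 ^ k / 2 * (norm (fst z - snd z))\<^sup>2))"
      by (intro usc_on_add_continuous usc_on_Times a nb continuous_intros)
    show ?thesis
      using usc_on_attains_sup[OF compact_Times[OF K(1) K(1)] _ U] K(2) by (simp only: diff_conv_add_uminus) auto
  qed
  then obtain p where p: "\<And>k. p k \<in> K \<times> K" "\<And>k q. q \<in> K \<times> K \<Longrightarrow> ?\<Phi> k (fst q) (snd q) \<le> ?\<Phi> k (fst (p k)) (snd (p k))"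
    by metis
  define x where "x = (\<lambda>k. fst (p k))"
  define y where "y = (\<lambda>k. snd (p k))"
  have xK: "x k \<in> K" "y k \<in> K" for k using p(1)[of k] by (auto simp: x_def y_def)
  have max: "?\<Phi> k s t \<le> ?\<Phi> k (x k) (y k)" if "s \<in> K" "t \<in> K" for k s t
    using p(2)[of "(s, t)" k] that by (simp add: x_def y_def)
  define M where "M = (\<lambda>k. ?\<Phi> k (x k) (y k))"
  have diag: "a s - b s \<le> M k" if "s \<in> K" for s k using max[OF that that, of k] by (simp add: M_def)
  \<comment> \<open>The maximizer for \<open>Suc k\<close> is a competitor for \<open>k\<close>,
    where it pays only half the penalty.\<close>
  have gap: "2 ^ Suc k * (norm (x (Suc k) - y (Suc k)))\<^sup>2 / 4 \<le> M k - M (Suc k)" for k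
    using max[OF xK(1)[of "Suc k"] xK(2)[of "Suc k"], of k] by (simp add: M_def field_simps)
  have "decseq M"
  proof (rule decseq_SucI)
    fix k show "M (Suc k) \<le> M k" using gap[of k] zero_le_power2[of "norm (x (Suc k) - y (Suc k))"]
      by (smt (verit) divide_nonneg_nonneg mult_nonneg_nonneg zero_le_power)
  qed
  moreover obtain s where s: "s \<in> K" using K by auto
  ultimately obtain l where l: "M \<longlonglongrightarrow> l" using decseq_convergent[of M "a s - b s"] diag[OF s] by blast
  have "(\<lambda>k. 4 * (M k - M (Suc k))) \<longlonglongrightarrow> 4 * (l - l)"
    by (intro tendsto_intros l LIMSEQ_Suc[OF l])
  then have g0: "(\<lambda>k. 4 * (M k - M (Suc k))) \<longlonglongrightarrow> 0" by simp
  have pen: "(\<lambda>k. 2 ^ Suc k * (norm (x (Suc k) - y (Suc k)))\<^sup>2) \<longlonglongrightarrow> 0"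
  proof (rule tendsto_sandwich[OF _ always_eventually tendsto_const g0], intro always_eventually)
    have "t \<le> 4 * s" if "t / 4 \<le> s" for t s :: real using that by simp
    from this[OF gap] show "\<forall>k. 2 ^ Suc k * (norm (x (Suc k) - y (Suc k)))\<^sup>2 \<le> 4 * (M k - M (Suc k))" by blast
  qed simp
  obtain z r where z: "z \<in> K" and r: "strict_mono (r :: nat \<Rightarrow> nat)" "((\<lambda>k. x (Suc k)) \<circ> r) \<longlonglongrightarrow> z"
    using K(1) xK(1) unfolding compact_eq_seq_compact_metric seq_compact_def by metis
  define xs where "xs = (\<lambda>k. x (Suc (r k)))"
  define ys where "ys = (\<lambda>k. y (Suc (r k)))"
  define \<alpha> where "\<alpha> = (\<lambda>k. 2 ^ Suc (r k) :: real)"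
  have \<alpha>: "\<alpha> k > 0" "\<alpha> k \<ge> 1" for k unfolding \<alpha>_def by (simp, rule one_le_power, simp)
  have xz: "xs \<longlonglongrightarrow> z" using r(2) by (simp add: xs_def o_def)
  have pen': "(\<lambda>k. \<alpha> k * (norm (xs k - ys k))\<^sup>2) \<longlonglongrightarrow> 0"
    using LIMSEQ_subseq_LIMSEQ[OF pen r(1)] by (simp add: o_def xs_def ys_def \<alpha>_def)
  have "(\<lambda>k. (norm (xs k - ys k))\<^sup>2) \<longlonglongrightarrow> 0"
  proof (rule tendsto_sandwich[OF _ _ tendsto_const pen'])
    show "\<forall>\<^sub>F k in sequentially. (norm (xs k - ys k))\<^sup>2 \<le> \<alpha> k * (norm (xs k - ys k))\<^sup>2"
      using \<alpha>(2) by (auto simp: mult_le_cancel_right1)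
  qed auto
  from tendsto_real_sqrt[OF this] have "(\<lambda>k. norm (xs k - ys k)) \<longlonglongrightarrow> 0" by simp
  then have "(\<lambda>k. xs k - ys k) \<longlonglongrightarrow> 0" by (rule tendsto_norm_zero_cancel)
  from tendsto_diff[OF xz this] have yz: "ys \<longlonglongrightarrow> z" by simp
  have xsK: "xs k \<in> K" "ys k \<in> K" for k by (simp_all add: xs_def ys_def xK)
  have ge: "a s - b s \<le> a (xs k) + - b (ys k)" if "s \<in> K" for s k
  proof -
    have "0 \<le> 2 ^ Suc (r k) / 2 * (norm (x (Suc (r k)) - y (Suc (r k))))\<^sup>2" by simp
    then show ?thesis using diag[OF that, of "Suc (r k)"] unfolding M_def xs_def ys_def by linarith
  qed
  have az: "(\<lambda>k. a (xs k)) \<longlonglongrightarrow> a z"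
    by (rule usc_pair_limit[OF a nb z xsK xz yz]) (use ge[OF z] in simp)
  have bz: "(\<lambda>k. - b (ys k)) \<longlonglongrightarrow> - b z"
    by (rule usc_pair_limit[OF nb a z xsK(2,1) yz xz]) (use ge[OF z] in \<open>simp add: add.commute\<close>)
  have zmax: "a s - b s \<le> a z - b z" if "s \<in> K" for s
    using tendsto_lowerbound[OF tendsto_add[OF az bz] always_eventually] ge[OF that] by auto
  have "\<exists>X Y. (\<alpha> k *\<^sub>R (xs k - ys k), X) \<in> J2plus_bar K a (xs k) \<and> (\<alpha> k *\<^sub>R (xs k - ys k), Y) \<in> J2minus_bar K b (ys k) \<and>
      X \<in> sym_mats \<and> Y \<in> sym_mats \<and>
      (- 3 * \<alpha> k) *\<^sub>R blockmat (mat 1) 0 0 (mat 1) \<preceq> blockmat X 0 0 (- Y) \<and>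
      blockmat X 0 0 (- Y) \<preceq> (3 * \<alpha> k) *\<^sub>R blockmat (mat 1) (- mat 1) (- mat 1) (mat 1)" for k
    by (rule maximum_principle[OF K(1) a b xsK \<alpha>(1)])
       (use max[of _ _ "Suc (r k)"] in \<open>simp add: xs_def ys_def \<alpha>_def\<close>)
  then obtain X Y where "\<And>k. (\<alpha> k *\<^sub>R (xs k - ys k), X k) \<in> J2plus_bar K a (xs k)
    \<and> (\<alpha> k *\<^sub>R (xs k - ys k), Y k) \<in> J2minus_bar K b (ys k) \<and>
      X k \<in> sym_mats \<and> Y k \<in> sym_mats \<and>
      (- 3 * \<alpha> k) *\<^sub>R blockmat (mat 1) 0 0 (mat 1) \<preceq> blockmat (X k) 0 0 (- Y k) \<and>
      blockmat (X k) 0 0 (- Y k) \<preceq> (3 * \<alpha> k) *\<^sub>R blockmat (mat 1) (- mat 1) (- mat 1) (mat 1)" by metis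
  then show ?thesis
    using z zmax \<alpha>(1) xsK xz yz az tendsto_minus[OF bz] pen'
    by (intro exI[of _ z] exI[of _ \<alpha>] exI[of _ xs] exI[of _ ys] exI[of _ X] exI[of _ Y]) auto
qed

text \<open>Test with the vector \<open>(v, v)\<close>, on which the right-hand side vanishes. This
  serves the case \<open>x = y\<close> of (5), where \<open>\<omega>\<close> would be evaluated at
  \<open>0\<close>.\<close>

lemma blockmat_le_imp_le:
  fixes X Y :: "real^'n^'n"
  assumes "blockmat X 0 0 (- Y) \<preceq> c *\<^sub>R blockmat (mat 1) (- mat 1) (- mat 1) (mat 1)"
  shows "X \<preceq> Y"
  unfolding loewner_le_def
proof
  fix v :: "real^'n"
  define \<xi> :: "real^('n + 'n)" where "\<xi> = (\<chi> i. case i of Inl a \<Rightarrow> v $ a | Inr a \<Rightarrow> v $ a)"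
  have v: "(\<chi> i. \<xi> $ Inl i) = v" "(\<chi> i. \<xi> $ Inr i) = v" by (simp_all add: \<xi>_def vec_eq_iff)
  have mv: "(- A) *v w = - (A *v w)" for A :: "real^'n^'n" and w
    using matrix_vector_mult_diff_rdistrib[of 0 A w] by simp
  have "\<xi> \<bullet> (blockmat X 0 0 (- Y) *v \<xi>) \<le> c * (\<xi> \<bullet> (blockmat (mat 1) (- mat 1) (- mat 1) (mat 1) *v \<xi>))"
    using assms unfolding loewner_le_def by (simp add: scaleR_matrix_vector_assoc[symmetric])
  then show "v \<bullet> (X *v v) \<le> v \<bullet> (Y *v v)" unfolding blockmat_quadratic v by (simp add: mv)
qed

text \<open>For the perturbation removed from \<open>u\<close> in the comparison proof: a tilt, a
  linear correction and a fourth power at each of two centres, with the exact gradient but only a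
  scalar upper bound for the Hessian.\<close>

lemma two_quartics_expansion:
  fixes z z0 z1 e0 b0 :: "real^'n"
  assumes "e > 0"
  shows "\<exists>\<rho>>0. \<forall>x. norm (x - z) < \<rho> \<longrightarrow>
    \<epsilon> * (e0 \<bullet> (x - z0)) + norm (x - z0) ^ 4 - b0 \<bullet> (x - z1) + norm (x - z1) ^ 4
    \<le> (\<epsilon> * (e0 \<bullet> (z - z0)) + norm (z - z0) ^ 4 - b0 \<bullet> (z - z1) + norm (z - z1) ^ 4)
      + (\<epsilon> *\<^sub>R e0 + (4 * (norm (z - z0))\<^sup>2) *\<^sub>R (z - z0) - b0 + (4 * (norm (z - z1))\<^sup>2) *\<^sub>R (z - z1)) \<bullet> (x - z)
      + ((12 * (norm (z - z0))\<^sup>2 + 12 * (norm (z - z1))\<^sup>2) / 2 + e) * (norm (x - z))\<^sup>2"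
proof -
  obtain r where r: "r > 0" "\<And>x. norm (x - z) < r \<Longrightarrow> norm (x - z0) ^ 4 \<le> norm (z - z0) ^ 4 + (4 * (norm (z
    - z0))\<^sup>2) *\<^sub>R (z - z0) \<bullet> (x - z) + (12 * (norm (z - z0))\<^sup>2 / 2 + e / 2) * (norm (x - z))\<^sup>2"
    using quartic_expansion[of "e / 2" z z0] assms by auto
  obtain s where s: "s > 0" "\<And>x. norm (x - z) < s \<Longrightarrow> norm (x - z1) ^ 4 \<le> norm (z - z1) ^ 4 + (4 * (norm (z
    - z1))\<^sup>2) *\<^sub>R (z - z1) \<bullet> (x - z) + (12 * (norm (z - z1))\<^sup>2 / 2 + e / 2) * (norm (x - z))\<^sup>2"
    using quartic_expansion[of "e / 2" z z1] assms by auto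
  show ?thesis
  proof (intro exI[of _ "min r s"] conjI allI impI)
    fix x assume x: "norm (x - z) < min r s"
    have l: "\<epsilon> * (e0 \<bullet> (x - z0)) = \<epsilon> * (e0 \<bullet> (z - z0)) + (\<epsilon> *\<^sub>R e0) \<bullet> (x - z)" "b0 \<bullet> (x - z1) = b0 \<bullet> (z - z1) + b0 \<bullet> (x - z)"
      by (simp_all add: inner_diff_right algebra_simps)
    have m: "(12 * (norm (z - z0))\<^sup>2 / 2 + e / 2) * (norm (x - z))\<^sup>2 + (12 * (norm (z - z1))\<^sup>2 / 2 + e / 2) * (norm (x - z))\<^sup>2
      = ((12 * (norm (z - z0))\<^sup>2 + 12 * (norm (z - z1))\<^sup>2) / 2 + e) * (norm (x - z))\<^sup>2"
      by (simp add: field_simps)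
    show "\<epsilon> * (e0 \<bullet> (x - z0)) + norm (x - z0) ^ 4 - b0 \<bullet> (x - z1) + norm (x - z1) ^ 4
    \<le> (\<epsilon> * (e0 \<bullet> (z - z0)) + norm (z - z0) ^ 4 - b0 \<bullet> (z - z1) + norm (z - z1) ^ 4)
      + (\<epsilon> *\<^sub>R e0 + (4 * (norm (z - z0))\<^sup>2) *\<^sub>R (z - z0) - b0 + (4 * (norm (z - z1))\<^sup>2) *\<^sub>R (z - z1)) \<bullet> (x - z)
      + ((12 * (norm (z - z0))\<^sup>2 + 12 * (norm (z - z1))\<^sup>2) / 2 + e) * (norm (x - z))\<^sup>2"
      unfolding l m[symmetric] inner_add_left inner_diff_left using r(2)[of x] s(2)[of x] x by simp
  qed (use r s in auto)
qed

locale structured_neumann_bvp = neumann_bvp \<Omega> n r\<^sub>0 F f \<gamma>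
  for \<Omega> :: "(real^'n) set" and n :: "real^'n \<Rightarrow> real^'n" and r\<^sub>0 :: real
    and F :: "'n pde_op" and f :: "real^'n \<Rightarrow> real \<Rightarrow> real" and \<gamma> :: real +
  fixes V :: "(real^'n) set" and \<omega> :: "real \<Rightarrow> ereal"
  assumes \<omega>_lim: "(\<omega> \<longlongrightarrow> 0) (at_right 0)"
    and V_nbhd: "\<exists>U. openin (top_of_set (closure \<Omega>)) U \<and> frontier \<Omega> \<subseteq> U \<and> U \<subseteq> V"
    and F_unif: "\<And>x r p q X Y. x \<in> V \<Longrightarrow> X \<in> sym_mats \<Longrightarrow> Y \<in> sym_mats \<Longrightarrow>
           ereal \<bar>F x r p X - F x r q Y\<bar> \<le> \<omega> (norm (p - q) + spec_norm (X - Y))"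
    and F_struct: "\<And>\<alpha> x y r p X Y. \<alpha> > 0 \<Longrightarrow> x \<in> closure \<Omega> \<Longrightarrow> y \<in> closure \<Omega> \<Longrightarrow>
           X \<in> sym_mats \<Longrightarrow> Y \<in> sym_mats \<Longrightarrow>
           (- 3 * \<alpha>) *\<^sub>R blockmat (mat 1) 0 0 (mat 1) \<preceq> blockmat X 0 0 (- Y) \<Longrightarrow>
           blockmat X 0 0 (- Y) \<preceq> (3 * \<alpha>) *\<^sub>R blockmat (mat 1) (- mat 1) (- mat 1) (mat 1) \<Longrightarrow>
           ereal (F y r p Y - F x r p X) \<le> \<omega> (\<alpha> * norm (x - y) ^ 2 + norm (x - y) * (norm p + 1))"
begin

section \<open>Consequences of the structure conditions (4) and (5)\<close>

lemma \<omega>_small: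
  assumes "\<eta> > 0"
  obtains \<delta> where "\<delta> > 0" "\<And>t. 0 < t \<Longrightarrow> t < \<delta> \<Longrightarrow> \<omega> t < ereal \<eta>"
proof -
  have "\<forall>\<^sub>F t in at_right 0. \<omega> t < ereal \<eta>" using \<omega>_lim by (rule order_tendstoD(2)) (use assms in simp)
  then show thesis using that unfolding eventually_at_right_field by auto
qed

text \<open>For \<open>x = y\<close> the argument of \<open>\<omega>\<close> is \<open>0\<close>,
  about which the limit of \<open>\<omega>\<close> from the right says nothing; there the matrix
  inequality gives \<open>X \<preceq> Y\<close> and properness takes over.\<close>

lemma structure_bound:
  assumes \<omega>: "\<And>t. 0 < t \<Longrightarrow> t < \<delta> \<Longrightarrow> \<omega> t < ereal \<eta>" and "\<eta> > 0"
    and "\<alpha> > 0" and xy: "x \<in> closure \<Omega>" "y \<in> closure \<Omega>" and XY: "X \<in> sym_mats" "Y \<in> sym_mats"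
    and lo: "(- 3 * \<alpha>) *\<^sub>R blockmat (mat 1) 0 0 (mat 1) \<preceq> blockmat X 0 0 (- Y)"
    and up: "blockmat X 0 0 (- Y) \<preceq> (3 * \<alpha>) *\<^sub>R blockmat (mat 1) (- mat 1) (- mat 1) (mat 1)"
    and t: "\<alpha> * (norm (x - y))\<^sup>2 + norm (x - y) * (norm p + 1) < \<delta>"
  shows "F y r p Y - F x r p X < \<eta>"
proof (cases "x = y")
  case True
  then show ?thesis using F_proper'[OF xy(1) XY(2,1) blockmat_le_imp_le[OF up], of r p] \<open>\<eta> > 0\<close> by simp
next
  case False
  have "0 < norm (x - y) * (norm p + 1)" using False by (simp add: add_nonneg_pos)
  then have "0 < \<alpha> * (norm (x - y))\<^sup>2 + norm (x - y) * (norm p + 1)"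
    using \<open>\<alpha> > 0\<close> by (simp add: add_nonneg_pos)
  then have "ereal (F y r p Y - F x r p X) < ereal \<eta>"
    using F_struct[OF \<open>\<alpha> > 0\<close> xy XY lo up, of r p] \<omega> t by (meson le_less_trans)
  then show ?thesis by simp
qed

text \<open>When \<open>q\<close> and \<open>s\<close> vanish the two values coincide, which again
  avoids \<open>\<omega>\<close> at \<open>0\<close>.\<close>

lemma uniform_bound:
  assumes \<omega>: "\<And>t. 0 < t \<Longrightarrow> t < \<delta> \<Longrightarrow> \<omega> t < ereal \<eta>" and "\<eta> > 0"
    and "x \<in> V" "X \<in> sym_mats" "s \<ge> 0" "norm q + s < \<delta>"
  shows "\<bar>F x r (p + q) (X + s *\<^sub>R mat 1) - F x r p X\<bar> < \<eta>"
proof (cases "norm q + s > 0")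
  case True
  have "ereal \<bar>F x r (p + q) (X + s *\<^sub>R mat 1) - F x r p X\<bar> \<le> \<omega> (norm (p + q - p) + spec_norm (X + s *\<^sub>R mat 1 - X))"
    by (rule F_unif) (use assms in \<open>auto intro: sym_mats_add_scaled_identity\<close>)
  also have "norm (p + q - p) + spec_norm (X + s *\<^sub>R mat 1 - X) = norm q + s"
    using assms(5) by (simp add: spec_norm_scaled_identity)
  also have "\<omega> \<dots> < ereal \<eta>" by (rule \<omega>[OF True assms(6)])
  finally show ?thesis by simp
next
  case False
  then have "q = 0" "s = 0" using assms(5) norm_ge_zero[of q] by (smt (verit) norm_eq_zero)+
  then show ?thesis using \<open>\<eta> > 0\<close> by simp
qed

lemma super_bar:
  assumes "supersolution \<Omega> F bc v" "y \<in> closure \<Omega>" "(p, Y) \<in> J2minus_bar (closure \<Omega>) v y"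
  shows "0 \<le> F y (v y) p Y \<or> (y \<in> frontier \<Omega> \<and> 0 \<le> bc y (v y) p)"
  using assms unfolding supersolution_def closure_eq using not_frontier by (auto simp: le_max_iff_disj)

text \<open>At a boundary maximum \<open>z0\<close> of \<open>u - v\<close> the terms with \<open>e0 = n z0\<close> tilt both jets so that the
  boundary inequalities fail strictly, the exterior ball making the normal part of the penalty
  gradient harmless; the linear term with \<open>b0\<close> cancels \<open>f z (u z)\<close>. Hence the equation must hold in
  the viscosity sense at the doubled points even on the boundary.\<close>

theorem comparison:
  assumes u: "Sub u" and v: "supersolution \<Omega> F bc v" and x0: "x0 \<in> closure \<Omega>"
  shows "u x0 \<le> v x0"
proof (rule ccontr)
  let ?K = "closure \<Omega>"
  assume "\<not> ?thesis"
  then have pos0: "0 < u x0 - v x0" by simp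
  have K: "compact ?K" "?K \<noteq> {}" using compact_closure x0 by auto
  have uu: "usc_on ?K u" using u by (simp add: subsolution_def)
  have vv: "lsc_on ?K v" using v by (simp add: supersolution_def)
  have vn: "usc_on ?K (\<lambda>y. - v y)" using vv by (simp add: lsc_on_iff_usc_on_minus)
  show False
  proof (cases "\<exists>z0\<in>frontier \<Omega>. \<forall>x\<in>?K. u x - v x \<le> u z0 - v z0")
    \<comment> \<open>No maximum of \<open>u - v\<close> lies on the frontier, so the doubled points
      are eventually in \<open>\<Omega>\<close> and only the equation is tested.\<close>
    case False
    obtain z \<alpha> xs ys X Y where z: "z \<in> ?K" "\<And>x. x \<in> ?K \<Longrightarrow> u x - v x \<le> u z - v z"
      and \<alpha>: "\<And>k::nat. \<alpha> k > 0" and mem: "\<And>k. xs k \<in> ?K" "\<And>k. ys k \<in> ?K"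
      and jets: "\<And>k. (\<alpha> k *\<^sub>R (xs k - ys k), X k) \<in> J2plus_bar ?K u (xs k)"
        "\<And>k. (\<alpha> k *\<^sub>R (xs k - ys k), Y k) \<in> J2minus_bar ?K v (ys k)"
      and sym: "\<And>k. X k \<in> sym_mats" "\<And>k. Y k \<in> sym_mats"
      and blo: "\<And>k. (- 3 * \<alpha> k) *\<^sub>R blockmat (mat 1) 0 0 (mat 1) \<preceq> blockmat (X k) 0 0 (- Y k)"
      and bup: "\<And>k. blockmat (X k) 0 0 (- Y k) \<preceq> (3 * \<alpha> k) *\<^sub>R blockmat (mat 1) (- mat 1) (- mat 1) (mat 1)"
      and lim: "xs \<longlonglongrightarrow> z" "ys \<longlonglongrightarrow> z" "(\<lambda>k. u (xs k)) \<longlonglongrightarrow> u z" "(\<lambda>k. v (ys k)) \<longlonglongrightarrow> v z"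
      and pen: "(\<lambda>k. \<alpha> k * (norm (xs k - ys k))\<^sup>2) \<longlonglongrightarrow> 0"
      using doubling[OF K uu vv] by blast
    have "z \<notin> frontier \<Omega>" using False z(2) by blast
    then have z\<Omega>: "z \<in> \<Omega>" using z(1) by (simp add: closure_eq)
    define M where "M = u z - v z"
    have M: "M > 0" using pos0 z(2)[OF x0] by (simp add: M_def)
    define \<eta> where "\<eta> = \<gamma> * M / 2"
    have \<eta>: "\<eta> > 0" using M \<gamma> by (simp add: \<eta>_def)
    obtain \<delta> where \<delta>: "\<delta> > 0" "\<And>t. 0 < t \<Longrightarrow> t < \<delta> \<Longrightarrow> \<omega> t < ereal \<eta>" using \<omega>_small[OF \<eta>] by blast
    have d0: "(\<lambda>k. norm (xs k - ys k)) \<longlonglongrightarrow> 0"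
      using tendsto_norm[OF tendsto_diff[OF lim(1,2)]] by simp
    have "(\<lambda>k. \<alpha> k * (norm (xs k - ys k))\<^sup>2 + norm (xs k - ys k) * (norm (\<alpha> k *\<^sub>R (xs k - ys k)) + 1)) \<longlonglongrightarrow> 0"
    proof -
      have "\<alpha> k * (norm (xs k - ys k))\<^sup>2 + norm (xs k - ys k) * (norm (\<alpha> k *\<^sub>R (xs k - ys k)) + 1)
        = 2 * (\<alpha> k * (norm (xs k - ys k))\<^sup>2) + norm (xs k - ys k)" for k
      proof -
        have "norm (\<alpha> k *\<^sub>R (xs k - ys k)) = \<alpha> k * norm (xs k - ys k)" using \<alpha>[of k] by simp
        then show ?thesis by (simp only: power2_eq_square distrib_left mult_1_right) simp
      qed
      moreover have "(\<lambda>k. 2 * (\<alpha> k * (norm (xs k - ys k))\<^sup>2) + norm (xs k - ys k)) \<longlonglongrightarrow> 2 * 0 + 0"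
        by (intro tendsto_intros pen d0)
      ultimately show ?thesis by simp
    qed
    then have e1: "\<forall>\<^sub>F k in sequentially. \<alpha> k * (norm (xs k - ys k))\<^sup>2 + norm (xs k - ys k) * (norm (\<alpha> k *\<^sub>R
      (xs k - ys k)) + 1) < \<delta>"
      using \<delta>(1) by (rule order_tendstoD(2))
    have e2: "\<forall>\<^sub>F k in sequentially. xs k \<in> \<Omega>" "\<forall>\<^sub>F k in sequentially. ys k \<in> \<Omega>"
      using topological_tendstoD[OF lim(1) open_\<Omega> z\<Omega>] topological_tendstoD[OF lim(2) open_\<Omega> z\<Omega>] .
    have e3: "\<forall>\<^sub>F k in sequentially. M / 2 < u (xs k) - v (ys k)"
      by (rule order_tendstoD(1)[OF tendsto_diff[OF lim(3,4)]]) (use M in \<open>simp add: M_def\<close>)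
    have "\<forall>\<^sub>F k::nat in sequentially. False"
      using e1 e2 e3
    proof eventually_elim
      case (elim k)
      let ?p = "\<alpha> k *\<^sub>R (xs k - ys k)"
      have "F (xs k) (u (xs k)) ?p (X k) \<le> 0"
        using sub_bar[OF u mem(1)[of k] jets(1)[of k]] not_frontier[OF elim(2)] by (simp add: sub_cond_def)
      moreover have "0 \<le> F (ys k) (v (ys k)) ?p (Y k)"
        using super_bar[OF v mem(2)[of k] jets(2)[of k]] not_frontier[OF elim(3)] by simp
      moreover have "F (ys k) (v (ys k)) ?p (Y k) - F (xs k) (v (ys k)) ?p (X k) < \<eta>"
        by (rule structure_bound[OF \<delta>(2) \<eta> \<alpha> mem sym blo bup elim(1)])
      moreover have "\<gamma> * (u (xs k) - v (ys k)) \<le> F (xs k) (u (xs k)) ?p (X k) - F (xs k) (v (ys k)) ?p (X k)"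
        by (rule F_strict[OF mem(1) sym(1)]) (use elim(4) M in linarith)
      moreover have "\<gamma> * (M / 2) < \<gamma> * (u (xs k) - v (ys k))" using elim(4) \<gamma> by (intro mult_strict_left_mono) auto
      ultimately show False by (simp add: \<eta>_def)
    qed
    then show False by simp
  next
    case True
    then obtain z0 where z0: "z0 \<in> frontier \<Omega>" "\<And>x. x \<in> ?K \<Longrightarrow> u x - v x \<le> u z0 - v z0" by blast
    have z0K: "z0 \<in> ?K" using z0(1) by (simp add: closure_eq)
    define M where "M = u z0 - v z0"
    have M: "M > 0" using pos0 z0(2)[OF x0] by (simp add: M_def)
    \<comment> \<open>Two errors from (4) and one from (5), each below \<open>\<eta>\<close>, are to
      be outweighed by the gain from (3), which will exceed
      \<open>\<gamma> * (3 * M / 8)\<close>.\<close>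
    define \<eta> where "\<eta> = \<gamma> * M / 8"
    have \<eta>: "\<eta> > 0" using M \<gamma> by (simp add: \<eta>_def)
    obtain \<delta> where \<delta>: "\<delta> > 0" "\<And>t. 0 < t \<Longrightarrow> t < \<delta> \<Longrightarrow> \<omega> t < ereal \<eta>" using \<omega>_small[OF \<eta>] by blast
    obtain \<rho> where \<rho>: "\<rho> > 0" "\<And>x. x \<in> ?K \<Longrightarrow> norm (x - z0) < \<rho> \<Longrightarrow> x \<in> V"
    proof -
      obtain U where U: "openin (top_of_set ?K) U" "frontier \<Omega> \<subseteq> U" "U \<subseteq> V" using V_nbhd by blast
      then obtain e where "e > 0" "\<forall>x\<in>?K. dist x z0 < e \<longrightarrow> x \<in> U"
        using z0(1) unfolding openin_euclidean_subtopology_iff by blast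
      then show thesis using that U(3) by (auto simp: dist_norm)
    qed
    define e0 where "e0 = n z0"
    have e0: "norm e0 = 1" using norm_n[OF z0(1)] by (simp add: e0_def)
    obtain \<rho>n where \<rho>n: "\<rho>n > 0" "\<And>x. x \<in> frontier \<Omega> \<Longrightarrow> norm (x - z0) < \<rho>n \<Longrightarrow> 1 / 2 \<le> n x \<bullet> e0"
    proof -
      obtain d where d: "d > 0" "\<And>x. x \<in> frontier \<Omega> \<Longrightarrow> dist x z0 < d \<Longrightarrow> dist (n x) (n z0) < 1"
        using continuous_on_n z0(1) unfolding continuous_on_iff by (metis zero_less_one)
      have "1 / 2 \<le> n x \<bullet> e0" if x: "x \<in> frontier \<Omega>" "norm (x - z0) < d" for x
      proof -
        have "norm (n x - n z0) \<le> 1" using d(2)[OF x(1)] x(2) by (simp add: dist_norm)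
        then have "(norm (n x - n z0))\<^sup>2 \<le> 1" by (simp add: power_le_one)
        then show ?thesis unfolding norm_diff_square using norm_n[OF x(1)] norm_n[OF z0(1)] by (simp add: e0_def)
      qed
      then show thesis using that d(1) by blast
    qed
    \<comment> \<open>One radius for all demands: \<open>M / 2\<close> keeps the maximum positive
      after the tilt; \<open>\<rho>\<close> and \<open>\<rho>n\<close> keep the points in
      \<open>V\<close> and the normals close to \<open>e0\<close>; \<open>r\<^sub>0 / 32\<close>
      holds the normal derivative of the fourth power to \<open>\<epsilon> / 8\<close>;
      \<open>\<delta> / 34\<close> suits (4), since the perturbations there add up to at most
      \<open>17 * R\<close>.\<close>
    define R where "R = min (min (min 1 (M / 2)) (min (\<rho> / 2) (\<rho>n / 2))) (min (r\<^sub>0 / 32) (\<delta> / 34))"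
    have R: "R > 0" "R \<le> 1" "R \<le> M / 2" "R < \<rho>" "R < \<rho>n" "R \<le> r\<^sub>0 / 32" "R \<le> \<delta> / 34"
      using M \<rho>(1) \<rho>n(1) r\<^sub>0 \<delta>(1) unfolding R_def by auto
    \<comment> \<open>With the tilt \<open>2 * \<epsilon> = R ^ 3\<close> the fourth power wins
      beyond distance \<open>R\<close>.\<close>
    define \<epsilon> where "\<epsilon> = R ^ 3 / 2"
    have \<epsilon>: "\<epsilon> > 0" using R(1) by (simp add: \<epsilon>_def)
    have R3: "R ^ 3 \<le> R" "R ^ 2 \<le> R" "R ^ 4 \<le> R"
      using power_decreasing[of 1 3 R] power_decreasing[of 1 2 R] power_decreasing[of 1 4 R] R(1,2) by simp_all
    \<comment> \<open>The tilt \<open>2 * \<epsilon>\<close> will be shared equally between the two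
      jets. It may move the maximum away from \<open>z0\<close>; a second fourth power, centred at
      the new maximum \<open>z\<close>, will make \<open>z\<close> the only one.\<close>
    have "\<exists>z\<in>?K. \<forall>x\<in>?K. (u x + - v x) + - (2 * \<epsilon> * (e0 \<bullet> (x - z0)) + norm (x - z0) ^ 4) \<le> (u z + - v z) +
      - (2 * \<epsilon> * (e0 \<bullet> (z - z0)) + norm (z - z0) ^ 4)"
    proof (rule usc_on_attains_sup[OF K])
      have uv: "usc_on ?K (\<lambda>x. u x + - v x)"
        unfolding usc_on_iff
      proof (intro ballI allI impI)
        fix x and e :: real assume x: "x \<in> ?K" "e > 0"
        obtain d1 where d1: "d1 > 0" "\<And>y. y \<in> ?K \<Longrightarrow> dist y x < d1 \<Longrightarrow> u y < u x + e / 2"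
          using uu x unfolding usc_on_iff by (meson half_gt_zero)
        obtain d2 where d2: "d2 > 0" "\<And>y. y \<in> ?K \<Longrightarrow> dist y x < d2 \<Longrightarrow> - v y < - v x + e / 2"
          using vn x unfolding usc_on_iff by (meson half_gt_zero)
        show "\<exists>d>0. \<forall>y\<in>?K. dist y x < d \<longrightarrow> u y + - v y < u x + - v x + e"
        proof (intro exI[of _ "min d1 d2"] conjI ballI impI)
          fix y assume "y \<in> ?K" "dist y x < min d1 d2"
          then have "u y < u x + e / 2" "- v y < - v x + e / 2" using d1(2) d2(2) by auto
          then show "u y + - v y < u x + - v x + e" by linarith
        qed (use d1 d2 in auto)
      qed
      show "usc_on ?K (\<lambda>x. (u x + - v x) + - (2 * \<epsilon> * (e0 \<bullet> (x - z0)) + norm (x - z0) ^ 4))"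
        by (rule usc_on_add_continuous[OF uv]) (intro continuous_intros)
    qed
    then obtain z where z: "z \<in> ?K"
      and zmax: "\<And>x. x \<in> ?K \<Longrightarrow> u x - v x - 2 * \<epsilon> * (e0 \<bullet> (x - z0)) - norm (x - z0) ^ 4
        \<le> u z - v z - 2 * \<epsilon> * (e0 \<bullet> (z - z0)) - norm (z - z0) ^ 4"
      by (auto simp: algebra_simps)
    have e0le: "- (e0 \<bullet> (x - z0)) \<le> norm (x - z0)" for x
      using norm_cauchy_schwarz[of "- e0" "x - z0"] e0 by simp
    have Mz: "M \<le> u z - v z - 2 * \<epsilon> * (e0 \<bullet> (z - z0)) - norm (z - z0) ^ 4"
      using zmax[OF z0K] by (simp add: M_def)
    have zR: "norm (z - z0) \<le> R"
    proof (rule ccontr)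
      assume "\<not> ?thesis"
      then have gt: "R < norm (z - z0)" by simp
      have "2 * \<epsilon> * (- (e0 \<bullet> (z - z0))) \<le> 2 * \<epsilon> * norm (z - z0)" using e0le \<epsilon> by (intro mult_left_mono) auto
      then have "norm (z - z0) ^ 4 \<le> R ^ 3 * norm (z - z0)"
        using Mz z0(2)[OF z] by (simp add: M_def \<epsilon>_def)
      moreover have "R ^ 3 * norm (z - z0) < norm (z - z0) ^ 3 * norm (z - z0)"
        using gt R(1) by (intro mult_strict_right_mono power_strict_mono) auto
      ultimately show False by (simp add: power3_eq_cube power4_eq_xxxx mult.assoc)
    qed
    have uvz: "M / 2 \<le> u z - v z"
    proof -
      have "2 * \<epsilon> * (- (e0 \<bullet> (z - z0))) \<le> 2 * \<epsilon> * R" using e0le[of z] zR \<epsilon> by (intro mult_left_mono) auto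
      also have "\<dots> = R ^ 4" by (simp add: \<epsilon>_def power3_eq_cube power4_eq_xxxx)
      finally have "- (2 * \<epsilon> * (e0 \<bullet> (z - z0))) \<le> M / 2" using R3(3) R(3) by linarith
      then show ?thesis using Mz zero_le_power[OF norm_ge_zero, of "z - z0" 4] by linarith
    qed
    \<comment> \<open>Cancels \<open>f z (u z)\<close> in the boundary operator on the side of
      \<open>u\<close>; on the side of \<open>v\<close> it leaves
      \<open>f z (v z) - f z (u z)\<close>, which is nonpositive by (6). It is not small, but it
      shifts both gradients alike and so enters (5) and not (4).\<close>
    define b0 where "b0 = (if z \<in> frontier \<Omega> then f z (u z) *\<^sub>R n z else 0)"
    define \<psi> where "\<psi> = (\<lambda>x. \<epsilon> * (e0 \<bullet> (x - z0)) + norm (x - z0) ^ 4 - b0 \<bullet> (x - z) + norm (x - z) ^ 4)"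
    define \<phi> where "\<phi> = (\<lambda>y. \<epsilon> * (e0 \<bullet> (y - z0)) + b0 \<bullet> (y - z))"
    define a where "a = (\<lambda>x. u x + - \<psi> x)"
    define b where "b = (\<lambda>y. v y + \<phi> y)"
    have ua: "usc_on ?K a" unfolding a_def \<psi>_def by (rule usc_on_add_continuous[OF uu]) (intro continuous_intros)
    have lb: "lsc_on ?K b"
    proof -
      have "usc_on ?K (\<lambda>y. - v y + - \<phi> y)" unfolding \<phi>_def by (rule usc_on_add_continuous[OF vn]) (intro continuous_intros)
      then show ?thesis by (simp add: lsc_on_iff_usc_on_minus b_def add.commute)
    qed
    have ab: "a x - b x = u x - v x - 2 * \<epsilon> * (e0 \<bullet> (x - z0)) - norm (x - z0) ^ 4 - norm (x - z) ^ 4" for x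
      by (simp add: a_def b_def \<psi>_def \<phi>_def)
    have zero_power_4: "(0::real) ^ 4 = 0" by simp
    obtain z' \<alpha> xs ys X Y where z': "z' \<in> ?K" "\<And>x. x \<in> ?K \<Longrightarrow> a x - b x \<le> a z' - b z'"
      and \<alpha>: "\<And>k::nat. \<alpha> k > 0" and mem: "\<And>k. xs k \<in> ?K" "\<And>k. ys k \<in> ?K"
      and jets: "\<And>k. (\<alpha> k *\<^sub>R (xs k - ys k), X k) \<in> J2plus_bar ?K a (xs k)"
        "\<And>k. (\<alpha> k *\<^sub>R (xs k - ys k), Y k) \<in> J2minus_bar ?K b (ys k)"
      and sym: "\<And>k. X k \<in> sym_mats" "\<And>k. Y k \<in> sym_mats"
      and blo: "\<And>k. (- 3 * \<alpha> k) *\<^sub>R blockmat (mat 1) 0 0 (mat 1) \<preceq> blockmat (X k) 0 0 (- Y k)"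
      and bup: "\<And>k. blockmat (X k) 0 0 (- Y k) \<preceq> (3 * \<alpha> k) *\<^sub>R blockmat (mat 1) (- mat 1) (- mat 1) (mat 1)"
      and lim': "xs \<longlonglongrightarrow> z'" "ys \<longlonglongrightarrow> z'" "(\<lambda>k. a (xs k)) \<longlonglongrightarrow> a z'" "(\<lambda>k. b (ys k)) \<longlonglongrightarrow> b z'"
      and pen: "(\<lambda>k. \<alpha> k * (norm (xs k - ys k))\<^sup>2) \<longlonglongrightarrow> 0"
      using doubling[OF K ua lb] by blast
    \<comment> \<open>\<open>a - b\<close> is the tilted functional minus
      \<open>norm (x - z) ^ 4\<close>, so \<open>z\<close> is its only maximizer.\<close>
    have "z' = z"
    proof -
      have "norm (z' - z) ^ 4 \<le> 0" using z'(2)[OF z] zmax[OF z'(1)] unfolding ab diff_self norm_zero zero_power_4 by linarith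
      then show ?thesis by (simp add: power_le_zero_eq)
    qed
    note lim = lim'[unfolded this]
    define q where "q = (\<lambda>x. \<epsilon> *\<^sub>R e0 + (4 * (norm (x - z0))\<^sup>2) *\<^sub>R (x - z0) - b0 + (4 * (norm (x - z))\<^sup>2) *\<^sub>R (x - z))"
    define s where "s = (\<lambda>x. 12 * (norm (x - z0))\<^sup>2 + 12 * (norm (x - z))\<^sup>2)"
    let ?p = "\<lambda>k. \<alpha> k *\<^sub>R (xs k - ys k)"
    have ju: "(?p k + q (xs k), X k + s (xs k) *\<^sub>R mat 1) \<in> J2plus_bar ?K u (xs k)" for k
    proof -
      have "(?p k + q (xs k), X k + s (xs k) *\<^sub>R mat 1) \<in> J2plus_bar ?K (\<lambda>x. a x + \<psi> x) (xs k)"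
      proof (rule J2plus_bar_perturb[OF jets(1)])
        show "\<exists>\<rho>>0. \<forall>x. norm (x - y) < \<rho> \<longrightarrow> \<psi> x \<le> \<psi> y + q y \<bullet> (x - y) + (s y / 2 + e) * (norm (x - y))\<^sup>2" if "e > 0" for y e
          unfolding \<psi>_def q_def s_def by (rule two_quartics_expansion[OF that])
      qed (auto simp: \<psi>_def q_def s_def intro!: continuous_intros)
      then show ?thesis by (simp add: a_def)
    qed
    have jv: "(?p k - b0 + - (\<epsilon> *\<^sub>R e0), Y k) \<in> J2minus_bar ?K v (ys k)" for k
    proof -
      have j: "(- ?p k, - Y k) \<in> J2plus_bar ?K (\<lambda>y. - b y) (ys k)" using jets(2) by (simp add: J2minus_bar_iff_J2plus_bar)
      have "(- ?p k + (\<epsilon> *\<^sub>R e0 + b0), - Y k + 0 *\<^sub>R mat 1) \<in> J2plus_bar ?K (\<lambda>y. - b y + \<phi> y) (ys k)"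
      proof (rule J2plus_bar_perturb[OF j, where q = "\<lambda>_. \<epsilon> *\<^sub>R e0 + b0" and s = "\<lambda>_. 0"])
        show "\<exists>\<rho>>0. \<forall>x. norm (x - y) < \<rho> \<longrightarrow> \<phi> x \<le> \<phi> y + (\<epsilon> *\<^sub>R e0 + b0) \<bullet> (x - y) + (0 / 2 + e) * (norm (x
          - y))\<^sup>2" if "e > 0" for y e
        proof -
          have "\<phi> x \<le> \<phi> y + (\<epsilon> *\<^sub>R e0 + b0) \<bullet> (x - y) + (0 / 2 + e) * (norm (x - y))\<^sup>2" for x
          proof -
            have "\<phi> x = \<phi> y + (\<epsilon> *\<^sub>R e0 + b0) \<bullet> (x - y)"
              by (simp add: \<phi>_def inner_add_left inner_diff_right algebra_simps)
            moreover have "0 \<le> (0 / 2 + e) * (norm (x - y))\<^sup>2" using that by simp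
            ultimately show ?thesis by linarith
          qed
          then show ?thesis by (intro exI[of _ 1] conjI allI impI) simp_all
        qed
      qed (auto simp: \<phi>_def intro!: continuous_intros)
      moreover have "- ?p k + (\<epsilon> *\<^sub>R e0 + b0) = - (?p k - b0 + - (\<epsilon> *\<^sub>R e0))" "- Y k + 0 *\<^sub>R mat 1 = - Y k"
        "(\<lambda>y. - b y + \<phi> y) = (\<lambda>y. - v y)"
        by (simp_all add: b_def)
      ultimately show ?thesis by (simp only: J2minus_bar_iff_J2plus_bar)
    qed
    have d0: "(\<lambda>k. norm (xs k - ys k)) \<longlonglongrightarrow> 0"
      using tendsto_norm[OF tendsto_diff[OF lim(1,2)]] by simp
    have uvlim: "(\<lambda>k. u (xs k)) \<longlonglongrightarrow> u z" "(\<lambda>k. v (ys k)) \<longlonglongrightarrow> v z"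
    proof -
      have "(\<lambda>k. a (xs k) + \<psi> (xs k)) \<longlonglongrightarrow> a z + \<psi> z" unfolding \<psi>_def by (intro tendsto_intros lim)
      then show "(\<lambda>k. u (xs k)) \<longlonglongrightarrow> u z" by (simp add: a_def)
      have "(\<lambda>k. b (ys k) - \<phi> (ys k)) \<longlonglongrightarrow> b z - \<phi> z" unfolding \<phi>_def by (intro tendsto_intros lim)
      then show "(\<lambda>k. v (ys k)) \<longlonglongrightarrow> v z" by (simp add: b_def)
    qed
    have nz0: "(\<lambda>k. norm (xs k - z0)) \<longlonglongrightarrow> norm (z - z0)" "(\<lambda>k. norm (ys k - z0)) \<longlonglongrightarrow> norm (z - z0)"
      by (intro tendsto_intros lim)+
    have nzz: "(\<lambda>k. norm (xs k - z)) \<longlonglongrightarrow> 0"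
      using tendsto_norm[OF tendsto_diff[OF lim(1) tendsto_const[of z]]] by simp
    have ev_near: "\<forall>\<^sub>F k in sequentially. norm (xs k - z0) < min \<rho> \<rho>n" "\<forall>\<^sub>F k in sequentially. norm (ys k - z0) < min \<rho> \<rho>n"
      by (rule order_tendstoD(2)[OF nz0(1)] order_tendstoD(2)[OF nz0(2)], use zR R(4,5) in simp)+
    \<comment> \<open>The part of \<open>q\<close> without \<open>b0\<close>; at \<open>z\<close> it
      is small, and (4) has to absorb it.\<close>
    define q' where "q' = (\<lambda>x. \<epsilon> *\<^sub>R e0 + (4 * (norm (x - z0))\<^sup>2) *\<^sub>R (x - z0) + (4 * (norm (x - z))\<^sup>2) *\<^sub>R (x - z))"
    have ev_small: "\<forall>\<^sub>F k in sequentially. norm (q' (xs k)) + s (xs k) < \<delta>"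
    proof (rule order_tendstoD(2))
      show "(\<lambda>k. norm (q' (xs k)) + s (xs k)) \<longlonglongrightarrow> norm (q' z) + s z"
        unfolding q'_def s_def by (intro tendsto_intros lim)
      have "norm (q' z) \<le> norm (\<epsilon> *\<^sub>R e0) + norm ((4 * (norm (z - z0))\<^sup>2) *\<^sub>R (z - z0))" 
        unfolding q'_def using norm_triangle_ineq[of "\<epsilon> *\<^sub>R e0" "(4 * (norm (z - z0))\<^sup>2) *\<^sub>R (z - z0)"] by simp
      also have "\<dots> = \<epsilon> + 4 * norm (z - z0) ^ 3" using \<epsilon> e0 by (simp add: power3_eq_cube power2_eq_square)
      also have "\<dots> \<le> \<epsilon> + 4 * R ^ 3" using zR by (intro add_left_mono mult_left_mono power_mono) auto
      finally have "norm (q' z) \<le> 5 * R" using R3(1) R(1) by (simp add: \<epsilon>_def)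
      moreover have "s z \<le> 12 * R"
      proof -
        have "(norm (z - z0))\<^sup>2 \<le> R\<^sup>2" using zR by (intro power_mono) auto
        then show ?thesis using R3(2) by (simp add: s_def)
      qed
      ultimately show "norm (q' z) + s z < \<delta>" using R(1,7) by linarith
    qed
    have ev_\<epsilon>: "norm (- (\<epsilon> *\<^sub>R e0)) + 0 < \<delta>" using e0 \<epsilon> R3(1) R(1,7) by (simp add: \<epsilon>_def)
    \<comment> \<open>Bookkeeping in sixteenths of \<open>\<epsilon>\<close>: the tilt contributes
      at least 8 with the right sign. On the side of \<open>u\<close> the penalty costs 1, the two
      fourth powers 3 and 1, and \<open>f\<close> against \<open>b0\<close> costs 1; on the side of
      \<open>v\<close> the penalty and \<open>f\<close> cost 1 each.\<close>
    have bdry: "\<forall>\<^sub>F k in sequentially. (xs k \<in> frontier \<Omega> \<longrightarrow> 0 < bc (xs k) (u (xs k)) (?p k + q (xs k))) \<and>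
       (ys k \<in> frontier \<Omega> \<longrightarrow> bc (ys k) (v (ys k)) (?p k - b0 + - (\<epsilon> *\<^sub>R e0)) < 0)"
    proof (cases "z \<in> frontier \<Omega>")
      case False
      then have "z \<in> \<Omega>" using z by (simp add: closure_eq)
      then have "\<forall>\<^sub>F k in sequentially. xs k \<in> \<Omega>" "\<forall>\<^sub>F k in sequentially. ys k \<in> \<Omega>"
        using topological_tendstoD[OF lim(1) open_\<Omega>] topological_tendstoD[OF lim(2) open_\<Omega>] by auto
      then show ?thesis by eventually_elim (use not_frontier in auto)
    next
      case True
      have "continuous_on (frontier \<Omega> \<times> UNIV) (\<lambda>y. (case y of (x, r) \<Rightarrow> f x r) - n (fst y) \<bullet> b0)"
        by (intro continuous_intros f_cont continuous_on_compose2[OF continuous_on_n]) auto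
      then obtain d where d: "d > 0" "\<And>y. y \<in> frontier \<Omega> \<times> UNIV \<Longrightarrow> dist y (z, u z) < d \<Longrightarrow>
          dist ((case y of (x, r) \<Rightarrow> f x r) - n (fst y) \<bullet> b0) ((case (z, u z) of (x, r) \<Rightarrow> f x r) - n (fst (z, u z)) \<bullet> b0) < \<epsilon> / 16"
        using True \<epsilon> unfolding continuous_on_iff by (metis SigmaI UNIV_I divide_pos_pos zero_less_numeral)
      obtain d' where d': "d' > 0" "\<And>y. y \<in> frontier \<Omega> \<times> UNIV \<Longrightarrow> dist y (z, v z) < d' \<Longrightarrow>
          dist ((case y of (x, r) \<Rightarrow> f x r) - n (fst y) \<bullet> b0) ((case (z, v z) of (x, r) \<Rightarrow> f x r) - n (fst (z, v z)) \<bullet> b0) < \<epsilon> / 16"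
        using True \<epsilon> \<open>continuous_on (frontier \<Omega> \<times> UNIV) (\<lambda>y. (case y of (x, r) \<Rightarrow> f x r) - n (fst y) \<bullet> b0)\<close>
        unfolding continuous_on_iff by (metis SigmaI UNIV_I divide_pos_pos zero_less_numeral)
      have nb: "n z \<bullet> b0 = f z (u z)" using True norm_n[OF True] by (simp add: b0_def dot_square_norm)
      have fv: "f z (v z) \<le> f z (u z)" using f_mono[OF True, of "v z" "u z"] uvz M by simp
      have ev1: "\<forall>\<^sub>F k in sequentially. dist (xs k, u (xs k)) (z, u z) < d"
        by (intro tendstoD[OF tendsto_Pair[OF lim(1) uvlim(1)] d(1)])
      have ev2: "\<forall>\<^sub>F k in sequentially. dist (ys k, v (ys k)) (z, v z) < d'"
        by (intro tendstoD[OF tendsto_Pair[OF lim(2) uvlim(2)] d'(1)])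
      have "(\<lambda>k. \<alpha> k * (norm (xs k - ys k))\<^sup>2 / (2 * r\<^sub>0)) \<longlonglongrightarrow> 0 / (2 * r\<^sub>0)"
        by (intro tendsto_intros pen) (use r\<^sub>0 in simp)
      then have ev3: "\<forall>\<^sub>F k in sequentially. \<alpha> k * (norm (xs k - ys k))\<^sup>2 / (2 * r\<^sub>0) < \<epsilon> / 16"
        by (rule order_tendstoD(2)) (use \<epsilon> in simp)
      have ev4: "\<forall>\<^sub>F k in sequentially. 2 * norm (xs k - z0) ^ 4 / r\<^sub>0 < \<epsilon> / 8 + \<epsilon> / 16"
      proof (rule order_tendstoD(2))
        show "(\<lambda>k. 2 * norm (xs k - z0) ^ 4 / r\<^sub>0) \<longlonglongrightarrow> 2 * norm (z - z0) ^ 4 / r\<^sub>0"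
          by (intro tendsto_intros nz0) (use r\<^sub>0 in simp)
        have "norm (z - z0) ^ 4 \<le> R ^ 4" using zR by (intro power_mono) auto
        also have "\<dots> = R ^ 3 * R" by (simp add: power3_eq_cube power4_eq_xxxx)
        also have "\<dots> \<le> R ^ 3 * (r\<^sub>0 / 32)" using R(1,6) by (intro mult_left_mono) auto
        finally have "2 * norm (z - z0) ^ 4 / r\<^sub>0 \<le> \<epsilon> / 8" using r\<^sub>0 by (simp add: \<epsilon>_def field_simps)
        then show "2 * norm (z - z0) ^ 4 / r\<^sub>0 < \<epsilon> / 8 + \<epsilon> / 16" using \<epsilon> by linarith
      qed
      have "(\<lambda>k. 2 * norm (xs k - z) ^ 4 / r\<^sub>0) \<longlonglongrightarrow> 2 * 0 ^ 4 / r\<^sub>0"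
        by (intro tendsto_intros nzz) (use r\<^sub>0 in simp)
      then have ev5: "\<forall>\<^sub>F k in sequentially. 2 * norm (xs k - z) ^ 4 / r\<^sub>0 < \<epsilon> / 16"
        by (rule order_tendstoD(2)) (use \<epsilon> in simp)
      \<comment> \<open>The exterior ball limits how far \<open>x - c\<close> can point against the
        normal, hence also the normal derivative of the fourth power.\<close>
      have quart: "- (2 * norm (x - c) ^ 4 / r\<^sub>0) \<le> 4 * (norm (x - c))\<^sup>2 * (n x \<bullet> (x - c))" if "x \<in> frontier \<Omega>" "c \<in> ?K" for x c
      proof -
        have "n x \<bullet> (c - x) \<le> (norm (c - x))\<^sup>2 / (2 * r\<^sub>0)" by (rule n_inner_le[OF that])
        then have "- ((norm (x - c))\<^sup>2 / (2 * r\<^sub>0)) \<le> n x \<bullet> (x - c)" by (simp add: inner_diff_right norm_minus_commute)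
        then have "4 * (norm (x - c))\<^sup>2 * - ((norm (x - c))\<^sup>2 / (2 * r\<^sub>0)) \<le> 4 * (norm (x - c))\<^sup>2 * (n x \<bullet> (x - c))"
          by (intro mult_left_mono) auto
        moreover have "4 * (norm (x - c))\<^sup>2 * - ((norm (x - c))\<^sup>2 / (2 * r\<^sub>0)) = - (2 * norm (x - c) ^ 4 / r\<^sub>0)"
          using r\<^sub>0 by (simp add: power2_eq_square power4_eq_xxxx field_simps)
        ultimately show ?thesis by simp
      qed
      show ?thesis
        using ev1 ev2 ev3 ev4 ev5 ev_near
      proof eventually_elim
        case (elim k)
        have "0 < bc (xs k) (u (xs k)) (?p k + q (xs k))" if x: "xs k \<in> frontier \<Omega>"
        proof -
          have "n (xs k) \<bullet> (ys k - xs k) \<le> (norm (ys k - xs k))\<^sup>2 / (2 * r\<^sub>0)" by (rule n_inner_le[OF x mem(2)])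
          then have "\<alpha> k * (n (xs k) \<bullet> (ys k - xs k)) \<le> \<alpha> k * ((norm (ys k - xs k))\<^sup>2 / (2 * r\<^sub>0))"
            using \<alpha>[of k] by (intro mult_left_mono) auto
          then have 1: "- (\<epsilon> / 16) < n (xs k) \<bullet> ?p k" 
            using elim(3) unfolding inner_scaleR_right inner_diff_right right_diff_distrib
              norm_minus_commute[of "ys k"] times_divide_eq_right by linarith
          have 2: "\<epsilon> / 2 \<le> n (xs k) \<bullet> (\<epsilon> *\<^sub>R e0)" using mult_left_mono[OF \<rho>n(2)[OF x], of \<epsilon>] elim(6) \<epsilon> by simp
          have 3: "- (\<epsilon> / 8 + \<epsilon> / 16) < n (xs k) \<bullet> ((4 * (norm (xs k - z0))\<^sup>2) *\<^sub>R (xs k - z0))"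
            using quart[OF x z0K] elim(4) by simp
          have 4: "- (\<epsilon> / 16) < n (xs k) \<bullet> ((4 * (norm (xs k - z))\<^sup>2) *\<^sub>R (xs k - z))"
            using quart[OF x z] elim(5) by simp
          have "\<bar>f (xs k) (u (xs k)) - n (xs k) \<bullet> b0\<bar> < \<epsilon> / 16"
            using d(2)[of "(xs k, u (xs k))"] x elim(1) nb by (simp add: dist_real_def)
          then have 5: "- (\<epsilon> / 16) < f (xs k) (u (xs k)) - n (xs k) \<bullet> b0" unfolding abs_less_iff by linarith
          have "bc (xs k) (u (xs k)) (?p k + q (xs k)) = n (xs k) \<bullet> ?p k + n (xs k) \<bullet> (\<epsilon> *\<^sub>R e0) + n (xs k) \<bullet>
            ((4 * (norm (xs k - z0))\<^sup>2) *\<^sub>R (xs k - z0))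
             + n (xs k) \<bullet> ((4 * (norm (xs k - z))\<^sup>2) *\<^sub>R (xs k - z)) + (f (xs k) (u (xs k)) - n (xs k) \<bullet> b0)"
            unfolding bc_def q_def inner_add_right[of "n (xs k)"] inner_diff_right[of "n (xs k)" _ b0] by simp
          then show ?thesis using 1 2 3 4 5 \<epsilon> by linarith
        qed
        moreover have "bc (ys k) (v (ys k)) (?p k - b0 + - (\<epsilon> *\<^sub>R e0)) < 0" if y: "ys k \<in> frontier \<Omega>"
        proof -
          have "n (ys k) \<bullet> (xs k - ys k) \<le> (norm (xs k - ys k))\<^sup>2 / (2 * r\<^sub>0)" by (rule n_inner_le[OF y mem(1)])
          then have "\<alpha> k * (n (ys k) \<bullet> (xs k - ys k)) \<le> \<alpha> k * ((norm (xs k - ys k))\<^sup>2 / (2 * r\<^sub>0))"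
            using \<alpha>[of k] by (intro mult_left_mono) auto
          then have 1: "n (ys k) \<bullet> ?p k < \<epsilon> / 16" using elim(3) by simp
          have 2: "\<epsilon> / 2 \<le> n (ys k) \<bullet> (\<epsilon> *\<^sub>R e0)" using mult_left_mono[OF \<rho>n(2)[OF y], of \<epsilon>] elim(7) \<epsilon> by simp
          have "\<bar>(f (ys k) (v (ys k)) - n (ys k) \<bullet> b0) - (f z (v z) - f z (u z))\<bar> < \<epsilon> / 16"
            using d'(2)[of "(ys k, v (ys k))"] y elim(2) nb by (simp add: dist_real_def)
          then have 5: "f (ys k) (v (ys k)) - n (ys k) \<bullet> b0 < \<epsilon> / 16" using fv unfolding abs_less_iff by linarith
          have "bc (ys k) (v (ys k)) (?p k - b0 + - (\<epsilon> *\<^sub>R e0)) = n (ys k) \<bullet> ?p k - n (ys k) \<bullet> (\<epsilon> *\<^sub>R e0)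
            + (f (ys k) (v (ys k)) - n (ys k) \<bullet> b0)"
            unfolding bc_def inner_add_right[of "n (ys k)"] inner_diff_right[of "n (ys k)" _ b0] inner_minus_right by simp
          then show ?thesis using 1 2 5 \<epsilon> by linarith
        qed
        ultimately show ?case by blast
      qed
    qed
    \<comment> \<open>Compared with \<open>?p k\<close>, the gradient \<open>?p k - b0\<close> adds
      only a fixed multiple of \<open>norm (xs k - ys k)\<close>.\<close>
    have ev_t: "\<forall>\<^sub>F k in sequentially. \<alpha> k * (norm (xs k - ys k))\<^sup>2 + norm (xs k - ys k) * (norm (?p k - b0) + 1) < \<delta>"
    proof -
      have le: "\<alpha> k * (norm (xs k - ys k))\<^sup>2 + norm (xs k - ys k) * (norm (?p k - b0) + 1)
        \<le> 2 * (\<alpha> k * (norm (xs k - ys k))\<^sup>2) + norm (xs k - ys k) * (norm b0 + 1)" for k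
      proof -
        have "norm (xs k - ys k) * (norm (?p k - b0) + 1) \<le> norm (xs k - ys k) * (norm (?p k) + norm b0 + 1)"
          by (intro mult_left_mono add_right_mono norm_triangle_ineq4) auto
        also have "\<dots> = \<alpha> k * (norm (xs k - ys k))\<^sup>2 + norm (xs k - ys k) * (norm b0 + 1)"
        proof -
          have "norm (?p k) = \<alpha> k * norm (xs k - ys k)" using \<alpha>[of k] by simp
          then show ?thesis by (simp only: power2_eq_square distrib_left mult_1_right) simp
        qed
        finally show ?thesis by simp
      qed
      have "(\<lambda>k. 2 * (\<alpha> k * (norm (xs k - ys k))\<^sup>2) + norm (xs k - ys k) * (norm b0 + 1)) \<longlonglongrightarrow> 2 * 0 + 0 * (norm b0 + 1)"
        by (intro tendsto_intros pen d0)
      then have "\<forall>\<^sub>F k in sequentially. 2 * (\<alpha> k * (norm (xs k - ys k))\<^sup>2) + norm (xs k - ys k) * (norm b0 + 1) < \<delta>"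
        by (rule order_tendstoD(2)) (use \<delta>(1) in simp)
      then show ?thesis by eventually_elim (rule le_less_trans[OF le])
    qed
    have ev_uv: "\<forall>\<^sub>F k in sequentially. 3 * M / 8 < u (xs k) - v (ys k)"
      by (rule order_tendstoD(1)[OF tendsto_diff[OF uvlim]]) (use uvz M in linarith)
    have "\<forall>\<^sub>F k::nat in sequentially. False"
      using bdry ev_t ev_uv ev_near ev_small
    proof eventually_elim
      case (elim k)
      let ?P = "?p k - b0"
      have V: "xs k \<in> V" "ys k \<in> V" using elim(4,5) \<rho>(2) mem by auto
      have "F (xs k) (u (xs k)) (?p k + q (xs k)) (X k + s (xs k) *\<^sub>R mat 1) \<le> 0"
        using sub_bar[OF u mem(1)[of k] ju[of k]] elim(1) unfolding sub_cond_def by fastforce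
      moreover have "?p k + q (xs k) = ?P + q' (xs k)" by (simp add: q_def q'_def)
      ultimately have 1: "F (xs k) (u (xs k)) (?P + q' (xs k)) (X k + s (xs k) *\<^sub>R mat 1) \<le> 0" by simp
      have "0 \<le> F (ys k) (v (ys k)) (?P + - (\<epsilon> *\<^sub>R e0)) (Y k)"
        using super_bar[OF v mem(2)[of k] jv[of k]] elim(1) by fastforce
      then have 2: "0 \<le> F (ys k) (v (ys k)) (?P + - (\<epsilon> *\<^sub>R e0)) (Y k + 0 *\<^sub>R mat 1)" by simp
      have 3: "\<bar>F (xs k) (u (xs k)) (?P + q' (xs k)) (X k + s (xs k) *\<^sub>R mat 1) - F (xs k) (u (xs k)) ?P (X k)\<bar> < \<eta>"
        by (rule uniform_bound[OF \<delta>(2) \<eta> V(1) sym(1) _ elim(6)]) (simp_all add: s_def)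
      have 4: "\<bar>F (ys k) (v (ys k)) (?P + - (\<epsilon> *\<^sub>R e0)) (Y k + 0 *\<^sub>R mat 1) - F (ys k) (v (ys k)) ?P (Y k)\<bar> < \<eta>"
        by (rule uniform_bound[OF \<delta>(2) \<eta> V(2) sym(2) _ ev_\<epsilon>]) simp_all
      have 5: "F (ys k) (v (ys k)) ?P (Y k) - F (xs k) (v (ys k)) ?P (X k) < \<eta>"
        by (rule structure_bound[OF \<delta>(2) \<eta> \<alpha> mem sym blo bup elim(2)])
      have 6: "\<gamma> * (u (xs k) - v (ys k)) \<le> F (xs k) (u (xs k)) ?P (X k) - F (xs k) (v (ys k)) ?P (X k)"
        by (rule F_strict[OF mem(1) sym(1)]) (use elim(3) M in linarith)
      have "\<gamma> * (3 * M / 8) < \<gamma> * (u (xs k) - v (ys k))" using elim(3) \<gamma> by (intro mult_strict_left_mono) auto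
      then have 7: "3 * \<eta> < \<gamma> * (u (xs k) - v (ys k))" by (simp add: \<eta>_def)
      \<comment> \<open>From the inequality for \<open>v\<close> to that for \<open>u\<close> by way
        of (4) at \<open>ys k\<close>, then (5), (3), and (4) at \<open>xs k\<close>: three errors
        below \<open>\<eta>\<close> against a gain above \<open>3 * \<eta>\<close>.\<close>
      show False using 1 2 3 4 5 6 7 unfolding abs_less_iff by linarith
    qed
    then show False by simp
  qed
qed

lemma solution_exists:
  assumes ne: "\<Omega> \<noteq> {}"
  shows "\<exists>u. solution \<Omega> F bc u"
proof -
  let ?K = "closure \<Omega>"
  \<comment> \<open>The lower barrier makes the family of subsolutions nonempty and bounds
    \<open>E\<close> from below; the upper one bounds all subsolutions through comparison.\<close>
  obtain g where g: "Sub g" "continuous_on ?K g" using barrier_subsolution[OF ne] by blast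
  obtain h where h: "supersolution \<Omega> F bc h" "continuous_on ?K h" using barrier_supersolution[OF ne] by blast
  obtain C where C: "\<And>x. x \<in> ?K \<Longrightarrow> h x \<le> C"
    using compact_imp_bounded[OF compact_continuous_image[OF h(2) compact_closure]] unfolding bounded_real
      by (meson abs_le_D1 imageI)
  obtain D where D: "\<And>x. x \<in> ?K \<Longrightarrow> - g x \<le> D"
    using compact_imp_bounded[OF compact_continuous_image[OF g(2) compact_closure]] unfolding bounded_real
      by (meson abs_le_D2 imageI)
  define W where "W = (\<lambda>x. Sup ((\<lambda>w. w x) ` {w. Sub w}))"
  have SubC: "w x \<le> C" if "Sub w" "x \<in> ?K" for w x
    using comparison[OF that(1) h(1) that(2)] C[OF that(2)] by linarith
  have bda: "bdd_above ((\<lambda>w. w x) ` {w. Sub w})" if "x \<in> ?K" for x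
    using SubC that by (auto intro!: bdd_aboveI[of _ C])
  have ne': "(\<lambda>w. w x) ` {w. Sub w} \<noteq> {}" for x using g(1) by auto
  have wW: "w x \<le> W x" if "Sub w" "x \<in> ?K" for w x
    unfolding W_def using that by (intro cSup_upper bda) auto
  have "W x \<le> C" if "x \<in> ?K" for x
    unfolding W_def using SubC that by (intro cSup_least ne') auto
  from usc_envelope_exists[of ?K W, OF this] obtain E where E: "usc_on ?K E" "\<And>x. x \<in> ?K \<Longrightarrow> W x \<le> E x"
    "\<And>z e. z \<in> ?K \<Longrightarrow> e > 0 \<Longrightarrow> \<exists>x\<in>?K. dist x z < e \<and> W x > E z - e" by blast
  have wE: "w x \<le> E x" if "Sub w" "x \<in> ?K" for w x using wW[OF that] E(2)[OF that(2)] by linarith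
  have SubE: "Sub E"
  proof (rule sup_subsolution[where \<W> = "{w. Sub w}"])
    fix z e :: real and z' assume z: "z' \<in> ?K" "e > 0"
    obtain x where x: "x \<in> ?K" "dist x z' < e" "E z' - e < W x" using E(3)[OF z] by blast
    obtain w where "Sub w" "E z' - e < w x"
      using x(3) unfolding W_def less_cSup_iff[OF ne' bda[OF x(1)]] by blast
    then show "\<exists>w\<in>{w. Sub w}. \<exists>x\<in>?K. dist x z' < e \<and> w x > E z' - e" using x by blast
  qed (use E(1) wE in auto)
  have "- E x \<le> D" if "x \<in> ?K" for x using wE[OF g(1) that] D[OF that] by linarith
  \<comment> \<open>\<open>- E'\<close> is the lower semicontinuous envelope of
    \<open>E\<close>.\<close>
  from usc_envelope_exists[of ?K "\<lambda>x. - E x", OF this] obtain E' where E': "usc_on ?K E'" "\<And>x. x \<in> ?K \<Longrightarrow> - E x \<le> E' x"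
    "\<And>z e. z \<in> ?K \<Longrightarrow> e > 0 \<Longrightarrow> \<exists>x\<in>?K. dist x z < e \<and> - E x > E' z - e" by blast
  have sup: "supersolution \<Omega> F bc (\<lambda>x. - E' x)"
  proof (rule maximal_subsolution_super[where W = E])
    show "- E' x \<le> E x" if "x \<in> ?K" for x using E'(2)[OF that] by linarith
    show "\<exists>x\<in>?K. dist x z < e \<and> E x < - E' z + e" if z: "z \<in> ?K" "e > 0" for z e
      using E'(3)[OF z] by (auto simp: algebra_simps)
  qed (use SubE wE E'(1) in auto)
  have "E x = - E' x" if "x \<in> ?K" for x
    using comparison[OF SubE sup that] E'(2)[OF that] by linarith
  then show ?thesis using SubE supersolution_cong[OF sup] unfolding solution_def by blast
qed

text \<open>The conditions see a function only on the closure; fixing it outside by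
  \<open>extensional\<close> makes uniqueness literal. Empty \<open>\<Omega>\<close> is treated
  apart, because the barriers are built from a nonempty frontier.\<close>

theorem unique_solution: "\<exists>!u. u \<in> extensional (closure \<Omega>) \<and> solution \<Omega> F bc u"
proof (rule ex_ex1I)
  show "\<exists>u. u \<in> extensional (closure \<Omega>) \<and> solution \<Omega> F bc u"
  proof (cases "\<Omega> = {}")
    case True
    then have "solution \<Omega> F bc (\<lambda>_. undefined)"
      by (simp add: solution_def subsolution_def supersolution_def usc_on_def lsc_on_def)
    then show ?thesis using True by auto
  next
    case False
    then obtain u where u: "solution \<Omega> F bc u" using solution_exists by blast
    let ?u = "restrict u (closure \<Omega>)"
    have "Sub ?u" by (rule subsolution_cong[of u]) (use u in \<open>auto simp: solution_def\<close>)
    moreover have "supersolution \<Omega> F bc ?u" by (rule supersolution_cong[of u]) (use u in \<open>auto simp: solution_def\<close>)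
    ultimately show ?thesis by (intro exI[of _ ?u]) (simp add: solution_def)
  qed
  fix u w assume u: "u \<in> extensional (closure \<Omega>) \<and> solution \<Omega> F bc u" and w: "w \<in> extensional (closure \<Omega>) \<and> solution \<Omega> F bc w"
  show "u = w"
  proof (rule extensionalityI[of _ "closure \<Omega>"])
    show "u x = w x" if "x \<in> closure \<Omega>" for x
      using comparison[OF _ _ that] u w unfolding solution_def by (intro antisym) auto
  qed (use u w in auto)
qed

end

theorem theorem7p5:
  fixes \<Omega> V :: "(real^'n) set"
    and F :: "real^'n \<Rightarrow> real \<Rightarrow> real^'n \<Rightarrow> real^'n^'n \<Rightarrow> real"
    and f :: "real^'n \<Rightarrow> real \<Rightarrow> real"
    and n :: "real^'n \<Rightarrow> real^'n"
    and B :: "real^'n \<Rightarrow> real \<Rightarrow> real^'n \<Rightarrow> real"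
    and r\<^sub>0 \<gamma> :: real
    and \<omega> :: "real \<Rightarrow> ereal"
  assumes open_\<Omega>: "open \<Omega>"
    and F_cont: "continuous_on (closure \<Omega> \<times> UNIV \<times> UNIV \<times> sym_mats) (\<lambda>(x, r, p, X). F x r p X)"
    and F_proper: "proper_op \<Omega> F"
    and f_cont: "continuous_on (frontier \<Omega> \<times> UNIV) (\<lambda>(x, r). f x r)"
    and normal: "\<And>x. x \<in> frontier \<Omega> \<Longrightarrow> outward_unit_normal \<Omega> x (n x)"
    and B_def: "B = (\<lambda>x r p. n x \<bullet> p + f x r)"
    and compact: "compact (closure \<Omega>)"
    and manifold: "C1_submanifold_with_boundary (closure \<Omega>)"
    and r\<^sub>0: "r\<^sub>0 > 0"
    and exterior_ball: "\<And>x. x \<in> frontier \<Omega> \<Longrightarrow> cball (x + r\<^sub>0 *\<^sub>R n x) r\<^sub>0 \<inter> \<Omega> = {}"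
    and \<gamma>: "\<gamma> > 0"
    and F_strict: "\<And>x r s p X. x \<in> closure \<Omega> \<Longrightarrow> X \<in> sym_mats \<Longrightarrow> r \<ge> s \<Longrightarrow>
           \<gamma> * (r - s) \<le> F x r p X - F x s p X"
    and \<omega>_nonneg: "\<And>t. t \<ge> 0 \<Longrightarrow> \<omega> t \<ge> 0"
    and \<omega>_lim: "(\<omega> \<longlongrightarrow> 0) (at_right 0)"
    and V_nbhd: "V \<subseteq> closure \<Omega>"
           "\<exists>U. openin (top_of_set (closure \<Omega>)) U \<and> frontier \<Omega> \<subseteq> U \<and> U \<subseteq> V"
    and F_unif: "\<And>x r p q X Y. x \<in> V \<Longrightarrow> X \<in> sym_mats \<Longrightarrow> Y \<in> sym_mats \<Longrightarrow>
           ereal \<bar>F x r p X - F x r q Y\<bar> \<le> \<omega> (norm (p - q) + spec_norm (X - Y))"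
    and F_struct: "\<And>\<alpha> x y r p X Y. \<alpha> > 0 \<Longrightarrow> x \<in> closure \<Omega> \<Longrightarrow> y \<in> closure \<Omega> \<Longrightarrow>
           X \<in> sym_mats \<Longrightarrow> Y \<in> sym_mats \<Longrightarrow>
           (- 3 * \<alpha>) *\<^sub>R blockmat (mat 1) 0 0 (mat 1) \<preceq> blockmat X 0 0 (- Y) \<Longrightarrow>
           blockmat X 0 0 (- Y) \<preceq> (3 * \<alpha>) *\<^sub>R blockmat (mat 1) (- mat 1) (- mat 1) (mat 1) \<Longrightarrow>
           ereal (F y r p Y - F x r p X) \<le> \<omega> (\<alpha> * norm (x - y) ^ 2 + norm (x - y) * (norm p + 1))"
    and f_mono: "\<And>x r s. x \<in> frontier \<Omega> \<Longrightarrow> r \<le> s \<Longrightarrow> f x r \<le> f x s"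
  shows "(\<forall>u v. subsolution \<Omega> F B u \<longrightarrow> supersolution \<Omega> F B v \<longrightarrow>
            (\<forall>x\<in>closure \<Omega>. u x \<le> v x)) \<and>
         (\<exists>!u. u \<in> extensional (closure \<Omega>) \<and> solution \<Omega> F B u)"
proof -
  interpret structured_neumann_bvp \<Omega> n r\<^sub>0 F f \<gamma> V \<omega>
    by unfold_locales (fact open_\<Omega> normal compact manifold r\<^sub>0 exterior_ball F_cont F_proper f_cont \<gamma> F_strict
      f_mono \<omega>_lim V_nbhd(2) F_unif F_struct)+
  have "B = bc" by (simp add: B_def bc_def)
  then show ?thesis using comparison unique_solution by blast
qed

end
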